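(* Let $\Omega \subset \mathbb{R}^d$ be open, let $Y \subset \mathbb{N}$ and let $\nu$ be the counting measure on $Y$. For all $k,l \in \{1,\ldots,d\}$ let $C_{kl} \colon \Omega \to \mathcal{L}(L_2(Y))$ be a bounded function such that $x \mapsto (C_{kl}(x) f, g)_{L_2(Y)}$ is a bounded measurable function for all $f,g \in L_2(Y)$. Suppose there is a $\mu > 0$ such that \[ \operatorname{Re} \sum_{k,l=1}^d (C_{kl}(x) f_l, f_k)_{L_2(Y)} \geq \mu \sum_{k=1}^d \|f_k\|_{L_2(Y)}^2 \] for all $f=(f_1,\ldots,f_d) \in L_2(Y)^d$ and a.e. $x \in \Omega$. Let $V = H^1_0(\Omega,L_2(Y))$ or $V = H^1(\Omega,L_2(Y))$. Define $\mathfrak{a} \colon V \times V \to \mathbb{C}$ by \[ \mathfrak{a}(u,v) = \sum_{k,l=1}^d \int_\Omega (C_{kl}(x) \, (\partial_l u)(x), (\partial_k v)(x))_{L_2(Y)} \, dx . \] Let $A$ be the operator in $L_2(\Omega,L_2(Y))$ associated with the form $\mathfrak{a}$ and let $S$ be the semigroup generated by $-A$. Then the following are equivalent. (i) The semigroup $S$ is positive. (ii) For all $n \in Y$ there exists a positive contraction semigroup $S^{(n)}$ on $L_2(\Omega)$ such that \[ S_t u = ( S^{(n)}_t u_n )_{n \in Y} \] for all $u = (u_n)_{n \in Y} \in \ell_2(Y,L_2(\Omega))$ and $t > 0$.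
   Context: All vector spaces are over $\mathbb{C}$ and inner products are linear in the first variable. $\mathcal{L}(L_2(Y))$ denotes the bounded linear operators on $L_2(Y)$. The space $L_2(\Omega,L_2(Y))$ is identified with $\ell_2(Y,L_2(\Omega)) = \{(u_n)_{n\in Y} : u_n \in L_2(\Omega) \text{ for all } n \in Y, \ \sum_{n\in Y}\|u_n\|_{L_2(\Omega)}^2<\infty\}$ via $u_n(x) = (u(x))(n)$. $H^1(\Omega,L_2(Y))$ is the Hilbert space of all $u \in L_2(\Omega,L_2(Y))$ for which there are $u_1,\ldots,u_d \in L_2(\Omega,L_2(Y))$ (weak partial derivatives, $\partial_k u = u_k$) with $\int_\Omega (\partial_k \tau)(x)\, u(x)\,dx = -\int_\Omega \tau(x)\,u_k(x)\,dx$ for all $\tau \in C_c^\infty(\Omega)$, with $\|u\|_{H^1}^2 = \|u\|_{L_2(\Omega,L_2(Y))}^2 + \sum_{k=1}^d \|\partial_k u\|_{L_2(\Omega,L_2(Y))}^2$. $H^1_0(\Omega,L_2(Y))$ is the closure in $H^1(\Omega,L_2(Y))$ of the infinitely differentiable functions from $\Omega$ to $L_2(Y)$ with compact support. The operator $A$ associated with $\mathfrak{a}$: $u \in D(A)$ and $Au = h$ if and only if $u \in V$, $h \in L_2(\Omega,L_2(Y))$ and $\mathfrak{a}(u,v) = (h,v)_{L_2(\Omega,L_2(Y))}$ for all $v \in V$. $L_2(\Omega,L_2(Y))_+$ is the cone of all $u \in L_2(\Omega,L_2(Y))$ such that for a.e. $x \in \Omega$ one has $(u(x))(y) \in [0,\infty)$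 for all $y \in Y$. A linear map on $L_2(\Omega,L_2(Y))$ is positive if it maps this cone into itself, and a semigroup $S=(S_t)_{t>0}$ is positive if $S_t$ is positive for all $t>0$. Similarly, a semigroup on $L_2(\Omega)$ is positive if each of its operators maps a.e. nonnegative functions to a.e. nonnegative functions. *)

theory Defs
  imports "HOL-Analysis.Analysis" "HOL-Library.Nonpos_Ints"
begin

section \<open>Complex normed spaces\<close>

class complex_normed_vector = real_normed_vector +
  fixes scaleC :: "complex \<Rightarrow> 'a \<Rightarrow> 'a"  (infixr \<open>*\<^sub>C\<close> 75)
  assumes scaleC_add_right: "c *\<^sub>C (x + y) = c *\<^sub>C x + c *\<^sub>C y"
    and scaleC_add_left: "(c + c') *\<^sub>C x = c *\<^sub>C x + c' *\<^sub>C x"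
    and scaleC_scaleC: "c *\<^sub>C (c' *\<^sub>C x) = (c * c') *\<^sub>C x"
    and scaleC_of_real: "complex_of_real r *\<^sub>C x = r *\<^sub>R x"
    and norm_scaleC: "norm (c *\<^sub>C x) = cmod c * norm x"

instantiation complex :: complex_normed_vector
begin

definition scaleC_complex :: "complex \<Rightarrow> complex \<Rightarrow> complex" where
  "scaleC_complex c x = c * x"

instance
  by standard (auto simp: scaleC_complex_def algebra_simps norm_mult scaleR_conv_of_real)

end


section \<open>The Hilbert space of square summable complex sequences\<close>

definition square_summable :: "(nat \<Rightarrow> complex) \<Rightarrow> bool" where
  "square_summable f \<longleftrightarrow> summable (\<lambda>n. (cmod (f n))\<^sup>2)"

lemma square_summable_zero: "square_summable (\<lambda>_. 0)"
  by (simp add: square_summable_def)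

lemma square_summable_scale:
  assumes "square_summable f" shows "square_summable (\<lambda>n. c * f n)"
  using assms summable_mult[of "\<lambda>n. (cmod (f n))\<^sup>2" "(cmod c)\<^sup>2"]
  by (simp add: square_summable_def norm_mult power_mult_distrib)

lemma square_summable_mult_aux:
  assumes "square_summable f" "square_summable g"
  shows "summable (\<lambda>n. cmod (f n) * cmod (g n))"
proof (rule summable_comparison_test)
  show "summable (\<lambda>n. (cmod (f n))\<^sup>2 + (cmod (g n))\<^sup>2)"
    using assms by (auto simp: square_summable_def intro: summable_add)
  have "a * b \<le> a\<^sup>2 + b\<^sup>2" if "a \<ge> 0" "b \<ge> 0" for a b :: real
    using sum_squares_bound[of a b] mult_nonneg_nonneg[OF that] by linarith
  then show "\<exists>N. \<forall>n\<ge>N. norm (cmod (f n) * cmod (g n)) \<le> (cmod (f n))\<^sup>2 + (cmod (g n))\<^sup>2"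
    by auto
qed

lemma square_summable_add:
  assumes "square_summable f" "square_summable g"
  shows "square_summable (\<lambda>n. f n + g n)"
  unfolding square_summable_def
proof (rule summable_comparison_test)
  show "summable (\<lambda>n. (cmod (f n))\<^sup>2 + (cmod (g n))\<^sup>2 + 2 * (cmod (f n) * cmod (g n)))"
    using assms square_summable_mult_aux[OF assms]
    by (auto simp: square_summable_def intro!: summable_add summable_mult)
  have "(cmod (f n + g n))\<^sup>2 \<le> (cmod (f n) + cmod (g n))\<^sup>2" for n
    by (intro power_mono norm_triangle_ineq) auto
  then show "\<exists>N. \<forall>n\<ge>N. norm ((cmod (f n + g n))\<^sup>2)
      \<le> (cmod (f n))\<^sup>2 + (cmod (g n))\<^sup>2 + 2 * (cmod (f n) * cmod (g n))"
    by (auto simp: power2_sum algebra_simps)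
qed

typedef ell2 = "{f. square_summable f}" morphisms ell2_nth Abs_ell2
  using square_summable_zero by blast

setup_lifting type_definition_ell2

lemma square_summable_ell2_nth: "square_summable (ell2_nth f)"
  using ell2_nth by simp

lemma ell2_eqI: "(\<And>n. ell2_nth f n = ell2_nth g n) \<Longrightarrow> f = g"
  using ell2_nth_inject by blast

instantiation ell2 :: real_vector
begin

lift_definition zero_ell2 :: ell2 is "\<lambda>_. 0"
  by (rule square_summable_zero)
lift_definition plus_ell2 :: "ell2 \<Rightarrow> ell2 \<Rightarrow> ell2" is "\<lambda>f g n. f n + g n"
  by (rule square_summable_add)
lift_definition uminus_ell2 :: "ell2 \<Rightarrow> ell2" is "\<lambda>f n. - f n"
  by (simp add: square_summable_def)
lift_definition minus_ell2 :: "ell2 \<Rightarrow> ell2 \<Rightarrow> ell2" is "\<lambda>f g n. f n - g n"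
proof -
  fix f g assume "square_summable f" "square_summable g"
  then have "square_summable (\<lambda>n. f n + (-1) * g n)"
    by (intro square_summable_add square_summable_scale)
  then show "square_summable (\<lambda>n. f n - g n)" by simp
qed
lift_definition scaleR_ell2 :: "real \<Rightarrow> ell2 \<Rightarrow> ell2" is "\<lambda>r f n. complex_of_real r * f n"
  by (rule square_summable_scale)

instance
  by standard (transfer; auto simp: algebra_simps)+

end

lemma ell2_nth_simps [simp]:
  "ell2_nth 0 n = 0"
  "ell2_nth (f + g) n = ell2_nth f n + ell2_nth g n"
  "ell2_nth (- f) n = - ell2_nth f n"
  "ell2_nth (f - g) n = ell2_nth f n - ell2_nth g n"
  "ell2_nth (r *\<^sub>R f) n = complex_of_real r * ell2_nth f n"
  by (transfer; simp)+

definition cinner :: "ell2 \<Rightarrow> ell2 \<Rightarrow> complex" where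
  "cinner f g = (\<Sum>n. ell2_nth f n * cnj (ell2_nth g n))"

lemma summable_cinner: "summable (\<lambda>n. ell2_nth f n * cnj (ell2_nth g n))"
  by (rule summable_norm_cancel)
    (simp add: norm_mult square_summable_mult_aux[OF square_summable_ell2_nth square_summable_ell2_nth])

lemma Re_cinner: "Re (cinner f g) = (\<Sum>n. Re (ell2_nth f n * cnj (ell2_nth g n)))"
  unfolding cinner_def by (rule Re_suminf[OF summable_cinner])

lemma summable_Re_cinner: "summable (\<lambda>n. Re (ell2_nth f n * cnj (ell2_nth g n)))"
  by (rule summable_Re[OF summable_cinner])

lemma cinner_add_left: "cinner (f + g) h = cinner f h + cinner g h"
  unfolding cinner_def by (simp add: suminf_add[OF summable_cinner summable_cinner] algebra_simps)

lemma cinner_self_Re: "Re (cinner f f) = (\<Sum>n. (cmod (ell2_nth f n))\<^sup>2)"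
  unfolding Re_cinner cmod_power2 by (simp add: power2_eq_square)

instantiation ell2 :: real_inner
begin

definition inner_ell2 :: "ell2 \<Rightarrow> ell2 \<Rightarrow> real" where
  "inner_ell2 f g = Re (cinner f g)"
definition norm_ell2 :: "ell2 \<Rightarrow> real" where
  "norm_ell2 f = sqrt (inner f f)"
definition dist_ell2 :: "ell2 \<Rightarrow> ell2 \<Rightarrow> real" where
  "dist_ell2 f g = norm (f - g)"
definition sgn_ell2 :: "ell2 \<Rightarrow> ell2" where
  "sgn_ell2 f = inverse (norm f) *\<^sub>R f"
definition uniformity_ell2 :: "(ell2 \<times> ell2) filter" where
  "uniformity_ell2 = (INF e\<in>{0<..}. principal {(f, g). dist f g < e})"
definition open_ell2 :: "ell2 set \<Rightarrow> bool" where
  "open_ell2 U \<longleftrightarrow> (\<forall>f\<in>U. eventually (\<lambda>(f', g). f' = f \<longrightarrow> g \<in> U) uniformity)"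

instance
proof
  fix f g h :: ell2 and r :: real
  show "inner f g = inner g f"
    by (simp add: inner_ell2_def Re_cinner algebra_simps)
  show "inner (f + g) h = inner f h + inner g h"
    by (simp add: inner_ell2_def cinner_add_left)
  have "(\<Sum>n. Re (complex_of_real r * (ell2_nth f n * cnj (ell2_nth g n))))
      = r * (\<Sum>n. Re (ell2_nth f n * cnj (ell2_nth g n)))"
    by (subst suminf_mult[OF summable_Re_cinner, symmetric]) (simp add: algebra_simps)
  then show "inner (r *\<^sub>R f) g = r * inner f g"
    by (simp add: inner_ell2_def Re_cinner mult.assoc)
  show "0 \<le> inner f f"
    using square_summable_ell2_nth[of f]
    by (simp add: inner_ell2_def cinner_self_Re square_summable_def suminf_nonneg)
  show "(inner f f = 0) = (f = 0)"
    using square_summable_ell2_nth[of f]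
    by (auto simp: inner_ell2_def cinner_self_Re square_summable_def suminf_eq_zero_iff
        intro!: ell2_eqI)
qed (simp_all add: norm_ell2_def dist_ell2_def sgn_ell2_def uniformity_ell2_def open_ell2_def)

end

lemma power2_norm_ell2: "(norm f)\<^sup>2 = (\<Sum>n. (cmod (ell2_nth f n))\<^sup>2)"
  by (simp add: power2_norm_eq_inner inner_ell2_def cinner_self_Re)

instantiation ell2 :: complex_normed_vector
begin

lift_definition scaleC_ell2 :: "complex \<Rightarrow> ell2 \<Rightarrow> ell2" is "\<lambda>c f n. c * f n"
  by (rule square_summable_scale)

instance
proof
  fix f g :: ell2 and c c' :: complex and r :: real
  show "c *\<^sub>C (f + g) = c *\<^sub>C f + c *\<^sub>C g" "(c + c') *\<^sub>C f = c *\<^sub>C f + c' *\<^sub>C f"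
    "c *\<^sub>C c' *\<^sub>C f = (c * c') *\<^sub>C f" "complex_of_real r *\<^sub>C f = r *\<^sub>R f"
    by (transfer; auto simp: algebra_simps)+
  have nth: "ell2_nth (c *\<^sub>C f) n = c * ell2_nth f n" for n
    by transfer simp
  have "(norm (c *\<^sub>C f))\<^sup>2 = (cmod c * norm f)\<^sup>2"
    using square_summable_ell2_nth[of f]
    by (simp add: power2_norm_ell2 nth norm_mult power_mult_distrib square_summable_def suminf_mult)
  then show "norm (c *\<^sub>C f) = cmod c * norm f"
    by (rule power2_eq_imp_eq) simp_all
qed

end

lemma ell2_nth_scaleC [simp]: "ell2_nth (c *\<^sub>C f) n = c * ell2_nth f n"
  by transfer simp

lemma sum_ell2_nth_le: "(\<Sum>n<N. (cmod (ell2_nth f n))\<^sup>2) \<le> (norm f)\<^sup>2"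
  unfolding power2_norm_ell2
  using square_summable_ell2_nth[of f]
  by (intro sum_le_suminf) (auto simp: square_summable_def)

lemma cmod_ell2_nth_le: "cmod (ell2_nth f n) \<le> norm f"
proof -
  have "(cmod (ell2_nth f n))\<^sup>2 \<le> (\<Sum>n<Suc n. (cmod (ell2_nth f n))\<^sup>2)"
    by (simp add: sum_nonneg)
  also have "\<dots> \<le> (norm f)\<^sup>2" by (rule sum_ell2_nth_le)
  finally show ?thesis by (rule power2_le_imp_le) simp
qed

lemma norm_ell2_leI:
  assumes "\<And>N. (\<Sum>n<N. (cmod (ell2_nth f n))\<^sup>2) \<le> e\<^sup>2" "e \<ge> 0"
  shows "norm f \<le> e"
proof -
  have "(norm f)\<^sup>2 \<le> e\<^sup>2"
    unfolding power2_norm_ell2 using square_summable_ell2_nth[of f] assms(1)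
    by (intro suminf_le_const) (auto simp: square_summable_def)
  then show ?thesis using assms(2) by (rule power2_le_imp_le)
qed

instance ell2 :: banach
proof
  fix X :: "nat \<Rightarrow> ell2"
  assume X: "Cauchy X"
  have "Cauchy (\<lambda>m. ell2_nth (X m) n)" for n
  proof (rule metric_CauchyI)
    fix e :: real assume "e > 0"
    then obtain M where "\<forall>m\<ge>M. \<forall>k\<ge>M. dist (X m) (X k) < e"
      using X metric_CauchyD by blast
    then show "\<exists>M. \<forall>m\<ge>M. \<forall>k\<ge>M. dist (ell2_nth (X m) n) (ell2_nth (X k) n) < e"
      by (metis cmod_ell2_nth_le dist_norm ell2_nth_simps(4) order_le_less_trans)
  qed
  then have "\<exists>L. \<forall>n. (\<lambda>m. ell2_nth (X m) n) \<longlonglongrightarrow> L n"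
    by (meson Cauchy_convergent convergent_def)
  then obtain L where L: "\<And>n. (\<lambda>m. ell2_nth (X m) n) \<longlonglongrightarrow> L n" by blast
  have bound: "\<exists>M. \<forall>m\<ge>M. \<forall>N. (\<Sum>n<N. (cmod (ell2_nth (X m) n - L n))\<^sup>2) \<le> e\<^sup>2"
    if "e > 0" for e :: real
  proof -
    obtain M where M: "\<And>m k. m \<ge> M \<Longrightarrow> k \<ge> M \<Longrightarrow> norm (X m - X k) < e"
      using X \<open>e > 0\<close> unfolding Cauchy_def dist_norm by blast
    have "(\<Sum>n<N. (cmod (ell2_nth (X m) n - L n))\<^sup>2) \<le> e\<^sup>2" if "m \<ge> M" for m N
    proof (rule tendsto_upperbound)
      show "((\<lambda>k. \<Sum>n<N. (cmod (ell2_nth (X m) n - ell2_nth (X k) n))\<^sup>2)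
          \<longlongrightarrow> (\<Sum>n<N. (cmod (ell2_nth (X m) n - L n))\<^sup>2)) sequentially"
        by (intro tendsto_intros L)
      have "(\<Sum>n<N. (cmod (ell2_nth (X m) n - ell2_nth (X k) n))\<^sup>2) \<le> e\<^sup>2" if "k \<ge> M" for k
      proof -
        have "(\<Sum>n<N. (cmod (ell2_nth (X m - X k) n))\<^sup>2) \<le> (norm (X m - X k))\<^sup>2"
          by (rule sum_ell2_nth_le)
        also have "\<dots> \<le> e\<^sup>2"
          using M[OF \<open>m \<ge> M\<close> that] by (intro power_mono) auto
        finally show ?thesis by simp
      qed
      then show "\<forall>\<^sub>F k in sequentially. (\<Sum>n<N. (cmod (ell2_nth (X m) n - ell2_nth (X k) n))\<^sup>2) \<le> e\<^sup>2"
        by (auto simp: eventually_sequentially)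
    qed simp
    then show ?thesis by blast
  qed
  obtain m where m: "\<And>N. (\<Sum>n<N. (cmod (ell2_nth (X m) n - L n))\<^sup>2) \<le> 1"
    using bound[of 1] by force
  have "square_summable (\<lambda>n. ell2_nth (X m) n - L n)"
    unfolding square_summable_def by (rule bounded_imp_summable[of _ 1])
      (simp, use m in \<open>simp only: lessThan_Suc_atMost[symmetric]\<close>)
  then have "square_summable (\<lambda>n. ell2_nth (X m) n + (-1) * (ell2_nth (X m) n - L n))"
    by (intro square_summable_add square_summable_scale square_summable_ell2_nth)
  then have "square_summable L" by simp
  then obtain l where l: "\<And>n. ell2_nth l n = L n"
    by (metis Abs_ell2_inverse mem_Collect_eq)
  have "X \<longlonglongrightarrow> l"
  proof (rule metric_LIMSEQ_I)
    fix e :: real assume "e > 0"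
    then obtain M where M: "\<And>m N. m \<ge> M \<Longrightarrow> (\<Sum>n<N. (cmod (ell2_nth (X m) n - L n))\<^sup>2) \<le> (e/2)\<^sup>2"
      using bound[of "e/2"] by auto
    have "norm (X m - l) \<le> e/2" if "m \<ge> M" for m
      by (rule norm_ell2_leI) (use M[OF that] \<open>e > 0\<close> l in auto)
    then have "norm (X m - l) < e" if "m \<ge> M" for m
      using that \<open>e > 0\<close> by (smt (verit) field_sum_of_halves)
    then show "\<exists>M. \<forall>m\<ge>M. dist (X m) l < e"
      unfolding dist_norm by blast
  qed
  then show "convergent X" by (auto simp: convergent_def)
qed

definition ell2_approx :: "(rat \<times> rat) list \<Rightarrow> ell2" where
  "ell2_approx qs = Abs_ell2 (\<lambda>n. if n < length qs
     then Complex (of_rat (fst (qs ! n))) (of_rat (snd (qs ! n))) else 0)"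

lemma ell2_nth_approx: "ell2_nth (ell2_approx qs) n =
    (if n < length qs then Complex (of_rat (fst (qs ! n))) (of_rat (snd (qs ! n))) else 0)"
proof -
  have "square_summable (\<lambda>n. if n < length qs
     then Complex (of_rat (fst (qs ! n))) (of_rat (snd (qs ! n))) else 0)"
    unfolding square_summable_def by (rule summable_finite[of "{..<length qs}"]) auto
  then show ?thesis unfolding ell2_approx_def by (subst Abs_ell2_inverse) auto
qed

lemma complex_rat_approx:
  assumes "e > 0" shows "\<exists>p. cmod (z - Complex (of_rat (fst p)) (of_rat (snd p))) < e"
proof -
  obtain q where q: "Re z - e/2 < of_rat q" "of_rat q < Re z + e/2"
    using of_rat_dense[of "Re z - e/2" "Re z + e/2"] assms by auto
  obtain r where r: "Im z - e/2 < of_rat r" "of_rat r < Im z + e/2"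
    using of_rat_dense[of "Im z - e/2" "Im z + e/2"] assms by auto
  have "cmod (z - Complex (of_rat q) (of_rat r)) \<le> \<bar>Re z - of_rat q\<bar> + \<bar>Im z - of_rat r\<bar>"
    using cmod_le[of "z - Complex (of_rat q) (of_rat r)"] by simp
  also have "\<dots> < e" using q r by (simp add: abs_if)
  finally show ?thesis by (intro exI[of _ "(q, r)"]) simp
qed

lemma ell2_approx_dense:
  assumes "e > 0" shows "\<exists>qs. dist x (ell2_approx qs) < e"
proof -
  let ?h = "\<lambda>n. (cmod (ell2_nth x n))\<^sup>2"
  have sm: "summable ?h" using square_summable_ell2_nth square_summable_def by blast
  have "0 < e\<^sup>2/4" using assms by simp
  then obtain N where N: "norm (\<Sum>i. ?h (i + N)) < e\<^sup>2/4"
    using suminf_exist_split[OF _ sm, of "e\<^sup>2/4"] by blast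
  define d where "d = e / (2 * (real N + 1))"
  have d: "d > 0" using assms by (simp add: d_def)
  obtain p where p: "\<And>n. cmod (ell2_nth x n - Complex (of_rat (fst (p n))) (of_rat (snd (p n)))) < d"
    using choice[of "\<lambda>n p. cmod (ell2_nth x n - Complex (of_rat (fst p)) (of_rat (snd p))) < d"]
      complex_rat_approx[OF d] by blast
  define qs where "qs = map p [0..<N]"
  let ?y = "x - ell2_approx qs"
  have smy: "summable (\<lambda>n. (cmod (ell2_nth ?y n))\<^sup>2)"
    using square_summable_ell2_nth[of ?y] square_summable_def by blast
  have "(norm ?y)\<^sup>2 = (\<Sum>i. (cmod (ell2_nth ?y (i + N)))\<^sup>2) + (\<Sum>i<N. (cmod (ell2_nth ?y i))\<^sup>2)"
    unfolding power2_norm_ell2 by (rule suminf_split_initial_segment[OF smy])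
  also have "(\<Sum>i. (cmod (ell2_nth ?y (i + N)))\<^sup>2) = (\<Sum>i. ?h (i + N))"
    by (simp add: ell2_nth_approx qs_def)
  also have "(\<Sum>i<N. (cmod (ell2_nth ?y i))\<^sup>2) \<le> (\<Sum>i<N. d\<^sup>2)"
  proof (intro sum_mono power_mono)
    fix i assume "i \<in> {..<N}"
    then show "cmod (ell2_nth ?y i) \<le> d"
      using p[of i] by (simp add: ell2_nth_approx qs_def)
  qed simp
  also have "(\<Sum>i<N. d\<^sup>2) \<le> e\<^sup>2/4"
  proof -
    have "real N \<le> (real N + 1)\<^sup>2" by (simp add: power2_eq_square algebra_simps)
    then have "real N / (real N + 1)\<^sup>2 \<le> 1" by (simp add: divide_le_eq)
    then have "(e\<^sup>2/4) * (real N / (real N + 1)\<^sup>2) \<le> (e\<^sup>2/4) * 1"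
      by (intro mult_left_mono) auto
    moreover have "(\<Sum>i<N. d\<^sup>2) = (e\<^sup>2/4) * (real N / (real N + 1)\<^sup>2)"
      by (simp only: d_def power_divide power_mult_distrib sum_constant card_lessThan) simp
    ultimately show ?thesis by simp
  qed
  finally have "(norm ?y)\<^sup>2 < e\<^sup>2" using N \<open>0 < e\<^sup>2/4\<close> by simp
  then show ?thesis
    unfolding dist_norm using assms by (meson less_imp_le power2_less_imp_less)
qed

instance ell2 :: second_countable_topology
proof
  define b where "b = (\<lambda>p. ball (ell2_approx (fst p)) (of_rat (snd p)))"
  have "topological_basis (range b)"
  proof (rule topological_basisI)
    fix B assume "B \<in> range b" then show "open B" by (auto simp: b_def)
  next
    fix U and x :: ell2 assume "open U" "x \<in> U"
    then obtain e where e: "e > 0" "ball x e \<subseteq> U" using open_contains_ball by blast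
    obtain qs where qs: "dist x (ell2_approx qs) < e/3"
      using ell2_approx_dense[of "e/3" x] e by auto
    obtain q where q: "e/3 < of_rat q" "of_rat q < e/2"
      using of_rat_dense[of "e/3" "e/2"] e by auto
    have "b (qs, q) \<subseteq> ball x e"
    proof
      fix z assume z: "z \<in> b (qs, q)"
      have "dist x z \<le> dist x (ell2_approx qs) + dist (ell2_approx qs) z"
        by (rule dist_triangle)
      then show "z \<in> ball x e" using z qs q e by (simp add: b_def dist_commute)
    qed
    moreover have "x \<in> b (qs, q)"
      using qs q by (simp add: b_def dist_commute)
    ultimately show "\<exists>B'\<in>range b. x \<in> B' \<and> B' \<subseteq> U"
      using e(2) by (intro bexI[of _ "b (qs, q)"]) auto
  qed
  moreover have "countable (range b)" by simp
  ultimately show "\<exists>B::ell2 set set. countable B \<and> open = generate_topology B"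
    using topological_basis_imp_subbasis by blast
qed

text \<open>
  For \<open>Y\<close> a set of natural numbers with the counting measure, the space \<open>L\<^sub>2(Y)\<close> is the closed
  subspace of the sequences that vanish outside \<open>Y\<close>.
\<close>

definition ell2_on :: "nat set \<Rightarrow> ell2 set" where
  "ell2_on Y = {f. \<forall>n. n \<notin> Y \<longrightarrow> ell2_nth f n = 0}"

definition bounded_clinear_on ::
    "'b::complex_normed_vector set \<Rightarrow> ('b \<Rightarrow> 'b) \<Rightarrow> bool" where
  "bounded_clinear_on K T \<longleftrightarrow>
     (\<forall>f\<in>K. T f \<in> K) \<and>
     (\<forall>f\<in>K. \<forall>g\<in>K. T (f + g) = T f + T g) \<and>
     (\<forall>c. \<forall>f\<in>K. T (c *\<^sub>C f) = c *\<^sub>C T f) \<and>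
     (\<exists>M. \<forall>f\<in>K. norm (T f) \<le> M * norm f)"


section \<open>Square integrable functions\<close>

text \<open>
  Here \<open>K\<close> is a closed complex subspace of the space of values.  Elements of \<open>L\<^sub>2(\<Omega>, K)\<close> are
  represented by functions, and equality in \<open>L\<^sub>2(\<Omega>, K)\<close> is equality a.e. on \<open>\<Omega>\<close>.  All value
  types used are separable, so Borel measurability is strong measurability.
  Values of functions outside \<open>\<Omega>\<close> are irrelevant throughout.
\<close>

definition L2_fun ::
    "'a::euclidean_space set \<Rightarrow> 'b::{complex_normed_vector, banach, second_countable_topology} set
      \<Rightarrow> ('a \<Rightarrow> 'b) set" where
  "L2_fun \<Omega> K = {u. u \<in> borel_measurable (lebesgue_on \<Omega>) \<and> (\<forall>x\<in>\<Omega>. u x \<in> K) \<and>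
     integrable (lebesgue_on \<Omega>) (\<lambda>x. (norm (u x))\<^sup>2)}"

definition L2_norm :: "'a::euclidean_space set \<Rightarrow> ('a \<Rightarrow> 'b::real_normed_vector) \<Rightarrow> real" where
  "L2_norm \<Omega> u = sqrt (\<integral>x. (norm (u x))\<^sup>2 \<partial>lebesgue_on \<Omega>)"

definition L2_inner :: "'a::euclidean_space set \<Rightarrow> ('a \<Rightarrow> ell2) \<Rightarrow> ('a \<Rightarrow> ell2) \<Rightarrow> complex" where
  "L2_inner \<Omega> u v = (\<integral>x. cinner (u x) (v x) \<partial>lebesgue_on \<Omega>)"


section \<open>Smooth functions and Sobolev spaces\<close>

definition partial_deriv :: "'d::finite \<Rightarrow> (real^'d \<Rightarrow> 'b::real_normed_vector) \<Rightarrow> real^'d \<Rightarrow> 'b" where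
  "partial_deriv k f x = vector_derivative (\<lambda>t. f (x + t *\<^sub>R axis k 1)) (at 0)"

primrec C_on :: "nat \<Rightarrow> (real^'d::finite) set \<Rightarrow> (real^'d \<Rightarrow> 'b::real_normed_vector) \<Rightarrow> bool" where
  "C_on 0 \<Omega> f \<longleftrightarrow> continuous_on \<Omega> f"
| "C_on (Suc n) \<Omega> f \<longleftrightarrow> (\<forall>x\<in>\<Omega>. f differentiable at x) \<and> (\<forall>k. C_on n \<Omega> (partial_deriv k f))"

definition Cc_infinity ::
    "(real^'d::finite) set \<Rightarrow> 'b::real_normed_vector set \<Rightarrow> (real^'d \<Rightarrow> 'b) set" where
  "Cc_infinity \<Omega> K = {f. (\<forall>n. C_on n \<Omega> f) \<and> (\<forall>x\<in>\<Omega>. f x \<in> K) \<and>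
     (\<exists>E. compact E \<and> E \<subseteq> \<Omega> \<and> (\<forall>x\<in>\<Omega> - E. f x = 0))}"

definition has_weak_partial ::
    "(real^'d::finite) set \<Rightarrow> 'b::{complex_normed_vector, banach, second_countable_topology} set \<Rightarrow>
      'd \<Rightarrow> (real^'d \<Rightarrow> 'b) \<Rightarrow> (real^'d \<Rightarrow> 'b) \<Rightarrow> bool" where
  "has_weak_partial \<Omega> K k u w \<longleftrightarrow> u \<in> L2_fun \<Omega> K \<and> w \<in> L2_fun \<Omega> K \<and>
     (\<forall>\<tau> \<in> Cc_infinity \<Omega> (UNIV :: complex set).
        (\<integral>x. partial_deriv k \<tau> x *\<^sub>C u x \<partial>lebesgue_on \<Omega>) = - (\<integral>x. \<tau> x *\<^sub>C w x \<partial>lebesgue_on \<Omega>))"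

text \<open>For open \<open>\<Omega>\<close> the weak partial derivative is unique up to equality a.e., so the choice made
  here only selects a representative.\<close>

definition weak_partial ::
    "(real^'d::finite) set \<Rightarrow> 'b::{complex_normed_vector, banach, second_countable_topology} set \<Rightarrow>
      'd \<Rightarrow> (real^'d \<Rightarrow> 'b) \<Rightarrow> (real^'d \<Rightarrow> 'b)" where
  "weak_partial \<Omega> K k u = (SOME w. has_weak_partial \<Omega> K k u w)"

definition H1 ::
    "(real^'d::finite) set \<Rightarrow> 'b::{complex_normed_vector, banach, second_countable_topology} set \<Rightarrow>
      (real^'d \<Rightarrow> 'b) set" where
  "H1 \<Omega> K = {u \<in> L2_fun \<Omega> K. \<forall>k. \<exists>w. has_weak_partial \<Omega> K k u w}"

definition H1_norm ::
    "(real^'d::finite) set \<Rightarrow> 'b::{complex_normed_vector, banach, second_countable_topology} set \<Rightarrow>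
      (real^'d \<Rightarrow> 'b) \<Rightarrow> real" where
  "H1_norm \<Omega> K u = sqrt ((L2_norm \<Omega> u)\<^sup>2 + (\<Sum>k\<in>UNIV. (L2_norm \<Omega> (weak_partial \<Omega> K k u))\<^sup>2))"

definition H1_0 ::
    "(real^'d::finite) set \<Rightarrow> 'b::{complex_normed_vector, banach, second_countable_topology} set \<Rightarrow>
      (real^'d \<Rightarrow> 'b) set" where
  "H1_0 \<Omega> K = {u \<in> H1 \<Omega> K. \<forall>e>0. \<exists>\<phi> \<in> Cc_infinity \<Omega> K. H1_norm \<Omega> K (\<lambda>x. u x - \<phi> x) < e}"


section \<open>The form and its associated operator\<close>

definition elliptic_form ::
    "(real^'d::finite) set \<Rightarrow> nat set \<Rightarrow> ('d \<Rightarrow> 'd \<Rightarrow> real^'d \<Rightarrow> ell2 \<Rightarrow> ell2) \<Rightarrow>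
      (real^'d \<Rightarrow> ell2) \<Rightarrow> (real^'d \<Rightarrow> ell2) \<Rightarrow> complex" where
  "elliptic_form \<Omega> Y C u v =
     (\<Sum>k\<in>UNIV. \<Sum>l\<in>UNIV. \<integral>x. cinner (C k l x (weak_partial \<Omega> (ell2_on Y) l u x))
                                  (weak_partial \<Omega> (ell2_on Y) k v x) \<partial>lebesgue_on \<Omega>)"

text \<open>Operators in \<open>L\<^sub>2(\<Omega>, L\<^sub>2(Y))\<close> are given by their graphs.\<close>

definition associated_operator ::
    "'a::euclidean_space set \<Rightarrow> nat set \<Rightarrow> ('a \<Rightarrow> ell2) set \<Rightarrow>
      (('a \<Rightarrow> ell2) \<Rightarrow> ('a \<Rightarrow> ell2) \<Rightarrow> complex) \<Rightarrow> (('a \<Rightarrow> ell2) \<times> ('a \<Rightarrow> ell2)) set" where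
  "associated_operator \<Omega> Y V a =
     {(u, h). u \<in> V \<and> h \<in> L2_fun \<Omega> (ell2_on Y) \<and> (\<forall>v\<in>V. a u v = L2_inner \<Omega> h v)}"


section \<open>Semigroups\<close>

text \<open>Boundedness and additivity imply that the operator respects equality a.e.\<close>

definition bounded_clinear_L2 ::
    "'a::euclidean_space set \<Rightarrow> 'b::{complex_normed_vector, banach, second_countable_topology} set \<Rightarrow>
      (('a \<Rightarrow> 'b) \<Rightarrow> ('a \<Rightarrow> 'b)) \<Rightarrow> bool" where
  "bounded_clinear_L2 \<Omega> K T \<longleftrightarrow>
     (\<forall>u\<in>L2_fun \<Omega> K. T u \<in> L2_fun \<Omega> K) \<and>
     (\<forall>u\<in>L2_fun \<Omega> K. \<forall>v\<in>L2_fun \<Omega> K.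
        AE x in lebesgue_on \<Omega>. T (\<lambda>x. u x + v x) x = T u x + T v x) \<and>
     (\<forall>c. \<forall>u\<in>L2_fun \<Omega> K. AE x in lebesgue_on \<Omega>. T (\<lambda>x. c *\<^sub>C u x) x = c *\<^sub>C T u x) \<and>
     (\<exists>M. \<forall>u\<in>L2_fun \<Omega> K. L2_norm \<Omega> (T u) \<le> M * L2_norm \<Omega> u)"

text \<open>Strongly continuous semigroups \<open>(S\<^sub>t)\<close> indexed by \<open>t > 0\<close>; \<open>S t\<close> is irrelevant for \<open>t \<le> 0\<close>.\<close>

definition C0_semigroup ::
    "'a::euclidean_space set \<Rightarrow> 'b::{complex_normed_vector, banach, second_countable_topology} set \<Rightarrow>
      (real \<Rightarrow> ('a \<Rightarrow> 'b) \<Rightarrow> ('a \<Rightarrow> 'b)) \<Rightarrow> bool" where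
  "C0_semigroup \<Omega> K S \<longleftrightarrow>
     (\<forall>t>0. bounded_clinear_L2 \<Omega> K (S t)) \<and>
     (\<forall>s>0. \<forall>t>0. \<forall>u\<in>L2_fun \<Omega> K. AE x in lebesgue_on \<Omega>. S (s + t) u x = S s (S t u) x) \<and>
     (\<forall>u\<in>L2_fun \<Omega> K. ((\<lambda>t. L2_norm \<Omega> (\<lambda>x. S t u x - u x)) \<longlongrightarrow> 0) (at_right 0))"

definition generator ::
    "'a::euclidean_space set \<Rightarrow> 'b::{complex_normed_vector, banach, second_countable_topology} set \<Rightarrow>
      (real \<Rightarrow> ('a \<Rightarrow> 'b) \<Rightarrow> ('a \<Rightarrow> 'b)) \<Rightarrow> (('a \<Rightarrow> 'b) \<times> ('a \<Rightarrow> 'b)) set" where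
  "generator \<Omega> K S = {(u, h). u \<in> L2_fun \<Omega> K \<and> h \<in> L2_fun \<Omega> K \<and>
     ((\<lambda>t. L2_norm \<Omega> (\<lambda>x. (1 / t) *\<^sub>R (S t u x - u x) - h x)) \<longlongrightarrow> 0) (at_right 0)}"

definition generated_by_minus ::
    "'a::euclidean_space set \<Rightarrow> 'b::{complex_normed_vector, banach, second_countable_topology} set \<Rightarrow>
      (('a \<Rightarrow> 'b) \<times> ('a \<Rightarrow> 'b)) set \<Rightarrow> (real \<Rightarrow> ('a \<Rightarrow> 'b) \<Rightarrow> ('a \<Rightarrow> 'b)) \<Rightarrow> bool" where
  "generated_by_minus \<Omega> K A S \<longleftrightarrow>
     C0_semigroup \<Omega> K S \<and> generator \<Omega> K S = {(u, \<lambda>x. - h x) | u h. (u, h) \<in> A}"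

definition contraction_semigroup ::
    "'a::euclidean_space set \<Rightarrow> 'b::{complex_normed_vector, banach, second_countable_topology} set \<Rightarrow>
      (real \<Rightarrow> ('a \<Rightarrow> 'b) \<Rightarrow> ('a \<Rightarrow> 'b)) \<Rightarrow> bool" where
  "contraction_semigroup \<Omega> K S \<longleftrightarrow> C0_semigroup \<Omega> K S \<and>
     (\<forall>t>0. \<forall>u\<in>L2_fun \<Omega> K. L2_norm \<Omega> (S t u) \<le> L2_norm \<Omega> u)"

definition L2_ell2_cone :: "'a::euclidean_space set \<Rightarrow> nat set \<Rightarrow> ('a \<Rightarrow> ell2) set" where
  "L2_ell2_cone \<Omega> Y = {u \<in> L2_fun \<Omega> (ell2_on Y).
     AE x in lebesgue_on \<Omega>. \<forall>y\<in>Y. ell2_nth (u x) y \<in> \<real>\<^sub>\<ge>\<^sub>0}"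

definition L2_cone :: "'a::euclidean_space set \<Rightarrow> ('a \<Rightarrow> complex) set" where
  "L2_cone \<Omega> = {f \<in> L2_fun \<Omega> UNIV. AE x in lebesgue_on \<Omega>. f x \<in> \<real>\<^sub>\<ge>\<^sub>0}"

definition positive_semigroup :: "'f set \<Rightarrow> (real \<Rightarrow> 'f \<Rightarrow> 'f) \<Rightarrow> bool" where
  "positive_semigroup P S \<longleftrightarrow> (\<forall>t>0. \<forall>u\<in>P. S t u \<in> P)"

end

theory Submission
  imports Defs "HOL-Analysis.Analysis"
begin

text \<open>
  Why the coordinates decouple.  Write \<open>C\<^sub>k\<^sub>l\<close> as an infinite matrix in the coordinates of \<open>\<ell>\<^sub>2\<close>.  If all its entries
  off the diagonal vanished, the semigroup would act coordinatewise; the claim is that positivity forces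
  this as far as the form can see.

  Suppose that \<open>S\<close> is positive.  If \<open>u\<close> and \<open>v\<close> are positive elements of the form domain with \<open>(u, v) = 0\<close>,
  then \<open>(S\<^sub>t u - u, v) \<ge> 0\<close>, so \<open>Re \<aa>(u, v) \<le> 0\<close> (\<open>cone_form_nonpos\<close>; elements of the form domain need not
  lie in the domain of the operator, so the proof approximates \<open>u\<close> by \<open>l (l + A)\<^sup>-\<^sup>1 u\<close>, which stays in the cone by
  \<open>yosida_in_cone\<close>).  This applies to functions that live in two different coordinates \<open>m\<close> and \<open>n\<close>, which
  are orthogonal whatever their values.  Test with a bump function \<open>\<beta>\<close> times \<open>1 + cos (r \<xi> \<cdot> x)\<close> in
  coordinate \<open>m\<close> and \<open>\<beta>\<close> times \<open>1 \<plusminus> cos (r \<xi> \<cdot> x)\<close> in coordinate \<open>n\<close>.  Both are nonnegative, and the term of order \<open>r\<^sup>2\<close>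
  of the form changes sign with the choice of \<open>\<plusminus>\<close>.  As \<open>r \<rightarrow> \<infinity>\<close> it must vanish; adding the same statement for the sine gives
  \<open>\<integral> \<beta>\<^sup>2 \<Sum> \<xi>\<^sub>k \<xi>\<^sub>l c\<^sub>k\<^sub>l = 0\<close> with \<open>c\<^sub>k\<^sub>l = Re (C\<^sub>k\<^sub>l e\<^sub>m, e\<^sub>n)\<close>
  (\<open>coupling_quadratic_form_integral\<close>, based on \<open>wave_gradient\<close>).  Hence \<open>c\<^sub>k\<^sub>l = - c\<^sub>l\<^sub>k\<close> a.e.
  (\<open>ae_zero_if_bump_integrals_zero\<close>, \<open>coupling_antisymmetric\<close>).

  An antisymmetric \<open>c\<close> need not vanish, but its contribution to the form does.  For positive \<open>u\<close> and \<open>v\<close> put the scalar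
  function \<open>u\<^sub>p\<close> in coordinate \<open>m\<close> and \<open>v\<^sub>q\<close> in coordinate \<open>n\<close>.  Exchanging the two scalar functions changes the sign of
  the form, because \<open>c\<close> is antisymmetric, but both values are at most \<open>0\<close>.  So the form vanishes on these pairs
  (\<open>off_diagonal_cone\<close>; the imaginary part vanishes because the inequality also applies to
  \<open>\<plusminus>\<i> v\<close>).  Positivity also makes the projection onto the cone map the form domain into itself
  (\<open>cone_projection_form_domain\<close>, the invariance criterion for form domains), so the form domain is
  spanned over the complex numbers by its positive elements and the off-diagonal form vanishes identically
  (\<open>off_diagonal_zero\<close>).  Therefore the projection onto the \<open>n\<close>-th coordinate may be moved from one argument of
  the form to the other (\<open>move_diagonal\<close>), it commutes with the operator and with the semigroup (\<open>Sg_move\<close>),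
  and the semigroup splits into scalar semigroups.  They are contractive because the form is accretive, and
  positive because \<open>S\<close> is.

  The converse is immediate: a coordinatewise positive semigroup preserves the cone.

  The functional analysis is done in real Hilbert spaces, in the locales \<open>form_semigroup\<close> and
  \<open>form_semigroup_cone\<close>; complex scalars enter as a bounded operator \<open>I\<close> with \<open>I\<^sup>2 = -1\<close>.  A form domain
  appears there as the closed graph of the gradient, on which \<open>lax_milgram\<close> yields the resolvent and
  \<open>bounded_sequence_in_closed_graph\<close> yields weak limits.
\<close>

section \<open>Projections, the Lax-Milgram lemma and weak limits in Hilbert spaces\<close>

text \<open>By the parallelogram identity a minimizing sequence for the distance is a Cauchy sequence.\<close>

lemma closed_subspace_nearest_point:
  fixes W :: "'a::{real_inner,banach} set"
  assumes "subspace W" "closed W"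
  shows "\<exists>p\<in>W. \<forall>v\<in>W. (y - p) \<bullet> v = 0"
proof -
  define D where "D = (\<lambda>w. (norm (y - w))\<^sup>2) ` W"
  define d where "d = Inf D"
  have "D \<noteq> {}" using assms(1) subspace_0 by (auto simp: D_def)
  have bdd: "bdd_below D" by (rule bdd_belowI[of _ 0]) (auto simp: D_def)
  have d_le: "d \<le> (norm (y - w))\<^sup>2" if "w \<in> W" for w
    unfolding d_def using that by (intro cInf_lower bdd) (auto simp: D_def)
  have "\<exists>w\<in>W. (norm (y - w))\<^sup>2 < d + 1 / Suc n" for n
  proof -
    have "Inf D < d + 1 / Suc n" by (simp add: d_def)
    then show ?thesis using cInf_less_iff[OF \<open>D \<noteq> {}\<close> bdd] by (auto simp: D_def)
  qed
  then obtain w where w: "\<And>n. w n \<in> W" "\<And>n. (norm (y - w n))\<^sup>2 < d + 1 / Suc n" by metis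
  have close: "(norm (w m - w n))\<^sup>2 \<le> 2 / Suc m + 2 / Suc n" for m n
  proof -
    have "(1/2) *\<^sub>R (w m + w n) \<in> W"
      using assms(1) w by (intro subspace_scale subspace_add)
    then have "d \<le> (norm (y - (1/2) *\<^sub>R (w m + w n)))\<^sup>2" by (rule d_le)
    moreover have "(norm (w m - w n))\<^sup>2 =
        2 * (norm (y - w m))\<^sup>2 + 2 * (norm (y - w n))\<^sup>2 - 4 * (norm (y - (1/2) *\<^sub>R (w m + w n)))\<^sup>2"
      unfolding power2_norm_eq_inner by (simp add: algebra_simps inner_commute)
    ultimately show ?thesis using w(2)[of m] w(2)[of n] by simp
  qed
  have "Cauchy w"
  proof (rule metric_CauchyI)
    fix e :: real assume "e > 0"
    obtain N :: nat where N: "N > 4 / e\<^sup>2" using reals_Archimedean2 by blast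
    have "norm (w m - w n) < e" if "m \<ge> N" "n \<ge> N" for m n
    proof -
      have "2 / Suc m < e\<^sup>2 / 2" if "m \<ge> N" for m
      proof -
        have "4 / e\<^sup>2 < Suc m" using N that by linarith
        then show ?thesis using \<open>e > 0\<close> by (simp add: field_simps)
      qed
      from this[OF that(1)] this[OF that(2)] close[of m n]
      have "(norm (w m - w n))\<^sup>2 < e\<^sup>2" by linarith
      then show ?thesis using \<open>e > 0\<close> by (meson less_imp_le power2_less_imp_less)
    qed
    then show "\<exists>M. \<forall>m\<ge>M. \<forall>n\<ge>M. dist (w m) (w n) < e" by (auto simp: dist_norm)
  qed
  then obtain p where p: "w \<longlonglongrightarrow> p" using Cauchy_convergent convergent_def by blast
  have "p \<in> W" using closed_sequentially[OF assms(2)] w(1) p by blast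
  have "(norm (y - p))\<^sup>2 \<le> d"
  proof (rule tendsto_le)
    show "(\<lambda>n. (norm (y - w n))\<^sup>2) \<longlonglongrightarrow> (norm (y - p))\<^sup>2" by (intro tendsto_intros p)
    show "(\<lambda>n. d + 1 / real (Suc n)) \<longlonglongrightarrow> d"
      using tendsto_add[OF tendsto_const LIMSEQ_Suc[OF lim_1_over_n]] by fastforce
    show "\<forall>\<^sub>F n in sequentially. (norm (y - w n))\<^sup>2 \<le> d + 1 / real (Suc n)"
      using w(2) by (intro always_eventually allI less_imp_le)
  qed simp
  have "(y - p) \<bullet> v = 0" if "v \<in> W" for v
  proof (cases "v = 0")
    case False
    define t where "t = ((y - p) \<bullet> v) / (v \<bullet> v)"
    have "p + t *\<^sub>R v \<in> W" using \<open>p \<in> W\<close> that assms(1) by (simp add: subspace_add subspace_scale)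
    then have "(norm (y - p))\<^sup>2 \<le> (norm (y - (p + t *\<^sub>R v)))\<^sup>2"
      using d_le \<open>(norm (y - p))\<^sup>2 \<le> d\<close> order_trans by blast
    also have "\<dots> = (norm (y - p))\<^sup>2 - 2 * t * ((y - p) \<bullet> v) + t\<^sup>2 * (v \<bullet> v)"
      unfolding power2_norm_eq_inner by (simp add: algebra_simps inner_commute power2_eq_square)
    also have "\<dots> = (norm (y - p))\<^sup>2 - ((y - p) \<bullet> v)\<^sup>2 / (v \<bullet> v)"
      using False by (simp add: t_def field_simps power2_eq_square)
    finally have "((y - p) \<bullet> v)\<^sup>2 / (v \<bullet> v) \<le> 0" by simp
    then have "((y - p) \<bullet> v)\<^sup>2 \<le> 0" using False inner_gt_zero_iff[of v] by (simp add: divide_le_0_iff not_le del: inner_gt_zero_iff)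
    then show ?thesis by simp
  qed simp
  with \<open>p \<in> W\<close> show ?thesis by blast
qed

definition orth_proj :: "'a::{real_inner,banach} set \<Rightarrow> 'a \<Rightarrow> 'a" where
  "orth_proj W y = (SOME p. p \<in> W \<and> (\<forall>v\<in>W. (y - p) \<bullet> v = 0))"

context
  fixes W :: "'a::{real_inner,banach} set"
  assumes W: "subspace W" "closed W"
begin

lemma orth_proj:
  shows orth_proj_in: "orth_proj W y \<in> W"
    and orth_proj_orth: "v \<in> W \<Longrightarrow> (y - orth_proj W y) \<bullet> v = 0"
  using someI_ex[OF closed_subspace_nearest_point[OF W, of y, unfolded Bex_def]]
  unfolding orth_proj_def by auto

lemma orth_proj_inner: "v \<in> W \<Longrightarrow> orth_proj W y \<bullet> v = y \<bullet> v"
  using orth_proj_orth[of v y] by (simp add: inner_diff_left)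

lemma orth_proj_unique:
  assumes "p \<in> W" "\<And>v. v \<in> W \<Longrightarrow> p \<bullet> v = y \<bullet> v" shows "orth_proj W y = p"
proof -
  have "orth_proj W y - p \<in> W" using W assms orth_proj_in by (simp add: subspace_diff)
  then have "(orth_proj W y - p) \<bullet> (orth_proj W y - p) = 0"
    using orth_proj_inner assms by (simp add: inner_diff_left)
  then show ?thesis by simp
qed

lemma norm_orth_proj_le: "norm (orth_proj W y) \<le> norm y"
proof -
  have "(norm (orth_proj W y))\<^sup>2 = y \<bullet> orth_proj W y"
    by (simp add: power2_norm_eq_inner orth_proj_inner orth_proj_in)
  also have "\<dots> \<le> norm y * norm (orth_proj W y)" by (rule norm_cauchy_schwarz)
  finally have "norm (orth_proj W y) * norm (orth_proj W y) \<le> norm y * norm (orth_proj W y)"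
    by (simp add: power2_eq_square)
  then show ?thesis
    by (cases "norm (orth_proj W y) = 0") (simp_all add: mult_le_cancel_right)
qed

lemma bounded_linear_orth_proj: "bounded_linear (orth_proj W)"
proof (rule bounded_linear_intro[of _ 1])
  show "orth_proj W (x + y) = orth_proj W x + orth_proj W y" for x y
    by (rule orth_proj_unique)
      (auto simp: W subspace_add orth_proj_in inner_add_left orth_proj_inner)
  show "orth_proj W (r *\<^sub>R x) = r *\<^sub>R orth_proj W x" for r x
    by (rule orth_proj_unique) (auto simp: W subspace_scale orth_proj_in orth_proj_inner)
qed (simp add: norm_orth_proj_le)

lemma orthogonal_complement_trivial_imp_UNIV:
  assumes "\<And>y. (\<And>v. v \<in> W \<Longrightarrow> y \<bullet> v = 0) \<Longrightarrow> y = 0" shows "W = UNIV"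
proof -
  have "y - orth_proj W y = 0" for y by (rule assms) (rule orth_proj_orth)
  then show ?thesis using orth_proj_in by (metis UNIV_eq_I eq_iff_diff_eq_0)
qed

text \<open>The map \<open>w \<mapsto> w - \<rho> P (L w - y)\<close>, with \<open>P\<close> the projection onto \<open>W\<close>, is a
  strict contraction once \<open>\<rho>\<close> is small, and its fixed point solves the variational equation.\<close>

lemma lax_milgram:
  assumes L: "bounded_linear L" and "c > 0"
    and coercive: "\<And>w. w \<in> W \<Longrightarrow> L w \<bullet> w \<ge> c * (norm w)\<^sup>2"
  shows "\<exists>w\<in>W. \<forall>v\<in>W. L w \<bullet> v = y \<bullet> v"
proof -
  interpret L: bounded_linear L by fact
  interpret P: bounded_linear "orth_proj W" by (rule bounded_linear_orth_proj)
  obtain M where M: "M > 0" "\<And>x. norm (L x) \<le> norm x * M" using L.pos_bounded by blast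
  \<comment> \<open>The maximum ensures that \<open>1 - c\<^sup>2 / K\<^sup>2\<close>, the squared contraction constant, is not negative.\<close>
  define K where "K = max M c"
  have K: "K > 0" "c \<le> K" "norm (L x) \<le> norm x * K" for x
    using M(1) M(2)[of x] by (auto simp: K_def mult_left_mono order_trans[OF M(2)])
  define \<rho> where "\<rho> = c / K\<^sup>2"
  define q where "q = sqrt (1 - c\<^sup>2 / K\<^sup>2)"
  have cK: "c\<^sup>2 / K\<^sup>2 \<le> 1" using K \<open>c > 0\<close> by (simp add: power_mono)
  have q: "0 \<le> q" "q < 1" "q\<^sup>2 = 1 - c\<^sup>2 / K\<^sup>2"
    using cK K(1) \<open>c > 0\<close> by (auto simp: q_def)
  define F where "F = (\<lambda>w. w - \<rho> *\<^sub>R orth_proj W (L w - y))"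
  have contr: "dist (F v) (F w) \<le> q * dist v w" if "v \<in> W" "w \<in> W" for v w
  proof -
    define z where "z = v - w"
    have z: "z \<in> W" using that W by (simp add: z_def subspace_diff)
    have "F v - F w = z - \<rho> *\<^sub>R orth_proj W (L z)"
      by (simp add: F_def z_def L.diff P.diff algebra_simps)
    then have "(norm (F v - F w))\<^sup>2 =
        (norm z)\<^sup>2 - 2 * \<rho> * (orth_proj W (L z) \<bullet> z) + \<rho>\<^sup>2 * (norm (orth_proj W (L z)))\<^sup>2"
      unfolding power2_norm_eq_inner
      by (simp add: inner_diff_left inner_diff_right inner_commute power2_eq_square)
    also have "\<dots> = (norm z)\<^sup>2 - 2 * \<rho> * (L z \<bullet> z) + \<rho>\<^sup>2 * (norm (orth_proj W (L z)))\<^sup>2"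
      by (simp only: orth_proj_inner[OF z])
    also have "\<dots> \<le> (norm z)\<^sup>2 - 2 * \<rho> * (c * (norm z)\<^sup>2) + \<rho>\<^sup>2 * (norm z * K)\<^sup>2"
      using coercive[OF z] K(1) \<open>c > 0\<close> order_trans[OF norm_orth_proj_le K(3)]
      by (intro add_mono diff_mono mult_left_mono power_mono) (auto simp: \<rho>_def)
    also have "\<dots> = (q * norm z)\<^sup>2"
      using K(1) unfolding power_mult_distrib q \<rho>_def by (simp add: field_simps power2_eq_square)
    finally have "norm (F v - F w) \<le> q * norm z"
      by (rule power2_le_imp_le) (use q in auto)
    then show ?thesis by (simp add: dist_norm z_def)
  qed
  have "\<exists>!w. w \<in> W \<and> F w = w"
    using W q contr subspace_0[of W]
    by (intro Banach_fix) (auto simp: complete_eq_closed F_def orth_proj_in subspace_diff subspace_scale)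
  then obtain w where w: "w \<in> W" "F w = w" by blast
  then have "orth_proj W (L w - y) = 0" using K(1) \<open>c > 0\<close> by (simp add: F_def \<rho>_def)
  then have "(L w - y) \<bullet> v = 0" if "v \<in> W" for v using orth_proj_inner[OF that, of "L w - y"] by simp
  then show ?thesis using w by (auto simp: inner_diff_left)
qed

end

lemma riesz_representation:
  fixes \<psi> :: "'a::{real_inner,banach} \<Rightarrow> real"
  assumes "bounded_linear \<psi>" shows "\<exists>w. \<forall>y. \<psi> y = w \<bullet> y"
proof (cases "\<forall>y. \<psi> y = 0")
  case False
  interpret bounded_linear \<psi> by fact
  define N where "N = {y. \<psi> y = 0}"
  have N: "subspace N" "closed N"
    by (auto simp: N_def subspace_def zero add scale intro!: closed_Collect_eq continuous_on continuous_on_const continuous_on_id)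
  obtain z where z: "\<psi> z \<noteq> 0" using False by blast
  define e where "e = z - orth_proj N z"
  have "orth_proj N z \<in> N" by (rule orth_proj_in[OF N])
  then have e: "\<psi> e \<noteq> 0" using z by (simp add: e_def diff N_def)
  then have "e \<bullet> e \<noteq> 0" using zero by auto
  have "\<psi> y = ((\<psi> e / (e \<bullet> e)) *\<^sub>R e) \<bullet> y" for y
  proof -
    have "y - (\<psi> y / \<psi> e) *\<^sub>R e \<in> N" using e by (simp add: N_def diff scale)
    then have "e \<bullet> (y - (\<psi> y / \<psi> e) *\<^sub>R e) = 0"
      unfolding e_def by (rule orth_proj_orth[OF N])
    then show ?thesis using e \<open>e \<bullet> e \<noteq> 0\<close> by (simp add: inner_diff_right field_simps)
  qed
  then show ?thesis by blast
qed (auto intro!: exI[of _ 0])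

text \<open>Weak convergence of the whole sequence.  The vectors against which the
  sequence converges form a closed subspace; it contains the first factor, by assumption, and the
  orthogonal complement of \<open>W\<close>.  A vector orthogonal to both lies in \<open>W\<close> and has first component
  zero, so it vanishes because \<open>W\<close> is a graph.\<close>

lemma bounded_sequence_in_closed_graph:
  fixes W :: "('h::{real_inner,banach} \<times> 'g::{real_inner,banach}) set"
  assumes W: "subspace W" "closed W" and graph: "\<And>g. (0, g) \<in> W \<Longrightarrow> g = 0"
    and x: "\<And>k. x k \<in> W" "\<And>k. norm (x k) \<le> M" and lim: "(\<lambda>k. fst (x k)) \<longlonglongrightarrow> p"
  shows "\<exists>w\<in>W. fst w = p \<and> (\<forall>y. (\<lambda>k. x k \<bullet> y) \<longlonglongrightarrow> w \<bullet> y)"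
proof -
  have "M \<ge> 0" using x(2)[of 0] norm_ge_zero order_trans by blast
  define Z where "Z = {y. convergent (\<lambda>k. x k \<bullet> y)}"
  have Z: "subspace Z"
    by (auto simp: subspace_def Z_def inner_add_right intro: convergent_const convergent_add convergent_mult)
  have "closed Z"
  proof (unfold closed_sequential_limits, intro allI impI, elim conjE)
    fix y l assume y: "\<forall>n. y n \<in> Z" and yl: "y \<longlonglongrightarrow> l"
    have "Cauchy (\<lambda>k. x k \<bullet> l)"
    proof (rule metric_CauchyI)
      fix e :: real assume e: "e > 0"
      then have "e / (3 * (M + 1)) > 0" using \<open>M \<ge> 0\<close> by simp
      then obtain n where n: "norm (y n - l) < e / (3 * (M + 1))"
        using yl by (metis LIMSEQ_iff le_refl)
      have nb: "\<bar>x k \<bullet> (y n - l)\<bar> < e / 3" for k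
      proof -
        have "\<bar>x k \<bullet> (y n - l)\<bar> \<le> norm (x k) * norm (y n - l)" by (rule Cauchy_Schwarz_ineq2)
        also have "\<dots> \<le> (M + 1) * norm (y n - l)"
          using x(2)[of k] by (intro mult_right_mono) auto
        also have "\<dots> < e / 3" using n \<open>M \<ge> 0\<close> by (simp add: field_simps)
        finally show ?thesis .
      qed
      have "Cauchy (\<lambda>k. x k \<bullet> y n)" using y by (auto simp: Z_def convergent_Cauchy)
      then obtain N where N: "\<And>j k. j \<ge> N \<Longrightarrow> k \<ge> N \<Longrightarrow> dist (x j \<bullet> y n) (x k \<bullet> y n) < e / 3"
        using e unfolding Cauchy_def by (metis divide_pos_pos zero_less_numeral)
      have "dist (x j \<bullet> l) (x k \<bullet> l) < e" if "j \<ge> N" "k \<ge> N" for j k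
        using N[OF that] nb[of j] nb[of k] unfolding dist_real_def inner_diff_right by linarith
      then show "\<exists>N. \<forall>j\<ge>N. \<forall>k\<ge>N. dist (x j \<bullet> l) (x k \<bullet> l) < e" by blast
    qed
    then show "l \<in> Z" by (simp add: Z_def Cauchy_convergent)
  qed
  have Zfst: "(h, 0) \<in> Z" for h
  proof -
    have "(\<lambda>k. fst (x k) \<bullet> h) \<longlonglongrightarrow> p \<bullet> h" by (intro tendsto_intros lim)
    then show ?thesis by (auto simp: Z_def convergent_def inner_prod_def)
  qed
  have Zorth: "y \<in> Z" if "\<And>v. v \<in> W \<Longrightarrow> y \<bullet> v = 0" for y
    using that[OF x(1)] by (simp add: Z_def inner_commute convergent_const)
  have "Z = UNIV"
  proof (rule orthogonal_complement_trivial_imp_UNIV[OF Z \<open>closed Z\<close>])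
    fix y assume y: "\<And>v. v \<in> Z \<Longrightarrow> y \<bullet> v = 0"
    define q where "q = orth_proj W y"
    have "y - q \<in> Z" unfolding q_def by (intro Zorth orth_proj_orth[OF W])
    then have "y \<bullet> (y - q) = 0" by (rule y)
    moreover have "(y - q) \<bullet> q = 0" unfolding q_def by (intro orth_proj_orth[OF W] orth_proj_in[OF W])
    ultimately have "(y - q) \<bullet> (y - q) = 0" by (simp add: algebra_simps inner_commute)
    then have "y = q" by simp
    then have "y \<in> W" unfolding q_def using orth_proj_in[OF W] by metis
    have "y \<bullet> (fst y, 0) = 0" by (rule y[OF Zfst])
    then have "fst y = 0" by (simp add: inner_prod_def)
    then have "snd y = 0" using \<open>y \<in> W\<close> by (intro graph) (metis prod.collapse)
    with \<open>fst y = 0\<close> show "y = 0" by (simp add: prod_eq_iff)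
  qed
  then have conv: "(\<lambda>k. x k \<bullet> y) \<longlonglongrightarrow> lim (\<lambda>k. x k \<bullet> y)" for y
    by (auto simp: Z_def convergent_LIMSEQ_iff)
  have "bounded_linear (\<lambda>y. lim (\<lambda>k. x k \<bullet> y))"
  proof (rule bounded_linear_intro[of _ M])
    fix y z r
    show "lim (\<lambda>k. x k \<bullet> (y + z)) = lim (\<lambda>k. x k \<bullet> y) + lim (\<lambda>k. x k \<bullet> z)"
      using tendsto_add[OF conv[of y] conv[of z]] by (simp add: inner_add_right limI)
    show "lim (\<lambda>k. x k \<bullet> (r *\<^sub>R y)) = r *\<^sub>R lim (\<lambda>k. x k \<bullet> y)"
      using tendsto_mult_left[OF conv[of y], of r] by (simp add: limI)
    show "norm (lim (\<lambda>k. x k \<bullet> y)) \<le> norm y * M"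
    proof (rule tendsto_upperbound[OF tendsto_norm[OF conv]])
      have "norm (x k \<bullet> y) \<le> norm y * M" for k
        using Cauchy_Schwarz_ineq2[of "x k" y] mult_right_mono[OF x(2)[of k] norm_ge_zero[of y]]
        by (simp add: mult.commute)
      then show "\<forall>\<^sub>F k in sequentially. norm (x k \<bullet> y) \<le> norm y * M" by simp
    qed simp
  qed
  then obtain w where w: "\<And>y. lim (\<lambda>k. x k \<bullet> y) = w \<bullet> y" using riesz_representation by blast
  have "w - orth_proj W w = 0"
  proof -
    have "x k \<bullet> (w - orth_proj W w) = 0" for k
      using orth_proj_orth[OF W x(1)] by (simp add: inner_commute)
    then have "w \<bullet> (w - orth_proj W w) = 0" using w[of "w - orth_proj W w"] by simp
    moreover have "(w - orth_proj W w) \<bullet> orth_proj W w = 0"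
      by (intro orth_proj_orth[OF W] orth_proj_in[OF W])
    ultimately have "(w - orth_proj W w) \<bullet> (w - orth_proj W w) = 0"
      by (simp add: algebra_simps inner_commute)
    then show ?thesis by simp
  qed
  then have "w \<in> W" using orth_proj_in[OF W, of w] by simp
  moreover have "fst w = p"
  proof -
    have "fst w \<bullet> h = p \<bullet> h" for h
    proof (rule LIMSEQ_unique)
      show "(\<lambda>k. fst (x k) \<bullet> h) \<longlonglongrightarrow> p \<bullet> h" by (intro tendsto_intros lim)
      show "(\<lambda>k. fst (x k) \<bullet> h) \<longlonglongrightarrow> fst w \<bullet> h"
        using conv[of "(h, 0)"] unfolding w by (simp add: inner_prod_def)
    qed
    then show ?thesis by (metis inner_diff_left inner_eq_zero_iff right_minus_eq)
  qed
  ultimately show ?thesis using conv w by auto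
qed

section \<open>Uniform boundedness\<close>

text \<open>By Baire's theorem one of the closed sets on which all \<open>T n\<close> are bounded by \<open>m\<close> contains a ball.\<close>

lemma uniform_boundedness:
  fixes T :: "nat \<Rightarrow> 'a::banach \<Rightarrow> 'b::real_normed_vector"
  assumes T: "\<And>n. bounded_linear (T n)" and pw: "\<And>x. \<exists>M. \<forall>n. norm (T n x) \<le> M"
  shows "\<exists>M. \<forall>n x. norm (T n x) \<le> M * norm x"
proof -
  define F where "F = (\<lambda>m::nat. {x. \<forall>n. norm (T n x) \<le> m})"
  have clF: "closed (F m)" for m
  proof -
    have "closed {x. norm (T n x) \<le> m}" for n
      by (intro closed_Collect_le continuous_intros linear_continuous_on[OF T])
    then have "closed (\<Inter>n. {x. norm (T n x) \<le> m})" by blast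
    moreover have "F m = (\<Inter>n. {x. norm (T n x) \<le> m})" by (auto simp: F_def)
    ultimately show ?thesis by simp
  qed
  have "\<Union>(range F) = UNIV"
  proof -
    have "\<exists>m. x \<in> F m" for x
    proof -
      obtain M where M: "\<And>n. norm (T n x) \<le> M" using pw by blast
      obtain m :: nat where "M \<le> m" using real_arch_simple by blast
      then have "x \<in> F m" using M order_trans by (fastforce simp: F_def)
      then show ?thesis ..
    qed
    then show ?thesis by auto
  qed
  have "\<exists>m. interior (F m) \<noteq> {}"
  proof -
    have "countable (range F)" by simp
    moreover have "completely_metrizable_space (euclidean :: 'a topology)"
      by (rule completely_metrizable_space_euclidean)
    ultimately have "euclidean interior_of \<Union>(range F) = {}" if "\<And>m. interior (F m) = {}"
      using that clF Baire_category_alt[of "euclidean :: 'a topology" "range F"]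
      by (auto simp del: Union_iff)
    then show ?thesis
      using \<open>\<Union>(range F) = UNIV\<close> by (metis UNIV_not_empty interior_UNIV euclidean_interior_of)
  qed
  then obtain m x where "x \<in> interior (F m)" by blast
  then obtain e where e: "e > 0" "cball x e \<subseteq> F m" using mem_interior_cball by blast
  have "norm (T n z) \<le> (2 * m / e) * norm z" for n z
  proof (cases "z = 0")
    case True then show ?thesis using bounded_linear.linear[OF T] linear_0 by fastforce
  next
    case False
    interpret bounded_linear "T n" by (rule T)
    define y where "y = (e / norm z) *\<^sub>R z"
    have "x + y \<in> F m" "x \<in> F m" using e False by (auto simp: y_def dist_norm subset_iff)
    then have "norm (T n (x + y)) \<le> m" "norm (T n x) \<le> m" by (auto simp: F_def)
    moreover have "T n y = T n (x + y) - T n x" by (simp add: add)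
    ultimately have "norm (T n y) \<le> 2 * m"
      using norm_triangle_ineq4[of "T n (x + y)" "T n x"] by simp
    moreover have "norm (T n y) = (e / norm z) * norm (T n z)"
      using e by (simp add: y_def scale)
    ultimately show ?thesis using False e by (simp add: field_simps)
  qed
  then show ?thesis by blast
qed

section \<open>Semigroups generated by coercive forms\<close>

lemma subspace_closure_normed:
  fixes D :: "'a::real_normed_vector set"
  assumes "subspace D" shows "subspace (closure D)"
  unfolding subspace_def
proof (intro conjI ballI allI)
  show "0 \<in> closure D" using subspace_0[OF assms] closure_subset by blast
  fix x y assume "x \<in> closure D" "y \<in> closure D"
  then obtain a b where "\<And>n::nat. a n \<in> D" "a \<longlonglongrightarrow> x" "\<And>n::nat. b n \<in> D" "b \<longlonglongrightarrow> y"
    by (auto simp: closure_sequential)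
  then show "x + y \<in> closure D"
    unfolding closure_sequential using assms
    by (intro exI[of _ "\<lambda>n. a n + b n"]) (auto intro: subspace_add tendsto_add)
next
  fix r x assume "x \<in> closure D"
  then obtain a where "\<And>n::nat. a n \<in> D" "a \<longlonglongrightarrow> x" by (auto simp: closure_sequential)
  then show "r *\<^sub>R x \<in> closure D"
    unfolding closure_sequential using assms
    by (intro exI[of _ "\<lambda>n. r *\<^sub>R a n"]) (auto intro: subspace_scale tendsto_scaleR)
qed

text \<open>The semigroup \<open>S\<close> acts on the range of the projection \<open>P\<close> and is extended to the whole space by
  \<open>S t = S t P\<close>; in this way subspaces like \<open>L\<^sub>2(\<Omega>, L\<^sub>2(Y))\<close> are treated without a type of their own.  The form domain
  is given by its graph \<open>W\<close>, the pairs of \<open>u\<close> and its gradient, and \<open>B\<close> applies the coefficients, so that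
  the form is \<open>\<aa>(u, v) = (B g, k)\<close> for \<open>(u, g)\<close> and \<open>(v, k)\<close> in \<open>W\<close>.  The assumption \<open>gen\<close> says that \<open>- A\<close> generates
  \<open>S\<close>, where \<open>A\<close> is the operator associated with the form.\<close>

locale form_semigroup =
  fixes P :: "'h::{real_inner,banach} \<Rightarrow> 'h" and S :: "real \<Rightarrow> 'h \<Rightarrow> 'h"
    and W :: "('h \<times> 'g::{real_inner,banach}) set" and B :: "'g \<Rightarrow> 'g" and \<mu> :: real
  assumes P_lin: "bounded_linear P" and P_idem: "P (P u) = P u"
    and S_lin: "t > 0 \<Longrightarrow> bounded_linear (S t)"
    and S_P: "t > 0 \<Longrightarrow> S t (P u) = S t u" and P_S: "t > 0 \<Longrightarrow> P (S t u) = S t u"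
    and S_add: "s > 0 \<Longrightarrow> t > 0 \<Longrightarrow> S (s + t) u = S s (S t u)"
    and S_lim: "((\<lambda>t. S t u) \<longlongrightarrow> P u) (at_right 0)"
    and W_subspace: "subspace W" and W_closed: "closed W"
    and W_P: "(u, g) \<in> W \<Longrightarrow> P u = u" and W_graph: "(0, g) \<in> W \<Longrightarrow> g = 0"
    and B_lin: "bounded_linear B" and \<mu>_pos: "\<mu> > 0"
    and coercive: "(u, g) \<in> W \<Longrightarrow> \<mu> * (norm g)\<^sup>2 \<le> B g \<bullet> g"
    and gen: "P u = u \<Longrightarrow> P h = h \<Longrightarrow>
      ((\<lambda>t. (1 / t) *\<^sub>R (S t u - u)) \<longlongrightarrow> - h) (at_right 0) \<longleftrightarrow>
      (\<exists>g. (u, g) \<in> W \<and> (\<forall>(v, k) \<in> W. B g \<bullet> k = h \<bullet> v))"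
begin

sublocale P: bounded_linear P by (rule P_lin)
sublocale B: bounded_linear B by (rule B_lin)

text \<open>The graph of the operator \<open>A\<close> associated with the form.\<close>

definition A_rel :: "'h \<Rightarrow> 'h \<Rightarrow> bool" where
  "A_rel u h \<longleftrightarrow> P h = h \<and> (\<exists>g. (u, g) \<in> W \<and> (\<forall>(v, k) \<in> W. B g \<bullet> k = h \<bullet> v))"

text \<open>The value \<open>P\<close> at time \<open>0\<close> makes the orbits continuous on \<open>[0, \<infinity>)\<close>.\<close>

definition S0 :: "real \<Rightarrow> 'h \<Rightarrow> 'h" where
  "S0 t u = (if t \<le> 0 then P u else S t u)"

lemma S0_lin: "bounded_linear (S0 t)"
  using P_lin S_lin[of t] by (cases "t \<le> 0") (simp_all add: S0_def[abs_def])

lemma S0_P [simp]: "S0 t (P u) = S0 t u" and P_S0 [simp]: "P (S0 t u) = S0 t u"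
  by (simp_all add: S0_def S_P P_S P_idem)

lemma S0_add: "s \<ge> 0 \<Longrightarrow> t \<ge> 0 \<Longrightarrow> S0 (s + t) u = S0 s (S0 t u)"
  by (cases "s = 0"; cases "t = 0") (auto simp: S0_def S_add S_P P_S P_idem)

lemma A_rel_P: "A_rel u h \<Longrightarrow> P u = u" "A_rel u h \<Longrightarrow> P h = h"
  using W_P by (auto simp: A_rel_def)

lemma A_rel_gen:
  assumes "P u = u" "P h = h"
  shows "A_rel u h \<longleftrightarrow> ((\<lambda>t. (1 / t) *\<^sub>R (S t u - u)) \<longlongrightarrow> - h) (at_right 0)"
  unfolding A_rel_def gen[OF assms] using assms by simp

lemma A_rel_unique: assumes "A_rel u h" "A_rel u h'" shows "h = h'"
proof -
  have "((\<lambda>t. (1 / t) *\<^sub>R (S t u - u)) \<longlongrightarrow> - h) (at_right 0)"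
    "((\<lambda>t. (1 / t) *\<^sub>R (S t u - u)) \<longlongrightarrow> - h') (at_right 0)"
    using assms A_rel_gen A_rel_P by blast+
  then have "- h = - h'" using tendsto_unique trivial_limit_at_right_real by blast
  then show ?thesis by simp
qed

lemma A_rel_diff:
  assumes "A_rel u h" "A_rel v k" shows "A_rel (u - v) (h - k)"
proof -
  obtain g l where "(u, g) \<in> W" "(v, l) \<in> W"
    and g: "\<And>w k'. (w, k') \<in> W \<Longrightarrow> B g \<bullet> k' = h \<bullet> w" "\<And>w k'. (w, k') \<in> W \<Longrightarrow> B l \<bullet> k' = k \<bullet> w"
    using assms by (fastforce simp: A_rel_def)
  then have "(u - v, g - l) \<in> W" using subspace_diff[OF W_subspace, of "(u, g)" "(v, l)"] by simp
  then show ?thesis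
    using assms g by (auto simp: A_rel_def P.diff B.diff inner_diff_left intro!: exI[of _ "g - l"])
qed

lemma A_rel_subspace: "subspace {u. \<exists>h. A_rel u h}"
  unfolding subspace_def mem_Collect_eq
proof (intro conjI ballI allI)
  have "(0, 0) \<in> W" using subspace_0[OF W_subspace] by (simp add: zero_prod_def)
  then have z: "A_rel 0 0" by (auto simp: A_rel_def P.zero B.zero intro!: exI[of _ 0])
  then show "\<exists>h. A_rel 0 h" by blast
  have sc: "A_rel (r *\<^sub>R u) (r *\<^sub>R h)" if u: "A_rel u h" for u h r
  proof -
    obtain g where "(u, g) \<in> W" and g: "\<And>w k'. (w, k') \<in> W \<Longrightarrow> B g \<bullet> k' = h \<bullet> w"
      using u by (fastforce simp: A_rel_def)
    then have "(r *\<^sub>R u, r *\<^sub>R g) \<in> W" using subspace_scale[OF W_subspace, of "(u, g)" r] by simp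
    then show ?thesis using u g by (auto simp: A_rel_def P.scale B.scale intro!: exI[of _ "r *\<^sub>R g"])
  qed
  fix u v assume "u \<in> {u. \<exists>h. A_rel u h}" "v \<in> {u. \<exists>h. A_rel u h}"
  then obtain h k where "A_rel u h" "A_rel v k" by blast
  then have "A_rel (u - (- 1) *\<^sub>R v) (h - (- 1) *\<^sub>R k)" by (intro A_rel_diff sc)
  then show "\<exists>h. A_rel (u + v) h" by auto
next
  fix r u assume "u \<in> {u. \<exists>h. A_rel u h}"
  then obtain h where u: "A_rel u h" by blast
  obtain g where "(u, g) \<in> W" and g: "\<And>w k'. (w, k') \<in> W \<Longrightarrow> B g \<bullet> k' = h \<bullet> w"
    using u by (fastforce simp: A_rel_def)
  then have "(r *\<^sub>R u, r *\<^sub>R g) \<in> W" using subspace_scale[OF W_subspace, of "(u, g)" r] by simp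
  then have "A_rel (r *\<^sub>R u) (r *\<^sub>R h)"
    using u g by (auto simp: A_rel_def P.scale B.scale intro!: exI[of _ "r *\<^sub>R g"])
  then show "\<exists>h. A_rel (r *\<^sub>R u) h" by blast
qed

lemma A_rel_accretive: assumes "A_rel u h" shows "h \<bullet> u \<ge> 0"
proof -
  obtain g where g: "(u, g) \<in> W" "\<And>v k. (v, k) \<in> W \<Longrightarrow> B g \<bullet> k = h \<bullet> v"
    using assms by (fastforce simp: A_rel_def)
  have "0 \<le> \<mu> * (norm g)\<^sup>2" using \<mu>_pos by simp
  also have "\<dots> \<le> h \<bullet> u" using coercive[OF g(1)] g(2)[OF g(1)] by simp
  finally show ?thesis .
qed

text \<open>Strong continuity at \<open>0\<close> gives pointwise bounds along every null sequence of times; uniform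
  boundedness turns them into a bound of the operator norms near \<open>0\<close>.\<close>

lemma S0_locally_bounded: "\<exists>\<delta>>0. \<exists>M\<ge>1. \<forall>t\<in>{0..\<delta>}. \<forall>u. norm (S0 t u) \<le> M * norm u"
proof (rule ccontr)
  assume "\<not> ?thesis"
  then have neg: "\<exists>t\<in>{0..\<delta>}. \<exists>u. norm (S0 t u) > M * norm u" if "\<delta> > 0" "M \<ge> 1" for \<delta> M
    using that by (meson not_le)
  obtain K where K: "K > 0" "\<And>u. norm (P u) \<le> norm u * K" using P.pos_bounded by blast
  \<comment> \<open>Adding the bound \<open>K\<close> of \<open>P\<close> excludes the time \<open>0\<close>.\<close>
  have "\<exists>t u. 0 < t \<and> t \<le> 1 / Suc n \<and> norm (S t u) > (n + K + 1) * norm u" for n :: nat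
  proof -
    obtain t u where t: "t \<in> {0..1 / Suc n}" "norm (S0 t u) > (n + K + 1) * norm u"
      using neg[of "1 / Suc n" "n + K + 1"] K(1) by auto
    have "t \<noteq> 0"
    proof
      assume "t = 0"
      then have "(n + K + 1) * norm u < norm u * K" using t(2) K(2)[of u] by (simp add: S0_def)
      then have "(n + 1) * norm u < 0" by (simp add: algebra_simps)
      then show False by (simp add: mult_less_0_iff)
    qed
    then show ?thesis using t by (auto simp: S0_def intro!: exI[of _ t] exI[of _ u])
  qed
  then obtain t :: "nat \<Rightarrow> real" and u where t: "\<And>n. 0 < t n" "\<And>n. t n \<le> 1 / Suc n"
    and u: "\<And>n::nat. norm (S (t n) (u n)) > (n + K + 1) * norm (u n)" by metis
  have "t \<longlonglongrightarrow> 0"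
    by (rule tendsto_sandwich[OF _ _ tendsto_const LIMSEQ_Suc[OF lim_1_over_n]])
      (use t in \<open>auto intro!: always_eventually simp: less_imp_le\<close>)
  then have "filterlim t (at_right 0) sequentially"
    using t(1) by (intro tendsto_imp_filterlim_at_right) auto
  then have "(\<lambda>n. S (t n) x) \<longlonglongrightarrow> P x" for x using S_lim filterlim_compose by blast
  then have "\<exists>M. \<forall>n. norm (S (t n) x) \<le> M" for x
    using convergent_imp_bounded[of "\<lambda>n. S (t n) x"] by (auto simp: bounded_iff)
  then obtain M where M: "\<And>n x. norm (S (t n) x) \<le> M * norm x"
    using uniform_boundedness[of "\<lambda>n. S (t n)"] S_lin[OF t(1)] by blast
  obtain n :: nat where n: "M \<le> n" using real_arch_simple by blast
  have "(n + K + 1) * norm (u n) < M * norm (u n)" using u[of n] M[of n "u n"] by linarith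
  also have "\<dots> \<le> (n + K + 1) * norm (u n)" using n K(1) by (intro mult_right_mono) auto
  finally show False by simp
qed

lemma S0_bounded_on: "\<exists>M\<ge>1. \<forall>t\<in>{0..T}. \<forall>u. norm (S0 t u) \<le> M * norm u"
proof -
  obtain \<delta> M where \<delta>: "\<delta> > 0" "M \<ge> 1" and M: "\<And>t u. 0 \<le> t \<Longrightarrow> t \<le> \<delta> \<Longrightarrow> norm (S0 t u) \<le> M * norm u"
    using S0_locally_bounded by (metis atLeastAtMost_iff)
  have *: "norm (S0 t u) \<le> M ^ Suc n * norm u" if "0 \<le> t" "t \<le> Suc n * \<delta>" for n t u
    using that
  proof (induction n arbitrary: t u)
    case 0 then show ?case using M by simp
  next
    case (Suc n)
    show ?case
    proof (cases "t \<le> \<delta>")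
      case True
      then have "norm (S0 t u) \<le> M * norm u" using M Suc.prems by blast
      also have "\<dots> \<le> M ^ Suc (Suc n) * norm u"
        using self_le_power[of M "Suc (Suc n)"] \<delta> by (intro mult_right_mono) auto
      finally show ?thesis .
    next
      case False
      then have "S0 t u = S0 \<delta> (S0 (t - \<delta>) u)" using S0_add[of \<delta> "t - \<delta>" u] \<delta> by simp
      then have "norm (S0 t u) \<le> M * norm (S0 (t - \<delta>) u)" using M[of \<delta>] \<delta> by simp
      also have "\<dots> \<le> M * (M ^ Suc n * norm u)"
        using Suc.IH[of "t - \<delta>" u] Suc.prems False \<delta> by (intro mult_left_mono) (auto simp: algebra_simps)
      finally show ?thesis by (simp add: mult.assoc)
    qed
  qed
  obtain n :: nat where "T / \<delta> \<le> n" using real_arch_simple by blast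
  then have "T \<le> Suc n * \<delta>" using \<delta> by (simp add: field_simps)
  then have "\<forall>t\<in>{0..T}. \<forall>u. norm (S0 t u) \<le> M ^ Suc n * norm u" using * by fastforce
  then show ?thesis using \<delta>(2) by (intro exI[of _ "M ^ Suc n"]) (auto simp: one_le_power simp del: power_Suc)
qed

lemma S0_tendsto_0: assumes "e > 0" shows "\<exists>d>0. \<forall>t\<in>{0..<d}. norm (S0 t u - P u) < e"
proof -
  have "eventually (\<lambda>t. dist (S t u) (P u) < e) (at_right 0)"
    using S_lim assms by (rule tendstoD)
  then obtain d where "d > 0" "\<And>t. 0 < t \<Longrightarrow> t < d \<Longrightarrow> dist (S t u) (P u) < e"
    by (auto simp: eventually_at_right[OF zero_less_one])
  then show ?thesis using assms by (intro exI[of _ d]) (auto simp: S0_def dist_norm)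
qed

lemma S0_continuous: "continuous_on {0..} (\<lambda>t. S0 t u)"
  unfolding continuous_on_iff dist_norm
proof (intro ballI allI impI)
  fix t e :: real assume "t \<in> {0..}" and e: "0 < e"
  then have t: "0 \<le> t" by simp
  obtain M where M: "M \<ge> 1" "\<And>s v. 0 \<le> s \<Longrightarrow> s \<le> t + 1 \<Longrightarrow> norm (S0 s v) \<le> M * norm v"
    using S0_bounded_on[of "t + 1"] by auto
  obtain d where d: "d > 0" "\<And>s. 0 \<le> s \<Longrightarrow> s < d \<Longrightarrow> norm (S0 s u - P u) < e / M"
    using S0_tendsto_0[of "e / M" u] e M(1) by auto
  have *: "norm (S0 b u - S0 a u) < e" if "0 \<le> a" "a \<le> b" "b - a < d" "a \<le> t + 1" for a b
  proof -
    interpret bounded_linear "S0 a" by (rule S0_lin)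
    have "S0 b u - S0 a u = S0 a (S0 (b - a) u - P u)"
      using S0_add[of a "b - a" u] that by (simp add: diff)
    then have "norm (S0 b u - S0 a u) \<le> M * norm (S0 (b - a) u - P u)" using M(2) that by simp
    also have "\<dots> < M * (e / M)" using d(2)[of "b - a"] that M(1) by (intro mult_strict_left_mono) auto
    finally show ?thesis using M(1) by simp
  qed
  show "\<exists>d>0. \<forall>s\<in>{0..}. norm (s - t) < d \<longrightarrow> norm (S0 s u - S0 t u) < e"
  proof (intro exI[of _ "min d 1"] conjI ballI impI)
    fix s assume "s \<in> {0..}" "norm (s - t) < min d 1"
    then have s: "s \<ge> 0" "\<bar>s - t\<bar> < min d 1" by auto
    show "norm (S0 s u - S0 t u) < e"
      using *[of s t] *[of t s] s t by (cases "s \<le> t") (auto simp: norm_minus_commute)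
  qed (use d in auto)
qed

lemma A_rel_S0: assumes "A_rel u h" shows "A_rel (S0 t u) (S0 t h)"
proof (cases "t \<le> 0")
  case True then show ?thesis using assms A_rel_P[OF assms] by (simp add: S0_def)
next
  case False
  interpret S0: bounded_linear "S0 t" by (rule S0_lin)
  have "((\<lambda>s. (1 / s) *\<^sub>R (S s u - u)) \<longlongrightarrow> - h) (at_right 0)"
    using assms A_rel_gen A_rel_P by blast
  then have "((\<lambda>s. S0 t ((1 / s) *\<^sub>R (S s u - u))) \<longlongrightarrow> S0 t (- h)) (at_right 0)" by (rule S0.tendsto)
  moreover have "eventually (\<lambda>s. S0 t ((1 / s) *\<^sub>R (S s u - u)) = (1 / s) *\<^sub>R (S s (S0 t u) - S0 t u)) (at_right 0)"
    using eventually_at_right_less[of "0::real"]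
  proof eventually_elim
    case (elim s)
    have "S0 t (S s u) = S s (S0 t u)"
      using S_add[of t s u] S_add[of s t u] elim False by (simp add: S0_def add.commute)
    then show ?case by (simp add: S0.diff S0.scaleR)
  qed
  ultimately have "((\<lambda>s. (1 / s) *\<^sub>R (S s (S0 t u) - S0 t u)) \<longlongrightarrow> S0 t (- h)) (at_right 0)"
    by (rule Lim_transform_eventually)
  then have "((\<lambda>s. (1 / s) *\<^sub>R (S s (S0 t u) - S0 t u)) \<longlongrightarrow> - S0 t h) (at_right 0)"
    by (simp only: S0.neg)
  then show ?thesis by (subst A_rel_gen) auto
qed

text \<open>The generator gives the right derivative at \<open>0\<close>, hence at every \<open>t\<close>.  For \<open>s < t\<close> the increment is
  compared with the derivative at \<open>s\<close>, which is close to the one at \<open>t\<close> by continuity of the orbit of \<open>h\<close>.\<close>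

lemma S0_has_derivative:
  assumes u: "A_rel u h" and t: "t > 0"
  shows "((\<lambda>s. S0 s u) has_vector_derivative - S0 t h) (at t)"
  unfolding has_vector_derivative_def has_derivative_at_alt
proof (intro conjI allI impI)
  show "bounded_linear (\<lambda>x. x *\<^sub>R - S0 t h)" by (rule bounded_linear_scaleR_left)
  fix e :: real assume e: "e > 0"
  have Pu: "P u = u" using A_rel_P u by blast
  obtain M where M: "M \<ge> 1" "\<And>s v. 0 \<le> s \<Longrightarrow> s \<le> t \<Longrightarrow> norm (S0 s v) \<le> M * norm v"
    using S0_bounded_on[of t] by auto
  have "((\<lambda>t. (1 / t) *\<^sub>R (S t u - u)) \<longlongrightarrow> - h) (at_right 0)"
    using u A_rel_gen A_rel_P by blast
  then have "eventually (\<lambda>t. dist ((1 / t) *\<^sub>R (S t u - u)) (- h) < e / (2 * M)) (at_right 0)"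
    using e M by (intro tendstoD) auto
  then obtain d1 where d1: "d1 > 0"
    "\<And>s. 0 < s \<Longrightarrow> s < d1 \<Longrightarrow> norm ((1 / s) *\<^sub>R (S s u - u) + h) < e / (2 * M)"
    unfolding eventually_at_right[OF zero_less_one] by (auto simp: dist_norm)
  have q: "norm (S0 (a + s) u - S0 a u + s *\<^sub>R S0 a h) \<le> (e / 2) * s" if "0 < s" "s < d1" "0 \<le> a" "a \<le> t" for a s
  proof -
    interpret S0: bounded_linear "S0 a" by (rule S0_lin)
    have "S0 (a + s) u - S0 a u + s *\<^sub>R S0 a h = s *\<^sub>R S0 a ((1 / s) *\<^sub>R (S s u - u) + h)"
      using that S0_add[of a s u] by (simp add: S0.add S0.diff S0.scaleR S0_def[of s] algebra_simps)
    then have "norm (S0 (a + s) u - S0 a u + s *\<^sub>R S0 a h) \<le> s * (M * norm ((1 / s) *\<^sub>R (S s u - u) + h))"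
      using M(2)[of a] that by simp
    also have "\<dots> \<le> s * (M * (e / (2 * M)))"
      using d1(2)[of s] that M(1) by (intro mult_left_mono) auto
    finally show ?thesis using M(1) by (simp add: mult.commute)
  qed
  have "continuous_on {0..} (\<lambda>t. S0 t h)" by (rule S0_continuous)
  then obtain d2 where d2: "d2 > 0" "\<And>s. 0 \<le> s \<Longrightarrow> \<bar>s - t\<bar> < d2 \<Longrightarrow> norm (S0 s h - S0 t h) < e / 2"
    using t e unfolding continuous_on_iff dist_norm
    by (metis atLeast_iff half_gt_zero less_imp_le real_norm_def)
  show "\<exists>d>0. \<forall>s. norm (s - t) < d \<longrightarrow>
      norm (S0 s u - S0 t u - (s - t) *\<^sub>R - S0 t h) \<le> e * norm (s - t)"
  proof (intro exI[of _ "min (min d1 d2) t"] conjI allI impI)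
    fix s assume s: "norm (s - t) < min (min d1 d2) t"
    then have s0: "0 \<le> s" by auto
    consider "s = t" | "t < s" | "s < t" by linarith
    then show "norm (S0 s u - S0 t u - (s - t) *\<^sub>R - S0 t h) \<le> e * norm (s - t)"
    proof cases
      case 2
      have "norm (S0 s u - S0 t u - (s - t) *\<^sub>R - S0 t h) \<le> (e / 2) * (s - t)"
      proof -
        have "s - t < d1" "0 < s - t" using s 2 by auto
        from q[OF this(2) this(1), of t] show ?thesis using t by simp
      qed
      also have "\<dots> \<le> e * norm (s - t)" using 2 e by simp
      finally show ?thesis .
    next
      case 3
      have eq: "S0 s u - S0 t u - (s - t) *\<^sub>R - S0 t h =
          - (S0 t u - S0 s u + (t - s) *\<^sub>R S0 s h) + (t - s) *\<^sub>R (S0 s h - S0 t h)"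
        by (simp add: scaleR_diff_left scaleR_diff_right)
      have "norm (S0 s u - S0 t u - (s - t) *\<^sub>R - S0 t h)
          \<le> norm (S0 t u - S0 s u + (t - s) *\<^sub>R S0 s h) + norm ((t - s) *\<^sub>R (S0 s h - S0 t h))"
        unfolding eq using norm_triangle_ineq[of "- (S0 t u - S0 s u + (t - s) *\<^sub>R S0 s h)" "(t - s) *\<^sub>R (S0 s h - S0 t h)"]
        unfolding norm_minus_cancel .
      also have "\<dots> \<le> (e / 2) * (t - s) + (t - s) * (e / 2)"
      proof (rule add_mono)
        show "norm (S0 t u - S0 s u + (t - s) *\<^sub>R S0 s h) \<le> (e / 2) * (t - s)"
          using q[of "t - s" s] s s0 3 by simp
        have "norm (S0 s h - S0 t h) \<le> e / 2" using d2(2)[of s] s s0 by simp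
        then show "norm ((t - s) *\<^sub>R (S0 s h - S0 t h)) \<le> (t - s) * (e / 2)"
          using 3 by (simp only: norm_scaleR) (simp add: mult_left_mono)
      qed
      also have "\<dots> = e * norm (s - t)" using 3 by (simp add: field_simps)
      finally show ?thesis .
    qed simp
  qed (use d1 d2 t in auto)
qed

text \<open>The derivative of \<open>\<parallel>z\<parallel>\<^sup>2\<close> is \<open>- 2 (h, z) \<le> 0\<close>.  This serves for contractivity and for uniqueness of the
  solutions of \<open>z' = - A z\<close>.\<close>

lemma energy_decreasing:
  assumes cont: "continuous_on {0..} z"
    and der: "\<And>t. t > 0 \<Longrightarrow> (z has_vector_derivative - h t) (at t)"
    and A: "\<And>t. t > 0 \<Longrightarrow> A_rel (z t) (h t)" and t: "t \<ge> 0"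
  shows "norm (z t) \<le> norm (z 0)"
proof (cases "t = 0")
  case False
  have "z t \<bullet> z t \<le> z 0 \<bullet> z 0"
  proof (rule DERIV_nonpos_imp_decreasing_open[of 0 t "\<lambda>t. z t \<bullet> z t"])
    show "continuous_on {0..t} (\<lambda>t. z t \<bullet> z t)"
      by (intro continuous_intros continuous_on_subset[OF cont]) auto
    fix s assume s: "0 < s" "s < t"
    have "((\<lambda>t. z t \<bullet> z t) has_vector_derivative (z s \<bullet> (- h s) + (- h s) \<bullet> z s)) (at s)"
      by (rule bounded_bilinear.has_vector_derivative[OF bounded_bilinear_inner der der]) (use s in auto)
    moreover have "z s \<bullet> (- h s) + (- h s) \<bullet> z s \<le> 0"
      using A_rel_accretive[OF A[OF s(1)]] by (simp add: inner_commute)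
    ultimately show "\<exists>y. DERIV (\<lambda>t. z t \<bullet> z t) s :> y \<and> y \<le> 0"
      by (auto simp: has_real_derivative_iff_has_vector_derivative)
  qed (use t in auto)
  then show ?thesis by (simp add: norm_le)
qed simp

subsection \<open>The resolvent\<close>

text \<open>The equation \<open>w = l (l + A)\<^sup>-\<^sup>1 u\<close> in variational form.  The pair \<open>w\<close> contains the gradient as well,
  because the limits \<open>l \<rightarrow> \<infinity>\<close> are taken in the graph \<open>W\<close>.\<close>

definition yosida :: "real \<Rightarrow> 'h \<Rightarrow> 'h \<times> 'g \<Rightarrow> bool" where
  "yosida l u w \<longleftrightarrow> w \<in> W \<and> (\<forall>v\<in>W. B (snd w) \<bullet> snd v = l * ((u - fst w) \<bullet> fst v))"

lemma yosida_exists: assumes "l > 0" shows "\<exists>w. yosida l u w"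
proof -
  define L where "L = (\<lambda>x::'h \<times> 'g. (l *\<^sub>R fst x, B (snd x)))"
  have L: "bounded_linear L" unfolding L_def
    by (intro bounded_linear_Pair bounded_linear_compose[OF bounded_linear_scaleR_right bounded_linear_fst]
        bounded_linear_compose[OF B_lin bounded_linear_snd])
  have "\<exists>w\<in>W. \<forall>v\<in>W. L w \<bullet> v = (l *\<^sub>R u, 0) \<bullet> v"
  proof (rule lax_milgram[OF W_subspace W_closed L])
    show "min l \<mu> > 0" using assms \<mu>_pos by simp
    fix w assume w: "w \<in> W"
    obtain x g where wx: "w = (x, g)" by fastforce
    have "min l \<mu> * (norm w)\<^sup>2 = min l \<mu> * (norm x)\<^sup>2 + min l \<mu> * (norm g)\<^sup>2"
      by (simp add: wx norm_Pair algebra_simps)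
    also have "\<dots> \<le> l * (norm x)\<^sup>2 + \<mu> * (norm g)\<^sup>2" by (intro add_mono mult_right_mono) auto
    also have "\<dots> \<le> L w \<bullet> w"
      using coercive w wx by (simp add: L_def inner_prod_def power2_norm_eq_inner)
    finally show "L w \<bullet> w \<ge> min l \<mu> * (norm w)\<^sup>2" .
  qed
  then obtain w where w: "w \<in> W" "\<And>v. v \<in> W \<Longrightarrow> L w \<bullet> v = (l *\<^sub>R u, 0) \<bullet> v" by blast
  have "B (snd w) \<bullet> snd v = l * ((u - fst w) \<bullet> fst v)" if "v \<in> W" for v
    using w(2)[OF that] by (simp add: L_def inner_prod_def inner_diff_left algebra_simps)
  then show ?thesis using w(1) unfolding yosida_def by blast
qed

lemma yosida_sequence: "\<exists>w. \<forall>k. yosida (real (Suc k)) u (w k)"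
  by (intro choice allI yosida_exists) simp

lemma yosida_A_rel: "yosida l u w \<Longrightarrow> P u = u \<Longrightarrow> A_rel (fst w) (l *\<^sub>R (u - fst w))"
  unfolding A_rel_def yosida_def
  using W_P[of "fst w" "snd w"] by (auto simp: P.scale P.diff intro!: exI[of _ "snd w"])

lemma yosida_diff: "yosida l u w \<Longrightarrow> yosida l u' w' \<Longrightarrow> yosida l (u - u') (w - w')"
  unfolding yosida_def by (auto simp: B.diff inner_diff_left subspace_diff[OF W_subspace] algebra_simps)

lemma yosida_norm_le: assumes "yosida l u w" "l > 0" shows "norm (fst w) \<le> norm u"
proof -
  have w: "w \<in> W" using assms by (simp add: yosida_def)
  have "0 \<le> \<mu> * (norm (snd w))\<^sup>2" using \<mu>_pos by simp
  also have "\<dots> \<le> B (snd w) \<bullet> snd w" using w coercive[of "fst w" "snd w"] by simp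
  also have "\<dots> = l * ((u - fst w) \<bullet> fst w)" using assms w by (simp add: yosida_def)
  finally have "0 \<le> (u - fst w) \<bullet> fst w" using \<open>l > 0\<close> by (simp add: zero_le_mult_iff)
  then have "norm (fst w) * norm (fst w) \<le> u \<bullet> fst w"
    by (simp add: inner_diff_left flip: power2_norm_eq_inner power2_eq_square)
  also have "\<dots> \<le> norm u * norm (fst w)" by (rule norm_cauchy_schwarz)
  finally show ?thesis by (cases "norm (fst w) = 0") (auto simp: mult_le_cancel_right)
qed

text \<open>A vector orthogonal to the domain is of the form \<open>h = w + A w\<close> with \<open>(h, w) = 0\<close>, which forces
  \<open>w = 0\<close>; then \<open>h = 0\<close>, because a generator is single valued.\<close>

lemma domain_dense: assumes "P u = u" shows "u \<in> closure {u. \<exists>h. A_rel u h}"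
proof -
  define D where "D = closure {u. \<exists>h. A_rel u h}"
  have D: "subspace D" "closed D" unfolding D_def using A_rel_subspace by (auto intro: subspace_closure_normed)
  define h where "h = u - orth_proj D u"
  have "D \<subseteq> {u. P u = u}" unfolding D_def
    by (rule closure_minimal) (auto simp: A_rel_P intro!: closed_Collect_eq P.continuous_on continuous_intros)
  then have Ph: "P h = h" using orth_proj_in[OF D, of u] assms by (auto simp: h_def P.diff)
  obtain w where w: "yosida 1 h w" using yosida_exists zero_less_one by blast
  have A: "A_rel (fst w) (h - fst w)" using yosida_A_rel[OF w Ph] by simp
  then have "fst w \<in> D" using closure_subset by (force simp: D_def)
  then have "h \<bullet> fst w = 0" unfolding h_def by (rule orth_proj_orth[OF D])
  with A_rel_accretive[OF A] have "fst w \<bullet> fst w \<le> 0" by (simp add: inner_diff_left)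
  then have "fst w = 0" by (meson inner_gt_zero_iff not_less)
  then have "A_rel 0 h" using A by simp
  moreover have "A_rel 0 0" using A_rel_diff[OF A A] by simp
  ultimately have "h = 0" by (rule A_rel_unique)
  then have "u = orth_proj D u" by (simp add: h_def)
  then show ?thesis using orth_proj_in[OF D, of u] unfolding D_def by metis
qed

lemma S0_contraction: assumes "P u = u" "t \<ge> 0" shows "norm (S0 t u) \<le> norm u"
proof -
  have "{u. \<exists>h. A_rel u h} \<subseteq> {u. norm (S0 t u) \<le> norm u}"
  proof clarify
    fix u h assume u: "A_rel u h"
    have "norm (S0 t u) \<le> norm (S0 0 u)"
      by (rule energy_decreasing[OF S0_continuous S0_has_derivative[OF u] A_rel_S0[OF u] assms(2)])
    then show "norm (S0 t u) \<le> norm u" using A_rel_P[OF u] by (simp add: S0_def)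
  qed
  moreover have "closed {u. norm (S0 t u) \<le> norm u}"
    by (intro closed_Collect_le continuous_intros linear_continuous_on S0_lin)
  ultimately show ?thesis using closure_minimal domain_dense[OF assms(1)] by blast
qed

lemma S_contraction: assumes "P u = u" "t > 0" shows "norm (S t u) \<le> norm u"
  using S0_contraction[of u t] assms by (simp add: S0_def)

text \<open>The difference \<open>S\<^sub>t Q u - Q S\<^sub>t u\<close> solves \<open>z' = - A z\<close> with initial value \<open>0\<close>, so its energy stays zero.\<close>

lemma S_commute:
  assumes Q: "bounded_linear Q" and QP: "\<And>u. P u = u \<Longrightarrow> P (Q u) = Q u"
    and QA: "\<And>u h. A_rel u h \<Longrightarrow> A_rel (Q u) (Q h)" and u: "P u = u" and t: "t > 0"
  shows "S t (Q u) = Q (S t u)"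
proof -
  interpret Q: bounded_linear Q by fact
  interpret S0: bounded_linear "S0 t" by (rule S0_lin)
  have "{u. \<exists>h. A_rel u h} \<subseteq> {u. S0 t (Q u) = Q (S0 t u)}"
  proof clarify
    fix u h assume u: "A_rel u h"
    have "norm (S0 t (Q u) - Q (S0 t u)) \<le> norm (S0 0 (Q u) - Q (S0 0 u))"
    proof (rule energy_decreasing[where h = "\<lambda>t. S0 t (Q h) - Q (S0 t h)"])
      show "continuous_on {0..} (\<lambda>a. S0 a (Q u) - Q (S0 a u))"
        by (intro continuous_on_diff S0_continuous Q.continuous_on)
      fix s :: real assume s: "s > 0"
      have "((\<lambda>a. S0 a (Q u) - Q (S0 a u)) has_vector_derivative - S0 s (Q h) - Q (- S0 s h)) (at s)"
        by (intro has_vector_derivative_diff S0_has_derivative QA u s Q.has_vector_derivative)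
      then show "((\<lambda>a. S0 a (Q u) - Q (S0 a u)) has_vector_derivative - (S0 s (Q h) - Q (S0 s h))) (at s)"
        by (simp add: Q.neg)
      show "A_rel (S0 s (Q u) - Q (S0 s u)) (S0 s (Q h) - Q (S0 s h))"
        by (intro A_rel_diff A_rel_S0 QA u)
    qed (use t in auto)
    also have "\<dots> = 0" using A_rel_P[OF u] QP by (simp add: S0_def)
    finally show "S0 t (Q u) = Q (S0 t u)" by simp
  qed
  moreover have "closed {u. S0 t (Q u) = Q (S0 t u)}"
    by (intro closed_Collect_eq S0.continuous_on Q.continuous_on continuous_intros)
  ultimately have "S0 t (Q u) = Q (S0 t u)" using closure_minimal domain_dense[OF u] by blast
  then show ?thesis using t by (simp add: S0_def)
qed

text \<open>A symmetric operator that can be moved across the form can be moved across the operator \<open>A\<close>.  Here \<open>Q'\<close>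
  is the action of \<open>Q\<close> on gradients.\<close>

lemma S_commute_form:
  assumes Q: "bounded_linear Q" and QP: "\<And>u. P u = u \<Longrightarrow> P (Q u) = Q u"
    and Qsym: "\<And>u v. Q u \<bullet> v = u \<bullet> Q v"
    and QW: "\<And>u g. (u, g) \<in> W \<Longrightarrow> (Q u, Q' g) \<in> W"
    and QB: "\<And>u g v k. (u, g) \<in> W \<Longrightarrow> (v, k) \<in> W \<Longrightarrow> B (Q' g) \<bullet> k = B g \<bullet> Q' k"
    and u: "P u = u" and t: "t > 0"
  shows "S t (Q u) = Q (S t u)"
proof (rule S_commute[OF Q QP _ u t])
  fix u h assume "A_rel u h"
  then obtain g where g: "(u, g) \<in> W" "\<And>v k. (v, k) \<in> W \<Longrightarrow> B g \<bullet> k = h \<bullet> v" and h: "P h = h"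
    by (fastforce simp: A_rel_def)
  have "B (Q' g) \<bullet> k = Q h \<bullet> v" if "(v, k) \<in> W" for v k
    using QB[OF g(1) that] g(2)[OF QW[OF that]] by (simp add: Qsym)
  then show "A_rel (Q u) (Q h)" using QW[OF g(1)] QP[OF h] by (auto simp: A_rel_def)
qed

text \<open>On the domain of \<open>A\<close> the error is at most \<open>\<parallel>A u\<parallel> / l\<close>; the domain is dense and the maps
  \<open>l (l + A)\<^sup>-\<^sup>1\<close> are contractions.\<close>

lemma yosida_tendsto:
  assumes u: "P u = u" and w: "\<And>k. yosida (real (Suc k)) u (w k)"
  shows "(\<lambda>k. fst (w k)) \<longlonglongrightarrow> u"
proof (rule LIMSEQ_I)
  fix e :: real assume e: "e > 0"
  obtain u' h where u': "A_rel u' h" "norm (u - u') < e / 3"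
  proof -
    have "\<exists>y\<in>{u. \<exists>h. A_rel u h}. dist y u < e / 3"
      using domain_dense[OF u] e unfolding closure_approachable by (simp only: divide_pos_pos zero_less_numeral)
    then show ?thesis using that by (auto simp: dist_norm norm_minus_commute)
  qed
  obtain N :: nat where N: "norm h * 3 / e < N" using reals_Archimedean2 by blast
  have "norm (fst (w k) - u) < e" if k: "k \<ge> N" for k
  proof -
    let ?l = "real (Suc k)"
    obtain w' where w': "yosida ?l u' w'" using yosida_sequence by blast
    have "norm (fst (w k) - fst w') \<le> norm (u - u')"
      using yosida_norm_le[OF yosida_diff[OF w[of k] w']] by simp
    moreover have "norm (fst w' - u') \<le> norm h / ?l"
    proof -
      define d where "d = fst w' - u'"
      have "A_rel (fst w' - u') (?l *\<^sub>R (u' - fst w') - h)"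
        by (intro A_rel_diff yosida_A_rel w' u') (use A_rel_P[OF u'(1)] in auto)
      then have "0 \<le> (?l *\<^sub>R (u' - fst w') - h) \<bullet> d" unfolding d_def by (rule A_rel_accretive)
      also have "?l *\<^sub>R (u' - fst w') - h = - (?l *\<^sub>R d) - h" by (simp add: d_def algebra_simps)
      finally have "?l * (d \<bullet> d) \<le> - (h \<bullet> d)" by (simp add: algebra_simps)
      also have "\<dots> \<le> norm h * norm d" using Cauchy_Schwarz_ineq2[of h d] by linarith
      finally have "?l * norm d * norm d \<le> norm h * norm d"
        by (simp add: power2_norm_eq_inner[symmetric] power2_eq_square mult.assoc)
      then have "?l * norm d \<le> norm h"
        by (cases "norm d = 0") (simp, metis mult_le_cancel_right norm_ge_zero not_less order_antisym)
      then show ?thesis by (simp add: d_def field_simps)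
    qed
    moreover have "norm h / ?l < e / 3"
    proof -
      have "norm h * 3 / e < ?l" using N k by linarith
      then show ?thesis using e by (simp add: field_simps)
    qed
    moreover have "norm (fst (w k) - u) \<le> norm (fst (w k) - fst w') + norm (fst w' - u') + norm (u - u')"
      using norm_triangle_ineq[of "fst (w k) - fst w'" "fst w' - u'"]
        norm_triangle_ineq4[of "fst (w k) - u'" "u - u'"] by (simp add: algebra_simps)
    ultimately show ?thesis using u'(2) by linarith
  qed
  then show "\<exists>N. \<forall>k\<ge>N. norm (fst (w k) - u) < e" by blast
qed

text \<open>By coercivity an energy inequality bounds the gradients independently of \<open>l\<close>.\<close>

lemma yosida_weak_limit:
  assumes u: "P u = u" and w: "\<And>k. yosida (real (Suc k)) u (w k)"
    and energy: "\<And>k. B (snd (w k)) \<bullet> (snd (w k) - g) \<le> 0"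
  shows "\<exists>x\<in>W. fst x = u \<and> (\<forall>y. (\<lambda>k. w k \<bullet> y) \<longlonglongrightarrow> x \<bullet> y)"
proof (rule bounded_sequence_in_closed_graph[OF W_subspace W_closed W_graph])
  show wW: "w k \<in> W" for k using w by (simp add: yosida_def)
  show "(\<lambda>k. fst (w k)) \<longlonglongrightarrow> u" by (rule yosida_tendsto[OF u w])
  define K where "K = onorm B"
  have K: "K \<ge> 0" "norm (B g) \<le> norm g * K" for g
    using onorm[OF B_lin, of g] onorm_pos_le[OF B_lin] by (simp_all add: K_def mult.commute)
  show "norm (w k) \<le> norm u + K * norm g / \<mu>" for k
  proof -
    define d where "d = snd (w k)"
    have "\<mu> * (norm d)\<^sup>2 \<le> B d \<bullet> d"
      unfolding d_def by (rule coercive[of "fst (w k)"]) (simp add: wW)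
    also have "\<dots> \<le> B d \<bullet> g" using energy[of k] by (simp add: d_def inner_diff_right)
    also have "\<dots> \<le> norm (B d) * norm g" by (rule norm_cauchy_schwarz)
    also have "\<dots> \<le> norm d * K * norm g" by (intro mult_right_mono K) auto
    finally have "\<mu> * norm d * norm d \<le> K * norm g * norm d" by (simp add: power2_eq_square mult_ac)
    then have "\<mu> * norm d \<le> K * norm g"
      using K(1) by (cases "norm d = 0") (simp, metis mult_le_cancel_right norm_ge_zero not_less order_antisym)
    then have "norm d \<le> K * norm g / \<mu>" using \<mu>_pos by (simp add: field_simps)
    moreover have "norm (fst (w k)) \<le> norm u" using yosida_norm_le[OF w] by simp
    moreover have "norm (w k) \<le> norm (fst (w k)) + norm d"
      unfolding d_def using norm_Pair_le[of "fst (w k)" "snd (w k)"] by simp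
    ultimately show ?thesis by linarith
  qed
qed

end

text \<open>The assumptions on \<open>pC\<close> are the variational characterization of the metric projection onto a closed
  convex cone.\<close>

locale form_semigroup_cone = form_semigroup P S W B \<mu>
  for P :: "'h::{real_inner,banach} \<Rightarrow> 'h" and S and W :: "('h \<times> 'g::{real_inner,banach}) set" and B \<mu> +
  fixes C :: "'h set" and pC :: "'h \<Rightarrow> 'h"
  assumes C_P: "c \<in> C \<Longrightarrow> P c = c" and C_inv: "c \<in> C \<Longrightarrow> t > 0 \<Longrightarrow> S t c \<in> C"
    and pC_in: "P u = u \<Longrightarrow> pC u \<in> C"
    and pC_polar: "P u = u \<Longrightarrow> c \<in> C \<Longrightarrow> c \<bullet> (u - pC u) \<le> 0"
    and pC_orth: "P u = u \<Longrightarrow> pC u \<bullet> (u - pC u) = 0"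
begin

text \<open>With \<open>p\<close> the projection of \<open>w\<close> onto the cone, invariance of the cone gives
  \<open>(S\<^sub>t w - w, w - p) \<le> 0\<close>, hence \<open>(A w, w - p) \<ge> 0\<close>; since \<open>A w = l (u - w)\<close> with \<open>u\<close> in the cone,
  the distance of \<open>w\<close> to the cone vanishes.\<close>

lemma yosida_in_cone:
  assumes w: "yosida l u w" and "u \<in> C" "l > 0" shows "fst w \<in> C"
proof -
  define x where "x = fst w"
  define d where "d = x - pC x"
  have Pu: "P u = u" using C_P assms by blast
  have A: "A_rel x (l *\<^sub>R (u - x))" unfolding x_def by (rule yosida_A_rel[OF w Pu])
  then have Px: "P x = x" and Ph: "P (l *\<^sub>R (u - x)) = l *\<^sub>R (u - x)" using A_rel_P by blast+
  have pd: "pC x \<bullet> d = 0" "c \<in> C \<Longrightarrow> c \<bullet> d \<le> 0" for c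
    using pC_orth[OF Px] pC_polar[OF Px] by (auto simp: d_def)
  have xd: "x \<bullet> d = (norm d)\<^sup>2"
    using pd(1) by (simp add: d_def power2_norm_eq_inner inner_diff_left)
  have Pd: "P d = d" using Px C_P[OF pC_in[OF Px]] by (simp add: d_def P.diff)
  have "(S t x - x) \<bullet> d \<le> 0" if t: "t > 0" for t
  proof -
    interpret St: bounded_linear "S t" by (rule S_lin[OF t])
    have "S t x = S t d + S t (pC x)" by (simp add: d_def flip: St.add)
    moreover have "S t d \<bullet> d \<le> norm d * norm d"
      using norm_cauchy_schwarz[of "S t d" d] mult_right_mono[OF S_contraction[OF Pd t], of "norm d"] by simp
    moreover have "S t (pC x) \<bullet> d \<le> 0" by (intro pd C_inv pC_in Px t)
    ultimately show ?thesis using xd by (simp add: inner_diff_left inner_add_left power2_eq_square)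
  qed
  then have "((1 / t) *\<^sub>R (S t x - x)) \<bullet> d \<le> 0" if "t > 0" for t
    using that by (simp add: divide_le_0_iff)
  then have "eventually (\<lambda>t. ((1 / t) *\<^sub>R (S t x - x)) \<bullet> d \<le> 0) (at_right 0)"
    using eventually_at_right_less[of "0::real"] by (rule eventually_mono[rotated])
  moreover have "((\<lambda>t. ((1 / t) *\<^sub>R (S t x - x)) \<bullet> d) \<longlongrightarrow> (- (l *\<^sub>R (u - x))) \<bullet> d) (at_right 0)"
    using A A_rel_gen[OF Px Ph] by (intro tendsto_intros) auto
  ultimately have "(- (l *\<^sub>R (u - x))) \<bullet> d \<le> 0"
    using tendsto_upperbound trivial_limit_at_right_real by blast
  then have "l * (x \<bullet> d - u \<bullet> d) \<le> 0" by (simp add: inner_diff_left algebra_simps)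
  then have "x \<bullet> d \<le> u \<bullet> d" using \<open>l > 0\<close> by (simp add: mult_le_0_iff)
  also have "\<dots> \<le> 0" using pd(2) assms by blast
  finally have "d = 0" using xd by simp
  then have "x = pC x" by (simp add: d_def)
  then show ?thesis using pC_in[OF Px] by (simp add: x_def)
qed

text \<open>The invariance criterion for form domains.  With \<open>p\<close> the projection of \<open>u\<close> and \<open>x = l (l + A)\<^sup>-\<^sup>1 p\<close> one has
  \<open>\<aa>(x, x - u) = l (p - x, x - u)\<close>.  This is at most \<open>0\<close> because \<open>x\<close> lies in the cone, so the \<open>x\<close> are bounded
  in the form domain, and their limit \<open>p\<close> belongs to it.\<close>

lemma cone_projection_form_domain:
  assumes u: "(u, g) \<in> W" shows "\<exists>g'. (pC u, g') \<in> W"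
proof -
  define p where "p = pC u"
  have Pu: "P u = u" using W_P u by blast
  have pC: "p \<in> C" using pC_in Pu by (simp add: p_def)
  have Pp: "P p = p" using C_P pC by blast
  obtain w where w: "\<And>k. yosida (real (Suc k)) p (w k)"
    using yosida_sequence by blast
  have "B (snd (w k)) \<bullet> (snd (w k) - g) \<le> 0" for k
  proof -
    define x where "x = fst (w k)"
    have wW: "w k \<in> W" using w by (simp add: yosida_def)
    then have "w k - (u, g) \<in> W" using subspace_diff[OF W_subspace] u by blast
    then have "B (snd (w k)) \<bullet> (snd (w k) - g) = Suc k * ((p - x) \<bullet> (x - u))"
      using w[of k] by (auto simp: yosida_def x_def)
    moreover have "x \<in> C" unfolding x_def by (rule yosida_in_cone[OF w pC]) simp
    then have "x \<bullet> (u - p) \<le> 0" "p \<bullet> (u - p) = 0" using pC_polar pC_orth Pu by (auto simp: p_def)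
    then have "(p - x) \<bullet> (x - u) \<le> - ((p - x) \<bullet> (p - x))" by (simp add: algebra_simps inner_commute)
    then have "(p - x) \<bullet> (x - u) \<le> 0" using inner_ge_zero[of "p - x"] by linarith
    ultimately show ?thesis by (simp add: mult_nonneg_nonpos)
  qed
  then have "\<exists>x\<in>W. fst x = p \<and> (\<forall>y. (\<lambda>k. w k \<bullet> y) \<longlonglongrightarrow> x \<bullet> y)"
    by (rule yosida_weak_limit[OF Pp w])
  then obtain y where yW: "y \<in> W" and yp: "fst y = p" by (elim bexE conjE)
  obtain a b where ab: "y = (a, b)" by (rule prod.exhaust)
  have "(pC u, b) \<in> W" using yW yp unfolding ab p_def by simp
  then show ?thesis by (rule exI)
qed

text \<open>With \<open>w = l (l + A)\<^sup>-\<^sup>1 u\<close>, which lies in the cone, \<open>\<aa>(w, v) = l (u - w, v) = - l (w, v) \<le> 0\<close>; the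
  inequality survives the limit \<open>l \<rightarrow> \<infinity>\<close>.  The vector \<open>v\<close> enters only through its pairing with the cone, so it may
  also be \<open>\<plusminus>\<i>\<close> times an element of the cone.\<close>

lemma cone_form_nonpos:
  assumes u: "(u, g) \<in> W" and v: "(v, k) \<in> W" and uC: "u \<in> C"
    and vC: "\<And>c. c \<in> C \<Longrightarrow> 0 \<le> c \<bullet> v" and uv: "u \<bullet> v = 0"
  shows "B g \<bullet> k \<le> 0"
proof -
  have Pu: "P u = u" using W_P u by blast
  obtain w where w: "\<And>j. yosida (real (Suc j)) u (w j)"
    using yosida_sequence by blast
  have wW: "w j \<in> W" for j using w by (simp add: yosida_def)
  have "B (snd (w j)) \<bullet> (snd (w j) - g) \<le> 0" for j
  proof -
    have "w j - (u, g) \<in> W" using subspace_diff[OF W_subspace] u wW by blast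
    then have "B (snd (w j)) \<bullet> (snd (w j) - g) = Suc j * ((u - fst (w j)) \<bullet> (fst (w j) - u))"
      using w[of j] by (auto simp: yosida_def)
    also have "(u - fst (w j)) \<bullet> (fst (w j) - u) = - ((u - fst (w j)) \<bullet> (u - fst (w j)))"
      by (simp add: algebra_simps)
    finally show ?thesis by simp
  qed
  from yosida_weak_limit[OF Pu w this] obtain y where y: "y \<in> W" "fst y = u" "\<And>z. (\<lambda>j. w j \<bullet> z) \<longlonglongrightarrow> y \<bullet> z"
    by (elim bexE conjE) (rule that, auto)
  have "y - (u, g) \<in> W" using subspace_diff[OF W_subspace] u y by blast
  moreover have "y - (u, g) = (0, snd y - g)" using y(2) by (simp add: prod_eq_iff)
  ultimately have "(0, snd y - g) \<in> W" by metis
  then have yg: "snd y = g" using W_graph[of "snd y - g"] by simp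
  have "bounded_linear (\<lambda>x::'h \<times> 'g. B (snd x) \<bullet> k)"
    by (intro bounded_linear_compose[OF bounded_linear_inner_left]
        bounded_linear_compose[OF B_lin bounded_linear_snd])
  from riesz_representation[OF this] obtain z where z: "\<And>x :: 'h \<times> 'g. B (snd x) \<bullet> k = z \<bullet> x" by blast
  have "(\<lambda>j. B (snd (w j)) \<bullet> k) \<longlonglongrightarrow> B g \<bullet> k"
  proof -
    have "B (snd (w j)) \<bullet> k = w j \<bullet> z" for j by (subst z) (rule inner_commute)
    moreover have "B g \<bullet> k = y \<bullet> z" unfolding yg[symmetric] by (subst z) (rule inner_commute)
    ultimately show ?thesis using y(3)[of z] by (simp only:)
  qed
  moreover have "B (snd (w j)) \<bullet> k \<le> 0" for j
  proof -
    have "fst (w j) \<in> C" by (rule yosida_in_cone[OF w uC]) simp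
    then have "(u - fst (w j)) \<bullet> v \<le> 0" using vC uv by (simp add: inner_diff_left)
    moreover have "B (snd (w j)) \<bullet> k = Suc j * ((u - fst (w j)) \<bullet> v)"
      using w[of j] v by (auto simp: yosida_def)
    ultimately show ?thesis by (simp add: mult_nonneg_nonpos)
  qed
  ultimately show ?thesis using LIMSEQ_le_const2 by blast
qed

end

section \<open>The Hilbert space of square integrable functions with values in \<open>\<ell>\<^sub>2\<close>\<close>

text \<open>The classes of functions on the whole space with values in all of \<open>\<ell>\<^sub>2\<close> form a type that depends on neither
  \<open>\<Omega>\<close> nor \<open>Y\<close>.  The space \<open>L\<^sub>2(\<Omega>, L\<^sub>2(Y))\<close> is the range of a projection in it.\<close>

definition sq_int :: "('a::euclidean_space \<Rightarrow> ell2) \<Rightarrow> bool" where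
  "sq_int u \<longleftrightarrow> u \<in> borel_measurable lebesgue \<and> integrable lebesgue (\<lambda>x. (norm (u x))\<^sup>2)"

lemma sq_int_bound:
  fixes w :: "'a::euclidean_space \<Rightarrow> ell2" and f :: "'a \<Rightarrow> real"
  assumes "w \<in> borel_measurable lebesgue" "integrable lebesgue f" "\<And>x. (norm (w x))\<^sup>2 \<le> f x"
  shows "sq_int w"
  unfolding sq_int_def
proof
  show "integrable lebesgue (\<lambda>x. (norm (w x))\<^sup>2)"
  proof (rule Bochner_Integration.integrable_bound[OF assms(2)])
    show "(\<lambda>x. (norm (w x))\<^sup>2) \<in> borel_measurable lebesgue" using assms(1) by measurable
    have "norm ((norm (w x))\<^sup>2) \<le> norm (f x)" for x
      using assms(3)[of x] zero_le_power2[of "norm (w x)"] unfolding real_norm_def abs_of_nonneg[OF zero_le_power2] by linarith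
    then show "AE x in lebesgue. norm ((norm (w x))\<^sup>2) \<le> norm (f x)" by simp
  qed
qed fact

lemma norm_add_square_le: "(norm (a + b))\<^sup>2 \<le> 2 * (norm a)\<^sup>2 + 2 * (norm (b::'b::real_normed_vector))\<^sup>2"
proof -
  have "(norm (a + b))\<^sup>2 \<le> (norm a + norm b)\<^sup>2" by (intro power_mono norm_triangle_ineq) auto
  also have "\<dots> \<le> 2 * (norm a)\<^sup>2 + 2 * (norm b)\<^sup>2"
    using sum_squares_bound[of "norm a" "norm b"] by (simp add: power2_sum)
  finally show ?thesis .
qed

lemma sq_int_add: assumes "sq_int u" "sq_int v" shows "sq_int (\<lambda>x. u x + v x)"
  by (rule sq_int_bound[where f = "\<lambda>x. 2 * (norm (u x))\<^sup>2 + 2 * (norm (v x))\<^sup>2"])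
    (use assms norm_add_square_le in \<open>auto simp: sq_int_def\<close>)

lemma sq_int_zero: "sq_int (\<lambda>x. 0)"
  by (simp add: sq_int_def)

lemma sq_int_scaleR: assumes "sq_int u" shows "sq_int (\<lambda>x. r *\<^sub>R u x)"
  by (rule sq_int_bound[where f = "\<lambda>x. r\<^sup>2 * (norm (u x))\<^sup>2"])
    (use assms in \<open>auto simp: sq_int_def power_mult_distrib\<close>)

lemma sq_int_minus: assumes "sq_int u" shows "sq_int (\<lambda>x. - u x)"
  using sq_int_scaleR[OF assms, of "-1"] by simp

lemma sq_int_diff: assumes "sq_int u" "sq_int v" shows "sq_int (\<lambda>x. u x - v x)"
  using sq_int_add[OF assms(1) sq_int_minus[OF assms(2)]] by simp

lemma integrable_inner_sq_int:
  assumes "sq_int u" "sq_int v" shows "integrable lebesgue (\<lambda>x. u x \<bullet> v x)"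
proof (rule Bochner_Integration.integrable_bound)
  show "integrable lebesgue (\<lambda>x. (norm (u x))\<^sup>2 + (norm (v x))\<^sup>2)"
    using assms by (auto simp: sq_int_def)
  show "(\<lambda>x. u x \<bullet> v x) \<in> borel_measurable lebesgue"
    using assms by (auto simp: sq_int_def)
  have "norm (u x \<bullet> v x) \<le> norm ((norm (u x))\<^sup>2 + (norm (v x))\<^sup>2)" for x
  proof -
    have "norm (u x \<bullet> v x) \<le> norm (u x) * norm (v x)" by (simp add: Cauchy_Schwarz_ineq2)
    also have "\<dots> \<le> 2 * norm (u x) * norm (v x)" by simp
    also have "\<dots> \<le> (norm (u x))\<^sup>2 + (norm (v x))\<^sup>2" by (rule sum_squares_bound)
    finally show ?thesis by simp
  qed
  then show "AE x in lebesgue. norm (u x \<bullet> v x) \<le> norm ((norm (u x))\<^sup>2 + (norm (v x))\<^sup>2)" by simp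
qed

definition ae_eq :: "('a::euclidean_space \<Rightarrow> ell2) \<Rightarrow> ('a \<Rightarrow> ell2) \<Rightarrow> bool" where
  "ae_eq u v \<longleftrightarrow> sq_int u \<and> sq_int v \<and> (AE x in lebesgue. u x = v x)"

quotient_type (overloaded) 'a l2v = "'a::euclidean_space \<Rightarrow> ell2" / partial: ae_eq
  morphisms l2_rep l2_abs
proof (rule part_equivpI)
  show "\<exists>x::'a \<Rightarrow> ell2. ae_eq x x" by (rule exI[of _ "\<lambda>x. 0"]) (simp add: ae_eq_def sq_int_zero)
  show "symp (ae_eq :: ('a \<Rightarrow> ell2) \<Rightarrow> _)" by (auto simp: symp_def ae_eq_def)
  show "transp (ae_eq :: ('a \<Rightarrow> ell2) \<Rightarrow> _)"
    unfolding transp_def ae_eq_def by (auto elim: AE_mp)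
qed

lemma sq_int_l2_rep: "sq_int (l2_rep U)"
  using Quotient3_rep_reflp[OF Quotient3_l2v, of U] by (simp add: ae_eq_def)

lemma l2_abs_rep [simp]: "l2_abs (l2_rep U) = U"
  by (rule Quotient3_abs_rep[OF Quotient3_l2v])

lemma l2_abs_eq_iff: "sq_int u \<Longrightarrow> sq_int v \<Longrightarrow> l2_abs u = l2_abs v \<longleftrightarrow> (AE x in lebesgue. u x = v x)"
  using Quotient3_rel[OF Quotient3_l2v, of u v] by (simp add: ae_eq_def)

lemma l2_rep_abs: assumes "sq_int u" shows "AE x in lebesgue. l2_rep (l2_abs u) x = u x"
  using l2_abs_eq_iff[OF sq_int_l2_rep assms, of "l2_abs u"] by simp

lemma measurable_l2_rep [measurable]: "l2_rep U \<in> borel_measurable lebesgue"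
  using sq_int_l2_rep[of U] by (simp add: sq_int_def)

instantiation l2v :: (euclidean_space) real_inner
begin

definition zero_l2v :: "'a l2v" where "zero_l2v = l2_abs (\<lambda>x. 0)"
definition plus_l2v :: "'a l2v \<Rightarrow> 'a l2v \<Rightarrow> 'a l2v" where "plus_l2v U V = l2_abs (\<lambda>x. l2_rep U x + l2_rep V x)"
definition uminus_l2v :: "'a l2v \<Rightarrow> 'a l2v" where "uminus_l2v U = l2_abs (\<lambda>x. - l2_rep U x)"
definition minus_l2v :: "'a l2v \<Rightarrow> 'a l2v \<Rightarrow> 'a l2v" where "minus_l2v U V = l2_abs (\<lambda>x. l2_rep U x - l2_rep V x)"
definition scaleR_l2v :: "real \<Rightarrow> 'a l2v \<Rightarrow> 'a l2v" where "scaleR_l2v r U = l2_abs (\<lambda>x. r *\<^sub>R l2_rep U x)"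
definition inner_l2v :: "'a l2v \<Rightarrow> 'a l2v \<Rightarrow> real" where
  "inner_l2v U V = (\<integral>x. l2_rep U x \<bullet> l2_rep V x \<partial>lebesgue)"
definition norm_l2v :: "'a l2v \<Rightarrow> real" where "norm_l2v U = sqrt (inner U U)"
definition dist_l2v :: "'a l2v \<Rightarrow> 'a l2v \<Rightarrow> real" where "dist_l2v U V = norm (U - V)"
definition sgn_l2v :: "'a l2v \<Rightarrow> 'a l2v" where "sgn_l2v U = inverse (norm U) *\<^sub>R U"
definition uniformity_l2v :: "('a l2v \<times> 'a l2v) filter" where
  "uniformity_l2v = (INF e\<in>{0<..}. principal {(f, g). dist f g < e})"
definition open_l2v :: "'a l2v set \<Rightarrow> bool" where
  "open_l2v U \<longleftrightarrow> (\<forall>f\<in>U. eventually (\<lambda>(f', g). f' = f \<longrightarrow> g \<in> U) uniformity)"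

lemma l2_rep_add: "AE x in lebesgue. l2_rep (U + V) x = l2_rep U x + l2_rep V x"
  unfolding plus_l2v_def by (intro l2_rep_abs sq_int_add sq_int_l2_rep)
lemma l2_rep_diff: "AE x in lebesgue. l2_rep (U - V) x = l2_rep U x - l2_rep V x"
  unfolding minus_l2v_def by (intro l2_rep_abs sq_int_diff sq_int_l2_rep)
lemma l2_rep_minus: "AE x in lebesgue. l2_rep (- U) x = - l2_rep U x"
  unfolding uminus_l2v_def by (intro l2_rep_abs sq_int_minus sq_int_l2_rep)
lemma l2_rep_scaleR: "AE x in lebesgue. l2_rep (r *\<^sub>R U) x = r *\<^sub>R l2_rep U x"
  unfolding scaleR_l2v_def by (intro l2_rep_abs sq_int_scaleR sq_int_l2_rep)
lemma l2_rep_zero: "AE x in lebesgue. l2_rep 0 x = 0"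
  unfolding zero_l2v_def by (intro l2_rep_abs sq_int_zero)

lemma l2_eqI: "(AE x in lebesgue. l2_rep U x = l2_rep V x) \<Longrightarrow> U = V"
  using l2_abs_eq_iff[OF sq_int_l2_rep sq_int_l2_rep, of U V] by simp

instance
proof
  fix U V Z :: "'a l2v" and r s :: real
  show "U + V + Z = U + (V + Z)"
    by (rule l2_eqI, use l2_rep_add[of "U + V" Z] l2_rep_add[of U V] l2_rep_add[of U "V + Z"] l2_rep_add[of V Z]
        in eventually_elim) simp
  show "U + V = V + U"
    by (rule l2_eqI, use l2_rep_add[of U V] l2_rep_add[of V U] in eventually_elim) simp
  show "0 + U = U"
    by (rule l2_eqI, use l2_rep_add[of 0 U] l2_rep_zero in eventually_elim) simp
  show "- U + U = 0"
    by (rule l2_eqI, use l2_rep_add[of "- U" U] l2_rep_minus[of U] l2_rep_zero in eventually_elim) simp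
  show "U - V = U + - V"
    by (rule l2_eqI, use l2_rep_add[of U "- V"] l2_rep_minus[of V] l2_rep_diff[of U V] in eventually_elim) simp
  show "r *\<^sub>R (U + V) = r *\<^sub>R U + r *\<^sub>R V"
    by (rule l2_eqI, use l2_rep_add[of U V] l2_rep_scaleR[of r U] l2_rep_scaleR[of r V] l2_rep_scaleR[of r "U + V"]
        l2_rep_add[of "r *\<^sub>R U" "r *\<^sub>R V"] in eventually_elim) (simp add: scaleR_add_right)
  show "(r + s) *\<^sub>R U = r *\<^sub>R U + s *\<^sub>R U"
    by (rule l2_eqI, use l2_rep_scaleR[of r U] l2_rep_scaleR[of s U] l2_rep_scaleR[of "r + s" U]
        l2_rep_add[of "r *\<^sub>R U" "s *\<^sub>R U"] in eventually_elim) (simp add: scaleR_add_left)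
  show "r *\<^sub>R s *\<^sub>R U = (r * s) *\<^sub>R U"
    by (rule l2_eqI, use l2_rep_scaleR[of s U] l2_rep_scaleR[of r "s *\<^sub>R U"] l2_rep_scaleR[of "r * s" U]
        in eventually_elim) simp
  show "1 *\<^sub>R U = U"
    by (rule l2_eqI, use l2_rep_scaleR[of 1 U] in eventually_elim) simp
  show "inner U V = inner V U"
    by (simp add: inner_l2v_def inner_commute)
  have "inner (U + V) Z = (\<integral>x. l2_rep U x \<bullet> l2_rep Z x + l2_rep V x \<bullet> l2_rep Z x \<partial>lebesgue)"
    unfolding inner_l2v_def
  proof (rule integral_cong_AE)
    show "AE x in lebesgue. l2_rep (U + V) x \<bullet> l2_rep Z x = l2_rep U x \<bullet> l2_rep Z x + l2_rep V x \<bullet> l2_rep Z x"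
      using l2_rep_add[of U V] by eventually_elim (simp add: inner_add_left)
  qed measurable
  then show "inner (U + V) Z = inner U Z + inner V Z"
    by (simp add: inner_l2v_def integrable_inner_sq_int sq_int_l2_rep)
  have "inner (r *\<^sub>R U) V = (\<integral>x. r * (l2_rep U x \<bullet> l2_rep V x) \<partial>lebesgue)"
    unfolding inner_l2v_def
  proof (rule integral_cong_AE)
    show "AE x in lebesgue. l2_rep (r *\<^sub>R U) x \<bullet> l2_rep V x = r * (l2_rep U x \<bullet> l2_rep V x)"
      using l2_rep_scaleR[of r U] by eventually_elim simp
  qed measurable
  then show "inner (r *\<^sub>R U) V = r * inner U V"
    by (simp add: inner_l2v_def)
  show "0 \<le> inner U U"
    unfolding inner_l2v_def by (rule integral_nonneg_AE) simp
  have "inner U U = 0 \<longleftrightarrow> (AE x in lebesgue. l2_rep U x \<bullet> l2_rep U x = 0)"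
    unfolding inner_l2v_def
    by (intro integral_nonneg_eq_0_iff_AE integrable_inner_sq_int sq_int_l2_rep) simp
  also have "\<dots> \<longleftrightarrow> (AE x in lebesgue. l2_rep U x = 0)" by simp
  also have "\<dots> \<longleftrightarrow> U = 0"
    using l2_abs_eq_iff[OF sq_int_l2_rep sq_int_zero, of U] by (simp add: zero_l2v_def)
  finally show "(inner U U = 0) = (U = 0)" .
qed (simp_all add: norm_l2v_def dist_l2v_def sgn_l2v_def uniformity_l2v_def open_l2v_def)

end

lemma inner_l2_abs:
  assumes "sq_int u" "sq_int v" shows "l2_abs u \<bullet> l2_abs v = (\<integral>x. u x \<bullet> v x \<partial>lebesgue)"
  unfolding inner_l2v_def
proof (rule integral_cong_AE)
  show "AE x in lebesgue. l2_rep (l2_abs u) x \<bullet> l2_rep (l2_abs v) x = u x \<bullet> v x"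
    using l2_rep_abs[OF assms(1)] l2_rep_abs[OF assms(2)] by eventually_elim simp
qed (use integrable_inner_sq_int assms sq_int_l2_rep in \<open>auto intro!: borel_measurable_integrable\<close>)

lemma norm_l2_abs: "sq_int u \<Longrightarrow> (norm (l2_abs u))\<^sup>2 = (\<integral>x. (norm (u x))\<^sup>2 \<partial>lebesgue)"
  by (simp add: power2_norm_eq_inner inner_l2_abs)

lemma norm_l2_rep: "(norm U)\<^sup>2 = (\<integral>x. (norm (l2_rep U x))\<^sup>2 \<partial>lebesgue)"
  using norm_l2_abs[OF sq_int_l2_rep, of U] by simp

lemma nn_integral_norm_l2: "sq_int u \<Longrightarrow> (\<integral>\<^sup>+x. ennreal ((norm (u x))\<^sup>2) \<partial>lebesgue) = ennreal ((norm (l2_abs u))\<^sup>2)"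
  unfolding norm_l2_abs by (rule nn_integral_eq_integral) (auto simp: sq_int_def)

lemma l2_abs_add: "sq_int u \<Longrightarrow> sq_int v \<Longrightarrow> l2_abs (\<lambda>x. u x + v x) = l2_abs u + l2_abs v"
  unfolding plus_l2v_def using l2_rep_abs[of u] l2_rep_abs[of v]
  by (subst l2_abs_eq_iff) (auto simp: sq_int_add sq_int_l2_rep elim: eventually_elim2)

lemma l2_abs_diff: "sq_int u \<Longrightarrow> sq_int v \<Longrightarrow> l2_abs (\<lambda>x. u x - v x) = l2_abs u - l2_abs v"
  unfolding minus_l2v_def using l2_rep_abs[of u] l2_rep_abs[of v]
  by (subst l2_abs_eq_iff) (auto simp: sq_int_diff sq_int_l2_rep elim: eventually_elim2)

lemma l2_abs_scaleR: "sq_int u \<Longrightarrow> l2_abs (\<lambda>x. r *\<^sub>R u x) = r *\<^sub>R l2_abs u"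
  unfolding scaleR_l2v_def using l2_rep_abs[of u]
  by (subst l2_abs_eq_iff) (auto simp: sq_int_scaleR sq_int_l2_rep elim: eventually_mono)

text \<open>Riesz and Fischer: along a subsequence with increments of norm at most \<open>4\<^sup>-\<^sup>n\<close> the
  representatives converge a.e., because the sum of \<open>4\<^sup>n\<close> times the squared increments is integrable;
  Fatou's lemma shows that the pointwise limit is the limit in the mean.\<close>

lemma ae_convergent_of_fast_cauchy:
  fixes v :: "nat \<Rightarrow> 'a::euclidean_space \<Rightarrow> ell2"
  assumes v: "\<And>n. sq_int (v n)" and fast: "\<And>n. norm (l2_abs (v (Suc n)) - l2_abs (v n)) \<le> 1 / 4 ^ n"
  shows "AE x in lebesgue. convergent (\<lambda>n. v n x)"
proof -
  define d where "d = (\<lambda>n x. v (Suc n) x - v n x)"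
  have d: "sq_int (d n)" for n unfolding d_def by (intro sq_int_diff v)
  have meas: "(\<lambda>x. (norm (d n x))\<^sup>2) \<in> borel_measurable lebesgue" for n
    using d[of n] by (auto simp: sq_int_def)
  have "(\<integral>\<^sup>+x. (\<Sum>n. ennreal (4 ^ n * (norm (d n x))\<^sup>2)) \<partial>lebesgue)
      = (\<Sum>n. \<integral>\<^sup>+x. ennreal (4 ^ n * (norm (d n x))\<^sup>2) \<partial>lebesgue)"
    using meas by (intro nn_integral_suminf) simp
  also have "\<dots> \<le> (\<Sum>n. ennreal ((1 / 4) ^ n))"
  proof (intro suminf_le allI)
    fix n
    have "(\<integral>\<^sup>+x. ennreal (4 ^ n * (norm (d n x))\<^sup>2) \<partial>lebesgue) = ennreal (4 ^ n) * ennreal ((norm (l2_abs (d n)))\<^sup>2)"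
      using meas[of n] by (simp add: ennreal_mult nn_integral_cmult nn_integral_norm_l2[OF d, symmetric])
    also have "\<dots> = ennreal (4 ^ n * (norm (l2_abs (d n)))\<^sup>2)" by (simp add: ennreal_mult)
    also have "\<dots> \<le> ennreal ((1 / 4) ^ n)"
    proof (rule ennreal_leI)
      have "(norm (l2_abs (d n)))\<^sup>2 \<le> (1 / 4 ^ n)\<^sup>2"
        using fast[of n] unfolding d_def l2_abs_diff[OF v v] by (intro power_mono) auto
      then have "4 ^ n * (norm (l2_abs (d n)))\<^sup>2 \<le> 4 ^ n * (1 / 4 ^ n)\<^sup>2" by (intro mult_left_mono) auto
      also have "\<dots> = (1 / 4) ^ n" by (simp add: power2_eq_square power_one_over field_simps)
      finally show "4 ^ n * (norm (l2_abs (d n)))\<^sup>2 \<le> (1 / 4) ^ n" .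
    qed
    finally show "(\<integral>\<^sup>+x. ennreal (4 ^ n * (norm (d n x))\<^sup>2) \<partial>lebesgue) \<le> ennreal ((1 / 4) ^ n)" .
  qed auto
  also have "\<dots> = ennreal (\<Sum>n. (1 / 4) ^ n)" by (intro suminf_ennreal_eq summable_sums) auto
  also have "\<dots> < \<infinity>" by simp
  finally have fin: "(\<integral>\<^sup>+x. (\<Sum>n. ennreal (4 ^ n * (norm (d n x))\<^sup>2)) \<partial>lebesgue) \<noteq> \<infinity>" by simp
  have "AE x in lebesgue. (\<Sum>n. ennreal (4 ^ n * (norm (d n x))\<^sup>2)) \<noteq> \<infinity>"
    by (rule nn_integral_PInf_AE[OF _ fin]) (use meas in measurable)
  then show ?thesis
  proof eventually_elim
    case (elim x)
    have "summable (\<lambda>n. 4 ^ n * (norm (d n x))\<^sup>2)"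
      by (rule summable_suminf_not_top) (use elim in auto)
    then have "Bseq (\<lambda>n. 4 ^ n * (norm (d n x))\<^sup>2)"
      using summable_LIMSEQ_zero convergent_imp_Bseq convergent_def by blast
    then obtain K where K: "K > 0" "\<And>n. norm (4 ^ n * (norm (d n x))\<^sup>2) \<le> K" by (auto simp: Bseq_def)
    have "norm (d n x) \<le> sqrt K * (1 / 2) ^ n" for n
    proof -
      have "(2 ^ n * norm (d n x))\<^sup>2 \<le> K"
      proof -
        have "((2::real) ^ n)\<^sup>2 = (2\<^sup>2) ^ n" by (simp only: power_mult[symmetric] mult.commute)
        then show ?thesis using K(2)[of n] by (simp add: power_mult_distrib)
      qed
      then have *: "2 ^ n * norm (d n x) \<le> sqrt K" by (rule real_le_rsqrt)
      have "norm (d n x) = (2 ^ n * norm (d n x)) * (1 / 2) ^ n"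
        by (simp add: power_one_over)
      also have "\<dots> \<le> sqrt K * (1 / 2) ^ n" using * by (rule mult_right_mono) simp
      finally show ?thesis .
    qed
    then have ex: "\<exists>N. \<forall>n\<ge>N. norm (d n x) \<le> sqrt K * (1 / 2) ^ n" by blast
    have "summable (\<lambda>n. sqrt K * (1 / 2) ^ n)" by (intro summable_mult summable_geometric) simp
    with ex have "summable (\<lambda>n. d n x)" by (rule summable_comparison_test)
    then have "convergent (\<lambda>n. \<Sum>k<n. d k x)" by (simp only: summable_iff_convergent)
    then have "convergent (\<lambda>n. (\<Sum>k<n. d k x) + v 0 x)" by (intro convergent_add convergent_const)
    moreover have "(\<Sum>k<n. d k x) + v 0 x = v n x" for n
      using sum_lessThan_telescope[of "\<lambda>k. v k x" n] by (simp add: d_def)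
    ultimately show ?case by simp
  qed
qed

instance l2v :: (euclidean_space) banach
proof
  fix X :: "nat \<Rightarrow> 'a l2v"
  assume X: "Cauchy X"
  have "\<exists>N. \<forall>m\<ge>N. \<forall>k\<ge>N. dist (X m) (X k) < 1 / 4 ^ n" for n :: nat
    using X unfolding Cauchy_def by simp
  then obtain N where N: "\<And>n m k. m \<ge> N n \<Longrightarrow> k \<ge> N n \<Longrightarrow> dist (X m) (X k) < 1 / 4 ^ n" by metis
  \<comment> \<open>Summing makes the choice of indices strictly increasing.\<close>
  define r where "r = (\<lambda>n. (\<Sum>k\<le>n. N k) + n)"
  have r: "strict_mono r" unfolding r_def by (rule strict_monoI_Suc) simp
  have rN: "r n \<ge> N n" for n using member_le_sum[of n "{..n}" N] by (simp add: r_def)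
  define v where "v = (\<lambda>n. l2_rep (X (r n)))"
  have v: "sq_int (v n)" for n by (simp add: v_def sq_int_l2_rep)
  have Xv: "l2_abs (v n) = X (r n)" for n by (simp add: v_def)
  have close: "norm (X (r m) - X (r n)) \<le> 1 / 4 ^ n" if "m \<ge> n" for m n
  proof -
    have "r m \<ge> N n" using rN[of n] that r by (meson order_trans strict_mono_less_eq)
    then show ?thesis using N[of n "r m" "r n"] rN[of n] by (simp add: dist_norm)
  qed
  have ae: "AE x in lebesgue. convergent (\<lambda>n. v n x)"
    by (rule ae_convergent_of_fast_cauchy[OF v]) (simp add: Xv close)
  define u where "u = (\<lambda>x. if convergent (\<lambda>n. v n x) then lim (\<lambda>n. v n x) else 0)"
  have vm [measurable]: "v n \<in> borel_measurable lebesgue" for n using v by (auto simp: sq_int_def)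
  have um [measurable]: "u \<in> borel_measurable lebesgue"
    unfolding u_def Cauchy_convergent_iff[symmetric]
    by (intro measurable_If borel_measurable_lim_metric measurable_const) measurable
  have fatou: "(\<integral>\<^sup>+x. ennreal ((norm (u x - v n x))\<^sup>2) \<partial>lebesgue) \<le> ennreal ((1 / 4 ^ n)\<^sup>2)" for n
  proof -
    have "(\<integral>\<^sup>+x. ennreal ((norm (u x - v n x))\<^sup>2) \<partial>lebesgue)
        = (\<integral>\<^sup>+x. liminf (\<lambda>m. ennreal ((norm (v m x - v n x))\<^sup>2)) \<partial>lebesgue)"
    proof (rule nn_integral_cong_AE, use ae in eventually_elim)
      case (elim x)
      then have "(\<lambda>m. v m x) \<longlonglongrightarrow> u x" by (simp add: u_def convergent_LIMSEQ_iff)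
      then have "(\<lambda>m. ennreal ((norm (v m x - v n x))\<^sup>2)) \<longlonglongrightarrow> ennreal ((norm (u x - v n x))\<^sup>2)"
        by (intro tendsto_intros) auto
      then show ?case using lim_imp_Liminf by (metis sequentially_bot)
    qed
    also have "\<dots> \<le> liminf (\<lambda>m. \<integral>\<^sup>+x. ennreal ((norm (v m x - v n x))\<^sup>2) \<partial>lebesgue)"
      by (rule nn_integral_liminf) measurable
    also have "\<dots> \<le> ennreal ((1 / 4 ^ n)\<^sup>2)"
    proof (rule Liminf_le)
      have "(\<integral>\<^sup>+x. ennreal ((norm (v m x - v n x))\<^sup>2) \<partial>lebesgue) \<le> ennreal ((1 / 4 ^ n)\<^sup>2)" if "m \<ge> n" for m
      proof -
        have "(norm (X (r m) - X (r n)))\<^sup>2 \<le> (1 / 4 ^ n)\<^sup>2"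
          using close[OF that] by (intro power_mono) auto
        then show ?thesis
          unfolding nn_integral_norm_l2[OF sq_int_diff[OF v v]] l2_abs_diff[OF v v] Xv
          by (rule ennreal_leI)
      qed
      then show "\<forall>\<^sub>F m in sequentially. (\<integral>\<^sup>+x. ennreal ((norm (v m x - v n x))\<^sup>2) \<partial>lebesgue) \<le> ennreal ((1 / 4 ^ n)\<^sup>2)"
        using eventually_sequentially by blast
    qed simp
    finally show ?thesis .
  qed
  have uv: "sq_int (\<lambda>x. u x - v n x)" for n
    unfolding sq_int_def
  proof
    show "integrable lebesgue (\<lambda>x. (norm (u x - v n x))\<^sup>2)"
    proof (rule integrableI_bounded)
      show "(\<integral>\<^sup>+ x. ennreal (norm ((norm (u x - v n x))\<^sup>2)) \<partial>lebesgue) < \<infinity>"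
        using fatou[of n] by (simp add: order_le_less_trans)
    qed measurable
  qed measurable
  have u: "sq_int u" using sq_int_add[OF uv[of 0] v[of 0]] by simp
  have bound: "norm (X (r n) - l2_abs u) \<le> 1 / 4 ^ n" for n
  proof -
    have "ennreal ((norm (l2_abs u - X (r n)))\<^sup>2) \<le> ennreal ((1 / 4 ^ n)\<^sup>2)"
      using fatou[of n] unfolding nn_integral_norm_l2[OF uv] l2_abs_diff[OF u v] Xv .
    then have "(norm (l2_abs u - X (r n)))\<^sup>2 \<le> (1 / 4 ^ n)\<^sup>2"
      by (subst (asm) ennreal_le_iff) auto
    then show ?thesis by (subst norm_minus_commute) (rule power2_le_imp_le, auto)
  qed
  have "(\<lambda>n. X (r n)) \<longlonglongrightarrow> l2_abs u"
  proof (rule LIM_zero_cancel, rule Lim_null_comparison)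
    show "\<forall>\<^sub>F n in sequentially. norm (X (r n) - l2_abs u) \<le> (1 / 4) ^ n"
      using bound by (simp add: power_one_over)
    show "(\<lambda>n. (1 / 4) ^ n) \<longlonglongrightarrow> (0::real)" by (rule LIMSEQ_realpow_zero) auto
  qed
  then have "X \<longlonglongrightarrow> l2_abs u"
    using Cauchy_converges_subseq[OF X r] by (simp add: o_def)
  then show "convergent X" by (auto simp: convergent_def)
qed

subsection \<open>Fibrewise operators\<close>

text \<open>One construction covers the coefficients of the form, multiplication by \<open>\<i>\<close>, the projection onto
  \<open>L\<^sub>2(\<Omega>, L\<^sub>2(Y))\<close> and the maps between coordinates.  Measurability is required in the form in which it is
  used, as preservation of measurable functions.\<close>

definition fibre_field :: "('a::euclidean_space \<Rightarrow> ell2 \<Rightarrow> ell2) \<Rightarrow> bool" where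
  "fibre_field F \<longleftrightarrow> (\<forall>x. linear (F x)) \<and> (\<exists>M. \<forall>x f. norm (F x f) \<le> M * norm f) \<and>
     (\<forall>u\<in>borel_measurable lebesgue. (\<lambda>x. F x (u x)) \<in> borel_measurable lebesgue)"

definition fibre_op :: "('a::euclidean_space \<Rightarrow> ell2 \<Rightarrow> ell2) \<Rightarrow> 'a l2v \<Rightarrow> 'a l2v" where
  "fibre_op F U = l2_abs (\<lambda>x. F x (l2_rep U x))"

lemma fibre_field_const: assumes "bounded_linear T" shows "fibre_field (\<lambda>x. T)"
  unfolding fibre_field_def
proof (intro conjI allI ballI)
  interpret bounded_linear T by fact
  show "linear T" by unfold_locales
  show "\<exists>M. \<forall>x f. norm (T f) \<le> M * norm f" using bounded by (metis mult.commute)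
  fix u :: "'a \<Rightarrow> ell2" assume "u \<in> borel_measurable lebesgue"
  then show "(\<lambda>x. T (u x)) \<in> borel_measurable lebesgue"
    using borel_measurable_continuous_onI[OF linear_continuous_on[OF assms]] by measurable
qed

context
  fixes F :: "'a::euclidean_space \<Rightarrow> ell2 \<Rightarrow> ell2"
  assumes F: "fibre_field F"
begin

lemma sq_int_fibre: assumes "sq_int u" shows "sq_int (\<lambda>x. F x (u x))"
proof -
  obtain M where M: "\<And>x f. norm (F x f) \<le> M * norm f" using F by (auto simp: fibre_field_def)
  show ?thesis
  proof (rule sq_int_bound)
    show "integrable lebesgue (\<lambda>x. M\<^sup>2 * (norm (u x))\<^sup>2)" using assms by (simp add: sq_int_def)
    show "(norm (F x (u x)))\<^sup>2 \<le> M\<^sup>2 * (norm (u x))\<^sup>2" for x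
      using power_mono[OF M[of x "u x"], of 2] by (simp add: power_mult_distrib)
  qed (use F assms in \<open>auto simp: fibre_field_def sq_int_def\<close>)
qed

lemma fibre_op_rep: "AE x in lebesgue. l2_rep (fibre_op F U) x = F x (l2_rep U x)"
  unfolding fibre_op_def by (intro l2_rep_abs sq_int_fibre sq_int_l2_rep)

lemma fibre_op_abs: "sq_int u \<Longrightarrow> fibre_op F (l2_abs u) = l2_abs (\<lambda>x. F x (u x))"
  unfolding fibre_op_def using l2_rep_abs[of u]
  by (subst l2_abs_eq_iff) (auto simp: sq_int_fibre sq_int_l2_rep elim: eventually_mono)

lemma bounded_linear_fibre_op: "bounded_linear (fibre_op F)"
proof -
  have lin: "linear (F x)" for x using F by (simp add: fibre_field_def)
  obtain M where M: "\<And>x f. norm (F x f) \<le> M * norm f" using F by (auto simp: fibre_field_def)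
  show ?thesis
  proof (rule bounded_linear_intro[of _ "\<bar>M\<bar>"])
    show "fibre_op F (U + V) = fibre_op F U + fibre_op F V" for U V
      by (rule l2_eqI, use fibre_op_rep[of "U + V"] fibre_op_rep[of U] fibre_op_rep[of V] l2_rep_add[of U V]
          l2_rep_add[of "fibre_op F U" "fibre_op F V"] in eventually_elim) (simp add: linear_add[OF lin])
    show "fibre_op F (r *\<^sub>R U) = r *\<^sub>R fibre_op F U" for r U
      by (rule l2_eqI, use fibre_op_rep[of "r *\<^sub>R U"] fibre_op_rep[of U] l2_rep_scaleR[of r U]
          l2_rep_scaleR[of r "fibre_op F U"] in eventually_elim) (simp add: linear_scale[OF lin])
    show "norm (fibre_op F U) \<le> norm U * \<bar>M\<bar>" for U
    proof (rule power2_le_imp_le)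
      have "(norm (fibre_op F U))\<^sup>2 = (\<integral>x. (norm (F x (l2_rep U x)))\<^sup>2 \<partial>lebesgue)"
        unfolding fibre_op_def by (intro norm_l2_abs sq_int_fibre sq_int_l2_rep)
      also have "\<dots> \<le> (\<integral>x. M\<^sup>2 * (norm (l2_rep U x))\<^sup>2 \<partial>lebesgue)"
      proof (rule integral_mono)
        show "(norm (F x (l2_rep U x)))\<^sup>2 \<le> M\<^sup>2 * (norm (l2_rep U x))\<^sup>2" for x
          using power_mono[OF M[of x "l2_rep U x"], of 2] by (simp add: power_mult_distrib)
      qed (use sq_int_fibre[OF sq_int_l2_rep, of U] sq_int_l2_rep[of U] in \<open>auto simp: sq_int_def\<close>)
      also have "\<dots> = (norm U * \<bar>M\<bar>)\<^sup>2" by (simp add: norm_l2_rep power_mult_distrib)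
      finally show "(norm (fibre_op F U))\<^sup>2 \<le> (norm U * \<bar>M\<bar>)\<^sup>2" .
    qed simp
  qed
qed

end

lemma fibre_op_compose:
  assumes F: "fibre_field F" and G: "fibre_field G" and FGH: "\<And>x f. F x (G x f) = H x f"
  shows "fibre_op F (fibre_op G U) = fibre_op H U"
  unfolding fibre_op_def[of G] fibre_op_abs[OF F sq_int_fibre[OF G sq_int_l2_rep]]
  by (simp add: fibre_op_def FGH)

lemma inner_fibre_op_adjoint:
  assumes F: "fibre_field F" and G: "fibre_field G" and FG: "\<And>x f g. F x f \<bullet> g = f \<bullet> G x g"
  shows "fibre_op F U \<bullet> V = U \<bullet> fibre_op G V"
proof -
  have "fibre_op F U \<bullet> V = (\<integral>x. F x (l2_rep U x) \<bullet> l2_rep V x \<partial>lebesgue)"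
    using inner_l2_abs[OF sq_int_fibre[OF F sq_int_l2_rep] sq_int_l2_rep, of U V] by (simp add: fibre_op_def)
  also have "\<dots> = (\<integral>x. l2_rep U x \<bullet> G x (l2_rep V x) \<partial>lebesgue)" by (simp add: FG)
  also have "\<dots> = U \<bullet> fibre_op G V"
    using inner_l2_abs[OF sq_int_l2_rep sq_int_fibre[OF G sq_int_l2_rep], of U V] by (simp add: fibre_op_def)
  finally show ?thesis .
qed

section \<open>Smooth functions\<close>

lemma bounded_bilinear_scaleC:
  "bounded_bilinear (scaleC :: complex \<Rightarrow> 'b::complex_normed_vector \<Rightarrow> 'b)"
proof
  fix a a' c :: complex and b b' :: 'b and r :: real
  show "(a + a') *\<^sub>C b = a *\<^sub>C b + a' *\<^sub>C b" by (rule scaleC_add_left)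
  show "a *\<^sub>C (b + b') = a *\<^sub>C b + a *\<^sub>C b'" by (rule scaleC_add_right)
  show "(r *\<^sub>R a) *\<^sub>C b = r *\<^sub>R (a *\<^sub>C b)"
    by (simp add: scaleR_conv_of_real scaleC_scaleC[symmetric] scaleC_of_real)
  show "a *\<^sub>C (r *\<^sub>R b) = r *\<^sub>R (a *\<^sub>C b)"
    unfolding scaleC_of_real[symmetric] scaleC_scaleC by (simp add: mult.commute)
  show "\<exists>K. \<forall>a b. norm ((a::complex) *\<^sub>C (b::'b)) \<le> norm a * norm b * K"
    by (rule exI[of _ 1]) (simp add: norm_scaleC)
qed

lemma scaleC_complex_eq [simp]: "(a::complex) *\<^sub>C (b::complex) = a * b"
  by (simp add: scaleC_complex_def)

lemma partial_deriv_eq: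
  fixes f :: "real^'d::finite \<Rightarrow> 'b::real_normed_vector"
  assumes "(f has_derivative f') (at x)"
  shows "partial_deriv k f x = f' (axis k 1)"
proof -
  have "((\<lambda>t::real. x + t *\<^sub>R axis k 1) has_derivative (\<lambda>t. t *\<^sub>R axis k 1)) (at 0)"
    by (auto intro!: derivative_eq_intros)
  moreover have "(f has_derivative f') (at (x + 0 *\<^sub>R axis k 1))" using assms by simp
  ultimately have "((\<lambda>t. f (x + t *\<^sub>R axis k 1)) has_derivative (\<lambda>t. f' (t *\<^sub>R axis k 1))) (at 0)"
    by (rule has_derivative_compose)
  moreover have "linear f'" using assms has_derivative_linear by blast
  ultimately have "((\<lambda>t. f (x + t *\<^sub>R axis k 1)) has_vector_derivative f' (axis k 1)) (at 0)"
    unfolding has_vector_derivative_def by (simp add: linear_scale)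
  then show ?thesis
    unfolding partial_deriv_def by (rule vector_derivative_at)
qed

lemma partial_deriv_has_vector_derivative:
  fixes f :: "real^'d::finite \<Rightarrow> 'b::real_normed_vector"
  assumes "f differentiable at (x + s *\<^sub>R axis k 1)"
  shows "((\<lambda>t. f (x + t *\<^sub>R axis k 1)) has_vector_derivative partial_deriv k f (x + s *\<^sub>R axis k 1)) (at s)"
proof -
  let ?y = "x + s *\<^sub>R axis k 1"
  obtain f' where f': "(f has_derivative f') (at ?y)" using assms differentiable_def by blast
  have "((\<lambda>t::real. x + t *\<^sub>R axis k 1) has_derivative (\<lambda>t. t *\<^sub>R axis k 1)) (at s)"
    by (auto intro!: derivative_eq_intros)
  from has_derivative_compose[OF this f']
  have "((\<lambda>t. f (x + t *\<^sub>R axis k 1)) has_derivative (\<lambda>t. f' (t *\<^sub>R axis k 1))) (at s)" .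
  moreover have "linear f'" using f' has_derivative_linear by blast
  ultimately show ?thesis
    unfolding has_vector_derivative_def partial_deriv_eq[OF f'] by (simp add: linear_scale)
qed

lemma eventually_line_in_open:
  fixes x :: "real^'d::finite"
  assumes "open \<Omega>" "x \<in> \<Omega>"
  shows "\<forall>\<^sub>F t in nhds 0. x + t *\<^sub>R axis k 1 \<in> \<Omega>"
proof -
  have "((\<lambda>t. x + t *\<^sub>R axis k 1) \<longlongrightarrow> x + 0 *\<^sub>R axis k (1::real)) (nhds 0)"
    by (intro tendsto_intros filterlim_ident)
  then show ?thesis using assms by (auto simp: tendsto_def)
qed

lemma partial_deriv_cong:
  fixes f g :: "real^'d::finite \<Rightarrow> 'b::real_normed_vector"
  assumes "open \<Omega>" "x \<in> \<Omega>" "\<And>y. y \<in> \<Omega> \<Longrightarrow> f y = g y"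
  shows "partial_deriv k f x = partial_deriv k g x"
  unfolding partial_deriv_def
proof (rule vector_derivative_cong_eq)
  show "\<forall>\<^sub>F t in nhds 0. t \<in> UNIV \<longrightarrow> f (x + t *\<^sub>R axis k 1) = g (x + t *\<^sub>R axis k 1)"
    using eventually_line_in_open[OF assms(1,2), of k] by eventually_elim (simp add: assms(3))
qed auto

lemma differentiable_cong_open:
  fixes f g :: "'a::real_normed_vector \<Rightarrow> 'b::real_normed_vector"
  assumes "open \<Omega>" "x \<in> \<Omega>" "\<And>y. y \<in> \<Omega> \<Longrightarrow> f y = g y" "f differentiable at x"
  shows "g differentiable at x"
  using assms has_derivative_transform_within_open unfolding differentiable_def by blast

lemma C_on_cong:
  assumes "open \<Omega>" "\<And>y. y \<in> \<Omega> \<Longrightarrow> f y = g y" "C_on n \<Omega> f" shows "C_on n \<Omega> g"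
  using assms(2,3)
proof (induction n arbitrary: f g)
  case 0 then show ?case by (simp cong: continuous_on_cong)
next
  case (Suc n)
  have "C_on n \<Omega> (partial_deriv k g)" for k
    by (rule Suc.IH[of "partial_deriv k f"])
      (use partial_deriv_cong[OF assms(1) _ Suc.prems(1)] Suc.prems in auto)
  moreover have "g differentiable at x" if "x \<in> \<Omega>" for x
    using Suc.prems that by (intro differentiable_cong_open[OF assms(1) that, of f g]) auto
  ultimately show ?case by simp
qed

lemma C_on_SucD: "C_on (Suc n) \<Omega> f \<Longrightarrow> C_on n \<Omega> f"
proof (induction n arbitrary: f)
  case 0
  then show ?case
    by (auto intro!: continuous_at_imp_continuous_on differentiable_imp_continuous_within)
next
  case (Suc n)
  then show ?case by (subst C_on.simps(2)) (metis C_on.simps(2))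
qed

lemma C_on_const:
  fixes \<Omega> :: "(real^'d::finite) set" and c :: "'b::real_normed_vector"
  shows "C_on n \<Omega> (\<lambda>x. c)"
proof (induction n arbitrary: c)
  case (Suc n)
  have "partial_deriv k (\<lambda>x::real^'d. c) = (\<lambda>x. 0)" for k
    by (simp add: partial_deriv_def fun_eq_iff)
  then show ?case using Suc by simp
qed simp

lemma C_on_add:
  assumes "open \<Omega>" "C_on n \<Omega> f" "C_on n \<Omega> g" shows "C_on n \<Omega> (\<lambda>x. f x + g x)"
  using assms(2,3)
proof (induction n arbitrary: f g)
  case 0 then show ?case by (simp add: continuous_on_add)
next
  case (Suc n)
  have "C_on n \<Omega> (partial_deriv k (\<lambda>x. f x + g x))" for k
  proof (rule C_on_cong[OF assms(1)])
    show "C_on n \<Omega> (\<lambda>x. partial_deriv k f x + partial_deriv k g x)" using Suc by simp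
    fix x assume "x \<in> \<Omega>"
    then obtain f' g' where fg: "(f has_derivative f') (at x)" "(g has_derivative g') (at x)"
      using Suc.prems unfolding C_on.simps differentiable_def by blast
    show "partial_deriv k f x + partial_deriv k g x = partial_deriv k (\<lambda>x. f x + g x) x"
      unfolding partial_deriv_eq[OF has_derivative_add[OF fg]] partial_deriv_eq[OF fg(1)] partial_deriv_eq[OF fg(2)] ..
  qed
  then show ?case using Suc.prems by (auto intro: differentiable_add)
qed

lemma partial_deriv_bilinear:
  assumes "bounded_bilinear B" "f differentiable at x" "g differentiable at x"
  shows "partial_deriv k (\<lambda>x. B (f x) (g x)) x = B (f x) (partial_deriv k g x) + B (partial_deriv k f x) (g x)"
    and "(\<lambda>x. B (f x) (g x)) differentiable at x"
proof -
  obtain f' g' where fg: "(f has_derivative f') (at x)" "(g has_derivative g') (at x)"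
    using assms by (auto simp: differentiable_def)
  have "((\<lambda>x. B (f x) (g x)) has_derivative (\<lambda>h. B (f x) (g' h) + B (f' h) (g x))) (at x)"
    by (rule bounded_bilinear.FDERIV[OF assms(1) fg])
  from partial_deriv_eq[OF this] this
  show "partial_deriv k (\<lambda>x. B (f x) (g x)) x = B (f x) (partial_deriv k g x) + B (partial_deriv k f x) (g x)"
    and "(\<lambda>x. B (f x) (g x)) differentiable at x"
    by (auto simp: partial_deriv_eq[OF fg(1)] partial_deriv_eq[OF fg(2)] differentiable_def)
qed

lemma C_on_bilinear:
  assumes "open \<Omega>" "bounded_bilinear B" "C_on n \<Omega> f" "C_on n \<Omega> g" shows "C_on n \<Omega> (\<lambda>x. B (f x) (g x))"
  using assms(3,4)
proof (induction n arbitrary: f g)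
  case 0 then show ?case using bounded_bilinear.continuous_on[OF assms(2)] by simp
next
  case (Suc n)
  have "C_on n \<Omega> (partial_deriv k (\<lambda>x. B (f x) (g x)))" for k
  proof (rule C_on_cong[OF assms(1)])
    show "C_on n \<Omega> (\<lambda>x. B (f x) (partial_deriv k g x) + B (partial_deriv k f x) (g x))"
      by (intro C_on_add[OF assms(1)] Suc.IH C_on_SucD[OF Suc.prems(1)] C_on_SucD[OF Suc.prems(2)])
        (use Suc.prems in auto)
  qed (use Suc.prems in \<open>simp add: partial_deriv_bilinear(1)[OF assms(2)]\<close>)
  then show ?case using Suc.prems by (simp add: partial_deriv_bilinear(2)[OF assms(2)])
qed

lemma partial_deriv_linear:
  assumes "bounded_linear T" "f differentiable at x"
  shows "partial_deriv k (\<lambda>x. T (f x)) x = T (partial_deriv k f x)"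
    and "(\<lambda>x. T (f x)) differentiable at x"
proof -
  obtain f' where f: "(f has_derivative f') (at x)" using assms by (auto simp: differentiable_def)
  from bounded_linear.has_derivative[OF assms(1) this]
  have *: "((\<lambda>x. T (f x)) has_derivative (\<lambda>h. T (f' h))) (at x)" .
  from partial_deriv_eq[OF *] * show "partial_deriv k (\<lambda>x. T (f x)) x = T (partial_deriv k f x)"
    and "(\<lambda>x. T (f x)) differentiable at x" by (auto simp: partial_deriv_eq[OF f] differentiable_def)
qed

lemma C_on_linear:
  assumes "open \<Omega>" "bounded_linear T" "C_on n \<Omega> f" shows "C_on n \<Omega> (\<lambda>x. T (f x))"
  using assms(3)
proof (induction n arbitrary: f)
  case 0 then show ?case using bounded_linear.continuous_on[OF assms(2)] by simp
next
  case (Suc n)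
  have "C_on n \<Omega> (partial_deriv k (\<lambda>x. T (f x)))" for k
  proof (rule C_on_cong[OF assms(1)])
    show "C_on n \<Omega> (\<lambda>x. T (partial_deriv k f x))" using Suc by simp
  qed (use Suc.prems in \<open>simp add: partial_deriv_linear(1)[OF assms(2)]\<close>)
  then show ?case using Suc.prems by (simp add: partial_deriv_linear(2)[OF assms(2)])
qed

lemma C_on_prod:
  fixes f :: "'i \<Rightarrow> real^'d::finite \<Rightarrow> real"
  assumes "open \<Omega>" "finite I" "\<And>i. i \<in> I \<Longrightarrow> C_on n \<Omega> (f i)" shows "C_on n \<Omega> (\<lambda>x. \<Prod>i\<in>I. f i x)"
  using assms(2,3)
  by (induction I rule: finite_induct)
    (auto intro: C_on_const C_on_bilinear[OF assms(1) bounded_bilinear_mult])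

lemma has_derivative_ridge:
  fixes \<xi> :: "real^'d::finite" and p :: "real \<Rightarrow> real"
  assumes "(p has_real_derivative p') (at (\<xi> \<bullet> x + \<theta>))"
  shows "((\<lambda>x. p (\<xi> \<bullet> x + \<theta>)) has_derivative (\<lambda>h. (\<xi> \<bullet> h) * p')) (at x)"
proof -
  have "((\<lambda>x. \<xi> \<bullet> x + \<theta>) has_derivative (\<lambda>h. \<xi> \<bullet> h)) (at x)"
    by (auto intro!: derivative_eq_intros)
  from has_derivative_compose[OF this assms[unfolded has_field_derivative_def]]
  show ?thesis by (simp add: mult.commute)
qed

lemma partial_deriv_ridge:
  fixes \<xi> :: "real^'d::finite" and p :: "real \<Rightarrow> real"
  assumes "(p has_real_derivative p') (at (\<xi> \<bullet> x + \<theta>))"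
  shows "partial_deriv k (\<lambda>x. p (\<xi> \<bullet> x + \<theta>)) x = \<xi> $ k * p'"
  using partial_deriv_eq[OF has_derivative_ridge[OF assms]] by (simp add: inner_axis)

text \<open>A family of functions of one variable whose derivatives are linear combinations of members of the
  family consists of smooth functions; both the shifted cosines \<open>cos (t + m \<pi>/2)\<close> and the functions
  \<open>t\<^sup>-\<^sup>m exp (-1/t)\<close> are of this kind.\<close>

lemma C_on_ridge:
  fixes \<xi> :: "real^'d::finite" and p :: "nat \<Rightarrow> real \<Rightarrow> real"
  assumes "open \<Omega>" and p: "\<And>m t. (p m has_real_derivative \<alpha> m * p (m + 1) t + \<beta> m * p (m + 2) t) (at t)"
  shows "C_on n \<Omega> (\<lambda>x. p m (\<xi> \<bullet> x + \<theta>))"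
proof (induction n arbitrary: m)
  case 0
  have "continuous_on UNIV (p m)"
    using p by (intro continuous_at_imp_continuous_on ballI DERIV_isCont) blast
  then show ?case
    by (auto intro!: continuous_on_compose2[of UNIV "p m"] continuous_intros)
next
  case (Suc n)
  have "partial_deriv k (\<lambda>x. p m (\<xi> \<bullet> x + \<theta>)) =
    (\<lambda>x. (\<xi> $ k * \<alpha> m) * p (m + 1) (\<xi> \<bullet> x + \<theta>) + (\<xi> $ k * \<beta> m) * p (m + 2) (\<xi> \<bullet> x + \<theta>))" for k
    by (rule ext, subst partial_deriv_ridge[OF p]) (simp add: algebra_simps)
  moreover have "C_on n \<Omega> (\<lambda>x. (\<xi> $ k * \<alpha> m) * p (m + 1) (\<xi> \<bullet> x + \<theta>) + (\<xi> $ k * \<beta> m) * p (m + 2) (\<xi> \<bullet> x + \<theta>))" for k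
    by (intro C_on_add[OF assms(1)] C_on_bilinear[OF assms(1) bounded_bilinear_mult] C_on_const Suc)
  moreover have "(\<lambda>x. p m (\<xi> \<bullet> x + \<theta>)) differentiable at x" for x
    using has_derivative_ridge[OF p] unfolding differentiable_def by blast
  ultimately show ?case by simp
qed

lemma C_on_cos: "open \<Omega> \<Longrightarrow> C_on n \<Omega> (\<lambda>x. cos (\<xi> \<bullet> x + \<theta>))"
proof -
  assume "open \<Omega>"
  then have "C_on n \<Omega> (\<lambda>x. (\<lambda>m t. cos (t + of_nat m * (pi / 2))) 0 (\<xi> \<bullet> x + \<theta>))"
  proof (rule C_on_ridge[where \<alpha> = "\<lambda>_. 1" and \<beta> = "\<lambda>_. 0"])
    fix m :: nat and t :: real
    have "((\<lambda>t. cos (t + of_nat m * (pi / 2))) has_real_derivative - sin (t + of_nat m * (pi / 2))) (at t)"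
      by (auto intro!: derivative_eq_intros)
    also have "- sin (t + of_nat m * (pi / 2)) = cos (t + of_nat m * (pi / 2) + pi / 2)"
      by (simp add: cos_add)
    finally show "((\<lambda>t. cos (t + of_nat m * (pi / 2))) has_real_derivative
        1 * cos (t + of_nat (m + 1) * (pi / 2)) + 0 * cos (t + of_nat (m + 2) * (pi / 2))) (at t)"
      by (simp add: algebra_simps add_divide_distrib)
  qed
  then show ?thesis by simp
qed

text \<open>The factors \<open>t\<^sup>-\<^sup>m\<close> keep the family closed under differentiation.\<close>

definition flat_exp :: "nat \<Rightarrow> real \<Rightarrow> real" where
  "flat_exp m t = (if t > 0 then (1 / t) ^ m * exp (- (1 / t)) else 0)"

lemma flat_exp_deriv:
  "(flat_exp m has_real_derivative - real m * flat_exp (m + 1) t + 1 * flat_exp (m + 2) t) (at t)"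
proof -
  consider "t > 0" | "t < 0" | "t = 0" by linarith
  then show ?thesis
  proof cases
    case 1
    have "((\<lambda>t. (1 / t) ^ m * exp (- (1 / t))) has_real_derivative
        - real m * flat_exp (m + 1) t + 1 * flat_exp (m + 2) t) (at t)"
    proof -
      have d: "((\<lambda>t. 1 / t) has_real_derivative - (1 / t) * (1 / t)) (at t)"
        using 1 by (auto intro!: derivative_eq_intros)
      have "((\<lambda>t. - (1 / t)) has_real_derivative (1 / t) * (1 / t)) (at t)"
        using DERIV_minus[OF d] by simp
      from DERIV_mult[OF DERIV_power[OF d, of m] DERIV_fun_exp[OF this]]
      have "((\<lambda>t. (1 / t) ^ m * exp (- (1 / t))) has_real_derivative
          real m * (- (1 / t) * (1 / t) * (1 / t) ^ (m - Suc 0)) * exp (- (1 / t)) +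
          exp (- (1 / t)) * ((1 / t) * (1 / t)) * (1 / t) ^ m) (at t)"
        by simp
      also have "real m * (- (1 / t) * (1 / t) * (1 / t) ^ (m - Suc 0)) * exp (- (1 / t)) +
          exp (- (1 / t)) * ((1 / t) * (1 / t)) * (1 / t) ^ m =
          - real m * flat_exp (m + 1) t + 1 * flat_exp (m + 2) t"
      proof -
        have "real m * (- i * i * i ^ (m - Suc 0)) * E + E * (i * i) * i ^ m
            = - real m * (i ^ (m + 1) * E) + 1 * (i ^ (m + 2) * E)" for i E :: real
          by (cases m) (simp_all add: algebra_simps)
        then show ?thesis by (simp only: flat_exp_def 1 if_True)
      qed
      finally show ?thesis .
    qed
    then show ?thesis
      by (rule has_field_derivative_transform_within_open[of _ _ _ "{0<..}"]) (use 1 in \<open>auto simp: flat_exp_def\<close>)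
  next
    case 2
    have "((\<lambda>t. 0) has_real_derivative 0) (at t)" by simp
    then have "(flat_exp m has_real_derivative 0) (at t)"
      by (rule has_field_derivative_transform_within_open[of _ _ _ "{..<0}"]) (use 2 in \<open>auto simp: flat_exp_def\<close>)
    then show ?thesis using 2 by (simp add: flat_exp_def)
  next
    case 3
    have "((\<lambda>h. flat_exp m h / h) \<longlongrightarrow> 0) (at_right 0)"
    proof -
      have "((\<lambda>y::real. y ^ (m + 1) / exp y) \<longlongrightarrow> 0) at_top" by (rule tendsto_power_div_exp_0)
      then have "((\<lambda>h::real. (inverse h) ^ (m + 1) / exp (inverse h)) \<longlongrightarrow> 0) (at_right 0)"
        using filterlim_inverse_at_top_right by (rule filterlim_compose)
      moreover have "eventually (\<lambda>h::real. (inverse h) ^ (m + 1) / exp (inverse h) = flat_exp m h / h) (at_right 0)"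
        using eventually_at_right_less[of "0::real"]
        by eventually_elim (simp add: flat_exp_def exp_minus field_simps)
      ultimately show ?thesis by (rule Lim_transform_eventually)
    qed
    moreover have "((\<lambda>h. flat_exp m h / h) \<longlongrightarrow> 0) (at_left 0)"
    proof (rule Lim_transform_eventually[OF tendsto_const])
      show "eventually (\<lambda>h::real. 0 = flat_exp m h / h) (at_left 0)"
        using eventually_at_left_field[of "\<lambda>h. 0 = flat_exp m h / h" 0]
        by (auto simp: flat_exp_def intro!: exI[of _ "-1"])
    qed
    ultimately have "((\<lambda>h. flat_exp m h / h) \<longlongrightarrow> 0) (at 0)" by (simp add: filterlim_split_at)
    then have "(flat_exp m has_real_derivative 0) (at 0)"
      by (simp add: has_field_derivative_iff flat_exp_def)
    then show ?thesis using 3 by (simp add: flat_exp_def)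
  qed
qed

subsection \<open>Bump functions on boxes\<close>

text \<open>Smooth functions with support in the box from \<open>a\<close> to \<open>b\<close> that increase to the indicator function of
  its interior as \<open>j \<rightarrow> \<infinity>\<close>.\<close>

definition bump :: "nat \<Rightarrow> real^'d::finite \<Rightarrow> real^'d \<Rightarrow> real^'d \<Rightarrow> real" where
  "bump j a b x = (\<Prod>i\<in>UNIV. flat_exp 0 (real (Suc j) * (x $ i - a $ i)) * flat_exp 0 (real (Suc j) * (b $ i - x $ i)))"

lemma flat_exp_0_bounds: "0 \<le> flat_exp 0 t" "flat_exp 0 t \<le> 1"
  by (auto simp: flat_exp_def)

lemma bump_bounds: "0 \<le> bump j a b x" "bump j a b x \<le> 1"
  unfolding bump_def by (auto intro!: prod_nonneg prod_le_1 mult_nonneg_nonneg mult_le_one flat_exp_0_bounds)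

lemma bump_outside: "x \<notin> box a b \<Longrightarrow> bump j a b x = 0"
  unfolding bump_def mem_box_cart flat_exp_def by (auto simp: zero_less_mult_iff)

lemma C_on_bump: assumes "open \<Omega>" shows "C_on n \<Omega> (bump j a b)"
proof -
  have "C_on n \<Omega> (\<lambda>x. flat_exp 0 ((real (Suc j) *\<^sub>R axis i 1) \<bullet> x + (- real (Suc j) * a $ i)) *
      flat_exp 0 ((- real (Suc j) *\<^sub>R axis i 1) \<bullet> x + real (Suc j) * b $ i))" for i
    by (intro C_on_bilinear[OF assms bounded_bilinear_mult] C_on_ridge[OF assms flat_exp_deriv])
  then have "C_on n \<Omega> (\<lambda>x. \<Prod>i\<in>UNIV. flat_exp 0 ((real (Suc j) *\<^sub>R axis i 1) \<bullet> x + (- real (Suc j) * a $ i)) *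
      flat_exp 0 ((- real (Suc j) *\<^sub>R axis i 1) \<bullet> x + real (Suc j) * b $ i))"
    by (intro C_on_prod assms) auto
  then show ?thesis
    by (rule C_on_cong[OF assms, rotated]) (simp add: bump_def inner_axis' algebra_simps)
qed

lemma bump_tendsto: assumes "x \<in> box a b" shows "(\<lambda>j. bump j a b x) \<longlonglongrightarrow> 1"
proof -
  have fe: "(\<lambda>j. flat_exp 0 (real (Suc j) * s)) \<longlonglongrightarrow> 1" if "s > 0" for s
  proof -
    have "(\<lambda>j. 1 / s * inverse (real (Suc j))) \<longlonglongrightarrow> 1 / s * 0"
      by (rule tendsto_mult_left[OF LIMSEQ_inverse_real_of_nat])
    then have "(\<lambda>j. exp (- (1 / s * inverse (real (Suc j))))) \<longlonglongrightarrow> exp (- (1 / s * 0))"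
      by (intro tendsto_exp tendsto_minus)
    moreover have "flat_exp 0 (real (Suc j) * s) = exp (- (1 / s * inverse (real (Suc j))))" for j
    proof -
      have "0 < real (Suc j) * s" using that by simp
      then show ?thesis by (simp add: flat_exp_def divide_inverse mult.commute del: of_nat_Suc)
    qed
    ultimately show ?thesis by simp
  qed
  have "(\<lambda>j. bump j a b x) \<longlonglongrightarrow> (\<Prod>i\<in>(UNIV::'a set). 1 * 1)"
    unfolding bump_def using assms by (intro tendsto_prod tendsto_mult fe) (auto simp: mem_box_cart)
  then show ?thesis by simp
qed

lemma bump_Cc_infinity:
  assumes "open \<Omega>" "cbox a b \<subseteq> \<Omega>" "\<And>n. C_on n \<Omega> g"
  shows "(\<lambda>x. complex_of_real (bump j a b x * g x)) \<in> Cc_infinity \<Omega> UNIV"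
  unfolding Cc_infinity_def
proof (intro CollectI conjI allI)
  show "C_on n \<Omega> (\<lambda>x. complex_of_real (bump j a b x * g x))" for n
    by (intro C_on_linear[OF assms(1) bounded_linear_of_real] C_on_bilinear[OF assms(1) bounded_bilinear_mult]
        C_on_bump assms)
  show "\<exists>E. compact E \<and> E \<subseteq> \<Omega> \<and> (\<forall>x\<in>\<Omega> - E. complex_of_real (bump j a b x * g x) = 0)"
  proof -
    have "bump j a b x = 0" if "x \<notin> cbox a b" for x
      using that box_subset_cbox[of a b] by (intro bump_outside) blast
    then show ?thesis using assms(2) by (intro exI[of _ "cbox a b"]) auto
  qed
qed auto

subsection \<open>The fundamental lemma of the calculus of variations\<close>

lemma borel_measurable_lebesgue_continuous:
  fixes f :: "'a::euclidean_space \<Rightarrow> 'b::topological_space"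
  assumes "continuous_on UNIV f" shows "f \<in> borel_measurable lebesgue"
  using borel_measurable_continuous_onI[OF assms] by (intro measurable_completion) simp

lemma continuous_bump: "continuous_on UNIV (bump j a b)"
  using C_on_bump[of UNIV 0 j a b] by simp

lemma bump_measurable [measurable]: "bump j a b \<in> borel_measurable lebesgue"
  by (intro borel_measurable_lebesgue_continuous continuous_bump)

lemma integral_zero_on_borel_if_zero_on_boxes:
  fixes g :: "'a::euclidean_space \<Rightarrow> real"
  assumes g: "integrable lebesgue g" and UNIV: "(\<integral>x. g x \<partial>lebesgue) = 0"
    and box: "\<And>a b. (\<integral>x. indicator (box a b) x * g x \<partial>lebesgue) = 0" and S: "S \<in> sets borel"
  shows "(\<integral>x. indicator S x * g x \<partial>lebesgue) = 0"
proof -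
  have int: "integrable lebesgue (\<lambda>x. indicator S x * g x)" if "S \<in> sets borel" for S
    using integrable_mult_indicator[OF _ g, of S] that by (simp add: sets_completionI_sets)
  have "Int_stable (range (\<lambda>(a, b). box a b :: 'a set))" by (auto simp: Int_stable_def box_Int_box)
  moreover have "range (\<lambda>(a, b). box a b :: 'a set) \<subseteq> Pow UNIV" by simp
  moreover have "S \<in> sigma_sets UNIV (range (\<lambda>(a, b). box a b :: 'a set))"
    using S by (simp add: borel_eq_box)
  ultimately show ?thesis
  proof (induction rule: sigma_sets_induct_disjoint)
    case (basic A) then show ?case using box by auto
  next
    case (compl A)
    then have A: "A \<in> sets borel" by (simp add: borel_eq_box)
    have "(\<integral>x. indicator (UNIV - A) x * g x \<partial>lebesgue) = (\<integral>x. g x - indicator A x * g x \<partial>lebesgue)"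
      by (rule Bochner_Integration.integral_cong) (auto simp: indicator_def)
    also have "\<dots> = 0" using compl UNIV int[OF A] g by simp
    finally show ?case .
  next
    case (union A)
    then have A: "A i \<in> sets borel" for i by (auto simp: borel_eq_box)
    then have AL: "A i \<in> sets lebesgue" for i by (simp add: sets_completionI_sets)
    have "(LINT x:(\<Union>i. A i)|lebesgue. g x) = (\<Sum>i. (LINT x:(A i)|lebesgue. g x))"
    proof (rule lebesgue_integral_countable_add)
      show "set_integrable lebesgue (\<Union>i. A i) g"
        using int[of "\<Union>i. A i"] A by (auto simp: set_integrable_def)
    qed (use AL union in \<open>auto simp: disjoint_family_on_def\<close>)
    then show ?case using union by (simp add: set_lebesgue_integral_def)
  qed auto
qed

text \<open>The boxes generate the Borel sets and are stable under intersection, so \<open>g\<close> integrates to zero over the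
  sets where it is positive and where it is negative.\<close>

lemma ae_zero_if_zero_on_boxes:
  fixes g :: "'a::euclidean_space \<Rightarrow> real"
  assumes g: "integrable lebesgue g" and UNIV: "(\<integral>x. g x \<partial>lebesgue) = 0"
    and box: "\<And>a b. (\<integral>x. indicator (box a b) x * g x \<partial>lebesgue) = 0"
  shows "AE x in lebesgue. g x = 0"
proof -
  obtain g' where g': "g' \<in> borel_measurable lborel" "AE x in lborel. g x = g' x"
    using completion_ex_borel_measurable_real[of g lborel] g by auto
  have ae: "AE x in lebesgue. g x = g' x" using g'(2) by (rule AE_completion)
  have gm [measurable]: "g' \<in> borel_measurable lebesgue" using g'(1) by (rule measurable_completion)
  have int': "integrable lebesgue g'"
    using g ae by (subst integrable_cong_AE[of _ _ g]) (auto elim: eventually_mono)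
  have zero: "(\<integral>x. indicator S x * g' x \<partial>lebesgue) = 0" if S: "S \<in> sets borel" for S
  proof -
    have [measurable]: "S \<in> sets lebesgue" using S by (simp add: sets_completionI_sets)
    have [measurable]: "g \<in> borel_measurable lebesgue" using g by auto
    have "(\<integral>x. indicator S x * g' x \<partial>lebesgue) = (\<integral>x. indicator S x * g x \<partial>lebesgue)"
      by (rule integral_cong_AE) (use ae in \<open>auto elim: eventually_mono\<close>)
    then show ?thesis using integral_zero_on_borel_if_zero_on_boxes[OF g UNIV box S] by simp
  qed
  have half: "AE x in lebesgue. indicator S x * g' x = 0"
    if S: "S \<in> sets borel" and s: "\<And>x. 0 \<le> s * (indicator S x * g' x)" "s \<noteq> 0" for S and s :: real
  proof -
    have [measurable]: "S \<in> sets lebesgue" using S by (simp add: sets_completionI_sets)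
    have "integrable lebesgue (\<lambda>x. s * (indicator S x * g' x))"
      using integrable_mult_indicator[OF _ int', of S] by (intro integrable_mult_right) simp
    moreover have "(\<integral>x. s * (indicator S x * g' x) \<partial>lebesgue) = 0" using zero[OF S] by simp
    ultimately have "AE x in lebesgue. s * (indicator S x * g' x) = 0"
      using integral_nonneg_eq_0_iff_AE[of lebesgue "\<lambda>x. s * (indicator S x * g' x)"] s(1) by auto
    then show ?thesis using s(2) by simp
  qed
  have S: "{x. g' x > 0} \<in> sets borel" "{x. g' x < 0} \<in> sets borel" using g'(1) by measurable
  have "AE x in lebesgue. indicator {x. g' x > 0} x * g' x = 0"
    by (rule half[of _ 1, OF S(1)]) (auto simp: indicator_def)
  moreover have "AE x in lebesgue. indicator {x. g' x < 0} x * g' x = 0"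
    by (rule half[of _ "-1", OF S(2)]) (auto simp: indicator_def)
  ultimately show ?thesis using ae
  proof eventually_elim
    case (elim x)
    then show ?case by (cases "g' x > 0"; cases "g' x < 0") (auto simp: indicator_def)
  qed
qed

text \<open>The powers of the bump functions converge to the indicator function of a box as well; first powers occur in the
  definition of weak derivatives, squares in the form.\<close>

lemma ae_zero_if_bump_integrals_zero:
  fixes h :: "real^'d::finite \<Rightarrow> real"
  assumes \<Omega>: "open \<Omega>" and p: "p > 0"
    and int: "\<And>a b. cbox a b \<subseteq> \<Omega> \<Longrightarrow> integrable lebesgue (\<lambda>x. indicator (cbox a b) x * h x)"
    and zero: "\<And>a b j. cbox a b \<subseteq> \<Omega> \<Longrightarrow> (\<integral>x. bump j a b x ^ p * h x \<partial>lebesgue) = 0"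
  shows "AE x in lebesgue. x \<in> \<Omega> \<longrightarrow> h x = 0"
proof -
  have box_zero: "(\<integral>x. indicator (box a b) x * h x \<partial>lebesgue) = 0" if ab: "cbox a b \<subseteq> \<Omega>" for a b
  proof -
    let ?w = "\<lambda>x. indicator (cbox a b) x * h x"
    have iw: "integrable lebesgue ?w" by (rule int[OF ab])
    have wm: "?w \<in> borel_measurable lebesgue" using iw by auto
    have eq: "bump j a b x ^ p * h x = bump j a b x ^ p * ?w x"
      "indicator (box a b) x * h x = indicator (box a b) x * ?w x" for j x
      using bump_outside[where x=x and a=a and b=b and j=j] box_subset_cbox[of a b] p by (auto simp: indicator_def)
    have "(\<lambda>j. \<integral>x. bump j a b x ^ p * ?w x \<partial>lebesgue) \<longlonglongrightarrow> (\<integral>x. indicator (box a b) x * ?w x \<partial>lebesgue)"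
    proof (rule integral_dominated_convergence[where w = "\<lambda>x. norm (?w x)"])
      show "AE x in lebesgue. (\<lambda>j. bump j a b x ^ p * ?w x) \<longlonglongrightarrow> indicator (box a b) x * ?w x"
      proof (rule AE_I2)
        fix x
        have "(\<lambda>j. bump j a b x ^ p) \<longlonglongrightarrow> indicator (box a b) x"
        proof (cases "x \<in> box a b")
          case True
          then show ?thesis using tendsto_power[OF bump_tendsto[OF True], of p] by simp
        next
          case False
          then show ?thesis using p by (simp add: bump_outside)
        qed
        then show "(\<lambda>j. bump j a b x ^ p * ?w x) \<longlonglongrightarrow> indicator (box a b) x * ?w x"
          by (rule tendsto_mult_right)
      qed
      have "norm (bump j a b x ^ p * ?w x) \<le> norm (?w x)" for j x
      proof -
        have "norm (bump j a b x ^ p) \<le> 1"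
          using bump_bounds[where j=j and a=a and b=b and x=x] by (simp add: power_le_one)
        from mult_right_mono[OF this norm_ge_zero[of "?w x"]] show ?thesis
          unfolding norm_mult by simp
      qed
      then show "AE x in lebesgue. norm (bump j a b x ^ p * ?w x) \<le> norm (?w x)" for j by simp
      show "integrable lebesgue (\<lambda>x. norm (?w x))" by (rule integrable_norm[OF iw])
      show "(\<lambda>x. bump j a b x ^ p * ?w x) \<in> borel_measurable lebesgue" for j
        by (rule borel_measurable_times[OF borel_measurable_power[OF bump_measurable] wm])
      show "(\<lambda>x. indicator (box a b) x * ?w x) \<in> borel_measurable lebesgue"
        by (rule borel_measurable_times[OF borel_measurable_indicator wm]) (auto simp: sets_completionI_sets)
    qed
    moreover have "(\<integral>x. bump j a b x ^ p * ?w x \<partial>lebesgue) = 0" for j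
      using zero[OF ab, of j] unfolding eq(1) .
    ultimately show ?thesis unfolding eq(2) by (simp add: LIMSEQ_const_iff)
  qed
  have local: "AE x in lebesgue. x \<in> cbox A B \<longrightarrow> h x = 0" if AB: "cbox A B \<subseteq> \<Omega>" for A B
  proof -
    define g where "g = (\<lambda>x. indicator (box A B) x * h x)"
    have "AE x in lebesgue. g x = 0"
    proof (rule ae_zero_if_zero_on_boxes)
      have "g = (\<lambda>x. indicator (box A B) x *\<^sub>R (indicator (cbox A B) x * h x))"
        using box_subset_cbox[of A B] by (auto simp: g_def indicator_def fun_eq_iff)
      then show "integrable lebesgue g"
        using integrable_mult_indicator[OF _ int[OF AB], of "box A B"] by (simp add: sets_completionI_sets)
      show "(\<integral>x. g x \<partial>lebesgue) = 0" unfolding g_def by (rule box_zero[OF AB])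
      fix a b :: "real^'d"
      obtain c d where cd: "box a b \<inter> box A B = box c d" using box_Int_box by blast
      have "(\<integral>x. indicator (box a b) x * g x \<partial>lebesgue) = (\<integral>x. indicator (box c d) x * h x \<partial>lebesgue)"
        unfolding g_def cd[symmetric] by (rule Bochner_Integration.integral_cong) (auto simp: indicator_def)
      also have "\<dots> = 0"
      proof (cases "box c d = {}")
        case False
        have "box c d \<subseteq> cbox A B" using cd box_subset_cbox[of A B] by blast
        then have "closure (box c d) \<subseteq> cbox A B" by (intro closure_minimal) auto
        then show ?thesis using AB closure_box[OF False] by (intro box_zero) auto
      qed simp
      finally show "(\<integral>x. indicator (box a b) x * g x \<partial>lebesgue) = 0" .
    qed
    moreover have "AE x in lebesgue. x \<notin> cbox A B - box A B"
      using negligible_frontier_interval[of A B] by (intro AE_not_in) (simp add: negligible_iff_null_sets)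
    ultimately show ?thesis by eventually_elim (auto simp: g_def indicator_def)
  qed
  obtain \<D> where D: "countable \<D>" "\<D> \<subseteq> Pow \<Omega>" "\<And>X. X \<in> \<D> \<Longrightarrow> \<exists>a b. X = cbox a b" "\<Union>\<D> = \<Omega>"
    using open_countable_Union_open_cbox[OF \<Omega>] by metis
  have "AE x in lebesgue. x \<in> X \<longrightarrow> h x = 0" if X: "X \<in> \<D>" for X
  proof -
    obtain a b where "X = cbox a b" "cbox a b \<subseteq> \<Omega>" using D(2) D(3)[OF X] X by auto
    then show ?thesis using local by simp
  qed
  then have "AE x in lebesgue. \<forall>X\<in>\<D>. x \<in> X \<longrightarrow> h x = 0"
    using AE_ball_countable[OF D(1), where M = lebesgue and P = "\<lambda>x X. x \<in> X \<longrightarrow> h x = 0"] by simp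
  then show ?thesis unfolding D(4)[symmetric] by eventually_elim blast
qed

subsection \<open>Integration by parts\<close>

text \<open>The integral of a partial derivative of a compactly supported function vanishes: by translation
  invariance every difference quotient has integral zero, and the difference quotients are dominated.\<close>

lemma integral_partial_deriv_eq_0:
  fixes F :: "real^'d::finite \<Rightarrow> 'b::{banach,second_countable_topology}"
  assumes diff: "\<And>x. F differentiable at x" and cont: "continuous_on UNIV (partial_deriv k F)"
    and E: "compact E" and out: "\<And>x. x \<notin> E \<Longrightarrow> F x = 0"
  shows "integrable lborel (partial_deriv k F)" "(\<integral>x. partial_deriv k F x \<partial>lborel) = 0"
proof -
  let ?e = "axis k 1 :: real^'d"
  have contF: "continuous_on UNIV F"
    using diff by (intro continuous_at_imp_continuous_on ballI differentiable_imp_continuous_within) auto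
  have dout: "partial_deriv k F x = 0" if "x \<notin> E" for x
  proof -
    have "partial_deriv k F x = partial_deriv k (\<lambda>x. 0) x"
      by (rule partial_deriv_cong[of "- E"]) (use E out that compact_imp_closed in auto)
    then show ?thesis by (simp add: partial_deriv_def)
  qed
  obtain K where K: "K \<ge> 0" "\<And>x. norm (partial_deriv k F x) \<le> K"
  proof -
    have "compact (partial_deriv k F ` E)"
      using E cont by (meson compact_continuous_image continuous_on_subset subset_UNIV)
    then obtain K where "\<And>x. x \<in> E \<Longrightarrow> norm (partial_deriv k F x) \<le> K"
      using compact_imp_bounded bounded_iff by (metis imageI)
    then have "norm (partial_deriv k F x) \<le> max K 0" for x
      by (cases "x \<in> E") (auto simp: dout le_max_iff_disj)
    then show thesis using that[of "max K 0"] by simp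
  qed
  obtain R where R: "\<And>x. x \<in> E \<Longrightarrow> norm x \<le> R" using E compact_imp_bounded bounded_iff by metis
  define q where "q = (\<lambda>n x. real (Suc n) *\<^sub>R (F (x + (1 / real (Suc n)) *\<^sub>R ?e) - F x))"
  have lip: "norm (F (x + s *\<^sub>R ?e) - F x) \<le> K * s" if "s \<ge> 0" for x s
  proof -
    have "norm (F (x + s *\<^sub>R ?e) - F (x + 0 *\<^sub>R ?e)) \<le> K * norm (s - 0)"
    proof (rule differentiable_bound[of "{0..s}" _ "\<lambda>t h. h *\<^sub>R partial_deriv k F (x + t *\<^sub>R ?e)"])
      show "((\<lambda>t. F (x + t *\<^sub>R ?e)) has_derivative (\<lambda>h. h *\<^sub>R partial_deriv k F (x + t *\<^sub>R ?e))) (at t within {0..s})" for t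
        using partial_deriv_has_vector_derivative[OF diff, where x=x and s=t and k=k]
        unfolding has_vector_derivative_def by (rule has_derivative_at_withinI)
      show "onorm (\<lambda>h. h *\<^sub>R partial_deriv k F (x + t *\<^sub>R ?e)) \<le> K" for t
      proof (rule onorm_bound[OF K(1)])
        fix h
        have "norm (partial_deriv k F (x + t *\<^sub>R ?e)) * \<bar>h\<bar> \<le> K * \<bar>h\<bar>"
          by (rule mult_right_mono[OF K(2)]) simp
        then show "norm (h *\<^sub>R partial_deriv k F (x + t *\<^sub>R ?e)) \<le> K * norm h"
          by (simp add: mult.commute)
      qed
    qed (use that in auto)
    then show ?thesis using that by simp
  qed
  have qb: "norm (q n x) \<le> indicator (cball 0 (R + 1)) x * K" for n x
  proof (cases "x \<in> cball 0 (R + 1)")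
    case True
    have "norm (q n x) = real (Suc n) * norm (F (x + (1 / real (Suc n)) *\<^sub>R ?e) - F x)" by (simp add: q_def)
    also have "\<dots> \<le> real (Suc n) * (K * (1 / real (Suc n)))" by (intro mult_left_mono lip) auto
    finally show ?thesis using True by simp
  next
    case False
    then have x: "norm x > R + 1" by simp
    have "norm x \<le> norm (x + (1 / real (Suc n)) *\<^sub>R ?e) + norm ((1 / real (Suc n)) *\<^sub>R ?e)"
      using norm_triangle_ineq4[of "x + (1 / real (Suc n)) *\<^sub>R ?e" "(1 / real (Suc n)) *\<^sub>R ?e"] by simp
    moreover have "norm ((1 / real (Suc n)) *\<^sub>R ?e) \<le> 1" by (simp add: norm_axis_1)
    ultimately have "norm (x + (1 / real (Suc n)) *\<^sub>R ?e) > R" "norm x > R" using x by linarith+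
    then have "x \<notin> E" "x + (1 / real (Suc n)) *\<^sub>R ?e \<notin> E" using R by fastforce+
    then have "q n x = 0" by (simp add: q_def out)
    then show ?thesis using K(1) by simp
  qed
  have intI: "integrable lborel (\<lambda>x::real^'d. indicator (cball 0 r) x * c)" for r and c :: real
  proof -
    have "integrable lborel (indicator (cball (0::real^'d) r) :: _ \<Rightarrow> real)"
      using emeasure_bounded_finite[OF bounded_cball, of "0::real^'d" r] by (intro integrable_real_indicator) auto
    then show ?thesis by (intro integrable_mult_left)
  qed
  have Fm [measurable]: "F \<in> borel_measurable borel" using contF by (rule borel_measurable_continuous_onI)
  have dm [measurable]: "partial_deriv k F \<in> borel_measurable borel" using cont by (rule borel_measurable_continuous_onI)
  have intF: "integrable lborel F"
  proof -
    have "compact (F ` E)" using E contF by (meson compact_continuous_image continuous_on_subset subset_UNIV)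
    then obtain c where c: "\<And>x. x \<in> E \<Longrightarrow> norm (F x) \<le> c"
      using compact_imp_bounded bounded_iff by (metis imageI)
    have "norm (F x) \<le> norm (indicator (cball 0 R) x * c)" for x
      using c[of x] R[of x] out[of x] by (cases "x \<in> E") (auto simp: indicator_def)
    then show ?thesis by (intro Bochner_Integration.integrable_bound[OF intI[of R c]]) auto
  qed
  have shift: "integrable lborel (\<lambda>x. F (x + a))" "(\<integral>x. F (x + a) \<partial>lborel) = (\<integral>x. F x \<partial>lborel)" for a
  proof -
    have "integrable (distr lborel borel ((+) a)) F" using intF by (simp add: lborel_distr_plus)
    then show "integrable lborel (\<lambda>x. F (x + a))" by (subst (asm) integrable_distr_eq) (auto simp: add.commute)
    have "(\<integral>x. F x \<partial>lborel) = (\<integral>x. F x \<partial>(distr lborel borel ((+) a)))" by (simp add: lborel_distr_plus)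
    also have "\<dots> = (\<integral>x. F (a + x) \<partial>lborel)" by (rule integral_distr) auto
    finally show "(\<integral>x. F (x + a) \<partial>lborel) = (\<integral>x. F x \<partial>lborel)" by (simp add: add.commute)
  qed
  have q0: "(\<integral>x. q n x \<partial>lborel) = 0" for n
    unfolding q_def using shift intF by simp
  have lim: "(\<lambda>n. q n x) \<longlonglongrightarrow> partial_deriv k F x" for x
  proof -
    have "((\<lambda>t. F (x + t *\<^sub>R ?e)) has_vector_derivative partial_deriv k F x) (at 0)"
      using partial_deriv_has_vector_derivative[where f=F and x=x and s=0 and k=k] diff by simp
    then have der: "((\<lambda>t. F (x + t *\<^sub>R ?e)) has_derivative (\<lambda>t. t *\<^sub>R partial_deriv k F x)) (at 0)"
      by (simp add: has_vector_derivative_def)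
    show ?thesis
    proof (rule LIMSEQ_I)
      fix r :: real assume r: "r > 0"
      then obtain d where d: "d > 0" "\<And>t. norm (t - 0) < d \<Longrightarrow>
          norm (F (x + t *\<^sub>R ?e) - F (x + 0 *\<^sub>R ?e) - (t - 0) *\<^sub>R partial_deriv k F x) \<le> r / 2 * norm (t - 0)"
        using der[unfolded has_derivative_at_alt] half_gt_zero[OF r] by blast
      obtain N :: nat where N: "1 / d < N" using reals_Archimedean2 by blast
      have "norm (q n x - partial_deriv k F x) < r" if n: "n \<ge> N" for n
      proof -
        define h where "h = 1 / real (Suc n)"
        have h: "h > 0" "real (Suc n) * h = 1" by (simp_all add: h_def)
        have "1 / d < real (Suc n)" using N n by linarith
        then have "h < d" using d(1) by (simp add: h_def field_simps)
        then have b: "norm (F (x + h *\<^sub>R ?e) - F x - h *\<^sub>R partial_deriv k F x) \<le> r / 2 * h"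
          using d(2)[of h] h(1) by simp
        have "q n x - partial_deriv k F x
            = real (Suc n) *\<^sub>R (F (x + h *\<^sub>R ?e) - F x) - (real (Suc n) * h) *\<^sub>R partial_deriv k F x"
          unfolding h(2) scaleR_one by (simp only: q_def h_def)
        also have "\<dots> = real (Suc n) *\<^sub>R (F (x + h *\<^sub>R ?e) - F x - h *\<^sub>R partial_deriv k F x)"
          by (simp add: scaleR_diff_right del: of_nat_Suc)
        finally have "norm (q n x - partial_deriv k F x)
            = real (Suc n) * norm (F (x + h *\<^sub>R ?e) - F x - h *\<^sub>R partial_deriv k F x)" by simp
        also have "\<dots> \<le> real (Suc n) * (r / 2 * h)" by (intro mult_left_mono b) simp
        also have "\<dots> = r / 2 * (real (Suc n) * h)" by simp
        also have "\<dots> < r" using h(2) r by simp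
        finally show ?thesis .
      qed
      then show "\<exists>N. \<forall>n\<ge>N. norm (q n x - partial_deriv k F x) < r" by blast
    qed
  qed
  have qm: "q n \<in> borel_measurable lborel" for n unfolding q_def by measurable
  show "integrable lborel (partial_deriv k F)"
    by (rule integrable_dominated_convergence[where s = q and w = "\<lambda>x. indicator (cball 0 (R + 1)) x * K"])
      (use lim qb qm intI dm in auto)
  have "(\<lambda>n. \<integral>x. q n x \<partial>lborel) \<longlonglongrightarrow> (\<integral>x. partial_deriv k F x \<partial>lborel)"
    by (rule integral_dominated_convergence[where w = "\<lambda>x. indicator (cball 0 (R + 1)) x * K"])
      (use lim qb qm intI dm in auto)
  then show "(\<integral>x. partial_deriv k F x \<partial>lborel) = 0" by (simp add: q0 LIMSEQ_const_iff)
qed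

section \<open>Smooth functions with compact support\<close>

definition ext_zero :: "'a set \<Rightarrow> ('a \<Rightarrow> 'b::zero) \<Rightarrow> 'a \<Rightarrow> 'b" where
  "ext_zero \<Omega> u = (\<lambda>x. if x \<in> \<Omega> then u x else 0)"

lemma ext_zero_simps [simp]: "x \<in> \<Omega> \<Longrightarrow> ext_zero \<Omega> u x = u x" "x \<notin> \<Omega> \<Longrightarrow> ext_zero \<Omega> u x = 0"
  by (simp_all add: ext_zero_def)

lemma integrable_compact_support:
  fixes g :: "'a::euclidean_space \<Rightarrow> 'b::{banach,second_countable_topology}"
  assumes "continuous_on UNIV g" "compact E" "\<And>x. x \<notin> E \<Longrightarrow> g x = 0"
  shows "integrable lebesgue g"
proof -
  have "set_integrable lborel E g"
    unfolding set_integrable_def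
    by (intro borel_integrable_compact assms(2) continuous_on_subset[OF assms(1)]) simp
  moreover have "(\<lambda>x. indicator E x *\<^sub>R g x) = g" using assms(3) by (auto simp: indicator_def fun_eq_iff)
  ultimately have "integrable lborel g" by (simp add: set_integrable_def)
  then show ?thesis using borel_measurable_continuous_onI[OF assms(1)] by (subst integrable_completion) auto
qed

lemma Cc_infinity_partial:
  fixes f :: "real^'d::finite \<Rightarrow> 'b::real_normed_vector"
  assumes \<Omega>: "open \<Omega>" and f: "f \<in> Cc_infinity \<Omega> K"
  shows "partial_deriv k f \<in> Cc_infinity \<Omega> UNIV"
proof -
  obtain E where E: "compact E" "E \<subseteq> \<Omega>" "\<And>x. x \<in> \<Omega> - E \<Longrightarrow> f x = 0" and C: "\<And>n. C_on n \<Omega> f"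
    using f by (auto simp: Cc_infinity_def)
  have "C_on n \<Omega> (partial_deriv k f)" for n using C[of "Suc n"] by simp
  moreover have "partial_deriv k f x = 0" if "x \<in> \<Omega> - E" for x
  proof -
    have "partial_deriv k f x = partial_deriv k (\<lambda>x. 0) x"
      by (rule partial_deriv_cong[of "\<Omega> - E"]) (use E that \<Omega> compact_imp_closed in auto)
    then show ?thesis by (simp add: partial_deriv_def)
  qed
  ultimately show ?thesis using E by (auto simp: Cc_infinity_def)
qed

lemma Cc_infinity_differentiable: "f \<in> Cc_infinity \<Omega> K \<Longrightarrow> x \<in> \<Omega> \<Longrightarrow> f differentiable at x"
  unfolding Cc_infinity_def using C_on.simps(2)[of 0 \<Omega> f] by blast

lemma Cc_infinity_C_on: "f \<in> Cc_infinity \<Omega> K \<Longrightarrow> C_on n \<Omega> f"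
  by (simp add: Cc_infinity_def)

text \<open>The function vanishes on \<open>\<Omega> - E\<close> for a compact set \<open>E\<close>, and \<open>\<Omega>\<close> and the complement of \<open>E\<close> are open sets that
  cover the space.\<close>

lemma Cc_infinity_ext_zero:
  fixes f :: "real^'d::finite \<Rightarrow> 'b::real_normed_vector"
  assumes \<Omega>: "open \<Omega>" and f: "f \<in> Cc_infinity \<Omega> K"
  shows "ext_zero \<Omega> f differentiable at x"
    and "partial_deriv k (ext_zero \<Omega> f) x = ext_zero \<Omega> (partial_deriv k f) x"
    and "continuous_on UNIV (ext_zero \<Omega> f)"
proof -
  obtain E where E: "compact E" "E \<subseteq> \<Omega>" "\<And>x. x \<in> \<Omega> - E \<Longrightarrow> f x = 0" and C: "\<And>n. C_on n \<Omega> f"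
    using f by (auto simp: Cc_infinity_def)
  have E': "open (- E)" using compact_imp_closed[OF E(1)] by (rule open_Compl)
  have out: "ext_zero \<Omega> f y = 0" if "y \<in> - E" for y using E(3)[of y] that by (cases "y \<in> \<Omega>") simp_all
  have d: "ext_zero \<Omega> f differentiable at x" for x
  proof (cases "x \<in> \<Omega>")
    case True
    show ?thesis
      by (rule differentiable_cong_open[OF \<Omega> True _ Cc_infinity_differentiable[OF f True]]) simp
  next
    case False
    then have "x \<in> - E" using E by auto
    then show ?thesis by (rule differentiable_cong_open[OF E' _ _ differentiable_const]) (simp add: out)
  qed
  show "ext_zero \<Omega> f differentiable at x" by (rule d)
  show "continuous_on UNIV (ext_zero \<Omega> f)"
    using d by (intro continuous_at_imp_continuous_on ballI differentiable_imp_continuous_within) auto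
  show "partial_deriv k (ext_zero \<Omega> f) x = ext_zero \<Omega> (partial_deriv k f) x"
  proof (cases "x \<in> \<Omega>")
    case True
    then show ?thesis using partial_deriv_cong[OF \<Omega> True, of "ext_zero \<Omega> f" f k] by simp
  next
    case False
    then have "x \<in> - E" using E by auto
    then have "partial_deriv k (ext_zero \<Omega> f) x = partial_deriv k (\<lambda>x. 0) x"
      using out by (intro partial_deriv_cong[OF E']) auto
    then show ?thesis using False by (simp add: partial_deriv_def)
  qed
qed

lemma Cc_infinity_integrable:
  fixes f :: "real^'d::finite \<Rightarrow> 'b::{banach,second_countable_topology}"
  assumes \<Omega>: "open \<Omega>" and f: "f \<in> Cc_infinity \<Omega> K"
  shows "integrable lebesgue (ext_zero \<Omega> f)" "integrable lebesgue (\<lambda>x. (norm (ext_zero \<Omega> f x))\<^sup>2)"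
    and "ext_zero \<Omega> f \<in> borel_measurable lebesgue"
proof -
  obtain E where E: "compact E" "E \<subseteq> \<Omega>" "\<And>x. x \<in> \<Omega> - E \<Longrightarrow> f x = 0"
    using f by (auto simp: Cc_infinity_def)
  have c: "continuous_on UNIV (ext_zero \<Omega> f)" by (rule Cc_infinity_ext_zero[OF \<Omega> f])
  have out: "ext_zero \<Omega> f y = 0" if "y \<notin> E" for y using E(3)[of y] that by (auto simp: ext_zero_def)
  show "integrable lebesgue (ext_zero \<Omega> f)" by (rule integrable_compact_support[OF c E(1) out])
  show "integrable lebesgue (\<lambda>x. (norm (ext_zero \<Omega> f x))\<^sup>2)"
    by (rule integrable_compact_support[OF _ E(1)]) (auto intro!: continuous_intros c simp: out)
  show "ext_zero \<Omega> f \<in> borel_measurable lebesgue" by (rule borel_measurable_lebesgue_continuous[OF c])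
qed

lemma Cc_infinity_bilinear:
  assumes \<Omega>: "open \<Omega>" and B: "bounded_bilinear B" and f: "f \<in> Cc_infinity \<Omega> K" and g: "\<And>n. C_on n \<Omega> g"
    and K': "\<And>x. x \<in> \<Omega> \<Longrightarrow> B (f x) (g x) \<in> K'"
  shows "(\<lambda>x. B (f x) (g x)) \<in> Cc_infinity \<Omega> K'"
proof -
  obtain E where E: "compact E" "E \<subseteq> \<Omega>" "\<And>x. x \<in> \<Omega> - E \<Longrightarrow> f x = 0" and C: "\<And>n. C_on n \<Omega> f"
    using f by (auto simp: Cc_infinity_def)
  have "C_on n \<Omega> (\<lambda>x. B (f x) (g x))" for n by (rule C_on_bilinear[OF \<Omega> B C g])
  moreover have "B (f x) (g x) = 0" if "x \<in> \<Omega> - E" for x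
    using E(3)[OF that] bounded_bilinear.zero_left[OF B] by simp
  ultimately show ?thesis using E K' by (auto simp: Cc_infinity_def)
qed

lemma Cc_infinity_linear:
  assumes \<Omega>: "open \<Omega>" and T: "bounded_linear T" and f: "f \<in> Cc_infinity \<Omega> K"
    and K': "\<And>x. x \<in> \<Omega> \<Longrightarrow> T (f x) \<in> K'"
  shows "(\<lambda>x. T (f x)) \<in> Cc_infinity \<Omega> K'"
proof -
  obtain E where E: "compact E" "E \<subseteq> \<Omega>" "\<And>x. x \<in> \<Omega> - E \<Longrightarrow> f x = 0" and C: "\<And>n. C_on n \<Omega> f"
    using f by (auto simp: Cc_infinity_def)
  have "C_on n \<Omega> (\<lambda>x. T (f x))" for n by (rule C_on_linear[OF \<Omega> T C])
  moreover have "T (f x) = 0" if "x \<in> \<Omega> - E" for x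
    using E(3)[OF that] linear_0[OF bounded_linear.linear[OF T]] by simp
  ultimately show ?thesis using E K' by (auto simp: Cc_infinity_def)
qed

lemma Cc_infinity_add:
  assumes \<Omega>: "open \<Omega>" and f: "f \<in> Cc_infinity \<Omega> K" and g: "g \<in> Cc_infinity \<Omega> K"
    and K: "\<And>x. x \<in> \<Omega> \<Longrightarrow> f x + g x \<in> K"
  shows "(\<lambda>x. f x + g x) \<in> Cc_infinity \<Omega> K"
proof -
  obtain E where E: "compact E" "E \<subseteq> \<Omega>" "\<And>x. x \<in> \<Omega> - E \<Longrightarrow> f x = 0" using f by (auto simp: Cc_infinity_def)
  obtain E' where E': "compact E'" "E' \<subseteq> \<Omega>" "\<And>x. x \<in> \<Omega> - E' \<Longrightarrow> g x = 0" using g by (auto simp: Cc_infinity_def)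
  have "C_on n \<Omega> (\<lambda>x. f x + g x)" for n by (intro C_on_add[OF \<Omega>] Cc_infinity_C_on[OF f] Cc_infinity_C_on[OF g])
  moreover have "\<exists>E. compact E \<and> E \<subseteq> \<Omega> \<and> (\<forall>x\<in>\<Omega> - E. f x + g x = 0)"
    using E E' by (intro exI[of _ "E \<union> E'"]) (auto intro: compact_Un)
  ultimately show ?thesis using K by (auto simp: Cc_infinity_def)
qed

text \<open>The partial derivative of the extension of \<open>\<tau> \<phi>\<close> by zero has integral zero.\<close>

lemma integration_by_parts:
  fixes \<phi> :: "real^'d::finite \<Rightarrow> 'b::{complex_normed_vector,banach,second_countable_topology}"
  assumes \<Omega>: "open \<Omega>" and \<tau>: "\<tau> \<in> Cc_infinity \<Omega> UNIV" and \<phi>: "\<phi> \<in> Cc_infinity \<Omega> K"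
  shows "(\<integral>x. partial_deriv k \<tau> x *\<^sub>C \<phi> x \<partial>lebesgue_on \<Omega>) = - (\<integral>x. \<tau> x *\<^sub>C partial_deriv k \<phi> x \<partial>lebesgue_on \<Omega>)"
proof -
  let ?F = "\<lambda>x. \<tau> x *\<^sub>C \<phi> x" and ?A = "\<lambda>x. partial_deriv k \<tau> x *\<^sub>C \<phi> x" and ?B = "\<lambda>x. \<tau> x *\<^sub>C partial_deriv k \<phi> x"
  have F: "?F \<in> Cc_infinity \<Omega> UNIV"
    by (rule Cc_infinity_bilinear[OF \<Omega> bounded_bilinear_scaleC \<tau> Cc_infinity_C_on[OF \<phi>]]) simp
  have A: "?A \<in> Cc_infinity \<Omega> UNIV"
    by (rule Cc_infinity_bilinear[OF \<Omega> bounded_bilinear_scaleC Cc_infinity_partial[OF \<Omega> \<tau>] Cc_infinity_C_on[OF \<phi>]]) simp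
  have B: "?B \<in> Cc_infinity \<Omega> UNIV"
    by (rule Cc_infinity_bilinear[OF \<Omega> bounded_bilinear_scaleC \<tau> Cc_infinity_C_on[OF Cc_infinity_partial[OF \<Omega> \<phi>]]]) simp
  obtain E where E: "compact E" "E \<subseteq> \<Omega>" "\<And>x. x \<in> \<Omega> - E \<Longrightarrow> ?F x = 0" using F by (auto simp: Cc_infinity_def)
  have pF: "partial_deriv k (ext_zero \<Omega> ?F) = (\<lambda>x. ext_zero \<Omega> ?B x + ext_zero \<Omega> ?A x)"
  proof
    fix x show "partial_deriv k (ext_zero \<Omega> ?F) x = ext_zero \<Omega> ?B x + ext_zero \<Omega> ?A x"
      unfolding Cc_infinity_ext_zero(2)[OF \<Omega> F]
      using partial_deriv_bilinear(1)[OF bounded_bilinear_scaleC Cc_infinity_differentiable[OF \<tau>] Cc_infinity_differentiable[OF \<phi>], of x k]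
      by (cases "x \<in> \<Omega>") auto
  qed
  have cA: "continuous_on UNIV (ext_zero \<Omega> ?A)" and cB: "continuous_on UNIV (ext_zero \<Omega> ?B)"
    using Cc_infinity_ext_zero(3)[OF \<Omega>] A B by blast+
  have cF: "continuous_on UNIV (partial_deriv k (ext_zero \<Omega> ?F))"
    unfolding pF by (intro continuous_on_add cA cB)
  have "(\<integral>x. partial_deriv k (ext_zero \<Omega> ?F) x \<partial>lborel) = 0"
    by (rule integral_partial_deriv_eq_0(2)[OF Cc_infinity_ext_zero(1)[OF \<Omega> F] cF E(1)])
      (use E(3) in \<open>auto simp: ext_zero_def\<close>)
  then have "(\<integral>x. ext_zero \<Omega> ?B x + ext_zero \<Omega> ?A x \<partial>lebesgue) = 0"
    unfolding pF[symmetric] using borel_measurable_continuous_onI[OF cF] by (subst integral_completion) auto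
  then have sum: "(\<integral>x. ext_zero \<Omega> ?B x \<partial>lebesgue) + (\<integral>x. ext_zero \<Omega> ?A x \<partial>lebesgue) = 0"
    using Cc_infinity_integrable(1)[OF \<Omega> A] Cc_infinity_integrable(1)[OF \<Omega> B] by simp
  have restr: "(\<integral>x. g x \<partial>lebesgue_on \<Omega>) = (\<integral>x. ext_zero \<Omega> g x \<partial>lebesgue)" for g :: "real^'d \<Rightarrow> 'b"
  proof -
    have "\<Omega> \<in> sets lebesgue" using \<Omega> by (simp add: sets_completionI_sets)
    then have "(\<integral>x. g x \<partial>lebesgue_on \<Omega>) = (\<integral>x. indicator \<Omega> x *\<^sub>R g x \<partial>lebesgue)"
      by (subst integral_restrict_space) auto
    also have "\<dots> = (\<integral>x. ext_zero \<Omega> g x \<partial>lebesgue)"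
      by (rule Bochner_Integration.integral_cong) (auto simp: ext_zero_def indicator_def)
    finally show ?thesis .
  qed
  show ?thesis unfolding restr using sum by (simp add: add_eq_0_iff)
qed

section \<open>Coordinates in \<open>\<ell>\<^sub>2\<close>\<close>

lemma cinner_scaleC_left: "cinner (c *\<^sub>C a) b = c * cinner a b"
  unfolding cinner_def using suminf_mult[OF summable_cinner[of a b], of c] by (simp add: mult.assoc)

lemma cinner_scaleC_right: "cinner a (c *\<^sub>C b) = cnj c * cinner a b"
  unfolding cinner_def using suminf_mult[OF summable_cinner[of a b], of "cnj c"] by (simp add: mult_ac)

lemma cinner_eq_inner: "cinner a b = complex_of_real (a \<bullet> b) + \<i> * complex_of_real (a \<bullet> (\<i> *\<^sub>C b))"
  by (rule complex_eqI) (simp_all add: inner_ell2_def cinner_scaleC_right)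

lemma inner_scaleC_left: "(c *\<^sub>C a) \<bullet> b = a \<bullet> (cnj c *\<^sub>C (b :: ell2))"
  by (simp add: inner_ell2_def cinner_scaleC_left cinner_scaleC_right)

definition unit_vec :: "nat \<Rightarrow> ell2" where
  "unit_vec n = Abs_ell2 (\<lambda>m. if m = n then 1 else 0)"

lemma ell2_nth_unit_vec [simp]: "ell2_nth (unit_vec n) m = (if m = n then 1 else 0)"
proof -
  have "square_summable (\<lambda>m. if m = n then 1 else 0)"
    unfolding square_summable_def by (rule summable_finite[of "{n}"]) auto
  then show ?thesis unfolding unit_vec_def by (subst Abs_ell2_inverse) auto
qed

lemma cinner_unit_vec: "cinner a (unit_vec n) = ell2_nth a n"
  unfolding cinner_def by (subst suminf_finite[of "{n}"]) auto

lemma cinner_unit_vec': "cinner a (c *\<^sub>C unit_vec n) = ell2_nth a n * cnj c"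
  by (simp add: cinner_scaleC_right cinner_unit_vec mult.commute)

lemma inner_unit_vec: "a \<bullet> (c *\<^sub>C unit_vec n) = Re (ell2_nth a n * cnj c)"
  by (simp add: inner_ell2_def cinner_unit_vec')

lemma norm_unit_vec [simp]: "norm (unit_vec n) = 1"
  by (simp add: norm_eq_sqrt_inner inner_ell2_def cinner_unit_vec)

lemma bounded_linear_ell2_nth: "bounded_linear (\<lambda>f. ell2_nth f n)"
  by (rule bounded_linear_intro[of _ 1]) (auto simp: cmod_ell2_nth_le scaleR_conv_of_real)

lemma unit_vec_in [simp]: "n \<in> Y \<Longrightarrow> c *\<^sub>C unit_vec n \<in> ell2_on Y"
  by (simp add: ell2_on_def)

definition restr :: "nat set \<Rightarrow> ell2 \<Rightarrow> ell2" where
  "restr Y f = Abs_ell2 (\<lambda>n. if n \<in> Y then ell2_nth f n else 0)"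

lemma ell2_nth_restr [simp]: "ell2_nth (restr Y f) n = (if n \<in> Y then ell2_nth f n else 0)"
proof -
  have "square_summable (\<lambda>n. if n \<in> Y then ell2_nth f n else 0)"
    unfolding square_summable_def
    by (rule summable_comparison_test[OF _ square_summable_ell2_nth[of f, unfolded square_summable_def]]) auto
  then show ?thesis unfolding restr_def by (subst Abs_ell2_inverse) auto
qed

lemma restr_in [simp]: "restr Y f \<in> ell2_on Y" by (simp add: ell2_on_def)

lemma restr_id: "f \<in> ell2_on Y \<Longrightarrow> restr Y f = f"
  by (rule ell2_eqI) (auto simp: ell2_on_def)

lemma inner_restr: "restr Y f \<bullet> g = f \<bullet> restr Y g"
  unfolding inner_ell2_def cinner_def by (rule arg_cong[of _ _ Re], rule suminf_cong) simp

lemma bounded_linear_restr: "bounded_linear (restr Y)"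
proof (rule bounded_linear_intro[of _ 1])
  fix f
  have "(norm (restr Y f))\<^sup>2 = f \<bullet> restr Y f"
    unfolding power2_norm_eq_inner inner_restr by (simp add: restr_id)
  also have "\<dots> \<le> norm f * norm (restr Y f)" by (rule norm_cauchy_schwarz)
  finally show "norm (restr Y f) \<le> norm f * 1"
    by (cases "norm (restr Y f) = 0") (simp_all add: power2_eq_square mult_le_cancel_right)
qed (auto intro!: ell2_eqI)

text \<open>The matrix unit that puts the \<open>p\<close>-th coordinate in place \<open>m\<close>.  For \<open>m = p\<close> it is the projection onto one
  coordinate.\<close>

definition coord_move :: "nat \<Rightarrow> nat \<Rightarrow> ell2 \<Rightarrow> ell2" where
  "coord_move m p f = ell2_nth f p *\<^sub>C unit_vec m"

lemma ell2_nth_coord_move [simp]: "ell2_nth (coord_move m p f) n = (if n = m then ell2_nth f p else 0)"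
  by (simp add: coord_move_def)

lemma bounded_linear_coord_move: "bounded_linear (coord_move m p)"
  by (rule bounded_linear_intro[of _ 1])
    (auto intro!: ell2_eqI simp: coord_move_def norm_scaleC cmod_ell2_nth_le)

lemma coord_move_scaleC: "coord_move m p (c *\<^sub>C f) = c *\<^sub>C coord_move m p f"
  by (rule ell2_eqI) simp

lemma inner_coord_move: "coord_move m p f \<bullet> g = f \<bullet> coord_move p m g"
  unfolding coord_move_def by (subst inner_commute) (simp add: inner_unit_vec mult.commute)

lemma bounded_linear_scaleC_ell2: "bounded_linear (scaleC c :: ell2 \<Rightarrow> ell2)"
  by (rule bounded_bilinear.bounded_linear_right[OF bounded_bilinear_scaleC])

lemma ell2_nth_sum: "ell2_nth (\<Sum>i\<in>I. f i) n = (\<Sum>i\<in>I. ell2_nth (f i) n)"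
  by (induction I rule: infinite_finite_induct) auto

lemma ell2_partial_sums: "(\<lambda>N. \<Sum>n<N. ell2_nth a n *\<^sub>C unit_vec n) \<longlonglongrightarrow> a"
proof -
  let ?s = "\<lambda>N. \<Sum>n<N. ell2_nth a n *\<^sub>C unit_vec n" and ?f = "\<lambda>n. (cmod (ell2_nth a n))\<^sup>2"
  have sm: "summable ?f" using square_summable_ell2_nth by (simp add: square_summable_def)
  have nth: "ell2_nth (?s N) n = (if n < N then ell2_nth a n else 0)" for N n
    by (simp add: ell2_nth_sum if_distrib cong: if_cong)
  have "(norm (?s N - a))\<^sup>2 = suminf ?f - sum ?f {..<N}" for N
  proof -
    have "(norm (?s N - a))\<^sup>2 = (\<Sum>n. ?f n - (if n \<in> {..<N} then ?f n else 0))"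
      unfolding power2_norm_ell2 by (rule suminf_cong) (simp add: nth)
    also have "\<dots> = suminf ?f - (\<Sum>n. if n \<in> {..<N} then ?f n else 0)"
      by (rule suminf_diff[symmetric]) (auto intro!: sm summable_If_finite_set)
    also have "(\<Sum>n. if n \<in> {..<N} then ?f n else 0) = sum ?f {..<N}"
      by (subst suminf_finite[of "{..<N}"]) auto
    finally show ?thesis .
  qed
  moreover have "(\<lambda>N. suminf ?f - sum ?f {..<N}) \<longlonglongrightarrow> suminf ?f - suminf ?f"
    by (intro tendsto_diff tendsto_const summable_LIMSEQ sm)
  ultimately have "(\<lambda>N. (norm (?s N - a))\<^sup>2) \<longlonglongrightarrow> 0" by simp
  then have "(\<lambda>N. sqrt ((norm (?s N - a))\<^sup>2)) \<longlonglongrightarrow> sqrt 0" by (rule tendsto_real_sqrt)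
  then have "(\<lambda>N. norm (?s N - a)) \<longlonglongrightarrow> 0" by simp
  then show ?thesis by (rule LIM_zero_cancel[OF tendsto_norm_zero_cancel])
qed

text \<open>The function is the pointwise limit of its finite partial sums.\<close>

lemma borel_measurable_ell2_coordinates:
  fixes f :: "'a \<Rightarrow> ell2"
  assumes "\<And>n. (\<lambda>x. ell2_nth (f x) n) \<in> borel_measurable M" shows "f \<in> borel_measurable M"
proof (rule borel_measurable_LIMSEQ_metric)
  show "(\<lambda>x. \<Sum>n<N. ell2_nth (f x) n *\<^sub>C unit_vec n) \<in> borel_measurable M" for N
  proof (intro borel_measurable_sum)
    fix n
    have "(\<lambda>c. c *\<^sub>C unit_vec n) \<in> borel_measurable borel"
      by (intro borel_measurable_continuous_onI linear_continuous_on
          bounded_bilinear.bounded_linear_left[OF bounded_bilinear_scaleC])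
    from measurable_compose[OF assms this] show "(\<lambda>x. ell2_nth (f x) n *\<^sub>C unit_vec n) \<in> borel_measurable M" .
  qed
  fix x
  show "(\<lambda>N. \<Sum>n<N. ell2_nth (f x) n *\<^sub>C unit_vec n) \<longlonglongrightarrow> f x"
    by (rule ell2_partial_sums)
qed

section \<open>Square integrable functions on a domain\<close>

locale l2_domain =
  fixes \<Omega> :: "(real^'d::finite) set" and Y :: "nat set"
  assumes open_domain: "open \<Omega>"
begin

lemma domain_sets [measurable, simp]: "\<Omega> \<in> sets lebesgue"
  using open_domain by (simp add: sets_completionI_sets)

lemma indicator_scaleR_eq_ext_zero:
  fixes f :: "real^'d \<Rightarrow> 'b::real_normed_vector"
  shows "(\<lambda>x. indicator \<Omega> x *\<^sub>R f x) = ext_zero \<Omega> f"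
  by (auto simp: ext_zero_def indicator_def fun_eq_iff)

lemma integrable_domain_iff:
  fixes f :: "real^'d \<Rightarrow> 'b::{banach,second_countable_topology}"
  shows "integrable (lebesgue_on \<Omega>) f \<longleftrightarrow> integrable lebesgue (ext_zero \<Omega> f)"
  by (simp add: integrable_restrict_space indicator_scaleR_eq_ext_zero)

lemma integral_domain_eq:
  fixes f :: "real^'d \<Rightarrow> 'b::{banach,second_countable_topology}"
  shows "(\<integral>x. f x \<partial>lebesgue_on \<Omega>) = (\<integral>x. ext_zero \<Omega> f x \<partial>lebesgue)"
  by (simp add: integral_restrict_space indicator_scaleR_eq_ext_zero)

lemma measurable_domain_iff:
  fixes f :: "real^'d \<Rightarrow> 'b::real_normed_vector"
  shows "f \<in> borel_measurable (lebesgue_on \<Omega>) \<longleftrightarrow> ext_zero \<Omega> f \<in> borel_measurable lebesgue"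
  by (simp add: borel_measurable_restrict_space_iff indicator_scaleR_eq_ext_zero)

lemma AE_domain_iff: "(AE x in lebesgue_on \<Omega>. Q x) \<longleftrightarrow> (AE x in lebesgue. x \<in> \<Omega> \<longrightarrow> Q x)"
  by (simp add: AE_restrict_space_iff)

lemma L2_fun_iff: "u \<in> L2_fun \<Omega> L \<longleftrightarrow> (\<forall>x\<in>\<Omega>. u x \<in> L) \<and> sq_int (ext_zero \<Omega> u)"
proof -
  have "ext_zero \<Omega> (\<lambda>x. (norm (u x))\<^sup>2) = (\<lambda>x. (norm (ext_zero \<Omega> u x))\<^sup>2)"
    by (auto simp: ext_zero_def fun_eq_iff)
  then show ?thesis
    by (auto simp: L2_fun_def sq_int_def measurable_domain_iff integrable_domain_iff)
qed

text \<open>The map \<open>J\<close> sends a function on \<open>\<Omega>\<close> to the class of its extension by zero, \<open>P\<close> is the projection onto the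
  range of \<open>J\<close> on \<open>L\<^sub>2(\<Omega>, L\<^sub>2(Y))\<close>, and \<open>rho\<close> is a section of \<open>J\<close> there.  Restricting the values to \<open>Y\<close> makes \<open>rho U\<close> a
  function with values in \<open>L\<^sub>2(Y)\<close> everywhere on \<open>\<Omega>\<close>, not only a.e.\<close>

definition J :: "(real^'d \<Rightarrow> ell2) \<Rightarrow> (real^'d) l2v" where "J u = l2_abs (ext_zero \<Omega> u)"

definition P :: "(real^'d) l2v \<Rightarrow> (real^'d) l2v" where
  "P = fibre_op (\<lambda>x f. if x \<in> \<Omega> then restr Y f else 0)"

definition rho :: "(real^'d) l2v \<Rightarrow> real^'d \<Rightarrow> ell2" where "rho U = (\<lambda>x. restr Y (l2_rep U x))"

definition I :: "(real^'d) l2v \<Rightarrow> (real^'d) l2v" where "I = fibre_op (\<lambda>x. scaleC \<i>)"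

definition move :: "nat \<Rightarrow> nat \<Rightarrow> (real^'d) l2v \<Rightarrow> (real^'d) l2v" where
  "move m p = fibre_op (\<lambda>x. coord_move m p)"

abbreviation L2Y where "L2Y \<equiv> L2_fun \<Omega> (ell2_on Y)"

lemma fibre_field_domain: "fibre_field (\<lambda>x f. if x \<in> \<Omega> then restr Y f else 0)"
  unfolding fibre_field_def
proof (intro conjI allI ballI)
  interpret bounded_linear "restr Y" by (rule bounded_linear_restr)
  show "linear (\<lambda>f. if x \<in> \<Omega> then restr Y f else 0)" for x
    by (cases "x \<in> \<Omega>") (auto simp: linear_axioms linear_zero)
  obtain M where "\<And>f. norm (restr Y f) \<le> norm f * M" using bounded by blast
  then have "norm (if x \<in> \<Omega> then restr Y f else 0) \<le> max M 0 * norm f" for x :: "real^'d" and f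
    by (auto simp: mult.commute[of "max M 0"] intro: order_trans[OF _ mult_left_mono[OF max.cobounded1]])
  then show "\<exists>M. \<forall>x f. norm (if x \<in> \<Omega> then restr Y f else 0) \<le> M * norm f" by blast
  fix u :: "real^'d \<Rightarrow> ell2" assume "u \<in> borel_measurable lebesgue"
  then have "(\<lambda>x. restr Y (u x)) \<in> borel_measurable lebesgue"
    using fibre_field_const[OF bounded_linear_restr, where 'a = "real^'d"] by (simp add: fibre_field_def)
  then show "(\<lambda>x. if x \<in> \<Omega> then restr Y (u x) else 0) \<in> borel_measurable lebesgue" by measurable
qed

lemma sq_int_L2Y: "u \<in> L2Y \<Longrightarrow> sq_int (ext_zero \<Omega> u)" by (simp add: L2_fun_iff)

lemma J_rep: "u \<in> L2Y \<Longrightarrow> AE x in lebesgue. l2_rep (J u) x = ext_zero \<Omega> u x"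
  unfolding J_def by (intro l2_rep_abs sq_int_L2Y)

lemma J_eq_iff: "u \<in> L2Y \<Longrightarrow> v \<in> L2Y \<Longrightarrow> J u = J v \<longleftrightarrow> (AE x in lebesgue_on \<Omega>. u x = v x)"
  unfolding J_def AE_domain_iff l2_abs_eq_iff[OF sq_int_L2Y sq_int_L2Y]
  by (rule arg_cong[where f = "almost_everywhere lebesgue"]) (auto simp: ext_zero_def)

lemma P_lin: "bounded_linear P"
  unfolding P_def by (rule bounded_linear_fibre_op[OF fibre_field_domain])

lemma P_rep: "AE x in lebesgue. l2_rep (P U) x = (if x \<in> \<Omega> then restr Y (l2_rep U x) else 0)"
  unfolding P_def by (rule fibre_op_rep[OF fibre_field_domain])

lemma P_idem: "P (P U) = P U"
  unfolding P_def by (rule fibre_op_compose[OF fibre_field_domain fibre_field_domain]) (simp add: restr_id)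

lemma P_J: assumes "u \<in> L2Y" shows "P (J u) = J u"
  unfolding P_def J_def fibre_op_abs[OF fibre_field_domain sq_int_L2Y[OF assms]]
  using assms by (intro arg_cong[of _ _ l2_abs]) (auto simp: L2_fun_iff ext_zero_def restr_id fun_eq_iff)

lemma ext_zero_rho: "ext_zero \<Omega> (rho U) = (\<lambda>x. if x \<in> \<Omega> then restr Y (l2_rep U x) else 0)"
  by (auto simp: ext_zero_def rho_def)

lemma rho_in: "rho U \<in> L2Y"
  unfolding L2_fun_iff ext_zero_rho
  using sq_int_fibre[OF fibre_field_domain sq_int_l2_rep] by (simp add: rho_def)

lemma J_rho: "J (rho U) = P U"
  unfolding J_def ext_zero_rho P_def fibre_op_def ..

lemma J_rho_id: "P U = U \<Longrightarrow> J (rho U) = U" by (simp add: J_rho)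

lemma ext_zero_add: "ext_zero \<Omega> (\<lambda>x. u x + v x) = (\<lambda>x. ext_zero \<Omega> u x + ext_zero \<Omega> (v :: _ \<Rightarrow> ell2) x)"
  by (auto simp: ext_zero_def)

lemma ext_zero_diff: "ext_zero \<Omega> (\<lambda>x. u x - v x) = (\<lambda>x. ext_zero \<Omega> u x - ext_zero \<Omega> (v :: _ \<Rightarrow> ell2) x)"
  by (auto simp: ext_zero_def)

lemma ext_zero_scaleR: "ext_zero \<Omega> (\<lambda>x. r *\<^sub>R u x) = (\<lambda>x. r *\<^sub>R ext_zero \<Omega> (u :: _ \<Rightarrow> ell2) x)"
  by (auto simp: ext_zero_def)

lemma ell2_on_add: "f \<in> ell2_on Z \<Longrightarrow> g \<in> ell2_on Z \<Longrightarrow> f + g \<in> ell2_on Z"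
  and ell2_on_diff: "f \<in> ell2_on Z \<Longrightarrow> g \<in> ell2_on Z \<Longrightarrow> f - g \<in> ell2_on Z"
  and ell2_on_scaleR: "f \<in> ell2_on Z \<Longrightarrow> r *\<^sub>R f \<in> ell2_on Z"
  and ell2_on_scaleC: "f \<in> ell2_on Z \<Longrightarrow> c *\<^sub>C f \<in> ell2_on Z"
  by (auto simp: ell2_on_def)

lemma L2Y_add: "u \<in> L2Y \<Longrightarrow> v \<in> L2Y \<Longrightarrow> (\<lambda>x. u x + v x) \<in> L2Y"
  and L2Y_diff: "u \<in> L2Y \<Longrightarrow> v \<in> L2Y \<Longrightarrow> (\<lambda>x. u x - v x) \<in> L2Y"
  and L2Y_scaleR: "u \<in> L2Y \<Longrightarrow> (\<lambda>x. r *\<^sub>R u x) \<in> L2Y"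
  by (auto simp: L2_fun_iff ext_zero_add ext_zero_diff ext_zero_scaleR ell2_on_add ell2_on_diff ell2_on_scaleR
      intro: sq_int_add sq_int_diff sq_int_scaleR)

lemma J_add: "u \<in> L2Y \<Longrightarrow> v \<in> L2Y \<Longrightarrow> J (\<lambda>x. u x + v x) = J u + J v"
  and J_diff: "u \<in> L2Y \<Longrightarrow> v \<in> L2Y \<Longrightarrow> J (\<lambda>x. u x - v x) = J u - J v"
  and J_scaleR: "u \<in> L2Y \<Longrightarrow> J (\<lambda>x. r *\<^sub>R u x) = r *\<^sub>R J u"
  unfolding J_def ext_zero_add ext_zero_diff ext_zero_scaleR
  by (simp_all add: l2_abs_add l2_abs_diff l2_abs_scaleR sq_int_L2Y)

text \<open>Since \<open>T 0 = 0\<close>, applying \<open>T\<close> in the fibres commutes with the extension by zero.\<close>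

lemma fibre_L2Y:
  assumes T: "bounded_linear T" and u: "u \<in> L2Y" and TK: "\<And>f. f \<in> ell2_on Y \<Longrightarrow> T f \<in> ell2_on Y"
  shows "(\<lambda>x. T (u x)) \<in> L2Y" "J (\<lambda>x. T (u x)) = fibre_op (\<lambda>x. T) (J u)"
proof -
  have eq: "ext_zero \<Omega> (\<lambda>x. T (u x)) = (\<lambda>x. T (ext_zero \<Omega> u x))"
    using linear_0[OF bounded_linear.linear[OF T]] by (auto simp: ext_zero_def)
  show "(\<lambda>x. T (u x)) \<in> L2Y"
    using u sq_int_fibre[OF fibre_field_const[OF T] sq_int_L2Y[OF u]] TK by (simp add: L2_fun_iff eq)
  show "J (\<lambda>x. T (u x)) = fibre_op (\<lambda>x. T) (J u)"
    unfolding J_def eq fibre_op_abs[OF fibre_field_const[OF T] sq_int_L2Y[OF u]] ..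
qed

lemmas I_field = fibre_field_const[OF bounded_linear_scaleC_ell2[of \<i>]]
lemmas move_field = fibre_field_const[OF bounded_linear_coord_move]

lemma J_move:
  assumes "u \<in> L2Y" "m \<in> Y"
  shows "(\<lambda>x. coord_move m p (u x)) \<in> L2Y" "J (\<lambda>x. coord_move m p (u x)) = move m p (J u)"
  unfolding move_def using fibre_L2Y[OF bounded_linear_coord_move assms(1)] assms(2)
  by (auto simp: ell2_on_def)

lemma I_lin: "bounded_linear I" and move_lin: "bounded_linear (move m p)"
  unfolding I_def move_def by (intro bounded_linear_fibre_op I_field move_field)+

lemma I_I: "I (I U) = - U"
proof -
  have "I (I U) = fibre_op (\<lambda>x f. - f) U"
    unfolding I_def by (rule fibre_op_compose[OF I_field I_field]) (auto intro!: ell2_eqI)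
  also have "\<dots> = - U" by (simp add: fibre_op_def uminus_l2v_def)
  finally show ?thesis .
qed

lemma inner_I: "I U \<bullet> V = - (U \<bullet> I V)"
proof -
  have f: "fibre_field (\<lambda>x::real^'d. scaleC (cnj \<i>) :: ell2 \<Rightarrow> ell2)" by (rule fibre_field_const[OF bounded_linear_scaleC_ell2])
  have "I U \<bullet> V = U \<bullet> fibre_op (\<lambda>x. scaleC (cnj \<i>)) V"
    unfolding I_def by (rule inner_fibre_op_adjoint[OF I_field f inner_scaleC_left])
  also have "fibre_op (\<lambda>x. scaleC (cnj \<i>)) V = - I V"
  proof (rule l2_eqI)
    show "AE x in lebesgue. l2_rep (fibre_op (\<lambda>x. scaleC (cnj \<i>)) V) x = l2_rep (- I V) x"
      using fibre_op_rep[OF f, of V] l2_rep_minus[of "I V"] fibre_op_rep[OF I_field, of V]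
      by eventually_elim (auto simp: I_def intro!: ell2_eqI)
  qed
  finally show ?thesis by simp
qed

lemma inner_move: "move m p U \<bullet> V = U \<bullet> move p m V"
  unfolding move_def by (rule inner_fibre_op_adjoint[OF move_field move_field inner_coord_move])

lemma P_fibre_commute:
  assumes T: "bounded_linear T" and TK: "\<And>f. f \<in> ell2_on Y \<Longrightarrow> T f \<in> ell2_on Y" and U: "P U = U"
  shows "P (fibre_op (\<lambda>x. T) U) = fibre_op (\<lambda>x. T) U"
proof -
  have "fibre_op (\<lambda>x. T) U = J (\<lambda>x. T (rho U x))"
    using fibre_L2Y(2)[OF T rho_in TK, of U] J_rho_id[OF U] by simp
  then show ?thesis using P_J[OF fibre_L2Y(1)[OF T rho_in TK]] by simp
qed

lemma P_I: "P U = U \<Longrightarrow> P (I U) = I U"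
  unfolding I_def by (rule P_fibre_commute[OF bounded_linear_scaleC_ell2 ell2_on_scaleC])

lemma P_move: "P U = U \<Longrightarrow> m \<in> Y \<Longrightarrow> P (move m p U) = move m p U"
  unfolding move_def by (rule P_fibre_commute[OF bounded_linear_coord_move]) (auto simp: ell2_on_def)

lemma L2_norm_eq: assumes "u \<in> L2Y" shows "L2_norm \<Omega> u = norm (J u)"
proof -
  have "(\<integral>x. (norm (u x))\<^sup>2 \<partial>lebesgue_on \<Omega>) = (\<integral>x. (norm (ext_zero \<Omega> u x))\<^sup>2 \<partial>lebesgue)"
    unfolding integral_domain_eq by (rule Bochner_Integration.integral_cong) (auto simp: ext_zero_def)
  then show ?thesis
    unfolding L2_norm_def using norm_l2_abs[OF sq_int_L2Y[OF assms]] by (simp add: J_def real_sqrt_unique)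
qed

text \<open>The real inner product and \<open>I\<close> together determine the complex inner product:
  \<open>Im (u, v) = Re (u, \<i> v)\<close>.\<close>

lemma integral_cinner_eq:
  assumes u: "sq_int u" and v: "sq_int v"
  shows "(\<integral>x. cinner (u x) (v x) \<partial>lebesgue) = Complex (l2_abs u \<bullet> l2_abs v) (l2_abs u \<bullet> I (l2_abs v))"
proof -
  have iv: "sq_int (\<lambda>x. \<i> *\<^sub>C v x)" by (rule sq_int_fibre[OF I_field v])
  have "(\<integral>x. cinner (u x) (v x) \<partial>lebesgue)
      = complex_of_real (\<integral>x. u x \<bullet> v x \<partial>lebesgue) + \<i> * complex_of_real (\<integral>x. u x \<bullet> (\<i> *\<^sub>C v x) \<partial>lebesgue)"
    unfolding cinner_eq_inner using integrable_inner_sq_int[OF u v] integrable_inner_sq_int[OF u iv]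
    by (subst Bochner_Integration.integral_add) auto
  then show ?thesis
    by (simp add: inner_l2_abs[OF u v] inner_l2_abs[OF u iv] I_def fibre_op_abs[OF I_field v] Complex_eq)
qed

lemma L2_inner_eq: assumes "u \<in> L2Y" "v \<in> L2Y"
  shows "L2_inner \<Omega> u v = Complex (J u \<bullet> J v) (J u \<bullet> I (J v))"
proof -
  have "L2_inner \<Omega> u v = (\<integral>x. cinner (ext_zero \<Omega> u x) (ext_zero \<Omega> v x) \<partial>lebesgue)"
    unfolding L2_inner_def integral_domain_eq
    by (rule Bochner_Integration.integral_cong) (auto simp: ext_zero_def cinner_def)
  then show ?thesis unfolding J_def using integral_cinner_eq[OF sq_int_L2Y sq_int_L2Y] assms by simp
qed

end

section \<open>The graph of the weak gradient\<close>

context l2_domain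
begin

text \<open>Pairing with \<open>tvec n g\<close> extracts the real part of the integral of \<open>cnj g\<close> against the \<open>n\<close>-th coordinate.
  The imaginary part is the pairing with another vector of this form, obtained from \<open>\<i>\<close> times \<open>g\<close>.\<close>

definition tvec :: "nat \<Rightarrow> (real^'d \<Rightarrow> complex) \<Rightarrow> (real^'d) l2v" where
  "tvec n g = J (\<lambda>x. g x *\<^sub>C unit_vec n)"

abbreviation test :: "(real^'d \<Rightarrow> complex) set" where "test \<equiv> Cc_infinity \<Omega> UNIV"

lemma tvec_cong: "(\<And>x. x \<in> \<Omega> \<Longrightarrow> g x = h x) \<Longrightarrow> tvec n g = tvec n h"
  unfolding tvec_def J_def by (intro arg_cong[of _ _ l2_abs]) (auto simp: ext_zero_def)

lemma bounded_linear_scaleC_unit: "bounded_linear (\<lambda>c. c *\<^sub>C unit_vec n)"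
  by (rule bounded_bilinear.bounded_linear_left[OF bounded_bilinear_scaleC])

lemma ext_zero_scaleC_unit:
  "ext_zero \<Omega> (\<lambda>x. g x *\<^sub>C unit_vec n) = (\<lambda>x. ext_zero \<Omega> g x *\<^sub>C unit_vec n)"
  using linear_0[OF bounded_linear.linear[OF bounded_linear_scaleC_unit]] by (auto simp: ext_zero_def)

lemma sq_int_scaleC_unit:
  assumes "g \<in> borel_measurable lebesgue" "integrable lebesgue (\<lambda>x. (cmod (g x))\<^sup>2)"
  shows "sq_int (\<lambda>x. g x *\<^sub>C unit_vec n)"
  unfolding sq_int_def
proof
  have "(\<lambda>c. c *\<^sub>C unit_vec n) \<in> borel_measurable borel"
    by (intro borel_measurable_continuous_onI linear_continuous_on bounded_linear_scaleC_unit)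
  from measurable_compose[OF assms(1) this] show "(\<lambda>x. g x *\<^sub>C unit_vec n) \<in> borel_measurable lebesgue" .
qed (use assms in \<open>simp add: norm_scaleC\<close>)

lemma test_sq_int: "g \<in> test \<Longrightarrow> sq_int (ext_zero \<Omega> (\<lambda>x. g x *\<^sub>C unit_vec n))"
  unfolding ext_zero_scaleC_unit
  by (intro sq_int_scaleC_unit Cc_infinity_integrable[OF open_domain])

lemma test_mult: "g \<in> test \<Longrightarrow> (\<lambda>x. c * g x) \<in> test"
  by (rule Cc_infinity_linear[OF open_domain bounded_linear_mult_right]) auto

lemma test_cnj: "g \<in> test \<Longrightarrow> (\<lambda>x. cnj (g x)) \<in> test"
  by (rule Cc_infinity_linear[OF open_domain bounded_linear_cnj]) auto

lemma test_partial: "g \<in> test \<Longrightarrow> partial_deriv k g \<in> test"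
  by (rule Cc_infinity_partial[OF open_domain])

lemma partial_mult: "g \<in> test \<Longrightarrow> x \<in> \<Omega> \<Longrightarrow> partial_deriv k (\<lambda>x. c * g x) x = c * partial_deriv k g x"
  by (rule partial_deriv_linear[OF bounded_linear_mult_right Cc_infinity_differentiable])

lemma test_integral:
  assumes g: "g \<in> test" and u: "u \<in> L2Y"
  shows "integrable (lebesgue_on \<Omega>) (\<lambda>x. g x *\<^sub>C u x)"
    and "Re (ell2_nth (\<integral>x. g x *\<^sub>C u x \<partial>lebesgue_on \<Omega>) n) = J u \<bullet> tvec n (\<lambda>x. cnj (g x))"
    and "Im (ell2_nth (\<integral>x. g x *\<^sub>C u x \<partial>lebesgue_on \<Omega>) n) = J u \<bullet> tvec n (\<lambda>x. cnj (- \<i> * g x))"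
proof -
  have su: "sq_int (ext_zero \<Omega> u)" by (rule sq_int_L2Y[OF u])
  have int: "integrable (lebesgue_on \<Omega>) (\<lambda>x. g x *\<^sub>C u x)" if g: "g \<in> test" for g
  proof -
    have "integrable lebesgue (\<lambda>x. ext_zero \<Omega> g x *\<^sub>C ext_zero \<Omega> u x)"
    proof (rule Bochner_Integration.integrable_bound)
      show "integrable lebesgue (\<lambda>x. (cmod (ext_zero \<Omega> g x))\<^sup>2 + (norm (ext_zero \<Omega> u x))\<^sup>2)"
        using su Cc_infinity_integrable[OF open_domain g] by (simp add: sq_int_def)
      have "(\<lambda>x. (ext_zero \<Omega> g x, ext_zero \<Omega> u x)) \<in> borel_measurable lebesgue"
        using su Cc_infinity_integrable[OF open_domain g] by (intro borel_measurable_Pair) (auto simp: sq_int_def)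
      moreover have "(\<lambda>p::complex \<times> ell2. fst p *\<^sub>C snd p) \<in> borel_measurable borel"
        by (rule borel_measurable_continuous_onI[OF bounded_bilinear.continuous_on[OF bounded_bilinear_scaleC
              continuous_on_fst[OF continuous_on_id] continuous_on_snd[OF continuous_on_id]]])
      ultimately have "(\<lambda>x. fst (ext_zero \<Omega> g x, ext_zero \<Omega> u x) *\<^sub>C snd (ext_zero \<Omega> g x, ext_zero \<Omega> u x))
          \<in> borel_measurable lebesgue"
        by (rule measurable_compose)
      then show "(\<lambda>x. ext_zero \<Omega> g x *\<^sub>C ext_zero \<Omega> u x) \<in> borel_measurable lebesgue" by simp
      have "norm (ext_zero \<Omega> g x *\<^sub>C ext_zero \<Omega> u x) \<le> norm ((cmod (ext_zero \<Omega> g x))\<^sup>2 + (norm (ext_zero \<Omega> u x))\<^sup>2)" for x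
      proof -
        have "norm (ext_zero \<Omega> g x *\<^sub>C ext_zero \<Omega> u x) \<le> 2 * cmod (ext_zero \<Omega> g x) * norm (ext_zero \<Omega> u x)"
          by (simp add: norm_scaleC)
        also have "\<dots> \<le> (cmod (ext_zero \<Omega> g x))\<^sup>2 + (norm (ext_zero \<Omega> u x))\<^sup>2" by (rule sum_squares_bound)
        finally show ?thesis by simp
      qed
      then show "AE x in lebesgue. norm (ext_zero \<Omega> g x *\<^sub>C ext_zero \<Omega> u x) \<le> norm ((cmod (ext_zero \<Omega> g x))\<^sup>2 + (norm (ext_zero \<Omega> u x))\<^sup>2)"
        by simp
    qed
    moreover have "(\<lambda>x. ext_zero \<Omega> g x *\<^sub>C ext_zero \<Omega> u x) = ext_zero \<Omega> (\<lambda>x. g x *\<^sub>C u x)"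
      using bounded_bilinear.zero_left[OF bounded_bilinear_scaleC, of "0::ell2"] by (auto simp: ext_zero_def)
    ultimately show ?thesis by (simp add: integrable_domain_iff)
  qed
  show "integrable (lebesgue_on \<Omega>) (\<lambda>x. g x *\<^sub>C u x)" by (rule int[OF g])
  have coord: "ell2_nth (\<integral>x. g x *\<^sub>C u x \<partial>lebesgue_on \<Omega>) n = (\<integral>x. g x * ell2_nth (u x) n \<partial>lebesgue_on \<Omega>)"
    "integrable (lebesgue_on \<Omega>) (\<lambda>x. g x * ell2_nth (u x) n)" if g: "g \<in> test" for g
    using integral_bounded_linear[OF bounded_linear_ell2_nth[of n] int[OF g]]
      integrable_bounded_linear[OF bounded_linear_ell2_nth[of n] int[OF g]] by simp_all
  have re: "Re (ell2_nth (\<integral>x. g x *\<^sub>C u x \<partial>lebesgue_on \<Omega>) n) = J u \<bullet> tvec n (\<lambda>x. cnj (g x))" if g: "g \<in> test" for g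
  proof -
    have "Re (\<integral>x. g x * ell2_nth (u x) n \<partial>lebesgue_on \<Omega>) = (\<integral>x. Re (g x * ell2_nth (u x) n) \<partial>lebesgue_on \<Omega>)"
      by (rule integral_Re[symmetric, OF coord(2)[OF g]])
    also have "\<dots> = (\<integral>x. ext_zero \<Omega> u x \<bullet> ext_zero \<Omega> (\<lambda>x. cnj (g x) *\<^sub>C unit_vec n) x \<partial>lebesgue)"
      unfolding integral_domain_eq
      by (rule Bochner_Integration.integral_cong) (auto simp: ext_zero_def inner_unit_vec mult.commute)
    also have "\<dots> = J u \<bullet> tvec n (\<lambda>x. cnj (g x))"
      unfolding J_def tvec_def by (rule inner_l2_abs[symmetric, OF su test_sq_int[OF test_cnj[OF g]]])
    finally show ?thesis by (simp add: coord[OF g])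
  qed
  show "Re (ell2_nth (\<integral>x. g x *\<^sub>C u x \<partial>lebesgue_on \<Omega>) n) = J u \<bullet> tvec n (\<lambda>x. cnj (g x))" by (rule re[OF g])
  have "Im (ell2_nth (\<integral>x. g x *\<^sub>C u x \<partial>lebesgue_on \<Omega>) n) = Re (- \<i> * ell2_nth (\<integral>x. g x *\<^sub>C u x \<partial>lebesgue_on \<Omega>) n)" by simp
  also have "\<dots> = Re (ell2_nth (\<integral>x. (- \<i> * g x) *\<^sub>C u x \<partial>lebesgue_on \<Omega>) n)"
    unfolding coord[OF g] coord[OF test_mult[OF g]] mult.assoc by simp
  also have "\<dots> = J u \<bullet> tvec n (\<lambda>x. cnj (- \<i> * g x))" by (rule re[OF test_mult[OF g]])
  finally show "Im (ell2_nth (\<integral>x. g x *\<^sub>C u x \<partial>lebesgue_on \<Omega>) n) = J u \<bullet> tvec n (\<lambda>x. cnj (- \<i> * g x))" .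
qed

text \<open>The weak derivative as a family of scalar equations between continuous linear functionals of \<open>U\<close> and \<open>G\<close>, from
  which closedness of the graph is evident.\<close>

definition weak_grad :: "'d \<Rightarrow> (real^'d) l2v \<Rightarrow> (real^'d) l2v \<Rightarrow> bool" where
  "weak_grad k U G \<longleftrightarrow> (\<forall>\<tau>\<in>test. \<forall>n.
     U \<bullet> tvec n (\<lambda>x. cnj (partial_deriv k \<tau> x)) = - (G \<bullet> tvec n (\<lambda>x. cnj (\<tau> x))))"

lemma has_weak_partial_iff:
  "has_weak_partial \<Omega> (ell2_on Y) k u w \<longleftrightarrow> u \<in> L2Y \<and> w \<in> L2Y \<and> weak_grad k (J u) (J w)"
proof (cases "u \<in> L2Y \<and> w \<in> L2Y")
  case True
  let ?A = "\<lambda>\<tau>. \<integral>x. partial_deriv k \<tau> x *\<^sub>C u x \<partial>lebesgue_on \<Omega>"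
  let ?B = "\<lambda>\<tau>. \<integral>x. \<tau> x *\<^sub>C w x \<partial>lebesgue_on \<Omega>"
  have uw: "u \<in> L2Y" "w \<in> L2Y" using True by auto
  have "(\<forall>\<tau>\<in>test. ?A \<tau> = - ?B \<tau>) \<longleftrightarrow> weak_grad k (J u) (J w)"
  proof
    assume L: "\<forall>\<tau>\<in>test. ?A \<tau> = - ?B \<tau>"
    show "weak_grad k (J u) (J w)"
      unfolding weak_grad_def
    proof (intro ballI allI)
      fix \<tau> n assume t: "\<tau> \<in> test"
      have "Re (ell2_nth (?A \<tau>) n) = - Re (ell2_nth (?B \<tau>) n)" using L t by simp
      then show "J u \<bullet> tvec n (\<lambda>x. cnj (partial_deriv k \<tau> x)) = - (J w \<bullet> tvec n (\<lambda>x. cnj (\<tau> x)))"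
        unfolding test_integral(2)[OF test_partial[OF t] uw(1)] test_integral(2)[OF t uw(2)] .
    qed
  next
    assume R: "weak_grad k (J u) (J w)"
    show "\<forall>\<tau>\<in>test. ?A \<tau> = - ?B \<tau>"
    proof (intro ballI ell2_eqI complex_eqI)
      fix \<tau> n assume t: "\<tau> \<in> test"
      show "Re (ell2_nth (?A \<tau>) n) = Re (ell2_nth (- ?B \<tau>) n)"
        using R t by (simp add: weak_grad_def test_integral(2)[OF test_partial[OF t] uw(1)] test_integral(2)[OF t uw(2)])
      have "Im (ell2_nth (?A \<tau>) n) = J u \<bullet> tvec n (\<lambda>x. cnj (partial_deriv k (\<lambda>x. - \<i> * \<tau> x) x))"
        unfolding test_integral(3)[OF test_partial[OF t] uw(1)]
        by (intro arg_cong[of _ _ "inner (J u)"] tvec_cong) (simp only: partial_mult[OF t])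
      also have "\<dots> = - (J w \<bullet> tvec n (\<lambda>x. cnj (- \<i> * \<tau> x)))"
        using R test_mult[OF t] unfolding weak_grad_def by blast
      also have "\<dots> = Im (ell2_nth (- ?B \<tau>) n)"
        using test_integral(3)[OF t uw(2), of n] by simp
      finally show "Im (ell2_nth (?A \<tau>) n) = Im (ell2_nth (- ?B \<tau>) n)" .
    qed
  qed
  then show ?thesis using True by (simp add: has_weak_partial_def)
qed (auto simp: has_weak_partial_def)

lemma l2_rep_coord_integrable_box:
  fixes r :: "complex \<Rightarrow> real" and a b :: "real^'d"
  assumes "bounded_linear r"
  shows "integrable lebesgue (\<lambda>x. indicator (cbox a b) x * r (ell2_nth (l2_rep G x) n))"
proof (rule Bochner_Integration.integrable_bound)
  define M where "M = onorm r + 1"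
  have M: "M > 0" "norm (r z) \<le> norm z * M" for z
    using onorm[OF assms, of z] onorm_pos_le[OF assms] by (auto simp: M_def algebra_simps intro: order_trans)
  show "integrable lebesgue (\<lambda>x. M * (indicator (cbox a b) x + (norm (l2_rep G x))\<^sup>2))"
  proof (intro integrable_mult_right Bochner_Integration.integrable_add)
    show "integrable lebesgue (indicator (cbox a b) :: real^'d \<Rightarrow> real)"
      using lmeasurable_cbox by (intro integrable_real_indicator) (auto simp: fmeasurable_def)
    show "integrable lebesgue (\<lambda>x. (norm (l2_rep G x))\<^sup>2)" using sq_int_l2_rep by (simp add: sq_int_def)
  qed
  have "(\<lambda>f. r (ell2_nth f n)) \<in> borel_measurable borel"
    by (intro borel_measurable_continuous_onI linear_continuous_on bounded_linear_compose[OF assms bounded_linear_ell2_nth])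
  from measurable_compose[OF measurable_l2_rep this]
  have "(\<lambda>x. r (ell2_nth (l2_rep G x) n)) \<in> borel_measurable lebesgue" .
  then show "(\<lambda>x. indicator (cbox a b) x * r (ell2_nth (l2_rep G x) n)) \<in> borel_measurable lebesgue"
    by (intro borel_measurable_times borel_measurable_indicator) auto
  have "norm (indicator (cbox a b) x * r (ell2_nth (l2_rep G x) n)) \<le> norm (M * (indicator (cbox a b) x + (norm (l2_rep G x))\<^sup>2))" for x
  proof (cases "x \<in> cbox a b")
    case True
    have *: "norm (r (ell2_nth (l2_rep G x) n)) \<le> norm (l2_rep G x) * M"
      using M(2)[of "ell2_nth (l2_rep G x) n"] cmod_ell2_nth_le[of "l2_rep G x" n] M(1)
      by (meson less_imp_le mult_right_mono order_trans)
    have "norm (l2_rep G x) \<le> 1 + (norm (l2_rep G x))\<^sup>2"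
      using sum_squares_bound[of 1 "norm (l2_rep G x)"] norm_ge_zero[of "l2_rep G x"]
      unfolding mult_1_right power_one by linarith
    from mult_right_mono[OF this, of M] have "norm (l2_rep G x) * M \<le> (1 + (norm (l2_rep G x))\<^sup>2) * M"
      using M(1) by simp
    with * have "norm (r (ell2_nth (l2_rep G x) n)) \<le> (1 + (norm (l2_rep G x))\<^sup>2) * M" by linarith
    then show ?thesis using True M(1) by (simp add: mult.commute abs_mult)
  qed simp
  then show "AE x in lebesgue. norm (indicator (cbox a b) x * r (ell2_nth (l2_rep G x) n)) \<le> norm (M * (indicator (cbox a b) x + (norm (l2_rep G x))\<^sup>2))"
    by simp
qed

lemma bump_test: "cbox a b \<subseteq> \<Omega> \<Longrightarrow> (\<lambda>x. complex_of_real (bump j a b x)) \<in> test"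
  using bump_Cc_infinity[OF open_domain _ C_on_const, of a b j 1] by simp

lemma inner_tvec_bump:
  assumes "cbox a b \<subseteq> \<Omega>"
  shows "G \<bullet> tvec n (\<lambda>x. c * complex_of_real (bump j a b x)) = (\<integral>x. bump j a b x * Re (ell2_nth (l2_rep G x) n * cnj c) \<partial>lebesgue)"
proof -
  have t: "(\<lambda>x. c * complex_of_real (bump j a b x)) \<in> test" by (rule test_mult[OF bump_test[OF assms]])
  have "G \<bullet> tvec n (\<lambda>x. c * complex_of_real (bump j a b x)) =
     (\<integral>x. l2_rep G x \<bullet> ext_zero \<Omega> (\<lambda>x. (c * complex_of_real (bump j a b x)) *\<^sub>C unit_vec n) x \<partial>lebesgue)"
    using inner_l2_abs[OF sq_int_l2_rep test_sq_int[OF t], of G n] by (simp add: tvec_def J_def)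
  also have "\<dots> = (\<integral>x. bump j a b x * Re (ell2_nth (l2_rep G x) n * cnj c) \<partial>lebesgue)"
  proof (rule Bochner_Integration.integral_cong)
    fix x
    show "l2_rep G x \<bullet> ext_zero \<Omega> (\<lambda>x. (c * complex_of_real (bump j a b x)) *\<^sub>C unit_vec n) x
        = bump j a b x * Re (ell2_nth (l2_rep G x) n * cnj c)"
    proof (cases "x \<in> \<Omega>")
      case True
      have "Re (z * cnj (c * complex_of_real t)) = t * Re (z * cnj c)" for z t by (simp add: algebra_simps)
      then show ?thesis using True by (simp only: ext_zero_simps inner_unit_vec)
    next
      case False
      then have "x \<notin> box a b" using assms box_subset_cbox[of a b] by blast
      then show ?thesis using False by (simp add: bump_outside)
    qed
  qed simp
  finally show ?thesis .
qed

lemma ae_coord_zero_if_orthogonal: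
  assumes "\<And>a b j. cbox a b \<subseteq> \<Omega> \<Longrightarrow> G \<bullet> tvec n (\<lambda>x. c * complex_of_real (bump j a b x)) = 0"
  shows "AE x in lebesgue. x \<in> \<Omega> \<longrightarrow> Re (ell2_nth (l2_rep G x) n * cnj c) = 0"
proof (rule ae_zero_if_bump_integrals_zero[OF open_domain, of 1])
  have "bounded_linear (\<lambda>z. Re (z * cnj c))"
    by (intro bounded_linear_compose[OF bounded_linear_Re] bounded_linear_mult_left)
  then show "integrable lebesgue (\<lambda>x. indicator (cbox a b) x * Re (ell2_nth (l2_rep G x) n * cnj c))" for a b
    using l2_rep_coord_integrable_box[of "\<lambda>z. Re (z * cnj c)"] by blast
qed (use assms inner_tvec_bump in auto)

text \<open>The real and imaginary parts of all coordinates integrate to zero against all bump functions.\<close>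

lemma zero_if_orthogonal_to_tests:
  assumes PG: "P G = G" and orth: "\<And>\<tau> n. \<tau> \<in> test \<Longrightarrow> G \<bullet> tvec n \<tau> = 0" shows "G = 0"
proof (rule l2_eqI)
  have "AE x in lebesgue. x \<in> \<Omega> \<longrightarrow> Re (ell2_nth (l2_rep G x) n * cnj c) = 0" for n c
    by (rule ae_coord_zero_if_orthogonal, rule orth, rule test_mult, rule bump_test)
  then have *: "AE x in lebesgue. x \<in> \<Omega> \<longrightarrow> Re (ell2_nth (l2_rep G x) n * cnj 1) = 0"
    "AE x in lebesgue. x \<in> \<Omega> \<longrightarrow> Re (ell2_nth (l2_rep G x) n * cnj \<i>) = 0" for n by blast+
  have "AE x in lebesgue. x \<in> \<Omega> \<longrightarrow> ell2_nth (l2_rep G x) n = 0" for n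
    using *[of n] by eventually_elim (simp add: complex_eq_iff)
  then have "AE x in lebesgue. \<forall>n. x \<in> \<Omega> \<longrightarrow> ell2_nth (l2_rep G x) n = 0" unfolding AE_all_countable by blast
  then show "AE x in lebesgue. l2_rep G x = l2_rep 0 x"
    using P_rep[of G] l2_rep_zero unfolding PG
    by eventually_elim (auto intro!: ell2_eqI)
qed

lemma weak_grad_unique:
  assumes "weak_grad k U G" "weak_grad k U G'" "P G = G" "P G' = G'" shows "G = G'"
proof -
  have "(G - G') \<bullet> tvec n \<tau> = 0" if t: "\<tau> \<in> test" for \<tau> n
  proof -
    have "- (G \<bullet> tvec n (\<lambda>x. cnj (cnj (\<tau> x)))) = - (G' \<bullet> tvec n (\<lambda>x. cnj (cnj (\<tau> x))))"
      using assms(1,2)[unfolded weak_grad_def, rule_format, OF test_cnj[OF t], of n] by (rule trans[OF sym])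
    then show ?thesis by (simp add: inner_diff_left)
  qed
  moreover have "P (G - G') = G - G'" using assms linear_diff[OF bounded_linear.linear[OF P_lin]] by simp
  ultimately have "G - G' = 0" by (intro zero_if_orthogonal_to_tests)
  then show ?thesis by simp
qed

text \<open>The graphs of the gradient on \<open>H\<^sup>1\<close> and, further below, on \<open>H\<^sup>1\<^sub>0\<close>.  The norm of the product space is the norm of
  \<open>H\<^sup>1\<close>.\<close>

definition W1 :: "((real^'d) l2v \<times> (((real^'d) l2v)^'d)) set" where
  "W1 = {(U, G). P U = U \<and> (\<forall>k. P (G $ k) = G $ k \<and> weak_grad k U (G $ k))}"

lemma weak_grad_zero: "weak_grad k 0 0"
  and weak_grad_add: "weak_grad k U G \<Longrightarrow> weak_grad k U' G' \<Longrightarrow> weak_grad k (U + U') (G + G')"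
  and weak_grad_scaleR: "weak_grad k U G \<Longrightarrow> weak_grad k (r *\<^sub>R U) (r *\<^sub>R G)"
  unfolding weak_grad_def by (simp_all add: inner_add_left)

lemma W1_subspace: "subspace W1"
  unfolding subspace_def
proof (intro conjI ballI allI)
  interpret P: bounded_linear P by (rule P_lin)
  show "0 \<in> W1" by (simp add: W1_def zero_prod_def P.zero weak_grad_zero)
  fix v w assume "v \<in> W1" "w \<in> W1"
  then show "v + w \<in> W1" by (simp add: W1_def split_beta P.add weak_grad_add)
next
  interpret P: bounded_linear P by (rule P_lin)
  fix r :: real and v assume "v \<in> W1"
  then show "r *\<^sub>R v \<in> W1" by (simp add: W1_def split_beta P.scaleR weak_grad_scaleR)
qed

lemma closed_weak_grad: "closed {w. weak_grad k (fst w) (snd w $ k)}"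
proof -
  have "closed {w :: (real^'d) l2v \<times> (((real^'d) l2v)^'d).
      fst w \<bullet> tvec n (\<lambda>x. cnj (partial_deriv k \<tau> x)) = - ((snd w $ k) \<bullet> tvec n (\<lambda>x. cnj (\<tau> x)))}" for \<tau> n
    by (intro closed_Collect_eq continuous_intros)
  then have "closed (\<Inter>\<tau>\<in>test. \<Inter>n. {w :: (real^'d) l2v \<times> (((real^'d) l2v)^'d).
      fst w \<bullet> tvec n (\<lambda>x. cnj (partial_deriv k \<tau> x)) = - ((snd w $ k) \<bullet> tvec n (\<lambda>x. cnj (\<tau> x)))})"
    by (intro closed_INT ballI)
  moreover have "{w. weak_grad k (fst w) (snd w $ k)} = (\<Inter>\<tau>\<in>test. \<Inter>n. {w :: (real^'d) l2v \<times> (((real^'d) l2v)^'d).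
      fst w \<bullet> tvec n (\<lambda>x. cnj (partial_deriv k \<tau> x)) = - ((snd w $ k) \<bullet> tvec n (\<lambda>x. cnj (\<tau> x)))})"
    unfolding weak_grad_def by blast
  ultimately show ?thesis by (simp only:)
qed

lemma W1_closed: "closed W1"
proof -
  have "closed {w :: (real^'d) l2v \<times> (((real^'d) l2v)^'d). P (fst w) = fst w}"
    by (intro closed_Collect_eq continuous_intros bounded_linear.continuous_on[OF P_lin])
  moreover have "closed {w :: (real^'d) l2v \<times> (((real^'d) l2v)^'d). P (snd w $ k) = snd w $ k}" for k
    by (intro closed_Collect_eq continuous_intros bounded_linear.continuous_on[OF P_lin])
  ultimately have "closed ({w. P (fst w) = fst w} \<inter>
      (\<Inter>k. {w. P (snd w $ k) = snd w $ k} \<inter> {w. weak_grad k (fst w) (snd w $ k)}))"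
    by (intro closed_Int closed_INT ballI closed_weak_grad)
  moreover have "W1 = {w. P (fst w) = fst w} \<inter>
      (\<Inter>k. {w. P (snd w $ k) = snd w $ k} \<inter> {w. weak_grad k (fst w) (snd w $ k)})"
    by (rule set_eqI) (simp add: W1_def split_beta)
  ultimately show ?thesis by (simp only:)
qed

lemma W1_graph: "(0, G) \<in> W1 \<Longrightarrow> G = 0"
proof -
  assume w: "(0, G) \<in> W1"
  interpret P: bounded_linear P by (rule P_lin)
  have "G $ k = 0" for k
    by (rule weak_grad_unique[of k 0]) (use w in \<open>auto simp: W1_def weak_grad_def P.zero\<close>)
  then show "G = 0" by (simp add: vec_eq_iff)
qed

lemma W1_unique: "(U, G) \<in> W1 \<Longrightarrow> (U, G') \<in> W1 \<Longrightarrow> G = G'"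
  using W1_graph[of "G - G'"] subspace_diff[OF W1_subspace, of "(U, G)" "(U, G')"] by simp

definition grad :: "(real^'d \<Rightarrow> ell2) \<Rightarrow> ((real^'d) l2v)^'d" where
  "grad u = (\<chi> k. J (weak_partial \<Omega> (ell2_on Y) k u))"

lemma has_weak_partial_weak_partial:
  assumes "u \<in> H1 \<Omega> (ell2_on Y)"
  shows "has_weak_partial \<Omega> (ell2_on Y) k u (weak_partial \<Omega> (ell2_on Y) k u)"
proof -
  have "\<exists>w. has_weak_partial \<Omega> (ell2_on Y) k u w" using assms by (simp add: H1_def)
  then show ?thesis unfolding weak_partial_def by (rule someI_ex)
qed

lemma grad_in_W1: "u \<in> H1 \<Omega> (ell2_on Y) \<Longrightarrow> (J u, grad u) \<in> W1"
  using has_weak_partial_weak_partial[of u] by (simp add: W1_def grad_def has_weak_partial_iff P_J)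

lemma H1_iff: "u \<in> H1 \<Omega> (ell2_on Y) \<longleftrightarrow> u \<in> L2Y \<and> (\<exists>G. (J u, G) \<in> W1)"
proof
  assume "u \<in> H1 \<Omega> (ell2_on Y)"
  then show "u \<in> L2Y \<and> (\<exists>G. (J u, G) \<in> W1)" using grad_in_W1 by (intro conjI exI) (simp add: H1_def)
next
  assume "u \<in> L2Y \<and> (\<exists>G. (J u, G) \<in> W1)"
  then obtain G where u: "u \<in> L2Y" and G: "\<And>k. P (G $ k) = G $ k" "\<And>k. weak_grad k (J u) (G $ k)"
    by (auto simp: W1_def)
  have "has_weak_partial \<Omega> (ell2_on Y) k u (rho (G $ k))" for k
    using u G rho_in J_rho_id by (simp add: has_weak_partial_iff)
  then show "u \<in> H1 \<Omega> (ell2_on Y)" unfolding H1_def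
    by (intro CollectI conjI allI exI) (rule u)
qed

lemma grad_eqI:
  assumes "u \<in> L2Y" "(J u, G) \<in> W1" shows "grad u = G"
proof -
  have "u \<in> H1 \<Omega> (ell2_on Y)" unfolding H1_iff using assms by (intro conjI exI)
  then show ?thesis using W1_unique[OF grad_in_W1] assms(2) by simp
qed

lemma Cc_infinity_in: "f \<in> Cc_infinity \<Omega> L \<Longrightarrow> x \<in> \<Omega> \<Longrightarrow> f x \<in> L"
  by (simp add: Cc_infinity_def)

lemma Cc_infinity_retarget: "f \<in> Cc_infinity \<Omega> L \<Longrightarrow> (\<And>x. x \<in> \<Omega> \<Longrightarrow> f x \<in> L') \<Longrightarrow> f \<in> Cc_infinity \<Omega> L'"
  by (simp add: Cc_infinity_def)

lemma smooth_in_L2Y: assumes "\<phi> \<in> Cc_infinity \<Omega> (ell2_on Y)" shows "\<phi> \<in> L2Y"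
  unfolding L2_fun_iff sq_int_def
  by (intro conjI ballI Cc_infinity_in[OF assms] Cc_infinity_integrable(2,3)[OF open_domain assms])

lemma smooth_partial:
  assumes \<phi>: "\<phi> \<in> Cc_infinity \<Omega> (ell2_on Y)" shows "partial_deriv k \<phi> \<in> Cc_infinity \<Omega> (ell2_on Y)"
proof -
  have "partial_deriv k \<phi> x \<in> ell2_on Y" if x: "x \<in> \<Omega>" for x
    unfolding ell2_on_def
  proof (intro CollectI allI impI)
    fix n assume n: "n \<notin> Y"
    have "ell2_nth (partial_deriv k \<phi> x) n = partial_deriv k (\<lambda>x. ell2_nth (\<phi> x) n) x"
      by (rule partial_deriv_linear(1)[symmetric, OF bounded_linear_ell2_nth Cc_infinity_differentiable[OF \<phi> x]])
    moreover have "ell2_nth (\<phi> y) n = 0" if "y \<in> \<Omega>" for y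
      using Cc_infinity_in[OF \<phi> that] n by (simp add: ell2_on_def)
    then have "partial_deriv k (\<lambda>x. ell2_nth (\<phi> x) n) x = partial_deriv k (\<lambda>x. 0) x"
      by (rule partial_deriv_cong[OF open_domain x])
    ultimately show "ell2_nth (partial_deriv k \<phi> x) n = 0" by (simp add: partial_deriv_def)
  qed
  then show ?thesis by (rule Cc_infinity_retarget[OF Cc_infinity_partial[OF open_domain \<phi>]])
qed

lemma smooth_in_W1:
  assumes \<phi>: "\<phi> \<in> Cc_infinity \<Omega> (ell2_on Y)" shows "(J \<phi>, \<chi> k. J (partial_deriv k \<phi>)) \<in> W1"
proof -
  have "has_weak_partial \<Omega> (ell2_on Y) k \<phi> (partial_deriv k \<phi>)" for k
    unfolding has_weak_partial_def
    by (intro conjI ballI smooth_in_L2Y \<phi> smooth_partial[OF \<phi>] integration_by_parts[OF open_domain _ \<phi>])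
  then show ?thesis using P_J by (auto simp: W1_def has_weak_partial_iff)
qed

lemma H1_norm_eq:
  assumes "u \<in> H1 \<Omega> (ell2_on Y)" shows "H1_norm \<Omega> (ell2_on Y) u = norm (J u, grad u)"
proof -
  have "weak_partial \<Omega> (ell2_on Y) k u \<in> L2Y" for k
    using has_weak_partial_weak_partial[OF assms] by (simp add: has_weak_partial_iff)
  then have "(\<Sum>k\<in>UNIV. (L2_norm \<Omega> (weak_partial \<Omega> (ell2_on Y) k u))\<^sup>2) = (\<Sum>k\<in>UNIV. (norm (grad u $ k))\<^sup>2)"
    by (simp add: L2_norm_eq grad_def)
  also have "\<dots> = (norm (grad u))\<^sup>2"
    unfolding norm_vec_def L2_set_def by (rule real_sqrt_pow2[symmetric]) (simp add: sum_nonneg)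
  finally have "(\<Sum>k\<in>UNIV. (L2_norm \<Omega> (weak_partial \<Omega> (ell2_on Y) k u))\<^sup>2) = (norm (grad u))\<^sup>2" .
  moreover have "u \<in> L2Y" using assms by (simp add: H1_def)
  ultimately show ?thesis unfolding H1_norm_def norm_Pair by (simp only: L2_norm_eq)
qed

definition W0 :: "((real^'d) l2v \<times> (((real^'d) l2v)^'d)) set" where
  "W0 = closure ((\<lambda>\<phi>. (J \<phi>, \<chi> k. J (partial_deriv k \<phi>))) ` Cc_infinity \<Omega> (ell2_on Y))"

lemma W0_subset_W1: "W0 \<subseteq> W1"
  unfolding W0_def by (rule closure_minimal[OF _ W1_closed]) (use smooth_in_W1 in auto)

text \<open>Approximation in the norm of \<open>H\<^sup>1\<close> is approximation of the pairs of function and gradient, and the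
  gradient is determined by the function.\<close>

lemma H1_0_iff: "u \<in> H1_0 \<Omega> (ell2_on Y) \<longleftrightarrow> u \<in> L2Y \<and> (\<exists>G. (J u, G) \<in> W0)"
proof -
  have key: "H1_norm \<Omega> (ell2_on Y) (\<lambda>x. u x - \<phi> x) = dist (J \<phi>, \<chi> k. J (partial_deriv k \<phi>)) (J u, grad u)"
    if u: "u \<in> H1 \<Omega> (ell2_on Y)" and \<phi>: "\<phi> \<in> Cc_infinity \<Omega> (ell2_on Y)" for \<phi>
  proof -
    have uL: "u \<in> L2Y" and pL: "\<phi> \<in> L2Y" using u smooth_in_L2Y[OF \<phi>] by (auto simp: H1_def)
    have "(J u, grad u) - (J \<phi>, \<chi> k. J (partial_deriv k \<phi>)) \<in> W1"
      by (rule subspace_diff[OF W1_subspace grad_in_W1[OF u] smooth_in_W1[OF \<phi>]])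
    then have w: "(J (\<lambda>x. u x - \<phi> x), grad u - (\<chi> k. J (partial_deriv k \<phi>))) \<in> W1"
      by (simp add: J_diff[OF uL pL])
    then have h: "(\<lambda>x. u x - \<phi> x) \<in> H1 \<Omega> (ell2_on Y)" using H1_iff L2Y_diff[OF uL pL] by blast
    show ?thesis
      unfolding H1_norm_eq[OF h] grad_eqI[OF L2Y_diff[OF uL pL] w] J_diff[OF uL pL]
      by (subst dist_commute) (simp add: dist_norm)
  qed
  have "u \<in> H1_0 \<Omega> (ell2_on Y) \<longleftrightarrow> u \<in> H1 \<Omega> (ell2_on Y) \<and> (J u, grad u) \<in> W0"
    unfolding W0_def closure_approachable H1_0_def using key by auto
  also have "\<dots> \<longleftrightarrow> u \<in> L2Y \<and> (\<exists>G. (J u, G) \<in> W0)"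
  proof
    assume "u \<in> L2Y \<and> (\<exists>G. (J u, G) \<in> W0)"
    then obtain G where u: "u \<in> L2Y" "(J u, G) \<in> W0" by blast
    then have "(J u, G) \<in> W1" using W0_subset_W1 by auto
    then show "u \<in> H1 \<Omega> (ell2_on Y) \<and> (J u, grad u) \<in> W0" using u grad_eqI[OF u(1)] by (auto simp: H1_iff)
  qed (auto simp: H1_def)
  finally show ?thesis .
qed

end

lemma norm_vec_le_sum: "norm (G :: 'a::real_normed_vector ^ 'd::finite) \<le> (\<Sum>k\<in>UNIV. norm (G $ k))"
  unfolding norm_vec_def by (rule L2_set_le_sum) simp

context l2_domain
begin

abbreviation vec_op :: "((real^'d) l2v \<Rightarrow> (real^'d) l2v) \<Rightarrow> ((real^'d) l2v)^'d \<Rightarrow> ((real^'d) l2v)^'d" where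
  "vec_op T G \<equiv> (\<chi> k. T (G $ k))"

lemma tvec_in: "g \<in> test \<Longrightarrow> tvec n g = l2_abs (ext_zero \<Omega> (\<lambda>x. g x *\<^sub>C unit_vec n))"
  by (simp add: tvec_def J_def)

lemma fibre_tvec:
  assumes T: "bounded_linear T" and g: "g \<in> test" and Tg: "\<And>c. T (c *\<^sub>C unit_vec n) = f c"
  shows "fibre_op (\<lambda>x. T) (tvec n g) = l2_abs (ext_zero \<Omega> (\<lambda>x. f (g x)))"
  unfolding tvec_in[OF g] fibre_op_abs[OF fibre_field_const[OF T] test_sq_int[OF g]]
  using linear_0[OF bounded_linear.linear[OF T]] by (intro arg_cong[of _ _ l2_abs]) (auto simp: ext_zero_def Tg)

lemma I_tvec: assumes "g \<in> test" shows "I (tvec n g) = tvec n (\<lambda>x. \<i> * g x)"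
  unfolding I_def fibre_tvec[OF bounded_linear_scaleC_ell2 assms scaleC_scaleC] tvec_in[OF test_mult[OF assms]] ..

lemma move_tvec: assumes "g \<in> test" shows "move p m (tvec n g) = (if n = m then tvec p g else 0)"
proof -
  have "coord_move p m (c *\<^sub>C unit_vec n) = (if n = m then c else 0) *\<^sub>C unit_vec p" for c
    by (rule ell2_eqI) simp
  then have "move p m (tvec n g) = l2_abs (ext_zero \<Omega> (\<lambda>x. (if n = m then g x else 0) *\<^sub>C unit_vec p))"
    unfolding move_def by (rule fibre_tvec[OF bounded_linear_coord_move assms])
  moreover have "ext_zero \<Omega> (\<lambda>x. (0::complex) *\<^sub>C unit_vec p) = (\<lambda>x. 0)"
    by (auto simp: ext_zero_def intro!: ell2_eqI)
  ultimately show ?thesis by (simp add: tvec_in[OF assms] zero_l2v_def)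
qed

lemma weak_grad_I: assumes w: "weak_grad k U G" shows "weak_grad k (I U) (I G)"
  unfolding weak_grad_def
proof (intro ballI allI)
  fix \<tau> n assume t: "\<tau> \<in> test"
  have "I U \<bullet> tvec n (\<lambda>x. cnj (partial_deriv k \<tau> x)) = - (U \<bullet> tvec n (\<lambda>x. cnj (partial_deriv k (\<lambda>x. - \<i> * \<tau> x) x)))"
    unfolding inner_I I_tvec[OF test_cnj[OF test_partial[OF t]]]
    by (intro arg_cong[of _ _ uminus] arg_cong[of _ _ "inner U"] tvec_cong) (simp only: partial_mult[OF t], simp)
  also have "\<dots> = G \<bullet> tvec n (\<lambda>x. cnj (- \<i> * \<tau> x))"
    using w[unfolded weak_grad_def, rule_format, OF test_mult[OF t, of "- \<i>"], of n] by simp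
  also have "\<dots> = - (I G \<bullet> tvec n (\<lambda>x. cnj (\<tau> x)))"
    unfolding inner_I I_tvec[OF test_cnj[OF t]] by simp
  finally show "I U \<bullet> tvec n (\<lambda>x. cnj (partial_deriv k \<tau> x)) = - (I G \<bullet> tvec n (\<lambda>x. cnj (\<tau> x)))" .
qed

lemma weak_grad_move: assumes w: "weak_grad k U G" shows "weak_grad k (move m p U) (move m p G)"
  unfolding weak_grad_def
proof (intro ballI allI)
  fix \<tau> n assume t: "\<tau> \<in> test"
  show "move m p U \<bullet> tvec n (\<lambda>x. cnj (partial_deriv k \<tau> x)) = - (move m p G \<bullet> tvec n (\<lambda>x. cnj (\<tau> x)))"
    unfolding inner_move move_tvec[OF test_cnj[OF test_partial[OF t]]] move_tvec[OF test_cnj[OF t]]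
    using w[unfolded weak_grad_def, rule_format, OF t, of p] by simp
qed

lemma W1_I: "(U, G) \<in> W1 \<Longrightarrow> (I U, vec_op I G) \<in> W1"
  by (simp add: W1_def P_I weak_grad_I)

lemma W1_move: "(U, G) \<in> W1 \<Longrightarrow> m \<in> Y \<Longrightarrow> (move m p U, vec_op (move m p) G) \<in> W1"
  by (simp add: W1_def P_move weak_grad_move)

lemma bounded_linear_vec_op: assumes "bounded_linear T" shows "bounded_linear (vec_op T)"
proof -
  interpret T: bounded_linear T by fact
  obtain K where K: "K \<ge> 0" "\<And>x. norm (T x) \<le> norm x * K" using T.nonneg_bounded by blast
  show ?thesis
  proof (rule bounded_linear_intro)
    fix G :: "((real^'d) l2v)^'d"
    have "norm (vec_op T G) \<le> (\<Sum>k\<in>UNIV. norm (vec_op T G $ k))" by (rule norm_vec_le_sum)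
    also have "\<dots> \<le> (\<Sum>k\<in>(UNIV::'d set). norm G * K)"
      by (intro sum_mono) (auto intro: order_trans[OF K(2)] mult_right_mono[OF Finite_Cartesian_Product.norm_nth_le] K)
    finally show "norm (vec_op T G) \<le> norm G * (K * CARD('d))" by (simp add: mult_ac)
  qed (simp_all add: vec_eq_iff T.add T.scale)
qed

text \<open>A bounded operator of the fibres maps smooth functions to smooth functions and commutes with differentiation; the
  rest is continuity.\<close>

lemma W0_fibre:
  assumes T: "bounded_linear T" and TK: "\<And>f. f \<in> ell2_on Y \<Longrightarrow> T f \<in> ell2_on Y" and w: "(U, G) \<in> W0"
  shows "(fibre_op (\<lambda>x. T) U, vec_op (fibre_op (\<lambda>x. T)) G) \<in> W0"
proof -
  let ?T = "fibre_op (\<lambda>x::real^'d. T)" and ?g = "\<lambda>\<phi>. (J \<phi>, \<chi> k. J (partial_deriv k \<phi>))"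
  define f where "f = (\<lambda>w. (?T (fst w), vec_op ?T (snd w)))"
  have "bounded_linear f" unfolding f_def
    by (intro bounded_linear_Pair bounded_linear_compose[OF bounded_linear_fibre_op[OF fibre_field_const[OF T]] bounded_linear_fst]
        bounded_linear_compose[OF bounded_linear_vec_op[OF bounded_linear_fibre_op[OF fibre_field_const[OF T]]] bounded_linear_snd])
  then have "continuous_on (closure (?g ` Cc_infinity \<Omega> (ell2_on Y))) f" by (rule linear_continuous_on)
  moreover have "f ` ?g ` Cc_infinity \<Omega> (ell2_on Y) \<subseteq> W0"
  proof (rule image_subsetI)
    fix w assume "w \<in> ?g ` Cc_infinity \<Omega> (ell2_on Y)"
    then obtain \<phi> where p: "\<phi> \<in> Cc_infinity \<Omega> (ell2_on Y)" and wp: "w = ?g \<phi>" by (rule imageE)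
    have q: "(\<lambda>x. T (\<phi> x)) \<in> Cc_infinity \<Omega> (ell2_on Y)"
      by (rule Cc_infinity_linear[OF open_domain T p]) (intro TK Cc_infinity_in[OF p])
    have "J (partial_deriv k (\<lambda>x. T (\<phi> x))) = ?T (J (partial_deriv k \<phi>))" for k
    proof -
      have "ext_zero \<Omega> (partial_deriv k (\<lambda>x. T (\<phi> x))) = ext_zero \<Omega> (\<lambda>x. T (partial_deriv k \<phi> x))"
        using partial_deriv_linear(1)[OF T Cc_infinity_differentiable[OF p]] by (auto simp: ext_zero_def)
      then have "J (partial_deriv k (\<lambda>x. T (\<phi> x))) = J (\<lambda>x. T (partial_deriv k \<phi> x))" by (simp only: J_def)
      also have "\<dots> = ?T (J (partial_deriv k \<phi>))" by (rule fibre_L2Y(2)[OF T smooth_in_L2Y[OF smooth_partial[OF p]] TK])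
      finally show ?thesis .
    qed
    then have "f (?g \<phi>) = ?g (\<lambda>x. T (\<phi> x))"
      by (simp add: f_def fibre_L2Y(2)[OF T smooth_in_L2Y[OF p] TK] vec_eq_iff)
    then have "f w \<in> ?g ` Cc_infinity \<Omega> (ell2_on Y)" unfolding wp by (rule image_eqI[OF _ q])
    then show "f w \<in> W0" unfolding W0_def by (rule subsetD[OF closure_subset])
  qed
  moreover have "closed W0" unfolding W0_def by (rule closed_closure)
  ultimately have *: "f ` closure (?g ` Cc_infinity \<Omega> (ell2_on Y)) \<subseteq> W0"
    by (intro image_closure_subset)
  have "f (U, G) \<in> W0" by (rule subsetD[OF * imageI[OF w[unfolded W0_def]]])
  then show ?thesis by (simp add: f_def)
qed

lemma W0_I: "(U, G) \<in> W0 \<Longrightarrow> (I U, vec_op I G) \<in> W0"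
  unfolding I_def by (rule W0_fibre[OF bounded_linear_scaleC_ell2 ell2_on_scaleC])

lemma W0_move: "(U, G) \<in> W0 \<Longrightarrow> m \<in> Y \<Longrightarrow> (move m p U, vec_op (move m p) G) \<in> W0"
  unfolding move_def by (rule W0_fibre[OF bounded_linear_coord_move]) (auto simp: ell2_on_def)

text \<open>The map from a smooth function to the class of its partial derivatives is seen to be additive through the
  uniqueness of weak gradients.\<close>

lemma W0_subspace: "subspace W0"
  unfolding W0_def
proof (rule subspace_closure_normed)
  let ?g = "\<lambda>\<phi>. (J \<phi>, \<chi> k. J (partial_deriv k \<phi>))" and ?C = "Cc_infinity \<Omega> (ell2_on Y)"
  show "subspace (?g ` ?C)"
    unfolding subspace_def
  proof (intro conjI ballI allI)
    have z: "(\<lambda>x. 0) \<in> ?C" by (auto simp: Cc_infinity_def C_on_const ell2_on_def intro: exI[of _ "{}"])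
    have "0 = ?g (\<lambda>x. 0)"
      using W1_graph[of "\<chi> k. J (partial_deriv k (\<lambda>x. 0))"] smooth_in_W1[OF z] J_scaleR[OF smooth_in_L2Y[OF z], of 0]
      by (simp add: zero_prod_def)
    then show "0 \<in> ?g ` ?C" by (rule image_eqI[OF _ z])
    fix v w assume v: "v \<in> ?g ` ?C" and w: "w \<in> ?g ` ?C"
    from v obtain a where a: "v = ?g a" "a \<in> ?C" by (rule imageE)
    from w obtain b where b: "w = ?g b" "b \<in> ?C" by (rule imageE)
    note ab = a(2) b(2) a(1) b(1)
    have s: "(\<lambda>x. a x + b x) \<in> ?C"
      by (rule Cc_infinity_add[OF open_domain ab(1,2)]) (rule ell2_on_add[OF Cc_infinity_in[OF ab(1)] Cc_infinity_in[OF ab(2)]])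
    have "v + w = ?g (\<lambda>x. a x + b x)"
    proof -
      have Jab: "J (\<lambda>x. a x + b x) = J a + J b" by (rule J_add[OF smooth_in_L2Y[OF ab(1)] smooth_in_L2Y[OF ab(2)]])
      have "?g a + ?g b \<in> W1" by (intro subspace_add[OF W1_subspace] smooth_in_W1 ab)
      then have "(J a + J b, (\<chi> k. J (partial_deriv k a)) + (\<chi> k. J (partial_deriv k b))) \<in> W1" by simp
      from W1_unique[OF this smooth_in_W1[OF s, unfolded Jab]] show ?thesis unfolding ab Jab by simp
    qed
    then show "v + w \<in> ?g ` ?C" by (rule image_eqI[OF _ s])
  next
    fix r v assume "v \<in> ?g ` ?C"
    then obtain a where a': "v = ?g a" "a \<in> ?C" by (rule imageE)
    note a = a'(2) a'(1)
    have s: "(\<lambda>x. r *\<^sub>R a x) \<in> ?C"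
      by (rule Cc_infinity_linear[OF open_domain bounded_linear_scaleR_right a(1)]) (rule ell2_on_scaleR[OF Cc_infinity_in[OF a(1)]])
    have Ja: "J (\<lambda>x. r *\<^sub>R a x) = r *\<^sub>R J a" by (rule J_scaleR[OF smooth_in_L2Y[OF a(1)]])
    have "r *\<^sub>R ?g a \<in> W1" by (intro subspace_scale[OF W1_subspace] smooth_in_W1 a)
    then have "(r *\<^sub>R J a, r *\<^sub>R (\<chi> k. J (partial_deriv k a))) \<in> W1" by simp
    from W1_unique[OF this smooth_in_W1[OF s, unfolded Ja]] have "r *\<^sub>R v = ?g (\<lambda>x. r *\<^sub>R a x)"
      unfolding a Ja by simp
    then show "r *\<^sub>R v \<in> ?g ` ?C" by (rule image_eqI[OF _ s])
  qed
qed

lemma test_in_W0: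
  assumes g: "g \<in> test" and n: "n \<in> Y"
  shows "(tvec n g, \<chi> k. tvec n (partial_deriv k g)) \<in> W0"
proof -
  have p: "(\<lambda>x. g x *\<^sub>C unit_vec n) \<in> Cc_infinity \<Omega> (ell2_on Y)"
    by (rule Cc_infinity_linear[OF open_domain bounded_linear_scaleC_unit g]) (simp add: n)
  have "J (partial_deriv k (\<lambda>x. g x *\<^sub>C unit_vec n)) = tvec n (partial_deriv k g)" for k
  proof -
    have "ext_zero \<Omega> (partial_deriv k (\<lambda>x. g x *\<^sub>C unit_vec n)) = ext_zero \<Omega> (\<lambda>x. partial_deriv k g x *\<^sub>C unit_vec n)"
      using partial_deriv_linear(1)[OF bounded_linear_scaleC_unit Cc_infinity_differentiable[OF g]] by (auto simp: ext_zero_def)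
    then show ?thesis by (simp only: J_def tvec_def)
  qed
  then have "(tvec n g, \<chi> k. tvec n (partial_deriv k g)) =
      (J (\<lambda>x. g x *\<^sub>C unit_vec n), \<chi> k. J (partial_deriv k (\<lambda>x. g x *\<^sub>C unit_vec n)))"
    by (simp add: tvec_def)
  then have "(tvec n g, \<chi> k. tvec n (partial_deriv k g)) \<in>
      (\<lambda>\<phi>. (J \<phi>, \<chi> k. J (partial_deriv k \<phi>))) ` Cc_infinity \<Omega> (ell2_on Y)"
    by (rule image_eqI[OF _ p])
  then show ?thesis unfolding W0_def by (rule subsetD[OF closure_subset])
qed

end

section \<open>The elliptic form on the Hilbert space\<close>

locale elliptic_coefficients = l2_domain \<Omega> Y
  for \<Omega> :: "(real^'d::finite) set" and Y :: "nat set" +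
  fixes C :: "'d \<Rightarrow> 'd \<Rightarrow> real^'d \<Rightarrow> ell2 \<Rightarrow> ell2" and \<mu> :: real
  assumes C_lin: "\<And>k l x. x \<in> \<Omega> \<Longrightarrow> bounded_clinear_on (ell2_on Y) (C k l x)"
    and C_bound: "\<And>k l. \<exists>M. \<forall>x\<in>\<Omega>. \<forall>f\<in>ell2_on Y. norm (C k l x f) \<le> M * norm f"
    and C_meas: "\<And>k l f g. f \<in> ell2_on Y \<Longrightarrow> g \<in> ell2_on Y \<Longrightarrow>
           (\<lambda>x. cinner (C k l x f) g) \<in> borel_measurable (lebesgue_on \<Omega>)"
    and \<mu>_pos: "\<mu> > 0"
    and elliptic: "\<And>f :: 'd \<Rightarrow> ell2. (\<And>k. f k \<in> ell2_on Y) \<Longrightarrow>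
           AE x in lebesgue_on \<Omega>.
             Re (\<Sum>k\<in>UNIV. \<Sum>l\<in>UNIV. cinner (C k l x (f l)) (f k)) \<ge> \<mu> * (\<Sum>k\<in>UNIV. (norm (f k))\<^sup>2)"
begin

text \<open>The coefficients, extended so that they act on all of \<open>\<ell>\<^sub>2\<close> and at all points.\<close>

definition F :: "'d \<Rightarrow> 'd \<Rightarrow> real^'d \<Rightarrow> ell2 \<Rightarrow> ell2" where
  "F k l x f = (if x \<in> \<Omega> then C k l x (restr Y f) else 0)"

lemma restr_scaleC: "restr Y (c *\<^sub>C f) = c *\<^sub>C restr Y f" by (rule ell2_eqI) simp

lemma F_scaleC: "F k l x (c *\<^sub>C f) = c *\<^sub>C F k l x f"
  using C_lin[of x k l] by (auto simp: F_def restr_scaleC bounded_clinear_on_def intro!: ell2_eqI)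

lemma F_bound: "\<exists>M\<ge>0. \<forall>x f. norm (F k l x f) \<le> M * norm f"
proof -
  obtain M where M: "\<And>x f. x \<in> \<Omega> \<Longrightarrow> f \<in> ell2_on Y \<Longrightarrow> norm (C k l x f) \<le> M * norm f" using C_bound by blast
  obtain K where K: "K \<ge> 0" "\<And>f. norm (restr Y f) \<le> norm f * K"
    using bounded_linear.nonneg_bounded[OF bounded_linear_restr] by blast
  have "norm (F k l x f) \<le> (max M 0 * K) * norm f" for x f
  proof (cases "x \<in> \<Omega>")
    case True
    then have "norm (F k l x f) \<le> M * norm (restr Y f)" using M by (simp add: F_def)
    also have "\<dots> \<le> max M 0 * norm (restr Y f)" by (intro mult_right_mono) auto
    also have "\<dots> \<le> max M 0 * (norm f * K)" by (intro mult_left_mono K) auto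
    finally show ?thesis by (simp add: mult_ac)
  next
    case False
    then show ?thesis using K(1) by (simp add: F_def)
  qed
  then show ?thesis using K(1) by (intro exI[of _ "max M 0 * K"]) auto
qed

lemma F_linear: "linear (F k l x)"
proof (rule linearI)
  fix a b :: ell2 and r :: real
  have "restr Y (a + b) = restr Y a + restr Y b" by (rule ell2_eqI) simp
  then show "F k l x (a + b) = F k l x a + F k l x b"
    using C_lin[of x k l] by (auto simp: F_def bounded_clinear_on_def)
  show "F k l x (r *\<^sub>R a) = r *\<^sub>R F k l x a"
    using F_scaleC[of k l x "complex_of_real r" a] by (simp add: scaleC_of_real)
qed

lemma F_bounded_linear: "bounded_linear (F k l x)"
proof -
  obtain M where "\<forall>x f. norm (F k l x f) \<le> M * norm f" using F_bound by blast
  then show ?thesis using F_linear[of k l x] by (intro bounded_linear_intro[of _ M]) (auto simp: linear_add linear_scale mult.commute)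
qed

lemma F_coord_measurable: "(\<lambda>x. ell2_nth (F k l x f) n) \<in> borel_measurable lebesgue"
proof (cases "n \<in> Y")
  case True
  have "(\<lambda>x. cinner (C k l x (restr Y f)) (unit_vec n)) \<in> borel_measurable (lebesgue_on \<Omega>)"
    using unit_vec_in[OF True, of 1] by (intro C_meas) (auto simp: ell2_on_def True)
  then have "ext_zero \<Omega> (\<lambda>x. ell2_nth (C k l x (restr Y f)) n) \<in> borel_measurable lebesgue"
    by (simp add: measurable_domain_iff cinner_unit_vec)
  moreover have "ext_zero \<Omega> (\<lambda>x. ell2_nth (C k l x (restr Y f)) n) = (\<lambda>x. ell2_nth (F k l x f) n)"
    by (auto simp: ext_zero_def F_def)
  ultimately show ?thesis by simp
next
  case False
  have "ell2_nth (F k l x f) n = 0" for x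
    using C_lin[of x k l] False restr_in[of Y f] by (auto simp: F_def bounded_clinear_on_def ell2_on_def)
  then show ?thesis by simp
qed

text \<open>Weak measurability suffices: the \<open>n\<close>-th coordinate of \<open>C\<^sub>k\<^sub>l(x) u(x)\<close> is the limit of finite sums of products of
  coordinates of \<open>u(x)\<close> with matrix entries of \<open>C\<^sub>k\<^sub>l(x)\<close>.\<close>

lemma F_field: "fibre_field (F k l)"
  unfolding fibre_field_def
proof (intro conjI allI ballI F_linear)
  show "\<exists>M. \<forall>x f. norm (F k l x f) \<le> M * norm f" using F_bound by blast
  fix u :: "real^'d \<Rightarrow> ell2" assume u: "u \<in> borel_measurable lebesgue"
  have um: "(\<lambda>x. ell2_nth (u x) m) \<in> borel_measurable lebesgue" for m
    by (rule measurable_compose[OF u borel_measurable_continuous_onI[OF linear_continuous_on[OF bounded_linear_ell2_nth]]])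
  show "(\<lambda>x. F k l x (u x)) \<in> borel_measurable lebesgue"
  proof (rule borel_measurable_ell2_coordinates, rule borel_measurable_LIMSEQ_metric)
    fix n
    show "(\<lambda>x. \<Sum>m<N. ell2_nth (u x) m * ell2_nth (F k l x (unit_vec m)) n) \<in> borel_measurable lebesgue" for N
      by (intro borel_measurable_sum borel_measurable_times um F_coord_measurable)
    fix x
    have "(\<lambda>N. ell2_nth (F k l x (\<Sum>m<N. ell2_nth (u x) m *\<^sub>C unit_vec m)) n) \<longlonglongrightarrow> ell2_nth (F k l x (u x)) n"
      by (intro bounded_linear.tendsto[OF bounded_linear_ell2_nth] bounded_linear.tendsto[OF F_bounded_linear] ell2_partial_sums)
    moreover have "ell2_nth (F k l x (\<Sum>m<N. ell2_nth (u x) m *\<^sub>C unit_vec m)) n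
        = (\<Sum>m<N. ell2_nth (u x) m * ell2_nth (F k l x (unit_vec m)) n)" for N
      by (simp add: linear_sum[OF F_linear] ell2_nth_sum F_scaleC)
    ultimately show "(\<lambda>N. \<Sum>m<N. ell2_nth (u x) m * ell2_nth (F k l x (unit_vec m)) n) \<longlonglongrightarrow> ell2_nth (F k l x (u x)) n"
      by simp
  qed
qed

definition B :: "((real^'d) l2v)^'d \<Rightarrow> ((real^'d) l2v)^'d" where
  "B G = (\<chi> k. \<Sum>l\<in>UNIV. fibre_op (F k l) (G $ l))"

lemma inner_B: "B G \<bullet> G' = (\<Sum>k\<in>UNIV. \<Sum>l\<in>UNIV. fibre_op (F k l) (G $ l) \<bullet> (G' $ k))"
  by (simp add: B_def inner_vec_def inner_sum_left)

lemma B_lin: "bounded_linear B"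
proof -
  have "bounded_linear (\<lambda>G. B G $ k)" for k
    unfolding B_def vec_lambda_beta
    by (intro bounded_linear_sum bounded_linear_compose[OF bounded_linear_fibre_op[OF F_field] bounded_linear_vec_nth])
  then interpret Bk: bounded_linear "\<lambda>G. B G $ k" for k .
  have "\<exists>K. \<forall>G. norm (B G $ k) \<le> norm G * K" for k using Bk.bounded .
  then obtain K where K: "\<And>k G. norm (B G $ k) \<le> norm G * K k" by metis
  show ?thesis
  proof (rule bounded_linear_intro)
    fix G
    have "norm (B G) \<le> (\<Sum>k\<in>UNIV. norm (B G $ k))" by (rule norm_vec_le_sum)
    also have "\<dots> \<le> (\<Sum>k\<in>UNIV. norm G * K k)" by (intro sum_mono K)
    finally show "norm (B G) \<le> norm G * (\<Sum>k\<in>UNIV. K k)" by (simp add: sum_distrib_left)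
  qed (simp_all add: vec_eq_iff Bk.add Bk.scale)
qed

text \<open>Ellipticity holds for every fixed choice of vectors outside a null set; the exceptional set can be
  chosen independently of the vectors because \<open>\<ell>\<^sub>2\<close> is separable.\<close>

lemma elliptic_ae:
  "AE x in lebesgue. x \<in> \<Omega> \<longrightarrow> (\<forall>f :: 'd \<Rightarrow> ell2. (\<forall>k. f k \<in> ell2_on Y) \<longrightarrow>
     \<mu> * (\<Sum>k\<in>UNIV. (norm (f k))\<^sup>2) \<le> (\<Sum>k\<in>UNIV. \<Sum>l\<in>UNIV. F k l x (f l) \<bullet> f k))"
proof -
  define r where "r = (\<lambda>(qs :: 'd \<Rightarrow> (rat \<times> rat) list) k. restr Y (ell2_approx (qs k)))"
  have "AE x in lebesgue. x \<in> \<Omega> \<longrightarrow>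
      \<mu> * (\<Sum>k\<in>UNIV. (norm (r qs k))\<^sup>2) \<le> (\<Sum>k\<in>UNIV. \<Sum>l\<in>UNIV. F k l x (r qs l) \<bullet> r qs k)" for qs
  proof -
    have rK: "r qs k \<in> ell2_on Y" for k by (simp add: r_def)
    show ?thesis using elliptic[OF rK] unfolding AE_domain_iff
      by eventually_elim (auto simp: F_def restr_id[OF rK] inner_ell2_def)
  qed
  then have "AE x in lebesgue. \<forall>qs. x \<in> \<Omega> \<longrightarrow>
      \<mu> * (\<Sum>k\<in>UNIV. (norm (r qs k))\<^sup>2) \<le> (\<Sum>k\<in>UNIV. \<Sum>l\<in>UNIV. F k l x (r qs l) \<bullet> r qs k)"
    unfolding AE_all_countable by blast
  then show ?thesis
  proof eventually_elim
    case (elim x)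
    show ?case
    proof (intro impI allI)
      fix f :: "'d \<Rightarrow> ell2" assume x: "x \<in> \<Omega>" and f: "\<forall>k. f k \<in> ell2_on Y"
      have "\<exists>q. \<forall>k. dist (f k) (ell2_approx (q k)) < 1 / real (Suc j)" for j
        by (intro choice allI ell2_approx_dense) simp
      then obtain q where q: "\<And>j k. dist (f k) (ell2_approx (q j k)) < 1 / real (Suc j)" by metis
      have lim: "(\<lambda>j. r (q j) k) \<longlonglongrightarrow> f k" for k
      proof -
        have "(\<lambda>j. ell2_approx (q j k)) \<longlonglongrightarrow> f k"
        proof (rule metric_LIMSEQ_I)
          fix e :: real assume "e > 0"
          then obtain N where N: "1 / real (Suc N) < e" using nat_approx_posE by blast
          have "dist (ell2_approx (q j k)) (f k) < e" if "j \<ge> N" for j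
          proof -
            have "1 / real (Suc j) \<le> 1 / real (Suc N)" using that by (intro divide_left_mono) auto
            then show ?thesis using q[of k j] N by (simp add: dist_commute)
          qed
          then show "\<exists>N. \<forall>j\<ge>N. dist (ell2_approx (q j k)) (f k) < e" by blast
        qed
        then have "(\<lambda>j. restr Y (ell2_approx (q j k))) \<longlonglongrightarrow> restr Y (f k)"
          by (rule bounded_linear.tendsto[OF bounded_linear_restr])
        then show ?thesis using f by (simp add: r_def restr_id)
      qed
      show "\<mu> * (\<Sum>k\<in>UNIV. (norm (f k))\<^sup>2) \<le> (\<Sum>k\<in>UNIV. \<Sum>l\<in>UNIV. F k l x (f l) \<bullet> f k)"
      proof (rule LIMSEQ_le)
        show "(\<lambda>j. \<mu> * (\<Sum>k\<in>UNIV. (norm (r (q j) k))\<^sup>2)) \<longlonglongrightarrow> \<mu> * (\<Sum>k\<in>UNIV. (norm (f k))\<^sup>2)"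
          by (intro tendsto_intros lim)
        show "(\<lambda>j. \<Sum>k\<in>UNIV. \<Sum>l\<in>UNIV. F k l x (r (q j) l) \<bullet> r (q j) k) \<longlonglongrightarrow> (\<Sum>k\<in>UNIV. \<Sum>l\<in>UNIV. F k l x (f l) \<bullet> f k)"
          by (intro tendsto_sum tendsto_inner bounded_linear.tendsto[OF F_bounded_linear] lim)
      qed (use elim x in blast)
    qed
  qed
qed

lemma B_coercive:
  assumes G: "\<And>k. P (G $ k) = G $ k" shows "\<mu> * (norm G)\<^sup>2 \<le> B G \<bullet> G"
proof -
  let ?g = "\<lambda>k. l2_rep (G $ k)"
  have int: "integrable lebesgue (\<lambda>x. F k l x (?g l x) \<bullet> ?g k x)" for k l
    by (intro integrable_inner_sq_int sq_int_fibre[OF F_field] sq_int_l2_rep)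
  have nint: "integrable lebesgue (\<lambda>x. (norm (?g k x))\<^sup>2)" for k using sq_int_l2_rep by (simp add: sq_int_def)
  have gK: "AE x in lebesgue. \<forall>k. ?g k x = (if x \<in> \<Omega> then restr Y (?g k x) else 0)"
    unfolding AE_all_countable using P_rep[of "G $ k" for k] G by simp
  have "\<mu> * (norm G)\<^sup>2 = \<mu> * (\<Sum>k\<in>UNIV. (norm (G $ k))\<^sup>2)"
    by (simp add: norm_vec_def L2_set_def sum_nonneg)
  also have "\<dots> = (\<integral>x. \<mu> * (\<Sum>k\<in>UNIV. (norm (?g k x))\<^sup>2) \<partial>lebesgue)"
    using nint by (simp add: norm_l2_rep)
  also have "\<dots> \<le> (\<integral>x. (\<Sum>k\<in>UNIV. \<Sum>l\<in>UNIV. F k l x (?g l x) \<bullet> ?g k x) \<partial>lebesgue)"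
  proof (rule integral_mono_AE)
    show "integrable lebesgue (\<lambda>x. \<mu> * (\<Sum>k\<in>UNIV. (norm (?g k x))\<^sup>2))" using nint by simp
    show "integrable lebesgue (\<lambda>x. \<Sum>k\<in>UNIV. \<Sum>l\<in>UNIV. F k l x (?g l x) \<bullet> ?g k x)" using int by simp
    show "AE x in lebesgue. \<mu> * (\<Sum>k\<in>UNIV. (norm (?g k x))\<^sup>2) \<le> (\<Sum>k\<in>UNIV. \<Sum>l\<in>UNIV. F k l x (?g l x) \<bullet> ?g k x)"
      using elliptic_ae gK
    proof eventually_elim
      case (elim x)
      show ?case
      proof (cases "x \<in> \<Omega>")
        case True
        then have "?g k x \<in> ell2_on Y" for k using elim(2) restr_in[of Y "?g k x"] by (metis)
        then show ?thesis using elim(1)[rule_format, OF True, of "\<lambda>k. ?g k x"] by blast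
      next
        case False
        then have "?g k x = 0" for k using elim(2) by metis
        then show ?thesis by simp
      qed
    qed
  qed
  also have "\<dots> = (\<Sum>k\<in>UNIV. \<Sum>l\<in>UNIV. \<integral>x. F k l x (?g l x) \<bullet> ?g k x \<partial>lebesgue)" using int by simp
  also have "\<dots> = B G \<bullet> G"
    unfolding inner_B fibre_op_def
    using inner_l2_abs[OF sq_int_fibre[OF F_field sq_int_l2_rep] sq_int_l2_rep] by simp
  finally show ?thesis .
qed

lemma elliptic_form_eq:
  assumes u: "u \<in> H1 \<Omega> (ell2_on Y)" and v: "v \<in> H1 \<Omega> (ell2_on Y)"
  shows "elliptic_form \<Omega> Y C u v = Complex (B (grad u) \<bullet> grad v) (B (grad u) \<bullet> vec_op I (grad v))"
proof -
  define w where "w = (\<lambda>l. weak_partial \<Omega> (ell2_on Y) l u)"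
  define z where "z = (\<lambda>k. weak_partial \<Omega> (ell2_on Y) k v)"
  have w: "w l \<in> L2Y" for l using has_weak_partial_weak_partial[OF u] by (simp add: w_def has_weak_partial_iff)
  have z: "z k \<in> L2Y" for k using has_weak_partial_weak_partial[OF v] by (simp add: z_def has_weak_partial_iff)
  have "(\<integral>x. cinner (C k l x (w l x)) (z k x) \<partial>lebesgue_on \<Omega>)
      = Complex (fibre_op (F k l) (grad u $ l) \<bullet> grad v $ k) (fibre_op (F k l) (grad u $ l) \<bullet> I (grad v $ k))" for k l
  proof -
    have s: "sq_int (\<lambda>x. F k l x (ext_zero \<Omega> (w l) x))" by (rule sq_int_fibre[OF F_field sq_int_L2Y[OF w]])
    have "(\<integral>x. cinner (C k l x (w l x)) (z k x) \<partial>lebesgue_on \<Omega>)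
      = (\<integral>x. cinner (F k l x (ext_zero \<Omega> (w l) x)) (ext_zero \<Omega> (z k) x) \<partial>lebesgue)"
      unfolding integral_domain_eq
    proof (rule Bochner_Integration.integral_cong)
      fix x
      have "w l x \<in> ell2_on Y" if "x \<in> \<Omega>" using w[of l] that by (simp add: L2_fun_iff)
      then show "ext_zero \<Omega> (\<lambda>x. cinner (C k l x (w l x)) (z k x)) x = cinner (F k l x (ext_zero \<Omega> (w l) x)) (ext_zero \<Omega> (z k) x)"
        by (cases "x \<in> \<Omega>") (simp_all add: F_def restr_id cinner_def)
    qed simp
    also have "\<dots> = Complex (fibre_op (F k l) (J (w l)) \<bullet> J (z k)) (fibre_op (F k l) (J (w l)) \<bullet> I (J (z k)))"
      unfolding integral_cinner_eq[OF s sq_int_L2Y[OF z]] J_def fibre_op_abs[OF F_field sq_int_L2Y[OF w]] ..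
    finally show ?thesis by (simp add: grad_def w_def z_def)
  qed
  then show ?thesis
    unfolding elliptic_form_def w_def[symmetric] z_def[symmetric] inner_B
    by (simp add: complex_eq_iff w_def z_def)
qed

end

section \<open>The semigroup on the Hilbert space\<close>

locale elliptic_problem = elliptic_coefficients \<Omega> Y C \<mu>
  for \<Omega> :: "(real^'d::finite) set" and Y :: "nat set"
    and C :: "'d \<Rightarrow> 'd \<Rightarrow> real^'d \<Rightarrow> ell2 \<Rightarrow> ell2" and \<mu> :: real +
  fixes V :: "(real^'d \<Rightarrow> ell2) set" and S :: "real \<Rightarrow> (real^'d \<Rightarrow> ell2) \<Rightarrow> (real^'d \<Rightarrow> ell2)"
  assumes V_cases: "V = H1_0 \<Omega> (ell2_on Y) \<or> V = H1 \<Omega> (ell2_on Y)"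
    and generated: "generated_by_minus \<Omega> (ell2_on Y) (associated_operator \<Omega> Y V (elliptic_form \<Omega> Y C)) S"
begin

text \<open>If \<open>H\<^sup>1\<close> and \<open>H\<^sup>1\<^sub>0\<close> coincide, either graph would do.\<close>

definition W :: "((real^'d) l2v \<times> (((real^'d) l2v)^'d)) set" where
  "W = (if V = H1 \<Omega> (ell2_on Y) then W1 else W0)"

lemma W_cases: obtains "V = H1 \<Omega> (ell2_on Y)" "W = W1" | "V = H1_0 \<Omega> (ell2_on Y)" "W = W0"
proof (cases "V = H1 \<Omega> (ell2_on Y)")
  case True
  moreover have "W = W1" unfolding W_def using True by (rule if_P)
  ultimately show thesis by (rule that(1))
next
  case False
  then have "V = H1_0 \<Omega> (ell2_on Y)" using V_cases by simp
  moreover have "W = W0" unfolding W_def using False by (rule if_not_P)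
  ultimately show thesis by (rule that(2))
qed

lemma V_iff: "u \<in> V \<longleftrightarrow> u \<in> L2Y \<and> (\<exists>G. (J u, G) \<in> W)"
  by (rule W_cases) (simp_all add: H1_iff H1_0_iff)

lemma W_W1: "w \<in> W \<Longrightarrow> w \<in> W1"
  using W0_subset_W1 by (auto simp: W_def split: if_splits)

lemma W_subspace: "subspace W" by (simp add: W_def W1_subspace W0_subspace)

lemma W_closed: "closed W" by (simp add: W_def W1_closed W0_def)

lemma W_P: "(U, G) \<in> W \<Longrightarrow> P U = U" "(U, G) \<in> W \<Longrightarrow> P (G $ k) = G $ k"
  using W_W1 by (auto simp: W1_def)

lemma W_I: "(U, G) \<in> W \<Longrightarrow> (I U, vec_op I G) \<in> W"
  by (rule W_cases) (simp_all add: W1_I W0_I)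

lemma W_move: "(U, G) \<in> W \<Longrightarrow> m \<in> Y \<Longrightarrow> (move m p U, vec_op (move m p) G) \<in> W"
  by (rule W_cases) (simp_all add: W1_move W0_move)

lemma test_in_W: "g \<in> test \<Longrightarrow> n \<in> Y \<Longrightarrow> (tvec n g, \<chi> k. tvec n (partial_deriv k g)) \<in> W"
  using test_in_W0 W0_subset_W1 by (auto simp: W_def)

lemma V_grad: "u \<in> V \<Longrightarrow> u \<in> H1 \<Omega> (ell2_on Y)" "u \<in> V \<Longrightarrow> (J u, grad u) \<in> W"
proof -
  assume "u \<in> V"
  then obtain G where u: "u \<in> L2Y" and G: "(J u, G) \<in> W" by (auto simp: V_iff)
  have "(J u, G) \<in> W1" by (rule W_W1[OF G])
  then show "u \<in> H1 \<Omega> (ell2_on Y)" unfolding H1_iff using u by (intro conjI exI)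
  show "(J u, grad u) \<in> W" using grad_eqI[OF u W_W1[OF G]] G by simp
qed

lemma rho_V: assumes "(U, G) \<in> W" shows "rho U \<in> V" "grad (rho U) = G" "J (rho U) = U"
proof -
  show J: "J (rho U) = U" using W_P(1)[OF assms] by (rule J_rho_id)
  show "rho U \<in> V" unfolding V_iff J using rho_in assms by (intro conjI exI)
  show "grad (rho U) = G" by (rule grad_eqI[OF rho_in]) (simp add: J W_W1[OF assms])
qed

text \<open>The semigroup on classes; \<open>S_cong\<close> shows that the choice of representatives is immaterial.\<close>

definition Sg :: "real \<Rightarrow> (real^'d) l2v \<Rightarrow> (real^'d) l2v" where "Sg t U = J (S t (rho U))"

lemma C0: "C0_semigroup \<Omega> (ell2_on Y) S" using generated by (simp add: generated_by_minus_def)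

lemma S_lin: "t > 0 \<Longrightarrow> bounded_clinear_L2 \<Omega> (ell2_on Y) (S t)" using C0 by (simp add: C0_semigroup_def)

lemma S_in: "t > 0 \<Longrightarrow> u \<in> L2Y \<Longrightarrow> S t u \<in> L2Y" using S_lin by (simp add: bounded_clinear_L2_def)

lemma J_S_add:
  assumes t: "t > 0" and u: "u \<in> L2Y" and v: "v \<in> L2Y"
  shows "J (S t (\<lambda>x. u x + v x)) = J (S t u) + J (S t v)"
proof -
  have "AE x in lebesgue_on \<Omega>. S t (\<lambda>x. u x + v x) x = S t u x + S t v x"
    using S_lin[OF t] u v by (simp add: bounded_clinear_L2_def)
  then have "J (S t (\<lambda>x. u x + v x)) = J (\<lambda>x. S t u x + S t v x)"
    by (subst J_eq_iff) (intro S_in L2Y_add t u v)+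
  then show ?thesis by (simp add: J_add S_in t u v)
qed

lemma S_bound: assumes t: "t > 0" shows "\<exists>M. \<forall>u\<in>L2Y. norm (J (S t u)) \<le> M * norm (J u)"
proof -
  obtain M where "\<And>u. u \<in> L2Y \<Longrightarrow> L2_norm \<Omega> (S t u) \<le> M * L2_norm \<Omega> u"
    using S_lin[OF t] unfolding bounded_clinear_L2_def by blast
  then have "\<forall>u\<in>L2Y. norm (J (S t u)) \<le> M * norm (J u)" using S_in[OF t] by (simp add: L2_norm_eq)
  then show ?thesis ..
qed

text \<open>An additive map that is bounded in the \<open>L\<^sub>2\<close> norm sends functions that vanish a.e. to functions that vanish
  a.e.\<close>

lemma S_cong:
  assumes t: "t > 0" and u: "u \<in> L2Y" and v: "v \<in> L2Y" and uv: "J u = J v"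
  shows "J (S t u) = J (S t v)"
proof -
  obtain M where M: "\<And>u. u \<in> L2Y \<Longrightarrow> norm (J (S t u)) \<le> M * norm (J u)" using S_bound[OF t] by blast
  have w: "(\<lambda>x. u x - v x) \<in> L2Y" by (rule L2Y_diff[OF u v])
  have "J (S t (\<lambda>x. u x - v x)) = 0" using M[OF w] J_diff[OF u v] uv by simp
  then show ?thesis using J_S_add[OF t w v] by simp
qed

lemma J_S: "t > 0 \<Longrightarrow> u \<in> L2Y \<Longrightarrow> J (S t u) = Sg t (J u)"
  unfolding Sg_def by (rule S_cong) (simp_all add: rho_in J_rho P_J)

lemma Sg_lin: assumes t: "t > 0" shows "bounded_linear (Sg t)"
proof -
  interpret P: bounded_linear P by (rule P_lin)
  obtain M where M: "\<And>u. u \<in> L2Y \<Longrightarrow> norm (J (S t u)) \<le> M * norm (J u)" using S_bound[OF t] by blast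
  obtain K where K: "K \<ge> 0" "\<And>U. norm (P U) \<le> norm U * K" using P.nonneg_bounded by blast
  show ?thesis
  proof (rule bounded_linear_intro)
    fix U U' :: "(real^'d) l2v" and r :: real
    have "Sg t (U + U') = J (S t (\<lambda>x. rho U x + rho U' x))"
      unfolding Sg_def by (rule S_cong[OF t]) (simp_all add: rho_in L2Y_add J_add J_rho P.add)
    then show "Sg t (U + U') = Sg t U + Sg t U'" by (simp add: J_S_add[OF t rho_in rho_in] Sg_def)
    have "Sg t (r *\<^sub>R U) = J (S t (\<lambda>x. r *\<^sub>R rho U x))"
      unfolding Sg_def by (rule S_cong[OF t]) (simp_all add: rho_in L2Y_scaleR J_scaleR J_rho P.scaleR)
    also have "AE x in lebesgue_on \<Omega>. S t (\<lambda>x. complex_of_real r *\<^sub>C rho U x) x = complex_of_real r *\<^sub>C S t (rho U) x"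
      using S_lin[OF t] rho_in by (simp add: bounded_clinear_L2_def)
    then have "J (S t (\<lambda>x. r *\<^sub>R rho U x)) = J (\<lambda>x. r *\<^sub>R S t (rho U) x)"
      unfolding scaleC_of_real by (subst J_eq_iff) (intro S_in L2Y_scaleR t rho_in)+
    also have "\<dots> = r *\<^sub>R Sg t U" by (simp add: J_scaleR S_in t rho_in Sg_def)
    finally show "Sg t (r *\<^sub>R U) = r *\<^sub>R Sg t U" .
    have "norm (Sg t U) \<le> M * norm (P U)" using M[OF rho_in] by (simp add: Sg_def J_rho)
    also have "\<dots> \<le> \<bar>M\<bar> * norm (P U)" by (intro mult_right_mono) auto
    also have "\<dots> \<le> \<bar>M\<bar> * (norm U * K)" by (intro mult_left_mono K) auto
    finally show "norm (Sg t U) \<le> norm U * (\<bar>M\<bar> * K)" by (simp add: mult_ac)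
  qed
qed

lemma Sg_P: "t > 0 \<Longrightarrow> Sg t (P U) = Sg t U"
  unfolding Sg_def by (rule S_cong) (simp_all add: rho_in J_rho P_idem)

lemma P_Sg: "t > 0 \<Longrightarrow> P (Sg t U) = Sg t U"
  unfolding Sg_def by (rule P_J[OF S_in[OF _ rho_in]])

lemma Sg_add: assumes "s > 0" "t > 0" shows "Sg (s + t) U = Sg s (Sg t U)"
proof -
  have "AE x in lebesgue_on \<Omega>. S (s + t) (rho U) x = S s (S t (rho U)) x"
    using C0 assms rho_in by (simp add: C0_semigroup_def)
  then have "Sg (s + t) U = J (S s (S t (rho U)))"
    unfolding Sg_def using assms by (subst J_eq_iff) (auto intro!: S_in rho_in)
  then show ?thesis using J_S[OF assms(1) S_in[OF assms(2) rho_in]] by (simp add: Sg_def)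
qed

lemma Sg_lim: "((\<lambda>t. Sg t U) \<longlongrightarrow> P U) (at_right 0)"
proof -
  have "((\<lambda>t. L2_norm \<Omega> (\<lambda>x. S t (rho U) x - rho U x)) \<longlongrightarrow> 0) (at_right 0)"
    using C0 rho_in by (simp add: C0_semigroup_def)
  moreover have "eventually (\<lambda>t. L2_norm \<Omega> (\<lambda>x. S t (rho U) x - rho U x) = norm (Sg t U - P U)) (at_right 0)"
    using eventually_at_right_less[of "0::real"]
    by eventually_elim (simp add: L2_norm_eq L2Y_diff S_in rho_in J_diff J_rho Sg_def)
  ultimately have "((\<lambda>t. norm (Sg t U - P U)) \<longlongrightarrow> 0) (at_right 0)" by (rule Lim_transform_eventually)
  then show ?thesis by (rule LIM_zero_cancel[OF tendsto_norm_zero_cancel])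
qed

lemma generator_iff:
  assumes U: "P U = U" and h: "P h = h"
  shows "((\<lambda>t. (1 / t) *\<^sub>R (Sg t U - U)) \<longlongrightarrow> - h) (at_right 0) \<longleftrightarrow>
    (rho U, \<lambda>x. - rho h x) \<in> generator \<Omega> (ell2_on Y) S"
proof -
  have mh: "(\<lambda>x. - rho h x) \<in> L2Y" using L2Y_scaleR[OF rho_in, of "-1" h] by simp
  have Jmh: "J (\<lambda>x. - rho h x) = - h" using J_scaleR[OF rho_in, of "-1" h] J_rho_id[OF h] by simp
  let ?D = "\<lambda>t x. (1 / t) *\<^sub>R (S t (rho U) x - rho U x) - (- rho h x)"
  have ev: "eventually (\<lambda>t. L2_norm \<Omega> (?D t) = norm ((1 / t) *\<^sub>R (Sg t U - U) - (- h))) (at_right 0)"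
    using eventually_at_right_less[of "0::real"]
  proof eventually_elim
    case (elim t)
    have d: "(\<lambda>x. S t (rho U) x - rho U x) \<in> L2Y" by (intro L2Y_diff S_in rho_in elim)
    have s: "(\<lambda>x. (1 / t) *\<^sub>R (S t (rho U) x - rho U x)) \<in> L2Y" by (rule L2Y_scaleR[OF d])
    have "J (?D t) = J (\<lambda>x. (1 / t) *\<^sub>R (S t (rho U) x - rho U x)) - J (\<lambda>x. - rho h x)" by (rule J_diff[OF s mh])
    also have "\<dots> = (1 / t) *\<^sub>R (J (S t (rho U)) - J (rho U)) - (- h)"
      by (simp only: Jmh J_scaleR[OF d] J_diff[OF S_in[OF elim rho_in] rho_in])
    finally show ?case using L2_norm_eq[OF L2Y_diff[OF s mh]] by (simp only: Sg_def J_rho_id[OF U])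
  qed
  have "(rho U, \<lambda>x. - rho h x) \<in> generator \<Omega> (ell2_on Y) S \<longleftrightarrow> ((\<lambda>t. L2_norm \<Omega> (?D t)) \<longlongrightarrow> 0) (at_right 0)"
    using rho_in mh by (simp add: generator_def)
  also have "\<dots> \<longleftrightarrow> ((\<lambda>t. norm ((1 / t) *\<^sub>R (Sg t U - U) - (- h))) \<longlongrightarrow> 0) (at_right 0)"
    by (rule tendsto_cong[OF ev])
  also have "\<dots> \<longleftrightarrow> ((\<lambda>t. (1 / t) *\<^sub>R (Sg t U - U)) \<longlongrightarrow> - h) (at_right 0)"
    by (simp only: tendsto_norm_zero_iff LIM_zero_iff)
  finally show ?thesis by (rule sym)
qed

text \<open>The equation between real parts for all \<open>v\<close> contains the one between imaginary parts, because the form domain is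
  invariant under multiplication by \<open>\<i>\<close>.\<close>

lemma operator_iff:
  assumes U: "P U = U" and h: "P h = h"
  shows "(rho U, rho h) \<in> associated_operator \<Omega> Y V (elliptic_form \<Omega> Y C) \<longleftrightarrow>
    (\<exists>g. (U, g) \<in> W \<and> (\<forall>(v, k) \<in> W. B g \<bullet> k = h \<bullet> v))"
proof
  assume A: "(rho U, rho h) \<in> associated_operator \<Omega> Y V (elliptic_form \<Omega> Y C)"
  then have UV: "rho U \<in> V" by (simp add: associated_operator_def)
  have "B (grad (rho U)) \<bullet> k = h \<bullet> v" if vk: "(v, k) \<in> W" for v k
  proof -
    have "elliptic_form \<Omega> Y C (rho U) (rho v) = L2_inner \<Omega> (rho h) (rho v)"
      using A rho_V(1)[OF vk] by (simp add: associated_operator_def)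
    then show ?thesis
      unfolding elliptic_form_eq[OF V_grad(1)[OF UV] V_grad(1)[OF rho_V(1)[OF vk]]] L2_inner_eq[OF rho_in rho_in]
        rho_V(2,3)[OF vk] J_rho_id[OF h] by simp
  qed
  moreover have "(U, grad (rho U)) \<in> W" using V_grad(2)[OF UV] J_rho_id[OF U] by simp
  ultimately show "\<exists>g. (U, g) \<in> W \<and> (\<forall>(v, k) \<in> W. B g \<bullet> k = h \<bullet> v)" by blast
next
  assume "\<exists>g. (U, g) \<in> W \<and> (\<forall>(v, k) \<in> W. B g \<bullet> k = h \<bullet> v)"
  then obtain g where g: "(U, g) \<in> W" and eq: "\<And>v k. (v, k) \<in> W \<Longrightarrow> B g \<bullet> k = h \<bullet> v" by blast
  have "elliptic_form \<Omega> Y C (rho U) v = L2_inner \<Omega> (rho h) v" if v: "v \<in> V" for v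
  proof -
    have vL: "v \<in> L2Y" using v by (simp add: V_iff)
    show ?thesis
      unfolding elliptic_form_eq[OF V_grad(1)[OF rho_V(1)[OF g]] V_grad(1)[OF v]] L2_inner_eq[OF rho_in vL]
        rho_V(2)[OF g] J_rho_id[OF h] eq[OF V_grad(2)[OF v]] eq[OF W_I[OF V_grad(2)[OF v]]] ..
  qed
  then show "(rho U, rho h) \<in> associated_operator \<Omega> Y V (elliptic_form \<Omega> Y C)"
    using rho_V(1)[OF g] rho_in by (simp add: associated_operator_def)
qed

sublocale fs: form_semigroup P Sg W B \<mu>
proof (rule form_semigroup.intro)
  show "((\<lambda>t. (1 / t) *\<^sub>R (Sg t U - U)) \<longlongrightarrow> - h) (at_right 0) \<longleftrightarrow>
      (\<exists>g. (U, g) \<in> W \<and> (\<forall>(v, k) \<in> W. B g \<bullet> k = h \<bullet> v))" if U: "P U = U" and h: "P h = h" for U h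
  proof -
    have "(rho U, \<lambda>x. - rho h x) \<in> generator \<Omega> (ell2_on Y) S \<longleftrightarrow>
        (\<exists>u h'. (rho U, \<lambda>x. - rho h x) = (u, \<lambda>x. - h' x) \<and> (u, h') \<in> associated_operator \<Omega> Y V (elliptic_form \<Omega> Y C))"
      using generated by (simp add: generated_by_minus_def)
    also have "\<dots> \<longleftrightarrow> (rho U, rho h) \<in> associated_operator \<Omega> Y V (elliptic_form \<Omega> Y C)"
      by (auto simp: fun_eq_iff) (metis ext)
    finally show ?thesis unfolding generator_iff[OF U h] operator_iff[OF U h] .
  qed
  show "G = 0" if "(0, G) \<in> W" for G by (rule W1_graph[OF W_W1[OF that]])
  show "\<mu> * (norm G)\<^sup>2 \<le> B G \<bullet> G" if "(U, G) \<in> W" for U G by (rule B_coercive[OF W_P(2)[OF that]])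
qed (simp_all add: P_lin P_idem Sg_lin Sg_P P_Sg Sg_add Sg_lim W_subspace W_closed W_P(1) B_lin \<mu>_pos)

end

section \<open>The positive cone\<close>

text \<open>The nearest point with nonnegative coordinates; for a complex number it is the positive part of the real part.\<close>

definition pos_part :: "ell2 \<Rightarrow> ell2" where
  "pos_part f = Abs_ell2 (\<lambda>n. complex_of_real (max 0 (Re (ell2_nth f n))))"

lemma ell2_nth_pos_part [simp]: "ell2_nth (pos_part f) n = complex_of_real (max 0 (Re (ell2_nth f n)))"
proof -
  have "(max 0 (Re z))\<^sup>2 \<le> (cmod z)\<^sup>2" for z
    using abs_Re_le_cmod[of z] by (intro power_mono) auto
  then have "square_summable (\<lambda>n. complex_of_real (max 0 (Re (ell2_nth f n))))"
    unfolding square_summable_def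
    by (intro summable_comparison_test[OF _ square_summable_ell2_nth[of f, unfolded square_summable_def]]) auto
  then show ?thesis unfolding pos_part_def by (subst Abs_ell2_inverse) auto
qed

lemma inner_ell2_nonneg:
  assumes "\<And>n. 0 \<le> Re (ell2_nth f n * cnj (ell2_nth g n))" shows "0 \<le> f \<bullet> g"
  unfolding inner_ell2_def Re_cinner by (rule suminf_nonneg[OF summable_Re_cinner assms])

lemma inner_ell2_eq_0:
  assumes "\<And>n. Re (ell2_nth f n * cnj (ell2_nth g n)) = 0" shows "f \<bullet> g = 0"
  unfolding inner_ell2_def Re_cinner assms by simp

lemma pos_part_orth: "pos_part f \<bullet> (f - pos_part f) = 0"
  by (rule inner_ell2_eq_0) (simp add: max_def)

lemma pos_part_polar: assumes "\<And>n. ell2_nth c n \<in> \<real>\<^sub>\<ge>\<^sub>0" shows "c \<bullet> (f - pos_part f) \<le> 0"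
proof -
  have "0 \<le> c \<bullet> (pos_part f - f)"
    using assms by (intro inner_ell2_nonneg) (auto simp: complex_nonneg_Reals_iff)
  then show ?thesis by (simp add: inner_diff_right)
qed

lemma norm_pos_part_le: "norm (pos_part f) \<le> norm f"
proof -
  have "norm (pos_part f) * norm (pos_part f) = pos_part f \<bullet> f"
    using pos_part_orth[of f] by (simp add: inner_diff_right flip: power2_norm_eq_inner power2_eq_square)
  also have "\<dots> \<le> norm (pos_part f) * norm f" by (rule norm_cauchy_schwarz)
  finally show ?thesis by (cases "norm (pos_part f) = 0") (auto simp: mult_le_cancel_left)
qed

lemma sq_int_pos_part: assumes "sq_int u" shows "sq_int (\<lambda>x. pos_part (u x))"
proof (rule sq_int_bound)
  show "integrable lebesgue (\<lambda>x. (norm (u x))\<^sup>2)" using assms by (simp add: sq_int_def)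
  show "(norm (pos_part (u x)))\<^sup>2 \<le> (norm (u x))\<^sup>2" for x by (intro power_mono norm_pos_part_le) simp
  show "(\<lambda>x. pos_part (u x)) \<in> borel_measurable lebesgue"
  proof (rule borel_measurable_ell2_coordinates)
    fix n
    have "continuous_on UNIV (\<lambda>f. ell2_nth f n)" by (rule linear_continuous_on[OF bounded_linear_ell2_nth])
    then have "continuous_on UNIV (\<lambda>f. complex_of_real (max 0 (Re (ell2_nth f n))))" by (intro continuous_intros)
    then have "(\<lambda>f. complex_of_real (max 0 (Re (ell2_nth f n)))) \<in> borel_measurable borel"
      by (rule borel_measurable_continuous_onI)
    from measurable_compose[OF _ this, of u lebesgue]
    show "(\<lambda>x. ell2_nth (pos_part (u x)) n) \<in> borel_measurable lebesgue" using assms by (simp add: sq_int_def)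
  qed
qed

context l2_domain
begin

definition cone :: "(real^'d) l2v set" where
  "cone = {U. P U = U \<and> (AE x in lebesgue. \<forall>n. ell2_nth (l2_rep U x) n \<in> \<real>\<^sub>\<ge>\<^sub>0)}"

definition cone_proj :: "(real^'d) l2v \<Rightarrow> (real^'d) l2v" where
  "cone_proj U = l2_abs (\<lambda>x. pos_part (l2_rep U x))"

lemma cone_P: "U \<in> cone \<Longrightarrow> P U = U" by (simp add: cone_def)

lemma cone_AE: "U \<in> cone \<Longrightarrow> AE x in lebesgue. \<forall>n. ell2_nth (l2_rep U x) n \<in> \<real>\<^sub>\<ge>\<^sub>0" by (simp add: cone_def)

lemma cone_proj_rep: "AE x in lebesgue. l2_rep (cone_proj U) x = pos_part (l2_rep U x)"
  unfolding cone_proj_def by (intro l2_rep_abs sq_int_pos_part sq_int_l2_rep)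

lemma inner_nonneg_AE: "(AE x in lebesgue. 0 \<le> l2_rep U x \<bullet> l2_rep V x) \<Longrightarrow> 0 \<le> U \<bullet> V"
  unfolding inner_l2v_def by (rule integral_nonneg_AE)

lemma inner_eq_0_AE: "(AE x in lebesgue. l2_rep U x \<bullet> l2_rep V x = 0) \<Longrightarrow> U \<bullet> V = 0"
  unfolding inner_l2v_def by (rule integral_eq_zero_AE)

lemma P_coord:
  assumes U: "P U = U" shows "AE x in lebesgue. \<forall>n. n \<notin> Y \<or> x \<notin> \<Omega> \<longrightarrow> ell2_nth (l2_rep U x) n = 0"
  using P_rep[of U] unfolding U by eventually_elim (metis ell2_nth_restr ell2_nth_simps(1))

lemma cone_proj_in: assumes U: "P U = U" shows "cone_proj U \<in> cone"
proof -
  have "P (cone_proj U) = cone_proj U"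
    by (rule l2_eqI, use P_rep[of "cone_proj U"] cone_proj_rep[of U] P_coord[OF U] in eventually_elim)
      (auto intro!: ell2_eqI)
  moreover have "AE x in lebesgue. \<forall>n. ell2_nth (l2_rep (cone_proj U) x) n \<in> \<real>\<^sub>\<ge>\<^sub>0"
    using cone_proj_rep[of U] by eventually_elim (simp add: complex_nonneg_Reals_iff)
  ultimately show ?thesis by (simp add: cone_def)
qed

lemma cone_proj_polar: assumes "c \<in> cone" shows "c \<bullet> (U - cone_proj U) \<le> 0"
proof -
  have "0 \<le> c \<bullet> (cone_proj U - U)"
    by (rule inner_nonneg_AE, use cone_AE[OF assms] cone_proj_rep[of U] l2_rep_diff[of "cone_proj U" U] in eventually_elim)
      (use pos_part_polar in \<open>simp add: inner_diff_right\<close>)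
  then show ?thesis by (simp add: inner_diff_right)
qed

lemma cone_proj_orth: "cone_proj U \<bullet> (U - cone_proj U) = 0"
  by (rule inner_eq_0_AE, use cone_proj_rep[of U] l2_rep_diff[of U "cone_proj U"] in eventually_elim)
    (simp add: pos_part_orth)

lemma cone_iff: "u \<in> L2_ell2_cone \<Omega> Y \<longleftrightarrow> u \<in> L2Y \<and> J u \<in> cone"
proof (cases "u \<in> L2Y")
  case True
  have "(AE x in lebesgue. \<forall>n. ell2_nth (l2_rep (J u) x) n \<in> \<real>\<^sub>\<ge>\<^sub>0) \<longleftrightarrow>
     (AE x in lebesgue. \<forall>n. ell2_nth (ext_zero \<Omega> u x) n \<in> \<real>\<^sub>\<ge>\<^sub>0)"
    using J_rep[OF True] by (auto elim: eventually_elim2)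
  also have "\<dots> \<longleftrightarrow> (AE x in lebesgue. x \<in> \<Omega> \<longrightarrow> (\<forall>y\<in>Y. ell2_nth (u x) y \<in> \<real>\<^sub>\<ge>\<^sub>0))"
  proof (intro arg_cong[where f = "almost_everywhere lebesgue"] ext)
    fix x
    have "ell2_nth (u x) n = 0" if "x \<in> \<Omega>" "n \<notin> Y" for n
      using True that by (simp add: L2_fun_iff ell2_on_def)
    then show "(\<forall>n. ell2_nth (ext_zero \<Omega> u x) n \<in> \<real>\<^sub>\<ge>\<^sub>0) = (x \<in> \<Omega> \<longrightarrow> (\<forall>y\<in>Y. ell2_nth (u x) y \<in> \<real>\<^sub>\<ge>\<^sub>0))"
    proof (cases "x \<in> \<Omega>")
      case True
      then have "ell2_nth (u x) n \<in> \<real>\<^sub>\<ge>\<^sub>0" if "n \<notin> Y" for n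
        using \<open>\<And>n. x \<in> \<Omega> \<Longrightarrow> n \<notin> Y \<Longrightarrow> ell2_nth (u x) n = 0\<close> that by simp
      then show ?thesis using True by auto
    qed simp
  qed
  finally show ?thesis using True P_J[OF True] by (simp add: L2_ell2_cone_def cone_def AE_domain_iff)
qed (simp add: L2_ell2_cone_def)

lemma I_rep: "AE x in lebesgue. l2_rep (I U) x = \<i> *\<^sub>C l2_rep U x"
  unfolding I_def by (rule fibre_op_rep[OF I_field])

lemma move_rep: "AE x in lebesgue. l2_rep (move m p U) x = coord_move m p (l2_rep U x)"
  unfolding move_def by (rule fibre_op_rep[OF move_field])

lemma cone_move: assumes "U \<in> cone" "m \<in> Y" shows "move m p U \<in> cone"
proof -
  have "AE x in lebesgue. \<forall>n. ell2_nth (l2_rep (move m p U) x) n \<in> \<real>\<^sub>\<ge>\<^sub>0"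
    using cone_AE[OF assms(1)] move_rep[of m p U] by eventually_elim simp
  then show ?thesis using P_move[OF cone_P] assms by (simp add: cone_def)
qed

lemma cone_inner_nonneg: assumes "U \<in> cone" "V \<in> cone" shows "0 \<le> U \<bullet> V"
  by (rule inner_nonneg_AE, use cone_AE[OF assms(1)] cone_AE[OF assms(2)] in eventually_elim)
    (auto intro!: inner_ell2_nonneg simp: complex_nonneg_Reals_iff)

lemma cone_inner_I: assumes "U \<in> cone" "V \<in> cone" shows "U \<bullet> I V = 0"
  by (rule inner_eq_0_AE, use cone_AE[OF assms(1)] cone_AE[OF assms(2)] I_rep[of V] in eventually_elim)
    (auto intro!: inner_ell2_eq_0 simp: complex_nonneg_Reals_iff)

lemma move_move_orth: assumes "m \<noteq> n" shows "move m p U \<bullet> move n q V = 0"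
  by (rule inner_eq_0_AE, use move_rep[of m p U] move_rep[of n q V] in eventually_elim)
    (use assms in \<open>auto intro!: inner_ell2_eq_0\<close>)

lemma I_move: "I (move m p U) = move m p (I U)"
  by (rule l2_eqI, use I_rep[of "move m p U"] move_rep[of m p U] I_rep[of U] move_rep[of m p "I U"] in eventually_elim)
    (simp add: coord_move_scaleC)

text \<open>The projection sees only real parts, and the imaginary part of \<open>U\<close> is the real part of \<open>-\<i> U\<close>.\<close>

lemma cone_decomposition: "U = (cone_proj U - cone_proj (- U)) + I (cone_proj (- I U) - cone_proj (I U))"
proof (rule l2_eqI)
  let ?A = "cone_proj U - cone_proj (- U)" and ?B = "cone_proj (- I U) - cone_proj (I U)"
  show "AE x in lebesgue. l2_rep U x = l2_rep (?A + I ?B) x"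
    using l2_rep_add[of ?A "I ?B"] I_rep[of ?B] l2_rep_diff[of "cone_proj U" "cone_proj (- U)"]
      l2_rep_diff[of "cone_proj (- I U)" "cone_proj (I U)"] cone_proj_rep[of U] cone_proj_rep[of "- U"]
      cone_proj_rep[of "- I U"] cone_proj_rep[of "I U"] l2_rep_minus[of U] l2_rep_minus[of "I U"] I_rep[of U]
    by eventually_elim (auto intro!: ell2_eqI complex_eqI simp: max_def)
qed

lemma move_zero: assumes "P U = U" "m \<notin> Y" shows "move n m U = 0"
  by (rule l2_eqI, use move_rep[of n m U] P_coord[OF assms(1)] l2_rep_zero in eventually_elim)
    (use assms in \<open>auto intro!: ell2_eqI\<close>)

lemma sum_move_tendsto: "(\<lambda>N. \<Sum>m<N. move m m U) \<longlonglongrightarrow> U"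
proof -
  let ?u = "l2_rep U"
  let ?s = "\<lambda>N x. \<Sum>m<N. coord_move m m (?u x)"
  have nth: "ell2_nth (?s N x) n = (if n < N then ell2_nth (?u x) n else 0)" for N x n
    by (simp add: ell2_nth_sum if_distrib cong: if_cong)
  have s: "sq_int (?s N)" for N
  proof (induction N)
    case (Suc N)
    then show ?case using sq_int_add[OF Suc sq_int_fibre[OF move_field sq_int_l2_rep]] by simp
  qed (simp add: sq_int_zero)
  have abs: "(\<Sum>m<N. move m m U) = l2_abs (?s N)" for N
  proof (induction N)
    case (Suc N)
    then show ?case
      using l2_abs_add[OF s sq_int_fibre[OF move_field sq_int_l2_rep], of N N N U] by (simp add: move_def fibre_op_def)
  qed (simp add: zero_l2v_def)
  have "(\<lambda>N. \<integral>x. (norm (?s N x - ?u x))\<^sup>2 \<partial>lebesgue) \<longlonglongrightarrow> (\<integral>x. 0 \<partial>(lebesgue :: (real^'d) measure))"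
  proof (rule integral_dominated_convergence[where w = "\<lambda>x. (norm (?u x))\<^sup>2"])
    show "integrable lebesgue (\<lambda>x. (norm (?u x))\<^sup>2)" using sq_int_l2_rep by (simp add: sq_int_def)
    show "(\<lambda>x. (norm (?s N x - ?u x))\<^sup>2) \<in> borel_measurable lebesgue" for N
      using sq_int_diff[OF s sq_int_l2_rep, of N U] by (auto simp: sq_int_def)
    have "(\<lambda>N. (norm (?s N x - ?u x))\<^sup>2) \<longlonglongrightarrow> 0" for x
    proof -
      have "(\<lambda>N. ?s N x) \<longlonglongrightarrow> ?u x" using ell2_partial_sums[of "?u x"] by (simp add: coord_move_def)
      then have "(\<lambda>N. (norm (?s N x - ?u x))\<^sup>2) \<longlonglongrightarrow> (norm (?u x - ?u x))\<^sup>2" by (intro tendsto_intros)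
      then show ?thesis by simp
    qed
    then show "AE x in lebesgue. (\<lambda>N. (norm (?s N x - ?u x))\<^sup>2) \<longlonglongrightarrow> 0" by simp
    have "(norm (?s N x - ?u x))\<^sup>2 \<le> (norm (?u x))\<^sup>2" for N x
      unfolding power2_norm_ell2
      by (rule suminf_le[OF _ square_summable_ell2_nth[unfolded square_summable_def] square_summable_ell2_nth[unfolded square_summable_def]])
        (simp add: nth)
    then show "AE x in lebesgue. norm ((norm (?s N x - ?u x))\<^sup>2) \<le> (norm (?u x))\<^sup>2" for N by simp
  qed simp
  then have "(\<lambda>N. (norm ((\<Sum>m<N. move m m U) - U))\<^sup>2) \<longlonglongrightarrow> 0"
    using norm_l2_abs[OF sq_int_diff[OF s sq_int_l2_rep]] l2_abs_diff[OF s sq_int_l2_rep] by (simp add: abs)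
  then have "(\<lambda>N. sqrt ((norm ((\<Sum>m<N. move m m U) - U))\<^sup>2)) \<longlonglongrightarrow> sqrt 0" by (rule tendsto_real_sqrt)
  then have "(\<lambda>N. norm ((\<Sum>m<N. move m m U) - U)) \<longlonglongrightarrow> 0" by simp
  then show ?thesis by (rule LIM_zero_cancel[OF tendsto_norm_zero_cancel])
qed

text \<open>Tested with \<open>\<i>\<close> times a real bump function, \<open>U\<close> pairs a real function with an imaginary one, which gives
  zero; so the imaginary part of \<open>G\<close> is orthogonal to all bump functions.\<close>

lemma weak_grad_real:
  assumes w: "weak_grad k U G" and U: "AE x in lebesgue. \<forall>n. Im (ell2_nth (l2_rep U x) n) = 0"
  shows "AE x in lebesgue. x \<in> \<Omega> \<longrightarrow> (\<forall>n. Im (ell2_nth (l2_rep G x) n) = 0)"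
proof -
  have "AE x in lebesgue. x \<in> \<Omega> \<longrightarrow> Re (ell2_nth (l2_rep G x) n * cnj \<i>) = 0" for n
  proof (rule ae_coord_zero_if_orthogonal)
    fix a b :: "real^'d" and j assume ab: "cbox a b \<subseteq> \<Omega>"
    let ?b = "\<lambda>x. complex_of_real (bump j a b x)"
    have t: "?b \<in> test" by (rule bump_test[OF ab])
    have pb: "partial_deriv k (\<lambda>x. - \<i> * ?b x) x = - \<i> * complex_of_real (partial_deriv k (bump j a b) x)" if x: "x \<in> \<Omega>" for x
    proof -
      have "bump j a b differentiable at x" using C_on_bump[OF open_domain, of "Suc 0" j a b] x by simp
      then have "partial_deriv k ?b x = complex_of_real (partial_deriv k (bump j a b) x)"
        by (rule partial_deriv_linear(1)[OF bounded_linear_of_real])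
      then show ?thesis by (simp only: partial_mult[OF t x])
    qed
    have "G \<bullet> tvec n (\<lambda>x. \<i> * ?b x) = - (U \<bullet> tvec n (\<lambda>x. cnj (partial_deriv k (\<lambda>x. - \<i> * ?b x) x)))"
      using w[unfolded weak_grad_def, rule_format, OF test_mult[OF t, of "- \<i>"], of n] by simp
    also have "tvec n (\<lambda>x. cnj (partial_deriv k (\<lambda>x. - \<i> * ?b x) x)) = tvec n (\<lambda>x. \<i> * complex_of_real (partial_deriv k (bump j a b) x))"
      by (rule tvec_cong) (simp only: pb, simp)
    also have "U \<bullet> \<dots> = 0"
    proof (rule inner_eq_0_AE)
      have t': "(\<lambda>x. cnj (partial_deriv k (\<lambda>x. - \<i> * ?b x) x)) \<in> test"
        by (intro test_cnj test_partial test_mult t)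
      have eq: "ext_zero \<Omega> (\<lambda>x. cnj (partial_deriv k (\<lambda>x. - \<i> * ?b x) x) *\<^sub>C unit_vec n)
          = ext_zero \<Omega> (\<lambda>x. (\<i> * complex_of_real (partial_deriv k (bump j a b) x)) *\<^sub>C unit_vec n)"
      proof
        fix x
        have "cnj (partial_deriv k (\<lambda>x. - \<i> * ?b x) x) = \<i> * complex_of_real (partial_deriv k (bump j a b) x)" if "x \<in> \<Omega>"
          by (simp only: pb[OF that], simp)
        then show "ext_zero \<Omega> (\<lambda>x. cnj (partial_deriv k (\<lambda>x. - \<i> * ?b x) x) *\<^sub>C unit_vec n) x
            = ext_zero \<Omega> (\<lambda>x. (\<i> * complex_of_real (partial_deriv k (bump j a b) x)) *\<^sub>C unit_vec n) x"
          by (cases "x \<in> \<Omega>") (simp_all only: ext_zero_simps not_False_eq_True)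
      qed
      have "AE x in lebesgue. l2_rep (tvec n (\<lambda>x. \<i> * complex_of_real (partial_deriv k (bump j a b) x))) x
          = ext_zero \<Omega> (\<lambda>x. (\<i> * complex_of_real (partial_deriv k (bump j a b) x)) *\<^sub>C unit_vec n) x"
        unfolding tvec_def J_def using l2_rep_abs[OF test_sq_int[OF t', of n]] unfolding eq .
      then show "AE x in lebesgue. l2_rep U x \<bullet> l2_rep (tvec n (\<lambda>x. \<i> * complex_of_real (partial_deriv k (bump j a b) x))) x = 0"
        using U
      proof eventually_elim
        case (elim x)
        then show ?case by (cases "x \<in> \<Omega>") (simp_all add: inner_unit_vec)
      qed
    qed
    finally show "G \<bullet> tvec n (\<lambda>x. \<i> * ?b x) = 0" by simp
  qed
  then have "AE x in lebesgue. \<forall>n. x \<in> \<Omega> \<longrightarrow> Re (ell2_nth (l2_rep G x) n * cnj \<i>) = 0"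
    unfolding AE_all_countable by blast
  then show ?thesis by eventually_elim simp
qed

end

section \<open>Positivity decouples the coordinates\<close>

locale positive_problem = elliptic_problem \<Omega> Y C \<mu> V S
  for \<Omega> :: "(real^'d::finite) set" and Y :: "nat set"
    and C :: "'d \<Rightarrow> 'd \<Rightarrow> real^'d \<Rightarrow> ell2 \<Rightarrow> ell2" and \<mu> :: real
    and V :: "(real^'d \<Rightarrow> ell2) set" and S :: "real \<Rightarrow> (real^'d \<Rightarrow> ell2) \<Rightarrow> (real^'d \<Rightarrow> ell2)" +
  assumes positive: "positive_semigroup (L2_ell2_cone \<Omega> Y) S"
begin

sublocale fsc: form_semigroup_cone P Sg W B \<mu> cone cone_proj
proof (rule form_semigroup_cone.intro[OF fs.form_semigroup_axioms], rule form_semigroup_cone_axioms.intro)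
  fix c t assume c: "c \<in> cone" and t: "(t::real) > 0"
  have "rho c \<in> L2_ell2_cone \<Omega> Y" using c rho_in J_rho_id[OF cone_P[OF c]] by (simp add: cone_iff)
  then have "S t (rho c) \<in> L2_ell2_cone \<Omega> Y" using positive t by (simp add: positive_semigroup_def)
  then show "Sg t c \<in> cone" by (simp add: cone_iff Sg_def)
qed (simp_all add: cone_P cone_proj_in cone_proj_polar cone_proj_orth)

text \<open>For \<open>v\<close> and \<open>u\<close> in the cone \<open>(u, \<i> v)\<close> is purely imaginary, so the inequality applies to \<open>\<i> v\<close> and to
  \<open>- \<i> v\<close>.\<close>

lemma orth_cone_form:
  assumes u: "(u, g) \<in> W" and v: "(v, k) \<in> W" and uC: "u \<in> cone" and vC: "v \<in> cone" and uv: "u \<bullet> v = 0"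
  shows "B g \<bullet> k \<le> 0" "B g \<bullet> vec_op I k = 0"
proof -
  show "B g \<bullet> k \<le> 0"
    by (rule fsc.cone_form_nonpos[OF u v uC cone_inner_nonneg[OF _ vC] uv])
  have "B g \<bullet> vec_op I k \<le> 0"
    by (rule fsc.cone_form_nonpos[OF u W_I[OF v] uC]) (simp_all add: cone_inner_I uC vC)
  moreover have "(- I v, - vec_op I k) \<in> W"
    using subspace_neg[OF W_subspace W_I[OF v]] by simp
  from fsc.cone_form_nonpos[OF u this uC] have "B g \<bullet> (- vec_op I k) \<le> 0"
    by (simp add: cone_inner_I uC vC)
  ultimately show "B g \<bullet> vec_op I k = 0" by simp
qed

text \<open>The real matrix entry through which the form couples coordinate \<open>m\<close> to coordinate \<open>n\<close>.\<close>

definition coupling :: "nat \<Rightarrow> nat \<Rightarrow> 'd \<Rightarrow> 'd \<Rightarrow> real^'d \<Rightarrow> real" where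
  "coupling m n k l x = Re (ell2_nth (F k l x (unit_vec m)) n)"

abbreviation rvec :: "nat \<Rightarrow> (real^'d \<Rightarrow> real) \<Rightarrow> (real^'d) l2v" where
  "rvec m f \<equiv> tvec m (\<lambda>x. complex_of_real (f x))"

lemma tvec_rep: "g \<in> test \<Longrightarrow> AE x in lebesgue. l2_rep (tvec m g) x = ext_zero \<Omega> (\<lambda>x. g x *\<^sub>C unit_vec m) x"
  unfolding tvec_in by (intro l2_rep_abs test_sq_int)

lemma rvec_cone:
  assumes f: "(\<lambda>x. complex_of_real (f x)) \<in> test" and m: "m \<in> Y" and nonneg: "\<And>x. x \<in> \<Omega> \<Longrightarrow> 0 \<le> f x"
  shows "rvec m f \<in> cone"
proof -
  have "AE x in lebesgue. \<forall>n. ell2_nth (l2_rep (rvec m f) x) n \<in> \<real>\<^sub>\<ge>\<^sub>0"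
    using tvec_rep[OF f, of m]
  proof eventually_elim
    case (elim x)
    then show ?case using nonneg by (cases "x \<in> \<Omega>") auto
  qed
  then show ?thesis using W_P(1)[OF test_in_W[OF f m]] by (simp add: cone_def)
qed

lemma tvec_orth: assumes f: "f \<in> test" and g: "g \<in> test" and mn: "m \<noteq> n" shows "tvec m f \<bullet> tvec n g = 0"
  by (rule inner_eq_0_AE, use tvec_rep[OF f, of m] tvec_rep[OF g, of n] in eventually_elim)
    (use mn in \<open>auto simp: ext_zero_def intro!: inner_ell2_eq_0\<close>)

lemma coupling_outside: "x \<notin> \<Omega> \<Longrightarrow> coupling m n k l x = 0"
  by (simp add: coupling_def F_def)

lemma inner_F_rvec:
  assumes f: "(\<lambda>x. complex_of_real (f x)) \<in> test" and g: "(\<lambda>x. complex_of_real (g x)) \<in> test"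
  shows "integrable lebesgue (\<lambda>x. f x * g x * coupling m n k l x)"
    and "fibre_op (F k l) (rvec m f) \<bullet> rvec n g = (\<integral>x. f x * g x * coupling m n k l x \<partial>lebesgue)"
proof -
  let ?f = "ext_zero \<Omega> (\<lambda>x. complex_of_real (f x) *\<^sub>C unit_vec m)"
  let ?g = "ext_zero \<Omega> (\<lambda>x. complex_of_real (g x) *\<^sub>C unit_vec n)"
  have s: "sq_int (\<lambda>x. F k l x (?f x))" "sq_int ?g"
    by (intro sq_int_fibre[OF F_field] test_sq_int f g)+
  have eq: "F k l x (?f x) \<bullet> ?g x = f x * g x * coupling m n k l x" for x
  proof (cases "x \<in> \<Omega>")
    case True
    then show ?thesis by (simp add: F_scaleC inner_unit_vec coupling_def)
  qed (simp add: coupling_outside)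
  show "integrable lebesgue (\<lambda>x. f x * g x * coupling m n k l x)"
    using integrable_inner_sq_int[OF s] unfolding eq .
  show "fibre_op (F k l) (rvec m f) \<bullet> rvec n g = (\<integral>x. f x * g x * coupling m n k l x \<partial>lebesgue)"
    using inner_l2_abs[OF s] unfolding eq tvec_in[OF f] tvec_in[OF g] fibre_op_abs[OF F_field test_sq_int[OF f]] .
qed

lemma norm_mono_AE:
  fixes X Z :: "(real^'d) l2v"
  assumes "AE x in lebesgue. norm (l2_rep X x) \<le> r * norm (l2_rep Z x)" "r \<ge> 0" shows "norm X \<le> r * norm Z"
proof (rule power2_le_imp_le)
  have "(norm X)\<^sup>2 \<le> (\<integral>x. r\<^sup>2 * (norm (l2_rep Z x))\<^sup>2 \<partial>lebesgue)"
    unfolding norm_l2_rep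
  proof (rule integral_mono_AE)
    show "AE x in lebesgue. (norm (l2_rep X x))\<^sup>2 \<le> r\<^sup>2 * (norm (l2_rep Z x))\<^sup>2"
      using assms(1) by eventually_elim (metis norm_ge_zero power_mono power_mult_distrib)
  qed (use sq_int_l2_rep[of X] sq_int_l2_rep[of Z] in \<open>auto simp: sq_int_def\<close>)
  then show "(norm X)\<^sup>2 \<le> (r * norm Z)\<^sup>2" by (simp add: norm_l2_rep[of Z] power_mult_distrib)
qed (use assms in simp)

definition wave :: "real \<Rightarrow> real^'d \<Rightarrow> real \<Rightarrow> real \<Rightarrow> real^'d \<Rightarrow> real" where
  "wave s \<xi> r \<theta> x = 1 + s * cos ((r *\<^sub>R \<xi>) \<bullet> x + \<theta>)"

text \<open>The gradient of a bump function times \<open>1 + s cos (r \<xi> \<cdot> x + \<theta>)\<close> is \<open>- s r \<beta> sin \<xi>\<close> up to a remainder whose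
  norm is bounded independently of the frequency \<open>r\<close>.\<close>

lemma wave_gradient:
  fixes a b \<xi> :: "real^'d" and r s \<theta> :: real and j m :: nat
  assumes ab: "cbox a b \<subseteq> \<Omega>" and m: "m \<in> Y" and s: "\<bar>s\<bar> = 1"
  defines "\<beta> \<equiv> bump j a b"
  defines "f \<equiv> \<lambda>x. \<beta> x * wave s \<xi> r \<theta> x" and "h \<equiv> \<lambda>x. \<beta> x * sin ((r *\<^sub>R \<xi>) \<bullet> x + \<theta>)"
  shows "(\<lambda>x. complex_of_real (f x)) \<in> test" "(\<lambda>x. complex_of_real (h x)) \<in> test" "\<And>x. 0 \<le> f x"
    and "norm ((\<chi> k. tvec m (partial_deriv k (\<lambda>x. complex_of_real (f x)))) + (s * r) *\<^sub>R (\<chi> k. \<xi> $ k *\<^sub>R rvec m h))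
      \<le> (\<Sum>k\<in>UNIV. 2 * norm (tvec m (partial_deriv k (\<lambda>x. complex_of_real (\<beta> x)))))"
    and "norm (\<chi> k. \<xi> $ k *\<^sub>R rvec m h) \<le> (\<Sum>k\<in>UNIV. \<bar>\<xi> $ k\<bar> * norm (rvec m \<beta>))"
proof -
  have Cw: "C_on i \<Omega> (wave s \<xi> r \<theta>)" for i
    unfolding wave_def
    by (intro C_on_add[OF open_domain] C_on_const C_on_bilinear[OF open_domain bounded_bilinear_mult] C_on_cos open_domain)
  show ft: "(\<lambda>x. complex_of_real (f x)) \<in> test"
    unfolding f_def \<beta>_def by (rule bump_Cc_infinity[OF open_domain ab Cw])
  have "C_on i \<Omega> (\<lambda>x. cos ((r *\<^sub>R \<xi>) \<bullet> x + (\<theta> - pi / 2)))" for i by (rule C_on_cos[OF open_domain])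
  moreover have "cos ((r *\<^sub>R \<xi>) \<bullet> x + (\<theta> - pi / 2)) = sin ((r *\<^sub>R \<xi>) \<bullet> x + \<theta>)" for x
    using cos_diff[of "(r *\<^sub>R \<xi>) \<bullet> x + \<theta>" "pi / 2"] by (simp add: add_diff_eq)
  ultimately have Cs: "C_on i \<Omega> (\<lambda>x. sin ((r *\<^sub>R \<xi>) \<bullet> x + \<theta>))" for i by simp
  show ht: "(\<lambda>x. complex_of_real (h x)) \<in> test"
    unfolding h_def \<beta>_def by (rule bump_Cc_infinity[OF open_domain ab Cs])
  have w: "0 \<le> wave s \<xi> r \<theta> x" "wave s \<xi> r \<theta> x \<le> 2" for x
  proof -
    have "\<bar>s * cos ((r *\<^sub>R \<xi>) \<bullet> x + \<theta>)\<bar> \<le> 1" using s by (simp add: abs_mult)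
    then show "0 \<le> wave s \<xi> r \<theta> x" "wave s \<xi> r \<theta> x \<le> 2" unfolding wave_def by linarith+
  qed
  show "0 \<le> f x" for x unfolding f_def \<beta>_def using w bump_bounds by (intro mult_nonneg_nonneg) auto
  have bt: "(\<lambda>x. complex_of_real (\<beta> x)) \<in> test" unfolding \<beta>_def by (rule bump_test[OF ab])
  have db: "\<beta> differentiable at x" if "x \<in> \<Omega>" for x
    using C_on_bump[OF open_domain, of "Suc 0" j a b] that by (simp add: \<beta>_def)
  have der: "((\<lambda>t. 1 + s * cos t) has_real_derivative - s * sin t) (at t)" for t
    by (auto intro!: derivative_eq_intros)
  have wd: "wave s \<xi> r \<theta> differentiable at x" "partial_deriv k (wave s \<xi> r \<theta>) x = (r * \<xi> $ k) * (- s * sin ((r *\<^sub>R \<xi>) \<bullet> x + \<theta>))" for k x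
    using has_derivative_ridge[OF der, where \<xi> = "r *\<^sub>R \<xi>" and x = x and \<theta> = \<theta>]
      partial_deriv_ridge[OF der, where k = k and \<xi> = "r *\<^sub>R \<xi>" and x = x and \<theta> = \<theta>]
    by (auto simp: wave_def[abs_def] differentiable_def)
  have pf: "partial_deriv k (\<lambda>x. complex_of_real (f x)) x
      = partial_deriv k (\<lambda>x. complex_of_real (\<beta> x)) x * complex_of_real (wave s \<xi> r \<theta> x)
        - complex_of_real (s * r * \<xi> $ k * h x)" if x: "x \<in> \<Omega>" for k x
  proof -
    have "partial_deriv k (\<lambda>x. complex_of_real (f x)) x = complex_of_real (partial_deriv k f x)"
      unfolding f_def by (rule partial_deriv_linear(1)[OF bounded_linear_of_real
          partial_deriv_bilinear(2)[OF bounded_bilinear_mult db[OF x] wd(1)]])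
    also have "partial_deriv k f x = \<beta> x * partial_deriv k (wave s \<xi> r \<theta>) x + partial_deriv k \<beta> x * wave s \<xi> r \<theta> x"
      unfolding f_def by (rule partial_deriv_bilinear(1)[OF bounded_bilinear_mult db[OF x] wd(1)])
    finally show ?thesis
      unfolding partial_deriv_linear(1)[OF bounded_linear_of_real db[OF x]] wd(2) h_def by (simp add: algebra_simps)
  qed
  have "norm (tvec m (partial_deriv k (\<lambda>x. complex_of_real (f x))) + (s * r) *\<^sub>R (\<xi> $ k *\<^sub>R rvec m h))
      \<le> 2 * norm (tvec m (partial_deriv k (\<lambda>x. complex_of_real (\<beta> x))))" for k
  proof (rule norm_mono_AE)
    let ?X = "tvec m (partial_deriv k (\<lambda>x. complex_of_real (f x)))"
    show "AE x in lebesgue. norm (l2_rep (?X + (s * r) *\<^sub>R (\<xi> $ k *\<^sub>R rvec m h)) x)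
        \<le> 2 * norm (l2_rep (tvec m (partial_deriv k (\<lambda>x. complex_of_real (\<beta> x)))) x)"
      using l2_rep_add[of ?X "(s * r) *\<^sub>R (\<xi> $ k *\<^sub>R rvec m h)"] l2_rep_scaleR[of "s * r" "\<xi> $ k *\<^sub>R rvec m h"]
        l2_rep_scaleR[of "\<xi> $ k" "rvec m h"] tvec_rep[OF test_partial[OF ft], of m k] tvec_rep[OF ht, of m]
        tvec_rep[OF test_partial[OF bt], of m k]
    proof eventually_elim
      case (elim x)
      show ?case
      proof (cases "x \<in> \<Omega>")
        case True
        have "l2_rep (?X + (s * r) *\<^sub>R (\<xi> $ k *\<^sub>R rvec m h)) x
            = (partial_deriv k (\<lambda>x. complex_of_real (\<beta> x)) x * complex_of_real (wave s \<xi> r \<theta> x)) *\<^sub>C unit_vec m"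
          unfolding elim(1) elim(2) elim(3) elim(4) elim(5) ext_zero_simps(1)[OF True] pf[OF True]
          by (rule ell2_eqI) (simp add: algebra_simps)
        then have "norm (l2_rep (?X + (s * r) *\<^sub>R (\<xi> $ k *\<^sub>R rvec m h)) x)
            = cmod (partial_deriv k (\<lambda>x. complex_of_real (\<beta> x)) x) * wave s \<xi> r \<theta> x"
          using w(1)[of x] by (simp add: norm_scaleC norm_mult)
        also have "\<dots> \<le> cmod (partial_deriv k (\<lambda>x. complex_of_real (\<beta> x)) x) * 2"
          by (intro mult_left_mono w) simp
        finally show ?thesis unfolding elim(6) ext_zero_simps(1)[OF True] by (simp add: norm_scaleC mult.commute)
      next
        case False
        then show ?thesis unfolding elim by simp
      qed
    qed
  qed simp
  then show "norm ((\<chi> k. tvec m (partial_deriv k (\<lambda>x. complex_of_real (f x)))) + (s * r) *\<^sub>R (\<chi> k. \<xi> $ k *\<^sub>R rvec m h))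
      \<le> (\<Sum>k\<in>UNIV. 2 * norm (tvec m (partial_deriv k (\<lambda>x. complex_of_real (\<beta> x)))))"
    by (intro order_trans[OF norm_vec_le_sum] sum_mono) simp
  have "norm (rvec m h) \<le> 1 * norm (rvec m \<beta>)"
  proof (rule norm_mono_AE)
    show "AE x in lebesgue. norm (l2_rep (rvec m h) x) \<le> 1 * norm (l2_rep (rvec m \<beta>) x)"
      using tvec_rep[OF ht, of m] tvec_rep[OF bt, of m]
    proof eventually_elim
      case (elim x)
      have "\<bar>h x\<bar> \<le> \<bar>\<beta> x\<bar>" unfolding h_def abs_mult using mult_left_mono[OF abs_sin_le_one abs_ge_zero, of "\<beta> x"] by simp
      then show ?case unfolding elim by (cases "x \<in> \<Omega>") (simp_all add: norm_scaleC)
    qed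
  qed simp
  then show "norm (\<chi> k. \<xi> $ k *\<^sub>R rvec m h) \<le> (\<Sum>k\<in>UNIV. \<bar>\<xi> $ k\<bar> * norm (rvec m \<beta>))"
    by (intro order_trans[OF norm_vec_le_sum] sum_mono) (simp add: mult_left_mono)
qed

text \<open>Insert \<open>\<beta> (1 + cos)\<close> in coordinate \<open>m\<close> and \<open>\<beta> (1 + s' cos)\<close>, with \<open>s' = \<plusminus>1\<close>, in coordinate \<open>n\<close>, so that the form is
  at most \<open>0\<close>.  Its term of order \<open>r\<^sup>2\<close> is \<open>s' r\<^sup>2\<close> times the integral of \<open>\<beta>\<^sup>2 sin\<^sup>2\<close> against the quadratic form, and all
  other terms are of order \<open>r\<close>.  The phases \<open>0\<close> and \<open>\<pi>/2\<close> together replace \<open>sin\<^sup>2\<close> by \<open>1\<close>, and \<open>r\<close> is arbitrarily large.\<close>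

lemma coupling_quadratic_form_integral:
  assumes ab: "cbox a b \<subseteq> \<Omega>" and m: "m \<in> Y" and n: "n \<in> Y" and mn: "m \<noteq> n"
  shows "(\<Sum>k\<in>UNIV. \<Sum>l\<in>UNIV. \<xi> $ k * \<xi> $ l * (\<integral>x. (bump j a b x)\<^sup>2 * coupling m n k l x \<partial>lebesgue)) = 0"
    (is "?N = 0")
proof -
  define \<beta> where "\<beta> = bump j a b"
  have bt: "(\<lambda>x. complex_of_real (\<beta> x)) \<in> test" unfolding \<beta>_def by (rule bump_test[OF ab])
  obtain K where K: "K \<ge> 0" "\<And>G. norm (B G) \<le> norm G * K" using bounded_linear.nonneg_bounded[OF B_lin] by blast
  note B_linear = bounded_linear.linear[OF B_lin]
  define A1 where "A1 = (\<lambda>p. \<Sum>k\<in>UNIV. 2 * norm (tvec p (partial_deriv k (\<lambda>x. complex_of_real (\<beta> x)))))"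
  define A2 where "A2 = (\<lambda>p. \<Sum>k\<in>UNIV. \<bar>\<xi> $ k\<bar> * norm (rvec p \<beta>))"
  define E where "E = A1 m + A2 m + A1 n + A2 n"
  have A0: "0 \<le> A1 p" "0 \<le> A2 p" for p by (auto simp: A1_def A2_def intro!: sum_nonneg)
  have key: "s' * r * ?N \<le> 6 * (K * E * E)" if r: "r \<ge> 1" and s': "\<bar>s'\<bar> = 1" for r s'
  proof -
    define h where "h = (\<lambda>\<theta> x. \<beta> x * sin ((r *\<^sub>R \<xi>) \<bullet> x + \<theta>))"
    \<comment> \<open>The vectors \<open>bb\<close> carry the order \<open>r\<close> of the gradients; \<open>E\<close> bounds them and the remainders \<open>aa\<close>.\<close>
    define bb where "bb = (\<lambda>p \<theta>. \<chi> k. \<xi> $ k *\<^sub>R rvec p (h \<theta>))"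
    have main: "s' * r * (B (bb m \<theta>) \<bullet> bb n \<theta>) \<le> 3 * (K * E * E)" for \<theta>
    proof -
      define f where "f = (\<lambda>s x. \<beta> x * wave s \<xi> r \<theta> x)"
      define gr where "gr = (\<lambda>p s. \<chi> k. tvec p (partial_deriv k (\<lambda>x. complex_of_real (f s x))))"
      define aa where "aa = (\<lambda>p s. gr p s + (s * r) *\<^sub>R bb p \<theta>)"
      have wg: "(\<lambda>x. complex_of_real (f s x)) \<in> test" "\<And>x. 0 \<le> f s x" "norm (aa p s) \<le> A1 p" "norm (bb p \<theta>) \<le> A2 p"
        if "p \<in> Y" "\<bar>s\<bar> = 1" for p s
        using wave_gradient[OF ab that, where j = j and \<xi> = \<xi> and r = r and \<theta> = \<theta>]
        unfolding f_def gr_def aa_def bb_def h_def A1_def A2_def \<beta>_def by blast+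
      have one: "\<bar>1::real\<bar> = 1" by simp
      have "B (gr m 1) \<bullet> gr n s' \<le> 0"
        unfolding gr_def
        by (rule orth_cone_form(1)[OF test_in_W[OF wg(1)[OF m one] m] test_in_W[OF wg(1)[OF n s'] n]
            rvec_cone[OF wg(1)[OF m one] m wg(2)[OF m one]] rvec_cone[OF wg(1)[OF n s'] n wg(2)[OF n s']]
            tvec_orth[OF wg(1)[OF m one] wg(1)[OF n s'] mn]])
      moreover have "gr p s = aa p s - (s * r) *\<^sub>R bb p \<theta>" for p s by (simp add: aa_def)
      ultimately have "B (aa m 1 - (1 * r) *\<^sub>R bb m \<theta>) \<bullet> (aa n s' - (s' * r) *\<^sub>R bb n \<theta>) \<le> 0" by simp
      then have le: "B (aa m 1) \<bullet> aa n s' - s' * r * (B (aa m 1) \<bullet> bb n \<theta>) - r * (B (bb m \<theta>) \<bullet> aa n s')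
          + r * (s' * r * (B (bb m \<theta>) \<bullet> bb n \<theta>)) \<le> 0"
        by (simp add: linear_diff[OF B_linear] linear_scale[OF B_linear] inner_diff_left inner_diff_right algebra_simps)
      have bound: "\<bar>B x \<bullet> z\<bar> \<le> K * E * E" if "norm x \<le> E" "norm z \<le> E" for x z
      proof -
        have "\<bar>B x \<bullet> z\<bar> \<le> norm (B x) * norm z" by (rule Cauchy_Schwarz_ineq2)
        also have "\<dots> \<le> (norm x * K) * norm z" by (intro mult_right_mono K) simp
        also have "\<dots> \<le> (E * K) * E" using that K(1) A0 by (intro mult_mono) (auto simp: E_def)
        finally show ?thesis by (simp add: mult_ac)
      qed
      have nE: "norm (aa m 1) \<le> E" "norm (aa n s') \<le> E" "norm (bb m \<theta>) \<le> E" "norm (bb n \<theta>) \<le> E"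
        using wg(3,4)[OF m one] wg(3,4)[OF n s'] A0[of m] A0[of n] by (auto simp: E_def)
      have b1: "\<bar>B (aa m 1) \<bullet> aa n s'\<bar> \<le> r * (K * E * E)"
        using bound[OF nE(1) nE(2)] r K(1) by (smt (verit) mult_le_cancel_right1 mult_nonneg_nonneg zero_le_square mult.assoc)
      have b2: "\<bar>s' * r * (B (aa m 1) \<bullet> bb n \<theta>)\<bar> \<le> r * (K * E * E)"
        using mult_left_mono[OF bound[OF nE(1) nE(4)], of r] s' r by (simp add: abs_mult)
      have b3: "\<bar>r * (B (bb m \<theta>) \<bullet> aa n s')\<bar> \<le> r * (K * E * E)"
        using mult_left_mono[OF bound[OF nE(3) nE(2)], of r] r by (simp add: abs_mult)
      have "r * (s' * r * (B (bb m \<theta>) \<bullet> bb n \<theta>)) \<le> r * (3 * (K * E * E))"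
        using le b1 b2 b3 by (simp add: abs_le_iff)
      then show ?thesis using r by (simp add: mult_le_cancel_left)
    qed
    have ht: "(\<lambda>x. complex_of_real (h \<theta> x)) \<in> test" for \<theta>
      using wave_gradient(2)[OF ab m, where s = 1 and j = j and r = r and \<xi> = \<xi> and \<theta> = \<theta>] by (simp add: h_def \<beta>_def)
    have Bbb: "B (bb m \<theta>) \<bullet> bb n \<theta> = (\<Sum>k\<in>UNIV. \<Sum>l\<in>UNIV. \<xi> $ k * \<xi> $ l * (\<integral>x. h \<theta> x * h \<theta> x * coupling m n k l x \<partial>lebesgue))" for \<theta>
      unfolding inner_B bb_def vec_lambda_beta
        linear_scale[OF bounded_linear.linear[OF bounded_linear_fibre_op[OF F_field]]]
      by (simp add: inner_F_rvec(2)[OF ht ht] mult_ac)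
    have pythagoras: "(\<integral>x. h 0 x * h 0 x * coupling m n k l x \<partial>lebesgue) + (\<integral>x. h (pi / 2) x * h (pi / 2) x * coupling m n k l x \<partial>lebesgue)
        = (\<integral>x. (bump j a b x)\<^sup>2 * coupling m n k l x \<partial>lebesgue)" for k l
    proof -
      have "(\<integral>x. h 0 x * h 0 x * coupling m n k l x \<partial>lebesgue) + (\<integral>x. h (pi / 2) x * h (pi / 2) x * coupling m n k l x \<partial>lebesgue)
        = (\<integral>x. h 0 x * h 0 x * coupling m n k l x + h (pi / 2) x * h (pi / 2) x * coupling m n k l x \<partial>lebesgue)"
        by (rule Bochner_Integration.integral_add[symmetric, OF inner_F_rvec(1)[OF ht ht] inner_F_rvec(1)[OF ht ht]])
      also have "\<dots> = (\<integral>x. (bump j a b x)\<^sup>2 * coupling m n k l x \<partial>lebesgue)"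
      proof (rule Bochner_Integration.integral_cong)
        fix x
        have trig: "sin t * sin t + sin (t + pi / 2) * sin (t + pi / 2) = 1" for t :: real
          using sin_cos_squared_add[of t] by (simp add: sin_add power2_eq_square)
        have "h 0 x * h 0 x + h (pi / 2) x * h (pi / 2) x = (bump j a b x)\<^sup>2"
        proof -
          define t where "t = (r *\<^sub>R \<xi>) \<bullet> x"
          have "h 0 x * h 0 x + h (pi / 2) x * h (pi / 2) x = (\<beta> x)\<^sup>2 * (sin t * sin t + sin (t + pi / 2) * sin (t + pi / 2))"
            unfolding h_def t_def[symmetric] by (simp add: power2_eq_square algebra_simps)
          then show ?thesis unfolding trig by (simp add: \<beta>_def)
        qed
        then show "h 0 x * h 0 x * coupling m n k l x + h (pi / 2) x * h (pi / 2) x * coupling m n k l x = (bump j a b x)\<^sup>2 * coupling m n k l x"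
          by (simp only: distrib_right[symmetric])
      qed simp
      finally show ?thesis .
    qed
    have N: "?N = B (bb m 0) \<bullet> bb n 0 + B (bb m (pi / 2)) \<bullet> bb n (pi / 2)"
      unfolding Bbb sum.distrib[symmetric] distrib_left[symmetric] pythagoras ..
    have "s' * r * ?N = s' * r * (B (bb m 0) \<bullet> bb n 0) + s' * r * (B (bb m (pi / 2)) \<bullet> bb n (pi / 2))"
      unfolding N by (rule distrib_left)
    then show ?thesis using main[of 0] main[of "pi / 2"] by linarith
  qed
  have "\<bar>?N\<bar> * r \<le> 6 * (K * E * E)" if "r \<ge> 1" for r
    using key[OF that, of 1] key[OF that, of "-1"] by (simp add: abs_if mult.commute)
  then have b: "\<bar>?N\<bar> * real (Suc i) \<le> 6 * (K * E * E)" for i by simp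
  show ?thesis
  proof (rule ccontr)
    assume "?N \<noteq> 0"
    then have pos: "\<bar>?N\<bar> > 0" by simp
    obtain i :: nat where "6 * (K * E * E) / \<bar>?N\<bar> < i" using reals_Archimedean2 by blast
    then have "6 * (K * E * E) < \<bar>?N\<bar> * i" using pos by (simp add: divide_less_eq mult.commute)
    moreover have "\<bar>?N\<bar> * i \<le> \<bar>?N\<bar> * real (Suc i)" by (intro mult_left_mono) auto
    ultimately show False using b[of i] by linarith
  qed
qed

lemma coupling_measurable: "coupling m n k l \<in> borel_measurable lebesgue"
  unfolding coupling_def[abs_def]
  by (rule measurable_compose[OF F_coord_measurable borel_measurable_continuous_onI[OF linear_continuous_on[OF bounded_linear_Re]]])

lemma coupling_bounded: "\<exists>M. \<forall>x. \<bar>coupling m n k l x\<bar> \<le> M"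
proof -
  obtain M where M: "\<And>x f. norm (F k l x f) \<le> M * norm f" using F_bound[of k l] by blast
  have "\<bar>coupling m n k l x\<bar> \<le> M" for x
    using abs_Re_le_cmod[of "ell2_nth (F k l x (unit_vec m)) n"] cmod_ell2_nth_le[of "F k l x (unit_vec m)" n] M[of x "unit_vec m"]
    by (simp add: coupling_def)
  then show ?thesis by blast
qed

lemma coupling_integrable_box: "integrable lebesgue (\<lambda>x. indicator (cbox a b) x * coupling m n k l x)"
proof -
  obtain M where M: "\<And>x. \<bar>coupling m n k l x\<bar> \<le> M" using coupling_bounded by blast
  show ?thesis
  proof (rule Bochner_Integration.integrable_bound)
    have "integrable lebesgue (indicator (cbox a b) :: real^'d \<Rightarrow> real)"
      using lmeasurable_cbox by (intro integrable_real_indicator) (auto simp: fmeasurable_def)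
    then show "integrable lebesgue (\<lambda>x. indicator (cbox a b) x * M)" by (intro integrable_mult_left)
    show "(\<lambda>x. indicator (cbox a b) x * coupling m n k l x) \<in> borel_measurable lebesgue"
      by (intro borel_measurable_times borel_measurable_indicator coupling_measurable) auto
    have "norm (indicator (cbox a b) x * coupling m n k l x) \<le> norm (indicator (cbox a b) x * M)" for x
      using M[of x] by (auto simp: indicator_def)
    then show "AE x in lebesgue. norm (indicator (cbox a b) x * coupling m n k l x) \<le> norm (indicator (cbox a b) x * M)" by simp
  qed
qed

lemma coupling_quadratic_form:
  assumes m: "m \<in> Y" and n: "n \<in> Y" and mn: "m \<noteq> n"
  shows "AE x in lebesgue. x \<in> \<Omega> \<longrightarrow> (\<Sum>k\<in>UNIV. \<Sum>l\<in>UNIV. \<xi> $ k * \<xi> $ l * coupling m n k l x) = 0"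
proof (rule ae_zero_if_bump_integrals_zero[OF open_domain, of 2])
  fix a b :: "real^'d" and j assume ab: "cbox a b \<subseteq> \<Omega>"
  have "(\<lambda>x. indicator (cbox a b) x * (\<Sum>k\<in>UNIV. \<Sum>l\<in>UNIV. \<xi> $ k * \<xi> $ l * coupling m n k l x))
    = (\<lambda>x. \<Sum>k\<in>UNIV. \<Sum>l\<in>UNIV. \<xi> $ k * \<xi> $ l * (indicator (cbox a b) x * coupling m n k l x))"
    by (simp add: sum_distrib_left mult_ac)
  then show "integrable lebesgue (\<lambda>x. indicator (cbox a b) x * (\<Sum>k\<in>UNIV. \<Sum>l\<in>UNIV. \<xi> $ k * \<xi> $ l * coupling m n k l x))"
    using coupling_integrable_box by simp
  have bt: "(\<lambda>x. complex_of_real (bump j a b x)) \<in> test" by (rule bump_test[OF ab])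
  have i: "integrable lebesgue (\<lambda>x. (bump j a b x)\<^sup>2 * coupling m n k l x)" for k l
    using inner_F_rvec(1)[OF bt bt, of m n k l] by (simp add: power2_eq_square)
  have "(\<lambda>x. bump j a b x ^ 2 * (\<Sum>k\<in>UNIV. \<Sum>l\<in>UNIV. \<xi> $ k * \<xi> $ l * coupling m n k l x))
    = (\<lambda>x. \<Sum>k\<in>UNIV. \<Sum>l\<in>UNIV. \<xi> $ k * \<xi> $ l * (bump j a b x ^ 2 * coupling m n k l x))"
    by (simp add: sum_distrib_left mult_ac)
  then have "(\<integral>x. bump j a b x ^ 2 * (\<Sum>k\<in>UNIV. \<Sum>l\<in>UNIV. \<xi> $ k * \<xi> $ l * coupling m n k l x) \<partial>lebesgue)
    = (\<Sum>k\<in>UNIV. \<Sum>l\<in>UNIV. \<xi> $ k * \<xi> $ l * (\<integral>x. (bump j a b x)\<^sup>2 * coupling m n k l x \<partial>lebesgue))"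
    using i by simp
  then show "(\<integral>x. bump j a b x ^ 2 * (\<Sum>k\<in>UNIV. \<Sum>l\<in>UNIV. \<xi> $ k * \<xi> $ l * coupling m n k l x) \<partial>lebesgue) = 0"
    using coupling_quadratic_form_integral[OF ab m n mn, of \<xi> j] by simp
qed simp

text \<open>Polarization: the quadratic form vanishes at \<open>e\<^sub>k\<close>, \<open>e\<^sub>l\<close> and \<open>e\<^sub>k + e\<^sub>l\<close>.\<close>

lemma coupling_antisymmetric:
  assumes m: "m \<in> Y" and n: "n \<in> Y" and mn: "m \<noteq> n"
  shows "AE x in lebesgue. coupling m n k l x + coupling m n l k x = 0"
proof -
  let ?Q = "\<lambda>\<xi> x. \<Sum>k\<in>UNIV. \<Sum>l\<in>UNIV. \<xi> $ k * \<xi> $ l * coupling m n k l x"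
  have Q: "?Q (axis i 1 + axis i' t) x = coupling m n i i x + t * coupling m n i i' x + t * coupling m n i' i x + t * t * coupling m n i' i' x" for i i' t x
  proof -
    have inner1: "(\<Sum>l\<in>UNIV. c * (axis i 1 + axis i' t) $ l * z l) = c * z i + t * c * z i'" for c z
    proof -
      have "(\<Sum>l\<in>UNIV. c * (axis i 1 + axis i' t) $ l * z l)
          = (\<Sum>l\<in>UNIV. (if l = i then c * z l else 0) + (if l = i' then t * c * z l else 0))"
        by (rule sum.cong) (auto simp: axis_def algebra_simps)
      then show ?thesis by (simp add: sum.distrib)
    qed
    have "(\<Sum>k\<in>UNIV. (axis i 1 + axis i' t) $ k * z k) = z i + t * z i'" for z :: "'d \<Rightarrow> real"
      using inner1[of 1 z] by simp
    note outer = this[of "\<lambda>k. coupling m n k i x + t * coupling m n k i' x"]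
    have "?Q (axis i 1 + axis i' t) x = (\<Sum>k\<in>UNIV. (axis i 1 + axis i' t) $ k * (coupling m n k i x + t * coupling m n k i' x))"
      by (rule sum.cong[OF refl]) (simp only: inner1, simp add: algebra_simps)
    then show ?thesis unfolding outer by (simp add: algebra_simps)
  qed
  have q: "AE x in lebesgue. x \<in> \<Omega> \<longrightarrow> ?Q (axis i 1 + axis i' t) x = 0" for i i' t
    by (rule coupling_quadratic_form[OF m n mn])
  show ?thesis
    using q[of k k 0] q[of l l 0] q[of k l 1]
  proof eventually_elim
    case (elim x)
    then show ?case unfolding Q by (cases "x \<in> \<Omega>") (auto simp: coupling_outside)
  qed
qed

subsection \<open>The form is diagonal\<close>

lemma F_coord_move: "F k l x (coord_move m p f) = ell2_nth f p *\<^sub>C F k l x (unit_vec m)"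
  by (simp add: coord_move_def F_scaleC)

lemma inner_F_move:
  shows "integrable lebesgue (\<lambda>x. Re (ell2_nth (l2_rep X x) p * ell2_nth (F k l x (unit_vec m)) n * cnj (ell2_nth (l2_rep Z x) q)))"
    and "fibre_op (F k l) (move m p X) \<bullet> move n q Z
      = (\<integral>x. Re (ell2_nth (l2_rep X x) p * ell2_nth (F k l x (unit_vec m)) n * cnj (ell2_nth (l2_rep Z x) q)) \<partial>lebesgue)"
proof -
  have s: "sq_int (\<lambda>x. coord_move m p (l2_rep X x))" "sq_int (\<lambda>x. coord_move n q (l2_rep Z x))"
    by (intro sq_int_fibre[OF move_field] sq_int_l2_rep)+
  have sF: "sq_int (\<lambda>x. F k l x (coord_move m p (l2_rep X x)))" by (rule sq_int_fibre[OF F_field s(1)])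
  have eq: "F k l x (coord_move m p f) \<bullet> coord_move n q g
      = Re (ell2_nth f p * ell2_nth (F k l x (unit_vec m)) n * cnj (ell2_nth g q))" for f g x
    unfolding F_coord_move by (simp add: coord_move_def[of n] inner_unit_vec)
  show "integrable lebesgue (\<lambda>x. Re (ell2_nth (l2_rep X x) p * ell2_nth (F k l x (unit_vec m)) n * cnj (ell2_nth (l2_rep Z x) q)))"
    using integrable_inner_sq_int[OF sF s(2)] unfolding eq .
  show "fibre_op (F k l) (move m p X) \<bullet> move n q Z
      = (\<integral>x. Re (ell2_nth (l2_rep X x) p * ell2_nth (F k l x (unit_vec m)) n * cnj (ell2_nth (l2_rep Z x) q)) \<partial>lebesgue)"
    using inner_l2_abs[OF sF s(2)] unfolding eq by (simp add: move_def fibre_op_def[of "\<lambda>x. coord_move _ _"] fibre_op_abs[OF F_field s(1)])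
qed

lemma cone_real: "U \<in> cone \<Longrightarrow> AE x in lebesgue. \<forall>n. Im (ell2_nth (l2_rep U x) n) = 0"
  by (drule cone_AE, erule eventually_mono) (simp add: complex_nonneg_Reals_iff)

lemma gradient_real:
  assumes "(U, G) \<in> W" "U \<in> cone"
  shows "AE x in lebesgue. \<forall>n. Im (ell2_nth (l2_rep (G $ k) x) n) = 0"
proof -
  have "weak_grad k U (G $ k)" using W_W1[OF assms(1)] by (simp add: W1_def)
  from weak_grad_real[OF this cone_real[OF assms(2)]]
  show ?thesis using P_coord[OF W_P(2)[OF assms(1)], of k]
    by eventually_elim (metis zero_complex.simps(2))
qed

text \<open>Exchanging the scalar functions \<open>u\<^sub>p\<close> and \<open>v\<^sub>q\<close> changes the sign of the form, because the coupling coefficients are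
  antisymmetric and the gradients are real; since both values are at most \<open>0\<close>, they vanish.\<close>

lemma off_diagonal_cone:
  assumes UG: "(U, G) \<in> W" and VK: "(V', K) \<in> W" and U: "U \<in> cone" and V': "V' \<in> cone"
    and m: "m \<in> Y" and n: "n \<in> Y" and mn: "m \<noteq> n"
  shows "B (vec_op (move m p) G) \<bullet> vec_op (move n q) K = 0"
    and "B (vec_op (move m p) G) \<bullet> vec_op I (vec_op (move n q) K) = 0"
proof -
  have le: "B (vec_op (move m p) G) \<bullet> vec_op (move n q) K \<le> 0"
    and "B (vec_op (move m p) G) \<bullet> vec_op I (vec_op (move n q) K) = 0"
    by (rule orth_cone_form[OF W_move[OF UG m] W_move[OF VK n] cone_move[OF U m] cone_move[OF V' n] move_move_orth[OF mn]])+
  then show "B (vec_op (move m p) G) \<bullet> vec_op I (vec_op (move n q) K) = 0" by blast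
  have le': "B (vec_op (move m q) K) \<bullet> vec_op (move n p) G \<le> 0"
    by (rule orth_cone_form[OF W_move[OF VK m] W_move[OF UG n] cone_move[OF V' m] cone_move[OF U n] move_move_orth[OF mn]])
  let ?\<phi> = "\<lambda>k l x. Re (ell2_nth (l2_rep (G $ l) x) p * ell2_nth (F k l x (unit_vec m)) n * cnj (ell2_nth (l2_rep (K $ k) x) q))"
  let ?\<psi> = "\<lambda>k l x. Re (ell2_nth (l2_rep (K $ l) x) q * ell2_nth (F k l x (unit_vec m)) n * cnj (ell2_nth (l2_rep (G $ k) x) p))"
  have pair: "(\<integral>x. ?\<phi> k l x \<partial>lebesgue) + (\<integral>x. ?\<psi> l k x \<partial>lebesgue) = 0" for k l
  proof -
    have "(\<integral>x. ?\<phi> k l x \<partial>lebesgue) + (\<integral>x. ?\<psi> l k x \<partial>lebesgue) = (\<integral>x. ?\<phi> k l x + ?\<psi> l k x \<partial>lebesgue)"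
      by (rule Bochner_Integration.integral_add[symmetric, OF inner_F_move(1) inner_F_move(1)])
    also have "\<dots> = 0"
    proof (rule integral_eq_zero_AE)
      show "AE x in lebesgue. ?\<phi> k l x + ?\<psi> l k x = 0"
        using gradient_real[OF UG U, of l] gradient_real[OF VK V', of k] coupling_antisymmetric[OF m n mn, of k l]
      proof eventually_elim
        case (elim x)
        have "?\<phi> k l x = Re (ell2_nth (l2_rep (G $ l) x) p) * Re (ell2_nth (l2_rep (K $ k) x) q) * coupling m n k l x"
          using elim(1,2) by (simp add: coupling_def)
        moreover have "?\<psi> l k x = Re (ell2_nth (l2_rep (G $ l) x) p) * Re (ell2_nth (l2_rep (K $ k) x) q) * coupling m n l k x"
          using elim(1,2) by (simp add: coupling_def)
        ultimately show ?case using elim(3) by (simp flip: distrib_left)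
      qed
    qed
    finally show ?thesis .
  qed
  have "B (vec_op (move m p) G) \<bullet> vec_op (move n q) K + B (vec_op (move m q) K) \<bullet> vec_op (move n p) G
      = (\<Sum>k\<in>UNIV. \<Sum>l\<in>UNIV. \<integral>x. ?\<phi> k l x \<partial>lebesgue) + (\<Sum>l\<in>UNIV. \<Sum>k\<in>UNIV. \<integral>x. ?\<psi> l k x \<partial>lebesgue)"
    unfolding inner_B vec_lambda_beta inner_F_move(2) ..
  also have "(\<Sum>l\<in>UNIV. \<Sum>k\<in>UNIV. \<integral>x. ?\<psi> l k x \<partial>lebesgue) = (\<Sum>k\<in>UNIV. \<Sum>l\<in>UNIV. \<integral>x. ?\<psi> l k x \<partial>lebesgue)"
    by (rule sum.swap)
  also have "(\<Sum>k\<in>UNIV. \<Sum>l\<in>UNIV. \<integral>x. ?\<phi> k l x \<partial>lebesgue) + \<dots> = 0"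
    unfolding sum.distrib[symmetric] pair by simp
  finally show "B (vec_op (move m p) G) \<bullet> vec_op (move n q) K = 0" using le le' by linarith
qed

lemma vec_op_linear: "bounded_linear T \<Longrightarrow> linear (vec_op T)"
  by (rule bounded_linear.linear[OF bounded_linear_vec_op])

lemma B_I: "B (vec_op I G) = vec_op I (B G)"
proof -
  have "fibre_op (F k l) (I X) = I (fibre_op (F k l) X)" for k l X
    unfolding I_def
    using fibre_op_compose[OF F_field I_field, of k l "\<lambda>x f. \<i> *\<^sub>C F k l x f" X]
      fibre_op_compose[OF I_field F_field, of k l "\<lambda>x f. \<i> *\<^sub>C F k l x f" X] by (simp add: F_scaleC)
  then show ?thesis by (simp add: B_def vec_eq_iff linear_sum[OF bounded_linear.linear[OF I_lin]])
qed

lemma inner_vec_I: "vec_op I G \<bullet> K = - (G \<bullet> vec_op I K)"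
  by (simp add: inner_vec_def inner_I sum_negf)

lemma vec_I_I: "vec_op I (vec_op I G) = - G"
  by (simp add: vec_eq_iff I_I)

text \<open>The parts in the decomposition of \<open>U\<close> into elements of the cone stay in the form domain by the invariance
  criterion.\<close>

lemma form_domain_decomposition:
  assumes "(U, G) \<in> W"
  obtains U1 U2 U3 U4 G1 G2 G3 G4 where "(U1, G1) \<in> W" "(U2, G2) \<in> W" "(U3, G3) \<in> W" "(U4, G4) \<in> W"
    "U1 \<in> cone" "U2 \<in> cone" "U3 \<in> cone" "U4 \<in> cone" "G = (G1 - G2) + vec_op I (G3 - G4)"
proof -
  have neg: "(- X, - Z) \<in> W" if "(X, Z) \<in> W" for X Z using subspace_neg[OF W_subspace that] by simp
  obtain G1 where 1: "(cone_proj U, G1) \<in> W" using fsc.cone_projection_form_domain[OF assms] by blast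
  obtain G2 where 2: "(cone_proj (- U), G2) \<in> W" using fsc.cone_projection_form_domain[OF neg[OF assms]] by blast
  obtain G3 where 3: "(cone_proj (- I U), G3) \<in> W" using fsc.cone_projection_form_domain[OF neg[OF W_I[OF assms]]] by blast
  obtain G4 where 4: "(cone_proj (I U), G4) \<in> W" using fsc.cone_projection_form_domain[OF W_I[OF assms]] by blast
  have a: "(cone_proj U - cone_proj (- U), G1 - G2) \<in> W" using subspace_diff[OF W_subspace 1 2] by simp
  have b: "(cone_proj (- I U) - cone_proj (I U), G3 - G4) \<in> W" using subspace_diff[OF W_subspace 3 4] by simp
  have "(U, (G1 - G2) + vec_op I (G3 - G4)) \<in> W"
    using subspace_add[OF W_subspace a W_I[OF b]] unfolding add_Pair cone_decomposition[of U, symmetric] .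
  then have "G = (G1 - G2) + vec_op I (G3 - G4)" using W1_unique[OF W_W1[OF assms] W_W1] by blast
  moreover have PU: "P U = U" "P (- U) = - U" "P (I U) = I U" "P (- I U) = - I U"
    using W_P(1)[OF assms] W_P(1)[OF neg[OF assms]] W_P(1)[OF W_I[OF assms]] W_P(1)[OF neg[OF W_I[OF assms]]] by blast+
  ultimately show thesis using that[OF 1 2 3 4] cone_proj_in by blast
qed

text \<open>On the cone this is known together with its imaginary part, and the conjunction of the two equations is stable
  under real linear combinations and multiplication by \<open>\<i>\<close> in both arguments.\<close>

lemma off_diagonal_zero:
  assumes UG: "(U, G) \<in> W" and VK: "(V', K) \<in> W" and m: "m \<in> Y" and n: "n \<in> Y" and mn: "m \<noteq> n"
  shows "B (vec_op (move m p) G) \<bullet> vec_op (move n q) K = 0"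
proof -
  note lm = vec_op_linear[OF move_lin] and li = vec_op_linear[OF I_lin] and lB = bounded_linear.linear[OF B_lin]
  define Z where "Z = (\<lambda>G K. B (vec_op (move m p) G) \<bullet> vec_op (move n q) K = 0 \<and>
    B (vec_op (move m p) G) \<bullet> vec_op I (vec_op (move n q) K) = 0)"
  have mI: "vec_op (move m p) (vec_op I G) = vec_op I (vec_op (move m p) G)" for m p G
    by (simp add: vec_eq_iff I_move)
  have dl: "Z (G - G') K" if "Z G K" "Z G' K" for G G' K
    using that unfolding Z_def linear_diff[OF lm] linear_diff[OF lB] by (simp add: inner_diff_left)
  have al: "Z (G + G') K" if "Z G K" "Z G' K" for G G' K
    using that unfolding Z_def linear_add[OF lm] linear_add[OF lB] by (simp add: inner_add_left)
  have il: "Z (vec_op I G) K" if "Z G K" for G K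
    using that unfolding Z_def mI B_I inner_vec_I vec_I_I by simp
  have dr: "Z G (K - K')" if "Z G K" "Z G K'" for G K K'
    using that unfolding Z_def linear_diff[OF lm] linear_diff[OF li] by (simp add: inner_diff_right)
  have ar: "Z G (K + K')" if "Z G K" "Z G K'" for G K K'
    using that unfolding Z_def linear_add[OF lm] linear_add[OF li] by (simp add: inner_add_right)
  have ir: "Z G (vec_op I K)" if "Z G K" for G K
    using that unfolding Z_def mI vec_I_I by simp
  have cc: "Z G K" if "(U, G) \<in> W" "(V', K) \<in> W" "U \<in> cone" "V' \<in> cone" for U G V' K
    unfolding Z_def using off_diagonal_cone[OF that m n mn] by blast
  have step: "Z G K" if VK: "(V', K) \<in> W" "V' \<in> cone" for V' K
  proof (rule form_domain_decomposition[OF UG])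
    fix U1 U2 U3 U4 G1 G2 G3 G4
    assume g: "(U1, G1) \<in> W" "(U2, G2) \<in> W" "(U3, G3) \<in> W" "(U4, G4) \<in> W"
      "U1 \<in> cone" "U2 \<in> cone" "U3 \<in> cone" "U4 \<in> cone" and G: "G = (G1 - G2) + vec_op I (G3 - G4)"
    show ?thesis unfolding G
      by (intro al dl il) (rule cc[OF g(1) VK(1) g(5) VK(2)] cc[OF g(2) VK(1) g(6) VK(2)]
          cc[OF g(3) VK(1) g(7) VK(2)] cc[OF g(4) VK(1) g(8) VK(2)])+
  qed
  have "Z G K"
  proof (rule form_domain_decomposition[OF VK])
    fix U1 U2 U3 U4 G1 G2 G3 G4
    assume g: "(U1, G1) \<in> W" "(U2, G2) \<in> W" "(U3, G3) \<in> W" "(U4, G4) \<in> W"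
      "U1 \<in> cone" "U2 \<in> cone" "U3 \<in> cone" "U4 \<in> cone" and K: "K = (G1 - G2) + vec_op I (G3 - G4)"
    show ?thesis unfolding K
      by (intro ar dr ir) (rule step[OF g(1) g(5)] step[OF g(2) g(6)] step[OF g(3) g(7)] step[OF g(4) g(8)])+
  qed
  then show ?thesis by (simp add: Z_def)
qed

lemma vec_sum_move_tendsto: "(\<lambda>N. \<Sum>m<N. vec_op (move m m) G) \<longlonglongrightarrow> G"
  by (rule vec_tendstoI) (simp add: sum_move_tendsto)

text \<open>Expand the other argument in its coordinates; only the diagonal term survives on either side.\<close>

lemma move_diagonal:
  assumes UG: "(U, G) \<in> W" and VK: "(V', K) \<in> W" and n: "n \<in> Y"
  shows "B (vec_op (move n n) G) \<bullet> K = B G \<bullet> vec_op (move n n) K"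
proof -
  note lB = bounded_linear.linear[OF B_lin]
  have zero: "vec_op (move m m) G = 0" if "(U, G) \<in> W" "m \<notin> Y" for U G m
    using that by (simp add: vec_eq_iff move_zero[OF W_P(2)])
  have off: "B (vec_op (move m m) G) \<bullet> vec_op (move m' m') K = 0" if "m \<noteq> m'" for m m'
    using off_diagonal_zero[OF UG VK _ _ that] zero[OF UG, of m] zero[OF VK, of m'] linear_0[OF lB]
    by (cases "m \<in> Y"; cases "m' \<in> Y") auto
  have sums: "(\<Sum>m<N. B (vec_op (move n n) G) \<bullet> vec_op (move m m) K) = B (vec_op (move n n) G) \<bullet> vec_op (move n n) K"
    "(\<Sum>m<N. B (vec_op (move m m) G) \<bullet> vec_op (move n n) K) = B (vec_op (move n n) G) \<bullet> vec_op (move n n) K"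
    if "N > n" for N
  proof -
    have "B (vec_op (move n n) G) \<bullet> vec_op (move m m) K = (if m = n then B (vec_op (move n n) G) \<bullet> vec_op (move n n) K else 0)"
      "B (vec_op (move m m) G) \<bullet> vec_op (move n n) K = (if m = n then B (vec_op (move n n) G) \<bullet> vec_op (move n n) K else 0)" for m
      using off[of n m] off[of m n] by auto
    note eqs = this
    show "(\<Sum>m<N. B (vec_op (move n n) G) \<bullet> vec_op (move m m) K) = B (vec_op (move n n) G) \<bullet> vec_op (move n n) K"
      by (subst eqs(1)) (use that in simp)
    show "(\<Sum>m<N. B (vec_op (move m m) G) \<bullet> vec_op (move n n) K) = B (vec_op (move n n) G) \<bullet> vec_op (move n n) K"
      by (subst eqs(2)) (use that in simp)
  qed
  have "B (vec_op (move n n) G) \<bullet> K = B (vec_op (move n n) G) \<bullet> vec_op (move n n) K"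
  proof (rule LIMSEQ_unique)
    have "(\<lambda>N. B (vec_op (move n n) G) \<bullet> (\<Sum>m<N. vec_op (move m m) K)) \<longlonglongrightarrow> B (vec_op (move n n) G) \<bullet> K"
      by (intro tendsto_inner tendsto_const vec_sum_move_tendsto)
    then show "(\<lambda>N. \<Sum>m<N. B (vec_op (move n n) G) \<bullet> vec_op (move m m) K) \<longlonglongrightarrow> B (vec_op (move n n) G) \<bullet> K"
      by (simp only: inner_sum_right)
    show "(\<lambda>N. \<Sum>m<N. B (vec_op (move n n) G) \<bullet> vec_op (move m m) K) \<longlonglongrightarrow> B (vec_op (move n n) G) \<bullet> vec_op (move n n) K"
      by (rule tendsto_eventually, rule eventually_mono[OF eventually_gt_at_top[of n]], rule sums(1))
  qed
  moreover have "B G \<bullet> vec_op (move n n) K = B (vec_op (move n n) G) \<bullet> vec_op (move n n) K"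
  proof (rule LIMSEQ_unique)
    have "(\<lambda>N. B (\<Sum>m<N. vec_op (move m m) G) \<bullet> vec_op (move n n) K) \<longlonglongrightarrow> B G \<bullet> vec_op (move n n) K"
      by (intro tendsto_inner tendsto_const bounded_linear.tendsto[OF B_lin] vec_sum_move_tendsto)
    then show "(\<lambda>N. \<Sum>m<N. B (vec_op (move m m) G) \<bullet> vec_op (move n n) K) \<longlonglongrightarrow> B G \<bullet> vec_op (move n n) K"
      by (simp only: linear_sum[OF lB] inner_sum_left)
    show "(\<lambda>N. \<Sum>m<N. B (vec_op (move m m) G) \<bullet> vec_op (move n n) K) \<longlonglongrightarrow> B (vec_op (move n n) G) \<bullet> vec_op (move n n) K"
      by (rule tendsto_eventually, rule eventually_mono[OF eventually_gt_at_top[of n]], rule sums(2))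
  qed
  ultimately show ?thesis by simp
qed

lemma Sg_move:
  assumes n: "n \<in> Y" and U: "P U = U" and t: "t > 0" shows "Sg t (move n n U) = move n n (Sg t U)"
  by (rule fs.S_commute_form[where Q' = "vec_op (move n n)", OF move_lin P_move inner_move W_move move_diagonal U t])
    (use n in auto)

end

section \<open>The scalar semigroups\<close>

context l2_domain
begin

abbreviation embed :: "nat \<Rightarrow> (real^'d \<Rightarrow> complex) \<Rightarrow> real^'d \<Rightarrow> ell2" where
  "embed n f \<equiv> \<lambda>x. f x *\<^sub>C unit_vec n"

abbreviation coord :: "nat \<Rightarrow> (real^'d \<Rightarrow> ell2) \<Rightarrow> real^'d \<Rightarrow> complex" where
  "coord n u \<equiv> \<lambda>x. ell2_nth (u x) n"

lemma embed_L2: assumes "f \<in> L2_fun \<Omega> UNIV" "n \<in> Y" shows "embed n f \<in> L2Y"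
proof -
  have "(\<lambda>c. c *\<^sub>C unit_vec n) \<in> borel_measurable borel"
    by (intro borel_measurable_continuous_onI linear_continuous_on bounded_linear_scaleC_unit)
  from measurable_compose[OF _ this, of f "lebesgue_on \<Omega>"] show ?thesis
    using assms by (simp add: L2_fun_def norm_scaleC)
qed

lemma L2_norm_embed: "L2_norm \<Omega> (embed n f) = L2_norm \<Omega> f"
  by (simp add: L2_norm_def norm_scaleC)

lemma coord_L2: assumes "u \<in> L2Y" shows "coord n u \<in> L2_fun \<Omega> UNIV"
proof -
  have u: "u \<in> borel_measurable (lebesgue_on \<Omega>)" "integrable (lebesgue_on \<Omega>) (\<lambda>x. (norm (u x))\<^sup>2)"
    using assms by (auto simp: L2_fun_def)
  have m: "coord n u \<in> borel_measurable (lebesgue_on \<Omega>)"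
    by (rule measurable_compose[OF u(1) borel_measurable_continuous_onI[OF linear_continuous_on[OF bounded_linear_ell2_nth]]])
  have "integrable (lebesgue_on \<Omega>) (\<lambda>x. (cmod (coord n u x))\<^sup>2)"
  proof (rule Bochner_Integration.integrable_bound[OF u(2)])
    have "norm ((cmod (coord n u x))\<^sup>2) \<le> norm ((norm (u x))\<^sup>2)" for x
      using power_mono[OF cmod_ell2_nth_le[of "u x" n], of 2] by simp
    then show "AE x in lebesgue_on \<Omega>. norm ((cmod (coord n u x))\<^sup>2) \<le> norm ((norm (u x))\<^sup>2)" by simp
  qed (use m in measurable)
  then show ?thesis using m by (simp add: L2_fun_def)
qed

lemma J_embed_coord: "u \<in> L2Y \<Longrightarrow> n \<in> Y \<Longrightarrow> J (embed n (coord n u)) = move n n (J u)"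
  using J_move(2)[of u n n] by (simp add: coord_move_def)

lemma J_embed_eq_iff:
  assumes "f \<in> L2_fun \<Omega> UNIV" "g \<in> L2_fun \<Omega> UNIV" "n \<in> Y"
  shows "J (embed n f) = J (embed n g) \<longleftrightarrow> (AE x in lebesgue_on \<Omega>. f x = g x)"
proof -
  have "f x *\<^sub>C unit_vec n = g x *\<^sub>C unit_vec n \<longleftrightarrow> f x = g x" for x
    by (metis ell2_nth_scaleC ell2_nth_unit_vec mult.right_neutral)
  then show ?thesis using J_eq_iff[OF embed_L2 embed_L2] assms by simp
qed

end

context positive_problem
begin

text \<open>The semigroup in coordinate \<open>n\<close>.  By \<open>Sg_move\<close> the orbit of a function in coordinate \<open>n\<close> stays there, so no information is
  lost when the other coordinates are dropped.\<close>

definition T :: "nat \<Rightarrow> real \<Rightarrow> (real^'d \<Rightarrow> complex) \<Rightarrow> (real^'d \<Rightarrow> complex)" where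
  "T n t f = coord n (S t (embed n f))"

lemma T_L2: "t > 0 \<Longrightarrow> n \<in> Y \<Longrightarrow> f \<in> L2_fun \<Omega> UNIV \<Longrightarrow> T n t f \<in> L2_fun \<Omega> UNIV"
  unfolding T_def by (intro coord_L2 S_in embed_L2)

lemma J_T:
  assumes t: "t > 0" and n: "n \<in> Y" and f: "f \<in> L2_fun \<Omega> UNIV"
  shows "J (embed n (T n t f)) = Sg t (J (embed n f))"
proof -
  have e: "embed n f \<in> L2Y" by (rule embed_L2[OF f n])
  have id: "move n n (J (embed n f)) = J (embed n f)"
    using J_embed_coord[OF e n] by simp
  have "J (embed n (T n t f)) = move n n (Sg t (J (embed n f)))"
    unfolding T_def using J_embed_coord[OF S_in[OF t e] n] by (simp add: J_S[OF t e])
  also have "\<dots> = Sg t (move n n (J (embed n f)))"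
    by (rule Sg_move[symmetric, OF n P_J[OF e] t])
  finally show ?thesis by (simp only: id)
qed

lemma T_linear: assumes t: "t > 0" and n: "n \<in> Y" shows "bounded_clinear_L2 \<Omega> UNIV (T n t)"
  unfolding bounded_clinear_L2_def
proof (intro conjI ballI allI)
  fix f g assume f: "f \<in> L2_fun \<Omega> (UNIV::complex set)" and g: "g \<in> L2_fun \<Omega> (UNIV::complex set)"
  have e: "embed n (\<lambda>x. f x + g x) = (\<lambda>x. embed n f x + embed n g x)" by (simp add: scaleC_add_left)
  have "AE x in lebesgue_on \<Omega>. S t (\<lambda>x. embed n f x + embed n g x) x = S t (embed n f) x + S t (embed n g) x"
    using S_lin[OF t] embed_L2[OF f n] embed_L2[OF g n] by (simp add: bounded_clinear_L2_def)
  then show "AE x in lebesgue_on \<Omega>. T n t (\<lambda>x. f x + g x) x = T n t f x + T n t g x"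
    unfolding T_def e by eventually_elim simp
next
  fix c :: complex and f assume f: "f \<in> L2_fun \<Omega> (UNIV::complex set)"
  have e: "embed n (\<lambda>x. c *\<^sub>C f x) = (\<lambda>x. c *\<^sub>C embed n f x)" by (simp add: scaleC_scaleC)
  have "AE x in lebesgue_on \<Omega>. S t (\<lambda>x. c *\<^sub>C embed n f x) x = c *\<^sub>C S t (embed n f) x"
    using S_lin[OF t] embed_L2[OF f n] by (simp add: bounded_clinear_L2_def)
  then show "AE x in lebesgue_on \<Omega>. T n t (\<lambda>x. c *\<^sub>C f x) x = c *\<^sub>C T n t f x"
    unfolding T_def e by eventually_elim simp
next
  show "\<exists>M. \<forall>f\<in>L2_fun \<Omega> (UNIV::complex set). L2_norm \<Omega> (T n t f) \<le> M * L2_norm \<Omega> f"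
  proof (intro exI[of _ 1] ballI)
    fix f assume f: "f \<in> L2_fun \<Omega> (UNIV::complex set)"
    show "L2_norm \<Omega> (T n t f) \<le> 1 * L2_norm \<Omega> f"
      using fs.S_contraction[OF P_J[OF embed_L2[OF f n]] t] J_T[OF t n f]
        L2_norm_eq[OF embed_L2[OF f n]] L2_norm_eq[OF embed_L2[OF T_L2[OF t n f] n]]
      by (simp add: L2_norm_embed)
  qed
qed (rule T_L2[OF t n])

lemma T_contraction_semigroup: assumes n: "n \<in> Y" shows "contraction_semigroup \<Omega> UNIV (T n)"
  unfolding contraction_semigroup_def C0_semigroup_def
proof (intro conjI allI impI ballI)
  fix s t :: real and f assume s: "0 < s" and t: "0 < t" and f: "f \<in> L2_fun \<Omega> (UNIV::complex set)"
  have st: "s + t > 0" using s t by simp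
  have "J (embed n (T n (s + t) f)) = J (embed n (T n s (T n t f)))"
    using s t by (simp add: J_T n f T_L2 Sg_add)
  then show "AE x in lebesgue_on \<Omega>. T n (s + t) f x = T n s (T n t f) x"
    using J_embed_eq_iff[OF T_L2[OF st n f] T_L2[OF s n T_L2[OF t n f]] n] by simp
next
  fix f assume f: "f \<in> L2_fun \<Omega> (UNIV::complex set)"
  have e: "embed n f \<in> L2Y" by (rule embed_L2[OF f n])
  have "((\<lambda>t. Sg t (J (embed n f)) - J (embed n f)) \<longlongrightarrow> 0) (at_right 0)"
    using Sg_lim[of "J (embed n f)"] by (simp add: P_J[OF e] LIM_zero_iff)
  then have "((\<lambda>t. norm (Sg t (J (embed n f)) - J (embed n f))) \<longlongrightarrow> 0) (at_right 0)"
    by (rule tendsto_norm_zero)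
  moreover have "eventually (\<lambda>t. norm (Sg t (J (embed n f)) - J (embed n f)) = L2_norm \<Omega> (\<lambda>x. T n t f x - f x)) (at_right 0)"
    using eventually_at_right_less[of "0::real"]
  proof eventually_elim
    case (elim t)
    have eT: "embed n (T n t f) \<in> L2Y" by (rule embed_L2[OF T_L2[OF elim n f] n])
    have "norm (embed n (T n t f) x - embed n f x) = norm (T n t f x - f x)" for x
    proof -
      have "embed n (T n t f) x - embed n f x = (T n t f x - f x) *\<^sub>C unit_vec n"
        by (rule ell2_eqI) (simp add: algebra_simps)
      then show ?thesis by (simp add: norm_scaleC)
    qed
    then have "L2_norm \<Omega> (\<lambda>x. T n t f x - f x) = L2_norm \<Omega> (\<lambda>x. embed n (T n t f) x - embed n f x)"
      by (simp add: L2_norm_def)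
    also have "\<dots> = norm (J (embed n (T n t f)) - J (embed n f))"
      using L2_norm_eq[OF L2Y_diff[OF eT e]] J_diff[OF eT e] by simp
    finally show ?case by (simp add: J_T[OF elim n f])
  qed
  ultimately show "((\<lambda>t. L2_norm \<Omega> (\<lambda>x. T n t f x - f x)) \<longlongrightarrow> 0) (at_right 0)"
    by (rule Lim_transform_eventually)
next
  fix t :: real and f assume t: "0 < t" and f: "f \<in> L2_fun \<Omega> (UNIV::complex set)"
  show "L2_norm \<Omega> (T n t f) \<le> L2_norm \<Omega> f"
    using fs.S_contraction[OF P_J[OF embed_L2[OF f n]] t] J_T[OF t n f]
      L2_norm_eq[OF embed_L2[OF f n]] L2_norm_eq[OF embed_L2[OF T_L2[OF t n f] n]]
    by (simp add: L2_norm_embed)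
qed (rule T_linear[OF _ n])

lemma T_positive: assumes n: "n \<in> Y" shows "positive_semigroup (L2_cone \<Omega>) (T n)"
  unfolding positive_semigroup_def
proof (intro allI impI ballI)
  fix t :: real and f assume t: "0 < t" and f: "f \<in> L2_cone \<Omega>"
  have fL: "f \<in> L2_fun \<Omega> UNIV" using f by (simp add: L2_cone_def)
  have "AE x in lebesgue_on \<Omega>. f x \<in> \<real>\<^sub>\<ge>\<^sub>0" using f by (simp add: L2_cone_def)
  then have "AE x in lebesgue_on \<Omega>. \<forall>y\<in>Y. ell2_nth (embed n f x) y \<in> \<real>\<^sub>\<ge>\<^sub>0"
    by eventually_elim auto
  then have "embed n f \<in> L2_ell2_cone \<Omega> Y" using embed_L2[OF fL n] by (simp add: L2_ell2_cone_def)
  then have "S t (embed n f) \<in> L2_ell2_cone \<Omega> Y" using positive t by (simp add: positive_semigroup_def)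
  then have "AE x in lebesgue_on \<Omega>. \<forall>y\<in>Y. ell2_nth (S t (embed n f) x) y \<in> \<real>\<^sub>\<ge>\<^sub>0" by (simp add: L2_ell2_cone_def)
  then have "AE x in lebesgue_on \<Omega>. T n t f x \<in> \<real>\<^sub>\<ge>\<^sub>0"
    unfolding T_def by eventually_elim (use n in blast)
  then show "T n t f \<in> L2_cone \<Omega>" using T_L2[OF t n fL] by (simp add: L2_cone_def)
qed

lemma S_coord_eq_T:
  assumes n: "n \<in> Y" and t: "t > 0" and u: "u \<in> L2Y"
  shows "AE x in lebesgue_on \<Omega>. ell2_nth (S t u x) n = T n t (coord n u) x"
proof -
  have "J (embed n (coord n (S t u))) = J (embed n (T n t (coord n u)))"
    using J_embed_coord[OF S_in[OF t u] n] J_S[OF t u] J_T[OF t n coord_L2[OF u]] J_embed_coord[OF u n]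
      Sg_move[OF n P_J[OF u] t] by simp
  then show ?thesis
    using J_embed_eq_iff[OF coord_L2[OF S_in[OF t u]] T_L2[OF t n coord_L2[OF u]] n] by simp
qed

end

theorem theorem1p2:
  fixes \<Omega> :: "(real^'d::finite) set" and Y :: "nat set"
    and C :: "'d \<Rightarrow> 'd \<Rightarrow> real^'d \<Rightarrow> ell2 \<Rightarrow> ell2"
    and \<mu> :: real
    and V :: "(real^'d \<Rightarrow> ell2) set"
    and A :: "((real^'d \<Rightarrow> ell2) \<times> (real^'d \<Rightarrow> ell2)) set"
    and S :: "real \<Rightarrow> (real^'d \<Rightarrow> ell2) \<Rightarrow> (real^'d \<Rightarrow> ell2)"
  assumes "open \<Omega>"
    and "\<And>k l x. x \<in> \<Omega> \<Longrightarrow> bounded_clinear_on (ell2_on Y) (C k l x)"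
    and "\<And>k l. \<exists>M. \<forall>x\<in>\<Omega>. \<forall>f\<in>ell2_on Y. norm (C k l x f) \<le> M * norm f"
    and "\<And>k l f g. f \<in> ell2_on Y \<Longrightarrow> g \<in> ell2_on Y \<Longrightarrow>
           (\<lambda>x. cinner (C k l x f) g) \<in> borel_measurable (lebesgue_on \<Omega>) \<and>
           bounded ((\<lambda>x. cinner (C k l x f) g) ` \<Omega>)"
    and "\<mu> > 0"
    and "\<And>f :: 'd \<Rightarrow> ell2. (\<And>k. f k \<in> ell2_on Y) \<Longrightarrow>
           AE x in lebesgue_on \<Omega>.
             Re (\<Sum>k\<in>UNIV. \<Sum>l\<in>UNIV. cinner (C k l x (f l)) (f k)) \<ge> \<mu> * (\<Sum>k\<in>UNIV. (norm (f k))\<^sup>2)"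
    and "V = H1_0 \<Omega> (ell2_on Y) \<or> V = H1 \<Omega> (ell2_on Y)"
    and "A = associated_operator \<Omega> Y V (elliptic_form \<Omega> Y C)"
    and "generated_by_minus \<Omega> (ell2_on Y) A S"
  shows "positive_semigroup (L2_ell2_cone \<Omega> Y) S \<longleftrightarrow>
    (\<forall>n\<in>Y. \<exists>T :: real \<Rightarrow> (real^'d \<Rightarrow> complex) \<Rightarrow> (real^'d \<Rightarrow> complex).
       contraction_semigroup \<Omega> UNIV T \<and> positive_semigroup (L2_cone \<Omega>) T \<and>
       (\<forall>u\<in>L2_fun \<Omega> (ell2_on Y). \<forall>t>0.
          AE x in lebesgue_on \<Omega>. ell2_nth (S t u x) n = T t (\<lambda>x. ell2_nth (u x) n) x))"
proof -
  interpret elliptic_problem \<Omega> Y C \<mu> V S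
  proof (intro elliptic_problem.intro elliptic_coefficients.intro l2_domain.intro
      elliptic_coefficients_axioms.intro elliptic_problem_axioms.intro)
    show "generated_by_minus \<Omega> (ell2_on Y) (associated_operator \<Omega> Y V (elliptic_form \<Omega> Y C)) S"
      using assms(8,9) by simp
    show "(\<lambda>x. cinner (C k l x f) g) \<in> borel_measurable (lebesgue_on \<Omega>)"
      if "f \<in> ell2_on Y" "g \<in> ell2_on Y" for k l f g using assms(4)[OF that] by blast
  qed (fact assms)+
  show ?thesis
  proof
    assume pos: "positive_semigroup (L2_ell2_cone \<Omega> Y) S"
    interpret positive_problem \<Omega> Y C \<mu> V S by unfold_locales (rule pos)
    show "\<forall>n\<in>Y. \<exists>T :: real \<Rightarrow> (real^'d \<Rightarrow> complex) \<Rightarrow> (real^'d \<Rightarrow> complex).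
       contraction_semigroup \<Omega> UNIV T \<and> positive_semigroup (L2_cone \<Omega>) T \<and>
       (\<forall>u\<in>L2_fun \<Omega> (ell2_on Y). \<forall>t>0.
          AE x in lebesgue_on \<Omega>. ell2_nth (S t u x) n = T t (\<lambda>x. ell2_nth (u x) n) x)"
    proof (intro ballI)
      fix n assume n: "n \<in> Y"
      show "\<exists>T :: real \<Rightarrow> (real^'d \<Rightarrow> complex) \<Rightarrow> (real^'d \<Rightarrow> complex).
       contraction_semigroup \<Omega> UNIV T \<and> positive_semigroup (L2_cone \<Omega>) T \<and>
       (\<forall>u\<in>L2_fun \<Omega> (ell2_on Y). \<forall>t>0.
          AE x in lebesgue_on \<Omega>. ell2_nth (S t u x) n = T t (\<lambda>x. ell2_nth (u x) n) x)"
        using T_contraction_semigroup[OF n] T_positive[OF n] S_coord_eq_T[OF n]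
        by (intro exI[of _ "T n"] conjI ballI allI impI)
    qed
  next
    assume diag: "\<forall>n\<in>Y. \<exists>T :: real \<Rightarrow> (real^'d \<Rightarrow> complex) \<Rightarrow> (real^'d \<Rightarrow> complex).
       contraction_semigroup \<Omega> UNIV T \<and> positive_semigroup (L2_cone \<Omega>) T \<and>
       (\<forall>u\<in>L2_fun \<Omega> (ell2_on Y). \<forall>t>0.
          AE x in lebesgue_on \<Omega>. ell2_nth (S t u x) n = T t (\<lambda>x. ell2_nth (u x) n) x)"
    show "positive_semigroup (L2_ell2_cone \<Omega> Y) S"
      unfolding positive_semigroup_def
    proof (intro allI impI ballI)
      fix t :: real and u assume t: "0 < t" and u: "u \<in> L2_ell2_cone \<Omega> Y"
      have uL: "u \<in> L2Y" and u0: "AE x in lebesgue_on \<Omega>. \<forall>y\<in>Y. ell2_nth (u x) y \<in> \<real>\<^sub>\<ge>\<^sub>0"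
        using u by (simp_all add: L2_ell2_cone_def)
      have "AE x in lebesgue_on \<Omega>. n \<in> Y \<longrightarrow> ell2_nth (S t u x) n \<in> \<real>\<^sub>\<ge>\<^sub>0" for n
      proof (cases "n \<in> Y")
        case True
        then obtain T where T: "positive_semigroup (L2_cone \<Omega>) T"
          "AE x in lebesgue_on \<Omega>. ell2_nth (S t u x) n = T t (\<lambda>x. ell2_nth (u x) n) x"
          using diag uL t by blast
        have "AE x in lebesgue_on \<Omega>. ell2_nth (u x) n \<in> \<real>\<^sub>\<ge>\<^sub>0"
          using u0 by eventually_elim (use True in blast)
        then have "(\<lambda>x. ell2_nth (u x) n) \<in> L2_cone \<Omega>" using coord_L2[OF uL] by (simp add: L2_cone_def)
        then have "T t (\<lambda>x. ell2_nth (u x) n) \<in> L2_cone \<Omega>" using T(1) t by (simp add: positive_semigroup_def)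
        then have "AE x in lebesgue_on \<Omega>. T t (\<lambda>x. ell2_nth (u x) n) x \<in> \<real>\<^sub>\<ge>\<^sub>0" by (simp add: L2_cone_def)
        with T(2) show ?thesis by eventually_elim simp
      qed simp
      then have "AE x in lebesgue_on \<Omega>. \<forall>n. n \<in> Y \<longrightarrow> ell2_nth (S t u x) n \<in> \<real>\<^sub>\<ge>\<^sub>0"
        unfolding AE_all_countable by blast
      then have "AE x in lebesgue_on \<Omega>. \<forall>y\<in>Y. ell2_nth (S t u x) y \<in> \<real>\<^sub>\<ge>\<^sub>0"
        by eventually_elim blast
      then show "S t u \<in> L2_ell2_cone \<Omega> Y" using S_in[OF t uL] by (simp add: L2_ell2_cone_def)
    qed
  qed
qed

end
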